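(* Let $\varphi:(0,\infty)\to[-\pi/2,\pi/2)$ be measurable with $\sin\varphi\in L^2(0,\infty)$, let $$H_d(x)=\begin{pmatrix}\sin^2\varphi(x)&0\\0&\cos^2\varphi(x)\end{pmatrix},$$ and let $$A=\limsup_{x\to\infty}\,x\int_x^\infty\sin^2\varphi(t)\,dt\in[0,\infty].$$ Then $$\frac{1}{2\sqrt A}\le M(H_d)\le\frac{1}{\sqrt A},$$ where $M(H_d)\in[0,\infty]$ denotes the smallest absolute value of a point of the essential spectrum of the canonical system with coefficient function $H_d$ (and $1/\sqrt A$ is read as $\infty$ if $A=0$ and as $0$ if $A=\infty$).
   Context: A canonical system is a differential equation $Ju'(x)=-zH(x)u(x)$ on $x\in[0,\infty)$ with $J=\begin{pmatrix}0&-1\\1&0\end{pmatrix}$, where $H(x)\in\mathbb{R}^{2\times2}$ is locally integrable with $H(x)\ge0$ (symmetric, positive semidefinite) and $\operatorname{tr}H(x)=1$ for almost every $x$. The boundary condition $u_2(0)=0$ is imposed at $x=0$. The system together with this boundary condition generates a self-adjoint relation $\mathcal S$ on the Hilbert space $L^2_H(0,\infty)=\{f:(0,\infty)\to\mathbb{C}^2:\int_0^\infty f^*(x)H(x)f(x)\,dx<\infty\}$ (functions identified if their difference has norm zero): $\mathcal S$ consists of all pairs $(f,h)$ of elements of $L^2_H(0,\infty)$ such that $f$ has a locally absolutely continuous representative on $[0,\infty)$, again denoted $f$, with $Jf'=-Hh$ almost everywhere and $f_2(0)=0$. After dividing out the multi-valued part $\{h:(0,h)\in\mathcal S\}$, i.e.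 restricting to its orthogonal complement, one obtains a self-adjoint operator; its essential spectrum is denoted $\sigma_{ess}(H)$. Define $M(H)=\min\{|t|:t\in\sigma_{ess}(H)\}$, with $M(H)=\infty$ if $\sigma_{ess}(H)=\emptyset$; here this is applied to $H=H_d$. *)

theory Defs
  imports "HOL-Analysis.Analysis"
begin

section \<open>Absolute continuity\<close>

text \<open>A division consists of finitely many non-overlapping compact intervals
  \<open>k = {Inf k..Sup k}\<close>; degenerate intervals contribute nothing to either sum.\<close>

definition abs_continuous_on :: "real set \<Rightarrow> (real \<Rightarrow> 'a::real_normed_vector) \<Rightarrow> bool" where
  "abs_continuous_on S f \<longleftrightarrow>
     (\<forall>\<epsilon>>0. \<exists>\<delta>>0. \<forall>d t. d division_of t \<and> t \<subseteq> S \<and> (\<Sum>k\<in>d. Sup k - Inf k) < \<delta>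
        \<longrightarrow> (\<Sum>k\<in>d. norm (f (Sup k) - f (Inf k))) < \<epsilon>)"

definition locally_abs_continuous :: "(real \<Rightarrow> 'a::real_normed_vector) \<Rightarrow> bool" where
  "locally_abs_continuous f \<longleftrightarrow> (\<forall>b>0. abs_continuous_on {0..b} f)"

section \<open>The space of functions square integrable with respect to a matrix weight\<close>

text \<open>Elements are represented by functions, so that
  equality of elements is the relation \<open>L2_eq\<close> and all sets of elements below are
  closed under it. Values outside \<open>(0,\<infinity>)\<close> are irrelevant in \<open>L2_space\<close>.\<close>

definition half_line :: "real measure" where
  "half_line = lebesgue_on {0<..}"

definition cmatrix :: "real^2^2 \<Rightarrow> complex^2^2" where
  "cmatrix = map_matrix complex_of_real"

definition pairing :: "real^2^2 \<Rightarrow> complex^2 \<Rightarrow> complex^2 \<Rightarrow> complex" where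
  "pairing A v w = (\<Sum>i\<in>UNIV. cnj (v $ i) * (cmatrix A *v w) $ i)"

text \<open>For positive semidefinite \<open>H x\<close> the integrand is real and nonnegative, so that
  integrability means that \<open>\<integral> f\<^sup>* H f\<close> is finite.\<close>

definition L2_space :: "(real \<Rightarrow> real^2^2) \<Rightarrow> (real \<Rightarrow> complex^2) set" where
  "L2_space H = {f \<in> borel_measurable half_line.
      integrable half_line (\<lambda>x. pairing (H x) (f x) (f x))}"

definition L2_inner ::
    "(real \<Rightarrow> real^2^2) \<Rightarrow> (real \<Rightarrow> complex^2) \<Rightarrow> (real \<Rightarrow> complex^2) \<Rightarrow> complex" where
  "L2_inner H f g = (LINT x|half_line. pairing (H x) (f x) (g x))"

definition L2_nrm :: "(real \<Rightarrow> real^2^2) \<Rightarrow> (real \<Rightarrow> complex^2) \<Rightarrow> real" where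
  "L2_nrm H f = sqrt (Re (L2_inner H f f))"

definition L2_eq ::
    "(real \<Rightarrow> real^2^2) \<Rightarrow> (real \<Rightarrow> complex^2) \<Rightarrow> (real \<Rightarrow> complex^2) \<Rightarrow> bool" where
  "L2_eq H f g \<longleftrightarrow> L2_nrm H (\<lambda>x. f x - g x) = 0"

section \<open>The self-adjoint relation of a canonical system and its operator part\<close>

definition J :: "complex^2^2" where
  "J = vector [vector [0, -1], vector [1, 0]]"

definition canonical_relation ::
    "(real \<Rightarrow> real^2^2) \<Rightarrow> ((real \<Rightarrow> complex^2) \<times> (real \<Rightarrow> complex^2)) set" where
  "canonical_relation H = {(f, h). f \<in> L2_space H \<and> h \<in> L2_space H \<and>
     (\<exists>g\<in>L2_space H. L2_eq H f g \<and> locally_abs_continuous g \<and>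
        (AE x in half_line. \<exists>g'. (g has_vector_derivative g') (at x) \<and>
            J *v g' = - (cmatrix (H x) *v h x)) \<and>
        g 0 $ 2 = 0)}"

definition multivalued_part :: "(real \<Rightarrow> real^2^2) \<Rightarrow> (real \<Rightarrow> complex^2) set" where
  "multivalued_part H = {h. (\<lambda>_. 0, h) \<in> canonical_relation H}"

definition operator_space :: "(real \<Rightarrow> real^2^2) \<Rightarrow> (real \<Rightarrow> complex^2) set" where
  "operator_space H = {f \<in> L2_space H. \<forall>h\<in>multivalued_part H. L2_inner H h f = 0}"

text \<open>The graph of the self-adjoint operator acting in \<open>operator_space H\<close>.\<close>

definition canonical_operator ::
    "(real \<Rightarrow> real^2^2) \<Rightarrow> ((real \<Rightarrow> complex^2) \<times> (real \<Rightarrow> complex^2)) set" where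
  "canonical_operator H = canonical_relation H \<inter> (operator_space H \<times> operator_space H)"

section \<open>Essential spectrum\<close>

text \<open>The norm bound contains the injectivity of the operator minus \<open>z\<close>, and says that
  its inverse is bounded.\<close>

definition resolvent_set :: "(real \<Rightarrow> real^2^2) \<Rightarrow> complex set" where
  "resolvent_set H = {z.
     (\<exists>C. \<forall>(f, h)\<in>canonical_operator H. L2_nrm H f \<le> C * L2_nrm H (\<lambda>x. h x - z *s f x)) \<and>
     (\<forall>k\<in>operator_space H. \<exists>(f, h)\<in>canonical_operator H. L2_eq H (\<lambda>x. h x - z *s f x) k)}"

definition spectrum :: "(real \<Rightarrow> real^2^2) \<Rightarrow> complex set" where
  "spectrum H = - resolvent_set H"

definition eigenspace :: "(real \<Rightarrow> real^2^2) \<Rightarrow> complex \<Rightarrow> (real \<Rightarrow> complex^2) set" where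
  "eigenspace H z = {f. \<exists>h. (f, h) \<in> canonical_operator H \<and> L2_eq H h (\<lambda>x. z *s f x)}"

definition finite_dimensional ::
    "(real \<Rightarrow> real^2^2) \<Rightarrow> (real \<Rightarrow> complex^2) set \<Rightarrow> bool" where
  "finite_dimensional H V \<longleftrightarrow>
     (\<exists>B. finite B \<and> B \<subseteq> V \<and> (\<forall>f\<in>V. \<exists>c. L2_eq H f (\<lambda>x. \<Sum>b\<in>B. c b *s b x)))"

definition discrete_spectrum :: "(real \<Rightarrow> real^2^2) \<Rightarrow> complex set" where
  "discrete_spectrum H = {z. z isolated_in spectrum H \<and>
     (\<exists>f\<in>eigenspace H z. L2_nrm H f \<noteq> 0) \<and> finite_dimensional H (eigenspace H z)}"

definition essential_spectrum :: "(real \<Rightarrow> real^2^2) \<Rightarrow> complex set" where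
  "essential_spectrum H = spectrum H - discrete_spectrum H"

definition M :: "(real \<Rightarrow> real^2^2) \<Rightarrow> ereal" where
  "M H = (if essential_spectrum H = {} then \<infinity>
          else ereal (LEAST r. \<exists>t\<in>essential_spectrum H. r = cmod t))"

section \<open>Diagonal coefficient functions\<close>

definition H_diag :: "(real \<Rightarrow> real) \<Rightarrow> real \<Rightarrow> real^2^2" where
  "H_diag \<phi> x = vector [vector [(sin (\<phi> x))\<^sup>2, 0], vector [0, (cos (\<phi> x))\<^sup>2]]"

text \<open>Only used for nonnegative arguments.\<close>

definition ereal_sqrt :: "ereal \<Rightarrow> ereal" where
  "ereal_sqrt a = (if a = \<infinity> then \<infinity> else ereal (sqrt (real_of_ereal a)))"

end

theory Submission
  imports Defs "HOL-Library.Function_Algebras" "HOL-Real_Asymp.Real_Asymp"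
begin

text \<open>Write \<open>s = sin\<^sup>2 \<phi>\<close> and \<open>c = cos\<^sup>2 \<phi>\<close>, and let \<open>\<Sigma>(x)\<close> be the integral of \<open>s\<close> over \<open>(x, \<infinity>)\<close>. The diagonal
form of \<open>H\<^sub>d\<close> decouples the equation \<open>J f' = - H h\<close> with \<open>f\<^sub>2(0) = 0\<close> into \<open>f\<^sub>1 = a - \<integral>\<^sub>0\<^sup>x c h\<^sub>2\<close> and
\<open>f\<^sub>2 = \<integral>\<^sub>0\<^sup>x s h\<^sub>1\<close> (\<open>canonical_relation_iff\<close>). The operator is thus off-diagonal, and up to the constant \<open>a\<close> its
inverse consists of two weighted Hardy operators, which are adjoint to each other. Because \<open>c = 1 - s\<close> with
\<open>s\<close> integrable, the first one acts essentially from unweighted \<open>L\<^sup>2\<close> to \<open>L\<^sup>2\<close> with weight \<open>s\<close>, and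
Muckenhoupt's quantity for it is \<open>x \<Sigma>(x)\<close>. The squared norm of its restriction to a half-line \<open>(N, \<infinity>)\<close>
tends to a limit between \<open>A\<close> and \<open>4 A\<close> as \<open>N\<close> grows; what happens on \<open>(0, N]\<close> is compact.
So the squared distance of the essential spectrum from zero lies between \<open>1 / (4 A)\<close> and \<open>1 / A\<close>.

For the lower bound, let \<open>x \<Sigma>(x) \<le> B\<close> for large \<open>x\<close>. The Hardy inequality with constant \<open>4 B\<close>
(\<open>hardy_real\<close>, proved with an explicit supersolution of a Riccati equation) and its dual
(\<open>dual_hardy_truncated\<close>) bound the inverse on a half-line. A bounded interval is cut into
pieces so short that the same constant holds on each of them after subtraction of constants. Together,
\<open>\<parallel>f\<parallel> \<le> 2 sqrt B \<parallel>h\<parallel>\<close> holds up to finitely many functionals of \<open>f\<close> (\<open>finitely_corrected_bound_exists\<close>), and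
such an estimate leaves only discrete spectrum in the disc of radius \<open>1 / (2 sqrt B)\<close> (\<open>discrete_in_ball\<close>):
Bessel's inequality limits the eigenvectors, a compactness argument bounds the operator minus \<open>z\<close> from
below when \<open>z\<close> is not an eigenvalue, and surjectivity spreads from one resolvent point over the connected
complement of the eigenvalues.

For the upper bound, let \<open>x \<Sigma>(x) > b\<close> for arbitrarily large \<open>x\<close>. Functions \<open>f\<close> whose second component is a
trapezoid with plateau \<open>1\<close> up to such an \<open>x\<close> have \<open>\<parallel>h\<parallel>\<^sup>2 / \<parallel>f\<parallel>\<^sup>2\<close> at most about \<open>1 / b\<close>
(\<open>trapezoid_test_function\<close>), and after normalisation they tend to zero weakly. If the spectrum in a disc of
radius \<open>r\<close> with \<open>r\<^sup>2 > 1 / b\<close> were discrete, there would be finitely many eigenvectors to split off; the rest of the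
operator would be bounded below by \<open>r\<close>, which such a sequence contradicts
(\<open>no_weakly_null_test_sequence\<close>). The spectral input for this is that resolvent norm and distance to the
spectrum are reciprocal (\<open>spectral_gap\<close>) and that isolated points of the spectrum are eigenvalues
(\<open>isolated_point_rho\<close>).

Self-adjointness enters through closedness (\<open>canonical_relation_closed\<close>), symmetry (\<open>V_symmetric\<close>, where the limit point
property at infinity is used) and the existence of one resolvent point near zero
(\<open>small_imaginary_resolvent\<close>).\<close>

section \<open>Semi-inner products\<close>

text \<open>Elements of \<open>L\<^sup>2_H\<close> are represented by functions, and two functions at distance zero stay distinct.
The Hilbert space theory is therefore developed for semi-inner products on a subspace \<open>L\<close>: null vectors
are allowed, and equality of elements reads \<open>nrm (x - y) = 0\<close>.\<close>

locale semi_inner = vector_space scl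
  for scl :: "complex \<Rightarrow> 'v::ab_group_add \<Rightarrow> 'v" (infixr "\<cdot>" 75) +
  fixes L :: "'v set" and ip :: "'v \<Rightarrow> 'v \<Rightarrow> complex"
  assumes zero_mem [simp]: "0 \<in> L"
    and add_mem [simp]: "x \<in> L \<Longrightarrow> y \<in> L \<Longrightarrow> x + y \<in> L"
    and scl_mem [simp]: "x \<in> L \<Longrightarrow> a \<cdot> x \<in> L"
    and ip_add_right: "x \<in> L \<Longrightarrow> y \<in> L \<Longrightarrow> z \<in> L \<Longrightarrow> ip x (y + z) = ip x y + ip x z"
    and ip_scl_right: "x \<in> L \<Longrightarrow> y \<in> L \<Longrightarrow> ip x (a \<cdot> y) = a * ip x y"
    and ip_cnj: "x \<in> L \<Longrightarrow> y \<in> L \<Longrightarrow> ip y x = cnj (ip x y)"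
    and ip_nonneg: "x \<in> L \<Longrightarrow> 0 \<le> Re (ip x x)"
begin

definition nrm :: "'v \<Rightarrow> real" where "nrm x = sqrt (Re (ip x x))"

lemma uminus_mem [simp]: "x \<in> L \<Longrightarrow> - x \<in> L"
  using scl_mem[of x "-1"] by simp

lemma diff_mem [simp]: "x \<in> L \<Longrightarrow> y \<in> L \<Longrightarrow> x - y \<in> L"
  using add_mem[of x "- y"] by simp

lemma sum_mem [simp]: "(\<And>i. i \<in> I \<Longrightarrow> f i \<in> L) \<Longrightarrow> sum f I \<in> L"
  by (induction I rule: infinite_finite_induct) auto

lemma ip_diff_right: "x \<in> L \<Longrightarrow> y \<in> L \<Longrightarrow> z \<in> L \<Longrightarrow> ip x (y - z) = ip x y - ip x z"
  using ip_add_right[of x y "(-1) \<cdot> z"] ip_scl_right[of x z "-1"] by simp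

lemma ip_zero_right [simp]: "x \<in> L \<Longrightarrow> ip x 0 = 0"
  using ip_scl_right[of x 0 0] by simp

lemma ip_add_left: "x \<in> L \<Longrightarrow> y \<in> L \<Longrightarrow> z \<in> L \<Longrightarrow> ip (y + z) x = ip y x + ip z x"
  using ip_add_right[of x y z] ip_cnj[of x "y + z"] ip_cnj[of x y] ip_cnj[of x z] by simp

lemma ip_diff_left: "x \<in> L \<Longrightarrow> y \<in> L \<Longrightarrow> z \<in> L \<Longrightarrow> ip (y - z) x = ip y x - ip z x"
  using ip_diff_right[of x y z] ip_cnj[of x "y - z"] ip_cnj[of x y] ip_cnj[of x z] by simp

lemma ip_scl_left: "x \<in> L \<Longrightarrow> y \<in> L \<Longrightarrow> ip (a \<cdot> y) x = cnj a * ip y x"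
  using ip_scl_right[of x y a] ip_cnj[of x "a \<cdot> y"] ip_cnj[of x y] by simp

lemma ip_zero_left [simp]: "x \<in> L \<Longrightarrow> ip 0 x = 0"
  using ip_cnj[of x 0] by simp

lemma ip_sum_right: "x \<in> L \<Longrightarrow> (\<And>i. i \<in> I \<Longrightarrow> f i \<in> L) \<Longrightarrow> ip x (sum f I) = (\<Sum>i\<in>I. ip x (f i))"
  by (induction I rule: infinite_finite_induct) (auto simp: ip_add_right)

lemmas ip_simps = ip_add_right ip_add_left ip_diff_right ip_diff_left ip_scl_right ip_scl_left

lemma nrm_nonneg [simp]: "x \<in> L \<Longrightarrow> 0 \<le> nrm x"
  by (simp add: nrm_def ip_nonneg)

lemma nrm_sq: "x \<in> L \<Longrightarrow> (nrm x)\<^sup>2 = Re (ip x x)"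
  by (simp add: nrm_def ip_nonneg)

lemma ip_self: "x \<in> L \<Longrightarrow> ip x x = of_real ((nrm x)\<^sup>2)"
  using ip_cnj[of x x] by (simp add: nrm_sq complex_eq_iff)

lemma nrm_0 [simp]: "nrm 0 = 0"
  by (simp add: nrm_def)

lemma nrm_scl: "x \<in> L \<Longrightarrow> nrm (a \<cdot> x) = cmod a * nrm x"
proof -
  assume x: "x \<in> L"
  have "(nrm (a \<cdot> x))\<^sup>2 = Re (a * cnj a * ip x x)"
    using x by (simp add: nrm_sq ip_simps ac_simps)
  also have "\<dots> = (cmod a * nrm x)\<^sup>2"
    using x by (simp add: complex_mult_cnj cmod_power2 ip_self power_mult_distrib)
  finally show ?thesis using x by (simp add: power2_eq_iff_nonneg)
qed

lemma nrm_uminus [simp]: "x \<in> L \<Longrightarrow> nrm (- x) = nrm x"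
  using nrm_scl[of x "-1"] by simp

lemma nrm_minus_commute: "x \<in> L \<Longrightarrow> y \<in> L \<Longrightarrow> nrm (x - y) = nrm (y - x)"
  using nrm_uminus[of "x - y"] by simp

lemma nrm_add_sq: "x \<in> L \<Longrightarrow> y \<in> L \<Longrightarrow> (nrm (x + y))\<^sup>2 = (nrm x)\<^sup>2 + 2 * Re (ip x y) + (nrm y)\<^sup>2"
  using ip_cnj[of x y] by (simp add: nrm_sq ip_simps)

lemma nrm_diff_sq: "x \<in> L \<Longrightarrow> y \<in> L \<Longrightarrow> (nrm (x - y))\<^sup>2 = (nrm x)\<^sup>2 - 2 * Re (ip x y) + (nrm y)\<^sup>2"
  using ip_cnj[of x y] by (simp add: nrm_sq ip_simps)

text \<open>The quadratic polynomial in \<open>t\<close> behind the Cauchy-Schwarz inequality. As \<open>y\<close> may be a null vector,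
\<open>t\<close> is left free here instead of being fixed to \<open>1 / (nrm y)\<^sup>2\<close>.\<close>

lemma nrm_sub_proj_sq:
  assumes [simp]: "x \<in> L" "y \<in> L"
  shows "(nrm (x - (complex_of_real t * ip y x) \<cdot> y))\<^sup>2
       = (nrm x)\<^sup>2 - 2 * t * (cmod (ip y x))\<^sup>2 + t\<^sup>2 * (cmod (ip y x))\<^sup>2 * (nrm y)\<^sup>2"
proof -
  have "ip y x * ip x y = of_real ((cmod (ip y x))\<^sup>2)"
    using ip_cnj[of y x] by (simp only: complex_norm_square assms)
  hence "Re (ip x ((of_real t * ip y x) \<cdot> y)) = t * (cmod (ip y x))\<^sup>2"
    by (simp add: ip_scl_right mult.assoc)
  thus ?thesis
    by (simp add: nrm_diff_sq nrm_scl norm_mult power_mult_distrib)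
qed

lemma cauchy_schwarz:
  assumes [simp]: "x \<in> L" "y \<in> L"
  shows "cmod (ip x y) \<le> nrm x * nrm y"
proof -
  define m where "m = (cmod (ip x y))\<^sup>2"
  have ge: "0 \<le> (nrm y)\<^sup>2 - 2 * t * m + t\<^sup>2 * m * (nrm x)\<^sup>2" for t
    using nrm_sub_proj_sq[of y x t] zero_le_power2[of "nrm (y - (complex_of_real t * ip x y) \<cdot> x)"]
    by (simp add: m_def)
  have "m \<le> (nrm x * nrm y)\<^sup>2"
  proof (cases "nrm x = 0")
    case True
    have "m = 0"
    proof (rule ccontr)
      assume "m \<noteq> 0"
      then have "m > 0" by (simp add: m_def)
      then show False using ge[of "((nrm y)\<^sup>2 + 1) / (2 * m)"] True by (simp add: field_simps)
    qed
    then show ?thesis by simp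
  next
    case False
    then have pos: "(nrm x)\<^sup>2 > 0" by simp
    have "0 \<le> (nrm y)\<^sup>2 - m / (nrm x)\<^sup>2"
      using ge[of "1 / (nrm x)\<^sup>2"] False by (simp add: power2_eq_square)
    then show ?thesis using pos by (simp add: pos_divide_le_eq power_mult_distrib mult.commute)
  qed
  thus ?thesis unfolding m_def using power2_le_imp_le by fastforce
qed

lemma nrm_triangle: "x \<in> L \<Longrightarrow> y \<in> L \<Longrightarrow> nrm (x + y) \<le> nrm x + nrm y"
proof -
  assume [simp]: "x \<in> L" "y \<in> L"
  have "Re (ip x y) \<le> nrm x * nrm y"
    using cauchy_schwarz[of x y] complex_Re_le_cmod[of "ip x y"] by simp
  hence "(nrm (x + y))\<^sup>2 \<le> (nrm x + nrm y)\<^sup>2"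
    by (simp add: nrm_add_sq power2_sum)
  thus ?thesis by (rule power2_le_imp_le) simp
qed

lemma nrm_triangle_diff: "x \<in> L \<Longrightarrow> y \<in> L \<Longrightarrow> nrm (x - y) \<le> nrm x + nrm y"
  using nrm_triangle[of x "- y"] by simp

lemma nrm_triangle3:
  "x \<in> L \<Longrightarrow> y \<in> L \<Longrightarrow> z \<in> L \<Longrightarrow> nrm (x - z) \<le> nrm (x - y) + nrm (y - z)"
  using nrm_triangle[of "x - y" "y - z"] by simp

lemma nrm_le_add: "x \<in> L \<Longrightarrow> y \<in> L \<Longrightarrow> nrm x \<le> nrm (x - y) + nrm y"
  using nrm_triangle[of "x - y" "y"] by simp

lemma ip_null_right: "x \<in> L \<Longrightarrow> y \<in> L \<Longrightarrow> nrm y = 0 \<Longrightarrow> ip x y = 0"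
  using cauchy_schwarz[of x y] by simp

lemma nrm_eq_if_null: "x \<in> L \<Longrightarrow> y \<in> L \<Longrightarrow> nrm (x - y) = 0 \<Longrightarrow> nrm x = nrm y"
  using nrm_le_add[of x y] nrm_le_add[of y x] nrm_minus_commute[of x y] by simp

text \<open>This removes a multiple of \<open>e\<close> with uncontrolled coefficient \<open>g\<close>: the price is one functional,
independent of \<open>g\<close>. Expanding the square, the claim follows from \<open>0 \<le> (\<bar>g\<bar> n - \<bar>ip e x\<bar> / n)\<^sup>2\<close> with \<open>n = nrm e\<close>;
for a null vector \<open>e\<close> the quotient is zero by convention, and then subtracting \<open>g \<cdot> e\<close> changes no norm.\<close>

lemma nrm_sq_le_diff_scl:
  assumes [simp]: "x \<in> L" "e \<in> L"
  shows "(nrm x)\<^sup>2 \<le> (nrm (x - g \<cdot> e))\<^sup>2 + (cmod (ip e x))\<^sup>2 / (nrm e)\<^sup>2"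
proof (cases "nrm e = 0")
  case True
  then have "nrm (x - (x - g \<cdot> e)) = 0" by (simp add: nrm_scl)
  hence "nrm x = nrm (x - g \<cdot> e)" by (intro nrm_eq_if_null) auto
  then show ?thesis using True by simp
next
  case False
  define a where "a = cmod g" define b where "b = cmod (ip e x)" define n where "n = nrm e"
  have n: "n \<noteq> 0" using False by (simp add: n_def)
  have "Re (ip x (g \<cdot> e)) \<le> a * b"
    using complex_Re_le_cmod[of "ip x (g \<cdot> e)"] ip_cnj[of e x]
    by (simp add: ip_scl_right norm_mult a_def b_def)
  hence "(nrm (x - g \<cdot> e))\<^sup>2 \<ge> (nrm x)\<^sup>2 - 2 * a * b + a\<^sup>2 * n\<^sup>2"
    by (simp add: nrm_diff_sq nrm_scl a_def n_def power_mult_distrib)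
  moreover have "0 \<le> (a * n - b / n)\<^sup>2" by simp
  hence "0 \<le> a\<^sup>2 * n\<^sup>2 - 2 * a * b + b\<^sup>2 / n\<^sup>2"
    using n by (simp add: power2_diff power_mult_distrib power_divide)
  ultimately show ?thesis unfolding b_def[symmetric] n_def[symmetric] by linarith
qed

definition orthonormal :: "'i set \<Rightarrow> ('i \<Rightarrow> 'v) \<Rightarrow> bool" where
  "orthonormal I e \<longleftrightarrow> (\<forall>i\<in>I. e i \<in> L \<and> nrm (e i) = 1) \<and> (\<forall>i\<in>I. \<forall>j\<in>I. i \<noteq> j \<longrightarrow> ip (e i) (e j) = 0)"

lemma orthonormal_ip:
  "orthonormal I e \<Longrightarrow> i \<in> I \<Longrightarrow> j \<in> I \<Longrightarrow> ip (e i) (e j) = (if i = j then 1 else 0)"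
  unfolding orthonormal_def by (auto simp: ip_self)

lemma orthonormal_ip_sum:
  assumes "orthonormal I e" "finite I" "i \<in> I"
  shows "ip (e i) (\<Sum>j\<in>I. c j \<cdot> e j) = c i"
proof -
  have m: "e j \<in> L" if "j \<in> I" for j using assms(1) that by (auto simp: orthonormal_def)
  have "ip (e i) (\<Sum>j\<in>I. c j \<cdot> e j) = (\<Sum>j\<in>I. ip (e i) (c j \<cdot> e j))"
    using assms m by (subst ip_sum_right) auto
  also have "\<dots> = (\<Sum>j\<in>I. if j = i then c i else 0)"
    using assms(3) m by (intro sum.cong) (auto simp: ip_scl_right orthonormal_ip[OF assms(1)])
  finally have "ip (e i) (\<Sum>j\<in>I. c j \<cdot> e j) = (\<Sum>j\<in>I. if j = i then c i else 0)" .
  thus ?thesis using assms by simp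
qed

lemma orthonormal_nrm_sum:
  assumes "orthonormal I e" "finite I"
  shows "(nrm (\<Sum>j\<in>I. c j \<cdot> e j))\<^sup>2 = (\<Sum>j\<in>I. (cmod (c j))\<^sup>2)"
proof -
  let ?s = "\<Sum>j\<in>I. c j \<cdot> e j"
  have m: "e j \<in> L" if "j \<in> I" for j using assms(1) that by (auto simp: orthonormal_def)
  have "ip ?s ?s = (\<Sum>j\<in>I. c j * ip ?s (e j))"
    using m by (subst ip_sum_right) (auto simp: ip_scl_right)
  also have "\<dots> = (\<Sum>j\<in>I. c j * cnj (c j))"
  proof (rule sum.cong)
    fix j assume j: "j \<in> I"
    have "ip ?s (e j) = cnj (ip (e j) ?s)" using m j by (intro ip_cnj) auto
    thus "c j * ip ?s (e j) = c j * cnj (c j)" using orthonormal_ip_sum[OF assms j] by simp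
  qed simp
  finally show ?thesis using m by (simp add: nrm_sq complex_mult_cnj cmod_power2)
qed

text \<open>Bessel's inequality for a bounded functional \<open>l\<close>: evaluate \<open>l\<close> at the combination of the \<open>e i\<close> with
coefficients \<open>cnj (l (e i))\<close>, where it equals the sum of squares.\<close>

lemma bessel_functional:
  assumes on: "orthonormal I e" and fin: "finite I"
    and add: "\<And>x y. x \<in> L \<Longrightarrow> y \<in> L \<Longrightarrow> l (x + y) = l x + l y"
    and scl: "\<And>x a. x \<in> L \<Longrightarrow> l (a \<cdot> x) = a * l x"
    and bnd: "\<And>x. x \<in> L \<Longrightarrow> cmod (l x) \<le> D * nrm x"
  shows "(\<Sum>i\<in>I. (cmod (l (e i)))\<^sup>2) \<le> D\<^sup>2"
proof -
  have m: "e j \<in> L" if "j \<in> I" for j using on that by (auto simp: orthonormal_def)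
  have l0: "l 0 = 0" using scl[of 0 0] by simp
  have lsum: "l (sum f K) = (\<Sum>i\<in>K. l (f i))" if "\<And>i. i \<in> K \<Longrightarrow> f i \<in> L" for f :: "'a \<Rightarrow> 'v" and K
    using that by (induction K rule: infinite_finite_induct) (auto simp: l0 add)
  define g where "g = (\<Sum>i\<in>I. cnj (l (e i)) \<cdot> e i)"
  define q where "q = (\<Sum>i\<in>I. (cmod (l (e i)))\<^sup>2)"
  have g: "g \<in> L" using m by (auto simp: g_def)
  have "l g = of_real q"
    using m by (simp add: g_def lsum scl q_def complex_norm_square mult.commute del: of_real_power)
  moreover have "(nrm g)\<^sup>2 = q"
    using orthonormal_nrm_sum[OF on fin, of "\<lambda>i. cnj (l (e i))"] by (simp add: g_def q_def)
  moreover have q0: "q \<ge> 0" by (auto simp: q_def intro: sum_nonneg)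
  ultimately have "q \<le> D * nrm g" using bnd[OF g] by simp
  hence "q\<^sup>2 \<le> D\<^sup>2 * q" using q0 \<open>(nrm g)\<^sup>2 = q\<close> by (metis power_mono power_mult_distrib)
  thus ?thesis unfolding q_def[symmetric] using q0
    by (cases "q = 0") (auto simp: power2_eq_square)
qed

lemma gram_schmidt_step:
  assumes on: "orthonormal I e" and fin: "finite I" and b: "b \<in> L" and i: "i \<in> I"
  shows "ip (e i) (b - (\<Sum>j\<in>I. ip (e j) b \<cdot> e j)) = 0"
proof -
  have m: "e j \<in> L" if "j \<in> I" for j using on that by (auto simp: orthonormal_def)
  show ?thesis using m b i by (subst ip_diff_right) (auto simp: orthonormal_ip_sum[OF on fin i])
qed

text \<open>Vectors whose remainder is null contribute nothing to \<open>E\<close>, so \<open>B\<close> need not be independent. That \<open>E\<close>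
stays inside the subspace \<open>V\<close> matters below, where \<open>V\<close> is an eigenspace.\<close>

lemma gram_schmidt:
  assumes "finite B" "B \<subseteq> V" and VL: "V \<subseteq> L" and V0: "0 \<in> V"
    and Vadd: "\<And>x y. x \<in> V \<Longrightarrow> y \<in> V \<Longrightarrow> x + y \<in> V"
    and Vscl: "\<And>a x. x \<in> V \<Longrightarrow> a \<cdot> x \<in> V"
  shows "\<exists>E. finite E \<and> E \<subseteq> V \<and> orthonormal E (\<lambda>e. e)
     \<and> (\<forall>b\<in>B. nrm (b - (\<Sum>e\<in>E. ip e b \<cdot> e)) = 0)"
  using assms(1,2)
proof (induction B)
  case empty
  show ?case by (rule exI[of _ "{}"]) (auto simp: orthonormal_def)
next
  case (insert b B)
  then obtain E where E: "finite E" "E \<subseteq> V" "orthonormal E (\<lambda>e. e)"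
      "\<And>x. x \<in> B \<Longrightarrow> nrm (x - (\<Sum>e\<in>E. ip e x \<cdot> e)) = 0" by blast
  have bV: "b \<in> V" and bL: "b \<in> L" using insert VL by auto
  have EL: "e \<in> L" if "e \<in> E" for e using that E VL by auto
  define d where "d = b - (\<Sum>e\<in>E. ip e b \<cdot> e)"
  have sumV: "(\<Sum>e\<in>F. c e \<cdot> e) \<in> V" if "F \<subseteq> V" for F c
    using that by (induction F rule: infinite_finite_induct) (auto intro: V0 Vadd Vscl)
  have "(-1) \<cdot> (\<Sum>e\<in>E. ip e b \<cdot> e) \<in> V" by (intro Vscl sumV E)
  hence dV: "d \<in> V" unfolding d_def using Vadd[OF bV] by fastforce
  have dL: "d \<in> L" using dV VL by auto
  have orth: "ip e d = 0" if "e \<in> E" for e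
    using gram_schmidt_step[OF E(3,1) bL that] by (simp add: d_def)
  show ?case
  proof (cases "nrm d = 0")
    case True
    then show ?thesis using E by (intro exI[of _ E]) (auto simp: d_def)
  next
    case False
    define u where "u = (1 / complex_of_real (nrm d)) \<cdot> d"
    have uV: "u \<in> V" and uL: "u \<in> L" using dV dL Vscl by (auto simp: u_def)
    have u1: "nrm u = 1" using False dL by (simp add: u_def nrm_scl norm_divide)
    have ou: "ip e u = 0" if "e \<in> E" for e using orth[OF that] EL[OF that] dL by (simp add: u_def ip_scl_right)
    have uo: "ip u e = 0" if "e \<in> E" for e using ou[OF that] ip_cnj[of e u] EL[OF that] uL by simp
    have uE: "u \<notin> E" using ou[of u] u1 uL by (auto simp: ip_self)
    have on: "orthonormal (insert u E) (\<lambda>e. e)"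
      using E(3) ou uo u1 uL by (auto simp: orthonormal_def)
    have ud: "d = complex_of_real (nrm d) \<cdot> u" using False by (simp add: u_def)
    have old: "nrm (x - (\<Sum>e\<in>insert u E. ip e x \<cdot> e)) = 0" if x: "x \<in> B" for x
    proof -
      have xL: "x \<in> L" using x insert VL by auto
      let ?s = "\<Sum>e\<in>E. ip e x \<cdot> e"
      have sL: "?s \<in> L" using EL by auto
      have "ip u ?s = (\<Sum>e\<in>E. 0)"
        using EL uL uo by (subst ip_sum_right) (auto simp: ip_scl_right)
      moreover have "ip u (x - ?s) = 0" using E(4)[OF x] uL xL sL by (intro ip_null_right) auto
      ultimately have "ip u x = 0" using uL xL sL by (simp add: ip_diff_right)
      thus ?thesis using E(4)[OF x] E(1) uE by simp
    qed
    have "ip u b = complex_of_real (nrm d)"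
    proof -
      have sL: "(\<Sum>e\<in>E. ip e b \<cdot> e) \<in> L" using EL by auto
      have "ip u (\<Sum>e\<in>E. ip e b \<cdot> e) = (\<Sum>e\<in>E. 0)"
        using EL uL uo by (subst ip_sum_right) (auto simp: ip_scl_right)
      hence "ip u b = ip u d" using bL uL sL by (simp add: d_def ip_diff_right)
      also have "\<dots> = of_real (nrm d) * ip u u" using uL by (subst ud) (simp add: ip_scl_right)
      finally show ?thesis using uL u1 by (simp add: ip_self)
    qed
    hence "b - (\<Sum>e\<in>insert u E. ip e b \<cdot> e) = d - complex_of_real (nrm d) \<cdot> u"
      using E(1) uE by (simp add: d_def algebra_simps)
    hence "nrm (b - (\<Sum>e\<in>insert u E. ip e b \<cdot> e)) = 0" using ud by simp
    thus ?thesis using E uV on old by (intro exI[of _ "insert u E"]) auto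
  qed
qed

end

locale semi_hilbert = semi_inner +
  assumes complete: "(\<And>n. X n \<in> L) \<Longrightarrow> (\<And>\<epsilon>. \<epsilon> > 0 \<Longrightarrow> \<exists>N. \<forall>m\<ge>N. \<forall>n\<ge>N. nrm (X m - X n) < \<epsilon>)
      \<Longrightarrow> \<exists>x\<in>L. (\<lambda>n. nrm (X n - x)) \<longlonglongrightarrow> 0"
begin

text \<open>Both the Neumann series and the powers of a contraction on a spectral subspace are summed with this;
the estimate of the distance to the starting point is what makes the limit useful there.\<close>

lemma geometric_limit:
  assumes X: "\<And>n::nat. X n \<in> L" and step: "\<And>n. nrm (X (Suc n) - X n) \<le> a * q ^ n"
    and q: "0 \<le> q" "q < 1"
  shows "\<exists>x\<in>L. (\<lambda>n. nrm (X n - x)) \<longlonglongrightarrow> 0 \<and> nrm (X 0 - x) \<le> a / (1 - q)"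
proof -
  have a0: "a \<ge> 0" using step[of 0] nrm_nonneg[OF diff_mem[OF X X], of 1 0] by simp
  have tail: "nrm (X (n + k) - X n) \<le> a / (1 - q) * q ^ n * (1 - q ^ k)" for n k
  proof (induction k)
    case (Suc k)
    have "nrm (X (n + Suc k) - X n) \<le> nrm (X (Suc (n + k)) - X (n + k)) + nrm (X (n + k) - X n)"
      using nrm_triangle3[of "X (Suc (n+k))" "X (n + k)" "X n"] X by simp
    also have "\<dots> \<le> a * q ^ (n + k) + a / (1 - q) * q ^ n * (1 - q ^ k)"
      by (intro add_mono step Suc.IH)
    also have "\<dots> = a / (1 - q) * q ^ n * (1 - q ^ Suc k)"
      using q by (simp add: field_simps power_add)
    finally show ?case .
  qed (simp add: X)
  have tail': "nrm (X m - X n) \<le> a / (1 - q) * q ^ n" if "n \<le> m" for m n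
  proof -
    have "nrm (X m - X n) \<le> a / (1 - q) * q ^ n * (1 - q ^ (m - n))"
      using tail[of n "m - n"] that by simp
    also have "\<dots> \<le> a / (1 - q) * q ^ n * 1"
      using q a0 by (intro mult_left_mono) auto
    finally show ?thesis by simp
  qed
  have lim: "(\<lambda>n. a / (1 - q) * q ^ n) \<longlonglongrightarrow> 0"
    by (intro tendsto_mult_right_zero LIMSEQ_power_zero) (use q in auto)
  have "\<exists>x\<in>L. (\<lambda>n. nrm (X n - x)) \<longlonglongrightarrow> 0"
  proof (rule complete[OF X])
    fix \<epsilon> :: real assume "\<epsilon> > 0"
    with lim obtain N where N: "\<And>n. n \<ge> N \<Longrightarrow> a / (1 - q) * q ^ n < \<epsilon>"
      by (metis (no_types, lifting) eventually_sequentially order_tendstoD(2))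
    show "\<exists>N. \<forall>m\<ge>N. \<forall>n\<ge>N. nrm (X m - X n) < \<epsilon>"
    proof (intro exI allI impI)
      fix m n assume "m \<ge> N" "n \<ge> N"
      show "nrm (X m - X n) < \<epsilon>"
      proof (cases "n \<le> m")
        case True then show ?thesis using tail'[OF True] N[OF \<open>n \<ge> N\<close>] by simp
      next
        case False then show ?thesis
          using tail'[of m n] N[OF \<open>m \<ge> N\<close>] nrm_minus_commute[OF X X, of m n] by simp
      qed
    qed
  qed
  then obtain x where x: "x \<in> L" "(\<lambda>n. nrm (X n - x)) \<longlonglongrightarrow> 0" by blast
  have "nrm (X 0 - x) \<le> a / (1 - q)"
  proof (rule LIMSEQ_le_const)
    show "(\<lambda>n. a / (1 - q) + nrm (X n - x)) \<longlonglongrightarrow> a / (1 - q)"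
      using tendsto_add[OF tendsto_const x(2)] by simp
    have "nrm (X 0 - x) \<le> a / (1 - q) + nrm (X n - x)" for n
      using nrm_triangle3[of "X 0" "X n" x] tail'[of 0 n] nrm_minus_commute[OF X X, of 0 n] X x by simp
    thus "\<exists>N. \<forall>n\<ge>N. nrm (X 0 - x) \<le> a / (1 - q) + nrm (X n - x)" by blast
  qed
  with x show ?thesis by blast
qed

end

section \<open>Closed symmetric relations and their resolvent sets\<close>

text \<open>The resolvent set, eigenvectors and discrete points are expressed through the graph \<open>S\<close> alone. Hence
everything applies to linear relations, and passing to a closed subspace only restricts the graph.\<close>

locale symmetric_relation = semi_hilbert scl L ip
  for scl :: "complex \<Rightarrow> 'v::ab_group_add \<Rightarrow> 'v" (infixr "\<cdot>" 75) and L ip +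
  fixes S :: "('v \<times> 'v) set"
  assumes graph_mem: "(f, h) \<in> S \<Longrightarrow> f \<in> L \<and> h \<in> L"
    and graph_zero: "(0, 0) \<in> S"
    and graph_add: "(f, h) \<in> S \<Longrightarrow> (f', h') \<in> S \<Longrightarrow> (f + f', h + h') \<in> S"
    and graph_scl: "(f, h) \<in> S \<Longrightarrow> (scl a f, scl a h) \<in> S"
    and graph_sym: "(f, h) \<in> S \<Longrightarrow> (f', h') \<in> S \<Longrightarrow> ip h f' = ip f h'"
    and graph_closed: "(\<And>n. (F n, G n) \<in> S) \<Longrightarrow> f \<in> L \<Longrightarrow> h \<in> L \<Longrightarrow>
        (\<lambda>n::nat. nrm (F n - f)) \<longlonglongrightarrow> 0 \<Longrightarrow> (\<lambda>n. nrm (G n - h)) \<longlonglongrightarrow> 0 \<Longrightarrow> (f, h) \<in> S"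
begin

lemma nrm_le_0_iff [simp]: "x \<in> L \<Longrightarrow> nrm x \<le> 0 \<longleftrightarrow> nrm x = 0"
  and nrm_pos_iff [simp]: "x \<in> L \<Longrightarrow> 0 < nrm x \<longleftrightarrow> nrm x \<noteq> 0"
  using nrm_nonneg[of x] by linarith+

lemma graph_fst [simp]: "(f, h) \<in> S \<Longrightarrow> f \<in> L" and graph_snd [simp]: "(f, h) \<in> S \<Longrightarrow> h \<in> L"
  using graph_mem by blast+

lemma graph_diff: "(f, h) \<in> S \<Longrightarrow> (f', h') \<in> S \<Longrightarrow> (f - f', h - h') \<in> S"
  using graph_add[OF _ graph_scl[of f' h' "-1"], of f h] by simp

lemma graph_null_cong:
  assumes "(f, h) \<in> S" "f' \<in> L" "h' \<in> L" "nrm (f - f') = 0" "nrm (h - h') = 0"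
  shows "(f', h') \<in> S"
  by (rule graph_closed[of "\<lambda>_. f" "\<lambda>_. h"]) (use assms in auto)

text \<open>The a priori estimate for the inverse of \<open>S - z\<close>, separated from surjectivity because the two
propagate by different arguments.\<close>

definition below :: "complex \<Rightarrow> real \<Rightarrow> bool" where
  "below z C \<longleftrightarrow> (\<forall>(f, h)\<in>S. nrm f \<le> C * nrm (h - z \<cdot> f))"

definition rho :: "complex set" where
  "rho = {z. (\<exists>C. below z C) \<and> (\<forall>k\<in>L. \<exists>(f, h)\<in>S. nrm (h - z \<cdot> f - k) = 0)}"

definition eigvecs :: "complex \<Rightarrow> 'v set" where
  "eigvecs z = {f. \<exists>h. (f, h) \<in> S \<and> nrm (h - z \<cdot> f) = 0}"

definition fin_dim :: "'v set \<Rightarrow> bool" where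
  "fin_dim V \<longleftrightarrow> (\<exists>B. finite B \<and> B \<subseteq> V \<and> (\<forall>f\<in>V. \<exists>c. nrm (f - (\<Sum>b\<in>B. c b \<cdot> b)) = 0))"

definition discrete_point :: "complex \<Rightarrow> bool" where
  "discrete_point z \<longleftrightarrow> z isolated_in (- rho) \<and> (\<exists>f\<in>eigvecs z. nrm f \<noteq> 0) \<and> fin_dim (eigvecs z)"

lemma belowD: "below z C \<Longrightarrow> (f, h) \<in> S \<Longrightarrow> nrm f \<le> C * nrm (h - z \<cdot> f)"
  by (auto simp: below_def)

lemma below_mono: "below z C \<Longrightarrow> C \<le> C' \<Longrightarrow> below z C'"
  unfolding below_def
proof safe
  fix f h assume *: "\<forall>(f, h)\<in>S. nrm f \<le> C * nrm (h - z \<cdot> f)" "C \<le> C'" "(f, h) \<in> S"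
  have "C * nrm (h - z \<cdot> f) \<le> C' * nrm (h - z \<cdot> f)"
    using * by (intro mult_right_mono) auto
  thus "nrm f \<le> C' * nrm (h - z \<cdot> f)" using * by fastforce
qed

lemma rho_below: assumes "z \<in> rho" obtains C where "C > 0" "below z C"
proof -
  obtain C where "below z C" using assms by (auto simp: rho_def)
  hence "below z (max C 1)" by (rule below_mono) auto
  thus ?thesis using that[of "max C 1"] by auto
qed

lemma rho_surj: assumes "z \<in> rho" "k \<in> L" obtains f where "(f, k + z \<cdot> f) \<in> S"
proof -
  obtain f h where fh: "(f, h) \<in> S" "nrm (h - z \<cdot> f - k) = 0"
    using assms by (auto simp: rho_def)
  have "(f, k + z \<cdot> f) \<in> S"
    by (rule graph_null_cong[OF fh(1)]) (use fh assms in \<open>auto simp: algebra_simps\<close>)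
  thus ?thesis using that by blast
qed

lemma rhoI:
  assumes "below z C" "\<And>k. k \<in> L \<Longrightarrow> \<exists>f. (f, k + z \<cdot> f) \<in> S"
  shows "z \<in> rho"
proof -
  have "\<exists>(f, h)\<in>S. nrm (h - z \<cdot> f - k) = 0" if k: "k \<in> L" for k
  proof -
    obtain f where "(f, k + z \<cdot> f) \<in> S" using assms(2)[OF k] by blast
    thus ?thesis by (intro bexI[of _ "(f, k + z \<cdot> f)"]) auto
  qed
  thus ?thesis using assms(1) unfolding rho_def by blast
qed

lemma below_perturb:
  assumes b: "below z0 C" and C: "C > 0" and q: "C * cmod (z - z0) < 1"
  shows "below z (C / (1 - C * cmod (z - z0)))"
  unfolding below_def
proof safe
  fix f h assume fh: "(f, h) \<in> S"
  have [simp]: "f \<in> L" "h \<in> L" using fh by auto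
  have eq: "h - z0 \<cdot> f = (h - z \<cdot> f) + (z - z0) \<cdot> f" by (simp add: algebra_simps)
  have "nrm (h - z0 \<cdot> f) \<le> nrm (h - z \<cdot> f) + cmod (z - z0) * nrm f"
    unfolding eq using nrm_triangle[of "h - z \<cdot> f" "(z - z0) \<cdot> f"] by (simp add: nrm_scl)
  hence "C * nrm (h - z0 \<cdot> f) \<le> C * (nrm (h - z \<cdot> f) + cmod (z - z0) * nrm f)"
    using C by simp
  with belowD[OF b fh] have "nrm f * (1 - C * cmod (z - z0)) \<le> C * nrm (h - z \<cdot> f)"
    by (simp add: algebra_simps)
  thus "nrm f \<le> C / (1 - C * cmod (z - z0)) * nrm (h - z \<cdot> f)"
    using q by (simp add: field_simps)
qed

text \<open>The equation \<open>(S - z) f = k\<close> reads \<open>(S - z0) f = k + (z - z0) f\<close>, and the solution operator of the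
left-hand side turns this into a fixed point problem with contraction factor \<open>C * cmod (z - z0)\<close>.\<close>

lemma neumann:
  assumes z0: "z0 \<in> rho" and b: "below z0 C" and C: "C > 0" and q: "C * cmod (z - z0) < 1"
  shows "z \<in> rho"
proof (rule rhoI)
  show "below z (C / (1 - C * cmod (z - z0)))" by (rule below_perturb[OF b C q])
next
  fix k assume k [simp]: "k \<in> L"
  define T where "T u = (SOME f. (f, u + z0 \<cdot> f) \<in> S)" for u
  have T: "(T u, u + z0 \<cdot> T u) \<in> S" if "u \<in> L" for u
    unfolding T_def by (rule someI_ex) (use rho_surj[OF z0 that] in blast)
  have TL [simp]: "T u \<in> L" if "u \<in> L" for u using T[OF that] by simp
  define X where "X n = ((\<lambda>f. T (k + (z - z0) \<cdot> f)) ^^ n) 0" for n :: nat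
  have XS: "X (Suc n) = T (k + (z - z0) \<cdot> X n)" for n by (simp add: X_def)
  have XL [simp]: "X n \<in> L" for n
  proof (induction n)
    case 0 show ?case by (simp add: X_def)
  next
    case (Suc n) thus ?case by (simp add: XS)
  qed
  have gr: "(X (Suc n), k + (z - z0) \<cdot> X n + z0 \<cdot> X (Suc n)) \<in> S" for n
    unfolding XS by (rule T) simp
  let ?q = "C * cmod (z - z0)"
  have step: "nrm (X (Suc n) - X n) \<le> nrm (X 1 - X 0) * ?q ^ n" for n
  proof (induction n)
    case (Suc n)
    have "nrm (X (Suc (Suc n)) - X (Suc n)) \<le> C * nrm ((k + (z - z0) \<cdot> X (Suc n) + z0 \<cdot> X (Suc (Suc n)))
       - (k + (z - z0) \<cdot> X n + z0 \<cdot> X (Suc n)) - z0 \<cdot> (X (Suc (Suc n)) - X (Suc n)))"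
      by (rule belowD[OF b graph_diff[OF gr gr]])
    also have "(k + (z - z0) \<cdot> X (Suc n) + z0 \<cdot> X (Suc (Suc n)))
       - (k + (z - z0) \<cdot> X n + z0 \<cdot> X (Suc n)) - z0 \<cdot> (X (Suc (Suc n)) - X (Suc n))
       = (z - z0) \<cdot> (X (Suc n) - X n)"
      by (simp add: scale_right_diff_distrib)
    also have "C * nrm \<dots> = ?q * nrm (X (Suc n) - X n)" by (simp add: nrm_scl)
    also have "\<dots> \<le> ?q * (nrm (X 1 - X 0) * ?q ^ n)"
      by (rule mult_left_mono[OF Suc.IH]) (use C in auto)
    finally show ?case by (simp add: algebra_simps)
  qed simp
  have "\<exists>x\<in>L. (\<lambda>n. nrm (X n - x)) \<longlonglongrightarrow> 0 \<and> nrm (X 0 - x) \<le> nrm (X 1 - X 0) / (1 - ?q)"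
    by (rule geometric_limit[OF XL step]) (use C q in auto)
  then obtain f where f [simp]: "f \<in> L" and lim: "(\<lambda>n. nrm (X n - f)) \<longlonglongrightarrow> 0" by blast
  have lim': "(\<lambda>n. nrm (X (Suc n) - f)) \<longlonglongrightarrow> 0"
    by (rule LIMSEQ_Suc[OF lim])
  have "(f, k + z \<cdot> f) \<in> S"
  proof (rule graph_closed[OF gr _ _ lim'])
    let ?u = "\<lambda>n. cmod (z - z0) * nrm (X n - f) + cmod z0 * nrm (X (Suc n) - f)"
    show "(\<lambda>n. nrm (k + (z - z0) \<cdot> X n + z0 \<cdot> X (Suc n) - (k + z \<cdot> f))) \<longlonglongrightarrow> 0"
    proof (rule tendsto_sandwich[of "\<lambda>_. 0" _ _ ?u])
      show "\<forall>\<^sub>F n in sequentially. nrm (k + (z - z0) \<cdot> X n + z0 \<cdot> X (Suc n) - (k + z \<cdot> f)) \<le> ?u n"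
      proof (rule always_eventually, rule allI)
        fix n
        have "k + (z - z0) \<cdot> X n + z0 \<cdot> X (Suc n) - (k + z \<cdot> f)
           = (z - z0) \<cdot> (X n - f) + z0 \<cdot> (X (Suc n) - f)"
          by (simp add: algebra_simps)
        thus "nrm (k + (z - z0) \<cdot> X n + z0 \<cdot> X (Suc n) - (k + z \<cdot> f)) \<le> ?u n"
          using nrm_triangle[of "(z - z0) \<cdot> (X n - f)" "z0 \<cdot> (X (Suc n) - f)"] by (simp add: nrm_scl)
      qed
      show "?u \<longlonglongrightarrow> 0" using tendsto_add[OF tendsto_mult_right_zero[OF lim] tendsto_mult_right_zero[OF lim']] by simp
    qed auto
  qed simp_all
  thus "\<exists>f. (f, k + z \<cdot> f) \<in> S" by blast
qed

lemma open_rho: "open rho"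
proof (rule openI)
  fix z0 assume z0: "z0 \<in> rho"
  obtain C where C: "C > 0" "below z0 C" using rho_below[OF z0] by blast
  have "ball z0 (1 / C) \<subseteq> rho"
  proof
    fix z assume "z \<in> ball z0 (1 / C)"
    hence "C * cmod (z - z0) < 1" using C(1) by (simp add: dist_norm norm_minus_commute field_simps)
    thus "z \<in> rho" by (rule neumann[OF z0 C(2,1)])
  qed
  thus "\<exists>e>0. ball z0 e \<subseteq> rho" using C(1) by (intro exI[of _ "1 / C"]) auto
qed

text \<open>Surjectivity of \<open>S - z\<close> spreads over a connected set on which \<open>S - z\<close> stays bounded below: by the
local uniformity of the lower bound, a Neumann series started at a point of \<open>rho\<close> sufficiently near \<open>z\<close>
reaches \<open>z\<close>. So \<open>rho\<close> and its complement are both open relative to the set.\<close>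

lemma rho_connected:
  assumes conn: "connected \<Omega>" and b: "\<And>z. z \<in> \<Omega> \<Longrightarrow> \<exists>C. below z C" and z0: "z0 \<in> \<Omega>" "z0 \<in> rho"
  shows "\<Omega> \<subseteq> rho"
proof -
  have far: "\<exists>e>0. ball z e \<inter> rho = {}" if z: "z \<in> \<Omega>" "z \<notin> rho" for z
  proof -
    obtain C0 where "below z C0" using b z by blast
    then obtain C where C: "C > 0" "below z C" using below_mono[of z C0 "max C0 1"] by (metis max.cobounded1 max.strict_coboundedI2 zero_less_one)
    \<comment> \<open>Within distance \<open>1 / (3 C)\<close> of \<open>z\<close> the constant \<open>C\<close> deteriorates at most to \<open>3 C / 2\<close>, which still
allows Neumann steps of length less than \<open>2 / (3 C)\<close>.\<close>
    have "w \<notin> rho" if w: "w \<in> ball z (1 / (3 * C))" for w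
    proof
      assume wr: "w \<in> rho"
      have d: "C * cmod (w - z) < 1 / 3" using w C(1) by (simp add: dist_norm norm_minus_commute field_simps)
      have "below w (C / (1 - C * cmod (w - z)))" by (rule below_perturb[OF C(2,1)]) (use d in simp)
      moreover have "C / (1 - C * cmod (w - z)) \<le> C / (2 / 3)"
        using d C(1) by (intro divide_left_mono) auto
      ultimately have bw: "below w (3 * C / 2)" by (rule below_mono[THEN below_mono[of _ "C / (2/3)"]]) auto
      have "z \<in> rho"
        by (rule neumann[OF wr bw]) (use d C(1) in \<open>auto simp: norm_minus_commute\<close>)
      thus False using z by simp
    qed
    thus ?thesis using C(1) by (intro exI[of _ "1 / (3 * C)"]) auto
  qed
  define V where "V = \<Union>{ball z e |z e. ball z e \<inter> rho = {}}"
  have "open V" unfolding V_def by auto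
  moreover have "\<Omega> \<subseteq> rho \<union> V"
  proof
    fix z assume z: "z \<in> \<Omega>"
    show "z \<in> rho \<union> V"
    proof (cases "z \<in> rho")
      case False
      then obtain e where "e > 0" "ball z e \<inter> rho = {}" using far[OF z] by blast
      hence "z \<in> V" unfolding V_def by (auto intro!: exI[of _ "ball z e"])
      thus ?thesis by simp
    qed simp
  qed
  moreover have "rho \<inter> V \<inter> \<Omega> = {}" unfolding V_def by auto
  ultimately have "rho \<inter> \<Omega> = {} \<or> V \<inter> \<Omega> = {}"
    using connectedD[OF conn open_rho, of V] by auto
  thus ?thesis using z0 \<open>\<Omega> \<subseteq> rho \<union> V\<close> by blast
qed

lemma ip_graph_real: "(f, h) \<in> S \<Longrightarrow> Im (ip f h) = 0"
  using graph_sym[of f h f h] ip_cnj[of f h] by (auto simp: complex_eq_iff)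

text \<open>As \<open>ip f h\<close> is real, the imaginary part of \<open>ip f (h - z \<cdot> f)\<close> is \<open>- Im z\<close> times the squared norm of
\<open>f\<close>; Cauchy-Schwarz does the rest.\<close>

lemma below_nonreal:
  assumes "Im z \<noteq> 0" shows "below z (1 / \<bar>Im z\<bar>)"
  unfolding below_def
proof safe
  fix f h assume fh: "(f, h) \<in> S"
  have [simp]: "f \<in> L" "h \<in> L" using fh by auto
  have "Im (ip f (h - z \<cdot> f)) = - Im z * (nrm f)\<^sup>2"
    using ip_graph_real[OF fh] by (simp add: ip_diff_right ip_scl_right ip_self del: of_real_power)
  hence "\<bar>Im z\<bar> * (nrm f)\<^sup>2 \<le> cmod (ip f (h - z \<cdot> f))"
    using abs_Im_le_cmod[of "ip f (h - z \<cdot> f)"] by (simp add: abs_mult)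
  also have "\<dots> \<le> nrm f * nrm (h - z \<cdot> f)" by (rule cauchy_schwarz) auto
  finally have "nrm f * (\<bar>Im z\<bar> * nrm f) \<le> nrm f * nrm (h - z \<cdot> f)" by (simp add: power2_eq_square algebra_simps)
  hence "\<bar>Im z\<bar> * nrm f \<le> nrm (h - z \<cdot> f)"
    using nrm_nonneg[of f] by (cases "nrm f = 0") (auto simp: mult_le_cancel_left)
  thus "nrm f \<le> 1 / \<bar>Im z\<bar> * nrm (h - z \<cdot> f)" using assms by (simp add: field_simps)
qed

lemma eigenvalue_real: "f \<in> eigvecs z \<Longrightarrow> nrm f \<noteq> 0 \<Longrightarrow> Im z = 0"
proof (rule ccontr)
  assume *: "f \<in> eigvecs z" "nrm f \<noteq> 0" "Im z \<noteq> 0"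
  then obtain h where "(f, h) \<in> S" "nrm (h - z \<cdot> f) = 0" by (auto simp: eigvecs_def)
  with belowD[OF below_nonreal[OF *(3)]] have "nrm f \<le> 0" by fastforce
  thus False using * nrm_nonneg[of f] \<open>(f, h) \<in> S\<close> by simp
qed

lemma eigenvalue_not_rho: "f \<in> eigvecs z \<Longrightarrow> nrm f \<noteq> 0 \<Longrightarrow> z \<notin> rho"
proof
  assume *: "f \<in> eigvecs z" "nrm f \<noteq> 0" "z \<in> rho"
  then obtain h where h: "(f, h) \<in> S" "nrm (h - z \<cdot> f) = 0" by (auto simp: eigvecs_def)
  obtain C where "below z C" using rho_below[OF *(3)] by blast
  from belowD[OF this h(1)] h * nrm_nonneg[of f] show False by simp
qed

lemma eigvecs_graph: "f \<in> eigvecs z \<Longrightarrow> (f, z \<cdot> f) \<in> S"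
proof -
  assume "f \<in> eigvecs z"
  then obtain h where h: "(f, h) \<in> S" "nrm (h - z \<cdot> f) = 0" by (auto simp: eigvecs_def)
  show ?thesis by (rule graph_null_cong[OF h(1)]) (use h in auto)
qed

lemma graph_eigvecs: "(f, z \<cdot> f) \<in> S \<Longrightarrow> f \<in> eigvecs z"
  unfolding eigvecs_def by (auto intro!: exI[of _ "z \<cdot> f"])

lemma eigvecs_subspace:
  "0 \<in> eigvecs z" "f \<in> eigvecs z \<Longrightarrow> g \<in> eigvecs z \<Longrightarrow> f + g \<in> eigvecs z"
  "f \<in> eigvecs z \<Longrightarrow> a \<cdot> f \<in> eigvecs z" "eigvecs z \<subseteq> L"
proof -
  show "0 \<in> eigvecs z" by (rule graph_eigvecs) (simp add: graph_zero)
  show "f \<in> eigvecs z \<Longrightarrow> g \<in> eigvecs z \<Longrightarrow> f + g \<in> eigvecs z"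
    using graph_add[OF eigvecs_graph eigvecs_graph, of f z g z] by (intro graph_eigvecs) (simp add: algebra_simps)
  show "f \<in> eigvecs z \<Longrightarrow> a \<cdot> f \<in> eigvecs z"
    using graph_scl[OF eigvecs_graph, of f z a] by (intro graph_eigvecs) (simp add: ac_simps)
  show "eigvecs z \<subseteq> L" using eigvecs_graph graph_fst by blast
qed

lemma eigvecs_orthogonal:
  assumes f: "f \<in> eigvecs z" and g: "g \<in> eigvecs w" and "z \<noteq> w"
  shows "ip f g = 0"
proof -
  have L [simp]: "f \<in> L" "g \<in> L" using f g eigvecs_subspace(4) by auto
  show ?thesis
  proof (cases "nrm f = 0 \<or> nrm g = 0")
    case True
    then show ?thesis using cauchy_schwarz[of f g] by auto
  next
    case False
    hence "cnj z = z" using eigenvalue_real[OF f] by (simp add: complex_eq_iff)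
    moreover have "cnj z * ip f g = w * ip f g"
      using graph_sym[OF eigvecs_graph[OF f] eigvecs_graph[OF g]] by (simp add: ip_scl_left ip_scl_right)
    ultimately show ?thesis using \<open>z \<noteq> w\<close> by simp
  qed
qed

section \<open>Spectral gaps and isolated points of the spectrum\<close>

text \<open>The norm of the resolvent is the reciprocal of the distance to the spectrum. Let \<open>\<nu>\<close> be the norm of
the symmetric operator \<open>T = (S - x)\<^sup>-\<^sup>1\<close>, and suppose \<open>1 / \<nu> < d\<close>. Choose \<open>u\<close> in the unit ball such that
\<open>\<parallel>T u\<parallel>\<close> is almost \<open>\<nu>\<close>; then \<open>\<parallel>T\<^sup>2 u - \<nu>\<^sup>2 u\<parallel>\<^sup>2 \<le> \<nu>\<^sup>2 (\<nu>\<^sup>2 - \<parallel>T u\<parallel>\<^sup>2)\<close> is almost zero. But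
\<open>T\<^sup>2 - \<nu>\<^sup>2\<close> factors into \<open>T - \<nu>\<close> and \<open>T + \<nu>\<close>, which are bounded below because \<open>x + 1 / \<nu>\<close> and
\<open>x - 1 / \<nu>\<close> belong to the resolvent set. So \<open>\<parallel>T u\<parallel>\<close> is almost zero as well, a contradiction.\<close>

lemma spectral_gap:
  assumes d: "d > 0" and gap: "\<And>t. \<bar>t - x\<bar> < d \<Longrightarrow> complex_of_real t \<in> rho" and fh: "(f, h) \<in> S"
  shows "d * nrm f \<le> nrm (h - complex_of_real x \<cdot> f)"
proof -
  let ?x = "complex_of_real x"
  define P where "P = {nrm f |f h. (f, h) \<in> S \<and> nrm (h - ?x \<cdot> f) \<le> 1}"
  \<comment> \<open>\<open>f\<close> runs through the vectors \<open>T u\<close> with \<open>u\<close> in the unit ball, so \<open>\<nu>\<close> is the norm of \<open>T\<close>.\<close>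
  define \<nu> where "\<nu> = Sup P"
  have xr: "?x \<in> rho" using gap[of x] d by simp
  obtain C where C: "C > 0" "below ?x C" using rho_below[OF xr] by blast
  have Pb: "p \<le> C" if pP: "p \<in> P" for p
  proof -
    obtain f h where p: "p = nrm f" "(f, h) \<in> S" "nrm (h - ?x \<cdot> f) \<le> 1" using pP by (auto simp: P_def)
    have "C * nrm (h - ?x \<cdot> f) \<le> C" using C(1) p(3) by (simp add: mult_left_le)
    thus ?thesis using belowD[OF C(2) p(2)] p(1) by simp
  qed
  have bdd: "bdd_above P" using Pb by (auto simp: bdd_above_def)
  have "nrm (0 - ?x \<cdot> 0) \<le> 1" by simp
  hence P0: "0 \<in> P" unfolding P_def using graph_zero nrm_0 by (metis (mono_tags, lifting) mem_Collect_eq)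
  have \<nu>0: "\<nu> \<ge> 0" unfolding \<nu>_def by (rule cSup_upper[OF P0 bdd])
  have b\<nu>: "nrm f \<le> \<nu> * nrm (h - ?x \<cdot> f)" if fh: "(f, h) \<in> S" for f h
  proof (cases "nrm (h - ?x \<cdot> f) = 0")
    case True
    then show ?thesis using belowD[OF C(2) fh] fh by simp
  next
    case False
    have [simp]: "f \<in> L" "h \<in> L" using fh by auto
    define n where "n = nrm (h - ?x \<cdot> f)"
    have n: "n > 0" using False by (simp add: n_def)
    let ?a = "complex_of_real (1 / n)"
    have "?a \<cdot> h - ?x \<cdot> (?a \<cdot> f) = ?a \<cdot> (h - ?x \<cdot> f)" by (simp add: algebra_simps)
    hence "nrm (?a \<cdot> h - ?x \<cdot> (?a \<cdot> f)) = 1" using n by (simp add: nrm_scl n_def norm_divide)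
    hence "nrm (?a \<cdot> f) \<in> P" unfolding P_def using graph_scl[OF fh, of ?a] by (intro CollectI exI[of _ "?a \<cdot> f"] exI[of _ "?a \<cdot> h"]) auto
    hence "nrm (?a \<cdot> f) \<le> \<nu>" unfolding \<nu>_def by (rule cSup_upper[OF _ bdd])
    thus ?thesis using n by (simp add: nrm_scl n_def[symmetric] norm_divide field_simps)
  qed
  have "d * \<nu> \<le> 1"
  proof (rule ccontr)
    assume "\<not> d * \<nu> \<le> 1"
    hence dn: "d * \<nu> > 1" by simp
    have \<nu>: "\<nu> > 0" using dn \<nu>0 by (cases "\<nu> = 0") auto
    have small: "1 / \<nu> < d" using dn \<nu> by (simp add: field_simps)
    define n where "n = complex_of_real \<nu>"
    have n: "n \<noteq> 0" "cmod n = \<nu>" using \<nu> by (auto simp: n_def)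
    obtain Cp where Cp: "Cp > 0" "below (?x + 1 / n) Cp"
    proof -
      have "complex_of_real (x + 1 / \<nu>) \<in> rho" by (rule gap) (use small \<nu> in auto)
      thus ?thesis using that rho_below by (auto simp: n_def)
    qed
    obtain Cm where Cm: "Cm > 0" "below (?x - 1 / n) Cm"
    proof -
      have "complex_of_real (x - 1 / \<nu>) \<in> rho" by (rule gap) (use small \<nu> in auto)
      thus ?thesis using that rho_below by (auto simp: n_def)
    qed
    define K where "K = Cm / \<nu>\<^sup>2 * (Cp / \<nu> + 1)"
    have K0: "K > 0" unfolding K_def using Cm(1) Cp(1) \<nu> by (intro mult_pos_pos add_pos_pos divide_pos_pos) auto
    have key: "(nrm f)\<^sup>2 \<le> K\<^sup>2 * (\<nu>\<^sup>2 * (\<nu>\<^sup>2 - (nrm f)\<^sup>2))"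
      if fh: "(f, h) \<in> S" and u1: "nrm (h - ?x \<cdot> f) \<le> 1" for f h
    proof -
      have fL [simp]: "f \<in> L" and hL [simp]: "h \<in> L" using fh by auto
      define u where "u = h - ?x \<cdot> f"
      have uL [simp]: "u \<in> L" by (simp add: u_def)
      obtain g where g: "(g, f + ?x \<cdot> g) \<in> S" using rho_surj[OF xr fL] by blast
      have gL [simp]: "g \<in> L" using g by auto
      have ng: "nrm g \<le> \<nu> * nrm f" using b\<nu>[OF g] by simp
      have nu: "nrm u \<le> 1" using u1 by (simp add: u_def)
      have "ip (f + ?x \<cdot> g) f = ip g h" by (rule graph_sym[OF g fh])
      hence "ip f f = ip g u" by (simp add: u_def ip_simps eq_diff_eq)
      hence re: "Re (ip g u) = (nrm f)\<^sup>2" by (simp add: ip_self[of f, symmetric] nrm_sq)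
      \<comment> \<open>Here \<open>f = T u\<close> and \<open>g = T f\<close>, so \<open>w\<close> is \<open>(T\<^sup>2 - \<nu>\<^sup>2) u\<close> and \<open>p\<close> below is \<open>T (T + \<nu>) u\<close>.\<close>
      define w where "w = g - n\<^sup>2 \<cdot> u"
      have wL [simp]: "w \<in> L" by (simp add: w_def)
      have "(nrm w)\<^sup>2 = (nrm g)\<^sup>2 - 2 * \<nu>\<^sup>2 * (nrm f)\<^sup>2 + (\<nu>\<^sup>2 * nrm u)\<^sup>2"
        using re by (simp add: w_def nrm_diff_sq ip_scl_right nrm_scl n_def norm_power)
      also have "\<dots> \<le> (\<nu> * nrm f)\<^sup>2 - 2 * \<nu>\<^sup>2 * (nrm f)\<^sup>2 + (\<nu>\<^sup>2 * 1)\<^sup>2"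
        by (intro add_mono diff_mono power_mono mult_left_mono) (use ng nu in auto)
      also have "\<dots> = \<nu>\<^sup>2 * (\<nu>\<^sup>2 - (nrm f)\<^sup>2)" by (simp add: power2_eq_square algebra_simps)
      finally have w2: "(nrm w)\<^sup>2 \<le> \<nu>\<^sup>2 * (\<nu>\<^sup>2 - (nrm f)\<^sup>2)" .
      define p where "p = g + n \<cdot> f"
      have pL [simp]: "p \<in> L" by (simp add: p_def)
      have pS: "(p, (f + ?x \<cdot> g) + n \<cdot> h) \<in> S"
        unfolding p_def by (rule graph_add[OF g graph_scl[OF fh]])
      have "(f + ?x \<cdot> g) + n \<cdot> h - (?x + 1 / n) \<cdot> p = (- 1 / n) \<cdot> w"
        using n(1) by (simp add: p_def w_def u_def algebra_simps power2_eq_square)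
      hence "nrm p \<le> Cp * (nrm w / \<nu>)"
        using belowD[OF Cp(2) pS] n \<nu> by (simp add: nrm_scl norm_divide)
      moreover have "n \<cdot> (f + n \<cdot> u) = p - w" by (simp add: p_def w_def algebra_simps power2_eq_square)
      hence "\<nu> * nrm (f + n \<cdot> u) \<le> nrm p + nrm w"
        using nrm_triangle_diff[OF pL wL] nrm_scl[of "f + n \<cdot> u" n] n by simp
      ultimately have y: "\<nu> * nrm (f + n \<cdot> u) \<le> (Cp / \<nu> + 1) * nrm w" by (simp add: algebra_simps)
      have "h - (?x - 1 / n) \<cdot> f = (1 / n) \<cdot> (f + n \<cdot> u)"
        using n(1) by (simp add: u_def algebra_simps)
      hence "nrm f \<le> Cm * (nrm (f + n \<cdot> u) / \<nu>)"
        using belowD[OF Cm(2) fh] n \<nu> by (simp add: nrm_scl norm_divide)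
      also have "\<dots> = Cm / \<nu>\<^sup>2 * (\<nu> * nrm (f + n \<cdot> u))" using \<nu> by (simp add: power2_eq_square)
      also have "\<dots> \<le> Cm / \<nu>\<^sup>2 * ((Cp / \<nu> + 1) * nrm w)"
        using y Cm(1) by (intro mult_left_mono) auto
      finally have "nrm f \<le> K * nrm w" by (simp add: K_def)
      hence "(nrm f)\<^sup>2 \<le> K\<^sup>2 * (nrm w)\<^sup>2" by (metis fL nrm_nonneg power_mono power_mult_distrib)
      also have "\<dots> \<le> K\<^sup>2 * (\<nu>\<^sup>2 * (\<nu>\<^sup>2 - (nrm f)\<^sup>2))" using w2 by (intro mult_left_mono) auto
      finally show ?thesis .
    qed
    \<comment> \<open>Solving the estimate \<open>key\<close> for the norm of \<open>f\<close> gives a bound \<open>\<beta>\<close> for its square that is strictly below \<open>\<nu>\<^sup>2\<close>.\<close>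
    define \<beta> where "\<beta> = K\<^sup>2 * \<nu>\<^sup>2 * \<nu>\<^sup>2 / (1 + K\<^sup>2 * \<nu>\<^sup>2)"
    have den: "1 + K\<^sup>2 * \<nu>\<^sup>2 > 0" by (intro add_pos_nonneg) auto
    have "\<nu> \<le> sqrt \<beta>"
      unfolding \<nu>_def
    proof (rule cSup_least)
      fix p assume "p \<in> P"
      then obtain f h where p: "p = nrm f" "(f, h) \<in> S" "nrm (h - ?x \<cdot> f) \<le> 1" by (auto simp: P_def)
      have "p\<^sup>2 * (1 + K\<^sup>2 * \<nu>\<^sup>2) \<le> K\<^sup>2 * \<nu>\<^sup>2 * \<nu>\<^sup>2" using key[OF p(2,3)] p(1) by (simp add: algebra_simps)
      hence "p\<^sup>2 \<le> \<beta>" using den by (simp add: \<beta>_def field_simps)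
      thus "p \<le> sqrt \<beta>" by (rule real_le_rsqrt)
    qed (use P0 in auto)
    hence "\<nu>\<^sup>2 \<le> \<beta>" using \<nu> by (metis abs_of_nonneg less_eq_real_def real_sqrt_ge_0_iff order.trans power_mono real_sqrt_pow2)
    hence "\<nu>\<^sup>2 * (1 + K\<^sup>2 * \<nu>\<^sup>2) \<le> K\<^sup>2 * \<nu>\<^sup>2 * \<nu>\<^sup>2" using den by (simp add: \<beta>_def pos_le_divide_eq)
    thus False using \<nu> by (simp add: algebra_simps)
  qed
  have "d * nrm f \<le> d * (\<nu> * nrm (h - ?x \<cdot> f))" using b\<nu>[OF fh] d by simp
  also have "\<dots> = d * \<nu> * nrm (h - ?x \<cdot> f)" by simp
  also have "\<dots> \<le> 1 * nrm (h - ?x \<cdot> f)" using \<open>d * \<nu> \<le> 1\<close> fh by (intro mult_right_mono) auto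
  finally show ?thesis by simp
qed

text \<open>An isolated point \<open>\<mu>\<close> of the spectrum is an eigenvalue, because the projection onto the eigenspace is a
limit of powers of one resolvent. Consider \<open>T = \<eta> (S - \<mu> + \<eta>)\<^sup>-\<^sup>1\<close>. In spectral terms \<open>T\<close> is multiplication by
\<open>\<eta> / (t - \<mu> + \<eta>)\<close>, which is \<open>1\<close> at \<open>\<mu>\<close> and at most \<open>1 / 3\<close> in modulus where \<open>\<bar>t - \<mu>\<bar> \<ge> 4 \<eta>\<close>. Hence \<open>T\<close>
contracts the range of \<open>1 - T\<close>, and the powers of \<open>T\<close> converge to the projection onto the eigenspace. If
the eigenspace is trivial, summing the increments gives \<open>\<parallel>u\<parallel> \<le> 2 \<parallel>u - T u\<parallel>\<close>, that is, a lower
bound for \<open>S - \<mu>\<close>; a Neumann step from a neighbouring point then reaches \<open>\<mu>\<close>.\<close>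

lemma isolated_point_rho:
  assumes \<eta>: "\<eta> > 0" and gap: "\<And>t. 0 < \<bar>t - \<mu>\<bar> \<Longrightarrow> \<bar>t - \<mu>\<bar> < 4 * \<eta> \<Longrightarrow> complex_of_real t \<in> rho"
    and noeig: "\<And>f. f \<in> eigvecs (complex_of_real \<mu>) \<Longrightarrow> nrm f = 0"
  shows "complex_of_real \<mu> \<in> rho"
proof -
  define l e where "l = complex_of_real \<mu>" and "e = complex_of_real \<eta>"
  have e: "e \<noteq> 0" "cmod e = \<eta>" "cnj e = e" "cnj l = l" using \<eta> by (auto simp: e_def l_def)
  \<comment> \<open>The gaps on both sides of \<open>\<mu>\<close>, used at distance \<open>2 \<eta>\<close>, say in spectral terms that
\<open>4 \<eta> \<bar>t - \<mu>\<bar> \<le> (t - \<mu>)\<^sup>2\<close> on the spectrum.\<close>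
  have quad: "4 * \<eta> * \<bar>Re (ip (h - l \<cdot> f) f)\<bar> \<le> (nrm (h - l \<cdot> f))\<^sup>2" if fh: "(f, h) \<in> S" for f h
  proof -
    have [simp]: "f \<in> L" "h \<in> L" using fh by auto
    define v where "v = h - l \<cdot> f"
    have vL [simp]: "v \<in> L" by (simp add: v_def)
    have one: "4 * \<eta> * (s * Re (ip v f)) \<le> (nrm v)\<^sup>2" if s: "s = 1 \<or> s = -1" for s :: real
    proof -
      have "2 * \<eta> * nrm f \<le> nrm (h - complex_of_real (\<mu> + s * 2 * \<eta>) \<cdot> f)"
        by (rule spectral_gap[OF _ gap fh]) (use \<eta> s in auto)
      also have "h - complex_of_real (\<mu> + s * 2 * \<eta>) \<cdot> f = v - complex_of_real (s * 2 * \<eta>) \<cdot> f"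
        by (simp add: v_def l_def algebra_simps)
      finally have "(2 * \<eta> * nrm f)\<^sup>2 \<le> (nrm (v - complex_of_real (s * 2 * \<eta>) \<cdot> f))\<^sup>2"
        using \<eta> by (intro power_mono) auto
      also have "\<dots> = (nrm v)\<^sup>2 - 4 * \<eta> * (s * Re (ip v f)) + (2 * \<eta> * nrm f)\<^sup>2"
        using s \<eta> by (auto simp: nrm_diff_sq ip_scl_right nrm_scl norm_mult)
      finally show ?thesis by simp
    qed
    show ?thesis using one[of 1] one[of "-1"] \<eta> by (auto simp: abs_if v_def)
  qed
  \<comment> \<open>\<open>B u b\<close> is the graph of \<open>T\<close>: it says \<open>b = T u\<close>.\<close>
  define B where "B u b \<longleftrightarrow> u \<in> L \<and> (b, e \<cdot> (u - b) + l \<cdot> b) \<in> S" for u b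
  have BL: "u \<in> L" "b \<in> L" if "B u b" for u b using that by (auto simp: B_def)
  have B_ex: "\<exists>b. B u b" if "u \<in> L" for u
  proof -
    have "complex_of_real (\<mu> - \<eta>) \<in> rho" by (rule gap) (use \<eta> in auto)
    then obtain b where "(b, e \<cdot> u + complex_of_real (\<mu> - \<eta>) \<cdot> b) \<in> S"
      using rho_surj[of _ "e \<cdot> u"] \<open>u \<in> L\<close> by (metis scl_mem)
    moreover have "e \<cdot> u + complex_of_real (\<mu> - \<eta>) \<cdot> b = e \<cdot> (u - b) + l \<cdot> b"
      by (simp add: e_def l_def algebra_simps)
    ultimately show ?thesis using that by (auto simp: B_def)
  qed
  have B_add: "B (u + u') (b + b')" if "B u b" "B u' b'" for u b u' b'
  proof -
    have "(b + b', (e \<cdot> (u - b) + l \<cdot> b) + (e \<cdot> (u' - b') + l \<cdot> b')) \<in> S"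
      using that by (intro graph_add) (auto simp: B_def)
    moreover have "(e \<cdot> (u - b) + l \<cdot> b) + (e \<cdot> (u' - b') + l \<cdot> b') = e \<cdot> (u + u' - (b + b')) + l \<cdot> (b + b')"
      by (simp add: algebra_simps)
    ultimately show ?thesis using that by (simp add: B_def)
  qed
  have B_diff: "B (u - u') (b - b')" if "B u b" "B u' b'" for u b u' b'
  proof -
    have "(b - b', (e \<cdot> (u - b) + l \<cdot> b) - (e \<cdot> (u' - b') + l \<cdot> b')) \<in> S"
      using that by (intro graph_diff) (auto simp: B_def)
    moreover have "(e \<cdot> (u - b) + l \<cdot> b) - (e \<cdot> (u' - b') + l \<cdot> b') = e \<cdot> (u - u' - (b - b')) + l \<cdot> (b - b')"
      by (simp add: algebra_simps)
    ultimately show ?thesis using that by (simp add: B_def)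
  qed
  have B_contr: "nrm b \<le> nrm u" if "B u b" for u b
  proof -
    have [simp]: "u \<in> L" "b \<in> L" using BL[OF that] .
    have "\<eta> * nrm b \<le> nrm (e \<cdot> (u - b) + l \<cdot> b - complex_of_real (\<mu> - \<eta>) \<cdot> b)"
      by (rule spectral_gap[OF \<eta> gap]) (use that \<eta> in \<open>auto simp: B_def\<close>)
    also have "e \<cdot> (u - b) + l \<cdot> b - complex_of_real (\<mu> - \<eta>) \<cdot> b = e \<cdot> u"
      by (simp add: e_def l_def algebra_simps)
    finally show ?thesis using \<eta> e by (simp add: nrm_scl)
  qed
  have B_quad: "4 * \<bar>Re (ip (u - b) b)\<bar> \<le> (nrm (u - b))\<^sup>2" if "B u b" for u b
  proof -
    have [simp]: "u \<in> L" "b \<in> L" using BL[OF that] .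
    have "4 * \<eta> * \<bar>\<eta> * Re (ip (u - b) b)\<bar> \<le> (\<eta> * nrm (u - b))\<^sup>2"
      using quad[of b "e \<cdot> (u - b) + l \<cdot> b"] that e by (simp add: B_def nrm_scl ip_scl_left) (simp add: e_def)
    hence "\<eta>\<^sup>2 * (4 * \<bar>Re (ip (u - b) b)\<bar>) \<le> \<eta>\<^sup>2 * (nrm (u - b))\<^sup>2"
      using \<eta> by (simp add: abs_mult power2_eq_square algebra_simps)
    thus ?thesis using \<eta> by simp
  qed
  have B_sym: "ip (u - b) b' = ip b (u' - b')" if B: "B u b" "B u' b'" for u b u' b'
  proof -
    have [simp]: "u \<in> L" "b \<in> L" "u' \<in> L" "b' \<in> L" using BL B by auto
    have "ip (e \<cdot> (u - b) + l \<cdot> b) b' = ip b (e \<cdot> (u' - b') + l \<cdot> b')"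
      by (rule graph_sym) (use B in \<open>auto simp: B_def\<close>)
    hence "e * ip (u - b) b' = e * ip b (u' - b')" 
      using e by (simp add: ip_add_left ip_add_right ip_scl_left ip_scl_right)
    thus ?thesis using e by simp
  qed
  \<comment> \<open>The contraction on the range of \<open>1 - T\<close>, with factor \<open>1 / 2\<close>: polarising the form estimate
\<open>B_quad\<close> turns it into a norm estimate.\<close>
  have B_half: "nrm (b - b2) \<le> 1 / 2 * nrm (u - b)" if B1: "B u b" and B2: "B b b2" for u b b2
  proof -
    have [simp]: "u \<in> L" "b \<in> L" "b2 \<in> L" using BL B1 B2 by auto
    define v d where "v = b - b2" and "d = u - b"
    have [simp]: "v \<in> L" "d \<in> L" by (auto simp: v_def d_def)
    have dv: "B d v" unfolding d_def v_def by (rule B_diff[OF B1 B2])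
    obtain p where p: "B v p" using B_ex[of v] by auto
    have [simp]: "p \<in> L" using BL[OF p] by simp
    define g where "g = v - p"
    have [simp]: "g \<in> L" by (simp add: g_def)
    have 1: "4 * \<bar>Re (ip (d + g) (b + p))\<bar> \<le> (nrm (d + g))\<^sup>2"
      using B_quad[OF B_add[OF B1 p]] by (simp add: d_def g_def algebra_simps)
    have 2: "4 * \<bar>Re (ip (d - g) (b - p))\<bar> \<le> (nrm (d - g))\<^sup>2"
      using B_quad[OF B_diff[OF B1 p]] by (simp add: d_def g_def algebra_simps)
    have "ip (d - v) p = ip v (v - p)" by (rule B_sym[OF dv p])
    hence dp: "ip d p = ip v v" by (simp add: ip_simps)
    have gb: "ip g b = ip p d" using B_sym[OF p B1] by (simp add: g_def d_def)
    have "Re (ip p d) = Re (ip d p)" using ip_cnj[of p d] by simp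
    hence "Re (ip (d + g) (b + p)) - Re (ip (d - g) (b - p)) = 4 * (nrm v)\<^sup>2"
      using dp gb by (simp add: ip_simps nrm_sq)
    hence "16 * (nrm v)\<^sup>2 \<le> (nrm (d + g))\<^sup>2 + (nrm (d - g))\<^sup>2" using 1 2 by linarith
    also have "\<dots> = 2 * (nrm d)\<^sup>2 + 2 * (nrm g)\<^sup>2" by (simp add: nrm_diff_sq nrm_add_sq)
    also have "nrm g \<le> 2 * nrm v"
      using nrm_triangle_diff[of v p] B_contr[OF p] by (simp add: g_def)
    hence "2 * (nrm d)\<^sup>2 + 2 * (nrm g)\<^sup>2 \<le> 2 * (nrm d)\<^sup>2 + 2 * (2 * nrm v)\<^sup>2"
      by (intro add_left_mono mult_left_mono power_mono) auto
    finally have "(2 * nrm v)\<^sup>2 \<le> (nrm d)\<^sup>2" by simp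
    hence "2 * nrm v \<le> nrm d" by (rule power2_le_imp_le) simp
    thus ?thesis by (simp add: v_def d_def)
  qed
  have B_below: "nrm u \<le> 2 * nrm (u - b)" if B: "B u b" for u b
  proof -
    have [simp]: "u \<in> L" "b \<in> L" using BL B by auto
    define U where "U n = ((\<lambda>u. SOME b. B u b) ^^ n) u" for n :: nat
    have UB: "B (U n) (U (Suc n))" for n
    proof (induction n)
      case 0 show ?case using someI_ex[OF B_ex[of u]] by (simp add: U_def)
    next
      case (Suc n)
      show ?case using someI_ex[OF B_ex[OF BL(2)[OF Suc]]] by (simp add: U_def)
    qed
    have UL [simp]: "U n \<in> L" for n using BL[OF UB[of n]] by simp
    have st: "nrm (U (Suc n) - U n) \<le> nrm (U 1 - U 0) * (1 / 2) ^ n" for n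
    proof (induction n)
      case (Suc n)
      have "nrm (U (Suc (Suc n)) - U (Suc n)) \<le> 1 / 2 * nrm (U (Suc n) - U n)"
        using B_half[OF UB UB, of n] nrm_minus_commute[OF UL UL] by metis
      thus ?case using Suc by simp
    qed simp
    obtain w where w [simp]: "w \<in> L" and lim: "(\<lambda>n. nrm (U n - w)) \<longlonglongrightarrow> 0"
      and wb: "nrm (U 0 - w) \<le> nrm (U 1 - U 0) / (1 - 1 / 2)"
      using geometric_limit[OF UL st] by auto
    have lim': "(\<lambda>n. nrm (U (Suc n) - w)) \<longlonglongrightarrow> 0" by (rule LIMSEQ_Suc[OF lim])
    have "(w, l \<cdot> w) \<in> S"
    proof (rule graph_closed[OF _ _ _ lim'])
      show "(U (Suc n), e \<cdot> (U n - U (Suc n)) + l \<cdot> U (Suc n)) \<in> S" for n using UB[of n] by (simp add: B_def)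
      let ?u = "\<lambda>n. \<eta> * (nrm (U 1 - U 0) * (1 / 2) ^ n) + cmod l * nrm (U (Suc n) - w)"
      show "(\<lambda>n. nrm (e \<cdot> (U n - U (Suc n)) + l \<cdot> U (Suc n) - l \<cdot> w)) \<longlonglongrightarrow> 0"
      proof (rule tendsto_sandwich[of "\<lambda>_. 0" _ _ ?u])
        show "\<forall>\<^sub>F n in sequentially. nrm (e \<cdot> (U n - U (Suc n)) + l \<cdot> U (Suc n) - l \<cdot> w) \<le> ?u n"
        proof (rule always_eventually, rule allI)
          fix n
          have eq: "e \<cdot> (U n - U (Suc n)) + l \<cdot> U (Suc n) - l \<cdot> w = e \<cdot> (U n - U (Suc n)) + l \<cdot> (U (Suc n) - w)"
            by (simp add: algebra_simps)
          have "nrm (e \<cdot> (U n - U (Suc n)) + l \<cdot> (U (Suc n) - w))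
              \<le> \<eta> * nrm (U n - U (Suc n)) + cmod l * nrm (U (Suc n) - w)"
            using nrm_triangle[of "e \<cdot> (U n - U (Suc n))" "l \<cdot> (U (Suc n) - w)"] e by (simp add: nrm_scl)
          also have "\<dots> \<le> ?u n"
            using st[of n] nrm_minus_commute[OF UL UL, of n "Suc n"] \<eta> by (intro add_right_mono mult_left_mono) auto
          finally show "nrm (e \<cdot> (U n - U (Suc n)) + l \<cdot> U (Suc n) - l \<cdot> w) \<le> ?u n" unfolding eq .
        qed
        have "?u \<longlonglongrightarrow> \<eta> * (nrm (U 1 - U 0) * 0) + cmod l * 0"
          by (intro tendsto_intros lim' LIMSEQ_power_zero) auto
        thus "?u \<longlonglongrightarrow> 0" by simp
      qed auto
    qed auto
    hence "nrm w = 0" using noeig[of w] graph_eigvecs by (simp add: l_def)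
    hence "nrm u \<le> nrm (U 0 - w)" using nrm_le_add[of u w] by (simp add: U_def)
    also have "\<dots> \<le> 2 * nrm (U 1 - U 0)" using wb by simp
    also have "nrm (U 1 - U 0) = nrm (u - b)"
    proof -
      have U0: "U 0 = u" by (simp add: U_def)
      have "nrm (U 1 - b) \<le> 0" using B_contr[OF B_diff[OF UB[of 0] B]] U0 by simp
      hence "nrm (U 1 - b) = 0" by simp
      hence "nrm (U 1 - u) = nrm (b - u)" by (intro nrm_eq_if_null) auto
      thus ?thesis using nrm_minus_commute[of b u] by (simp add: U_def)
    qed
    finally show ?thesis .
  qed
  have bl: "below l (3 / \<eta>)"
    unfolding below_def
  proof safe
    fix f h assume fh: "(f, h) \<in> S"
    have [simp]: "f \<in> L" "h \<in> L" using fh by auto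
    define d where "d = (1 / e) \<cdot> (h - l \<cdot> f)"
    have [simp]: "d \<in> L" by (simp add: d_def)
    have "e \<cdot> d + l \<cdot> f = h" using e by (simp add: d_def algebra_simps)
    hence "B (f + d) f" using fh by (simp add: B_def)
    hence "nrm (f + d) \<le> 2 * nrm d" using B_below by fastforce
    moreover have "nrm f \<le> nrm (f + d) + nrm d" using nrm_triangle_diff[of "f + d" d] by simp
    moreover have "nrm d = nrm (h - l \<cdot> f) / \<eta>" using e by (simp add: d_def nrm_scl norm_divide)
    ultimately show "nrm f \<le> 3 / \<eta> * nrm (h - l \<cdot> f)" by simp
  qed
  let ?m = "complex_of_real (\<mu> + \<eta> / 12)"
  have dist: "cmod (?m - l) = \<eta> / 12" "cmod (l - ?m) = \<eta> / 12" using \<eta> by (auto simp: l_def norm_minus_commute norm_divide)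
  have "below ?m ((3 / \<eta>) / (1 - (3 / \<eta>) * cmod (?m - l)))"
    by (rule below_perturb[OF bl]) (use \<eta> dist in auto)
  hence bm: "below ?m (4 / \<eta>)" using \<eta> unfolding dist by simp
  have "l \<in> rho"
  proof (rule neumann[OF gap bm])
    show "4 / \<eta> * cmod (l - ?m) < 1" using \<eta> unfolding dist by simp
  qed (use \<eta> in auto)
  thus ?thesis by (simp add: l_def)
qed

section \<open>Weakly null test sequences\<close>

text \<open>Used with three choices of \<open>E\<close>: the multi-valued part, a finite set of eigenvectors, and a vector
spanning the kernel.\<close>

lemma reduced_symmetric_relation:
  assumes E: "E \<subseteq> L"
  defines "L' \<equiv> {x \<in> L. \<forall>e\<in>E. ip e x = 0}"
  shows "symmetric_relation scl L' ip (S \<inter> L' \<times> L')"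
proof -
  have EL: "e \<in> L" if "e \<in> E" for e using E that by blast
  have si: "semi_inner scl L' ip"
  proof
    show "0 \<in> L'" using EL by (simp add: L'_def)
    show "x + y \<in> L'" if "x \<in> L'" "y \<in> L'" for x y using that EL by (auto simp: L'_def ip_add_right)
    show "a \<cdot> x \<in> L'" if "x \<in> L'" for x a using that EL by (auto simp: L'_def ip_scl_right)
    show "ip x (y + z) = ip x y + ip x z" if "x \<in> L'" "y \<in> L'" "z \<in> L'" for x y z
      using that by (auto simp: L'_def ip_add_right)
    show "ip x (a \<cdot> y) = a * ip x y" if "x \<in> L'" "y \<in> L'" for x y a
      using that by (auto simp: L'_def ip_scl_right)
    show "ip y x = cnj (ip x y)" if "x \<in> L'" "y \<in> L'" for x y
      using that by (auto simp: L'_def intro!: ip_cnj)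
    show "0 \<le> Re (ip x x)" if "x \<in> L'" for x using that by (auto simp: L'_def ip_nonneg)
  qed
  have sh: "semi_hilbert scl L' ip"
  proof (intro semi_hilbert.intro si semi_hilbert_axioms.intro)
    fix X :: "nat \<Rightarrow> 'v"
    assume X: "\<And>n. X n \<in> L'" and cau: "\<And>\<epsilon>. \<epsilon> > 0 \<Longrightarrow> \<exists>N. \<forall>m\<ge>N. \<forall>n\<ge>N. nrm (X m - X n) < \<epsilon>"
    have XL: "X n \<in> L" for n using X by (simp add: L'_def)
    obtain x where x: "x \<in> L" "(\<lambda>n. nrm (X n - x)) \<longlonglongrightarrow> 0" using complete[OF XL cau] by blast
    have "ip e x = 0" if e: "e \<in> E" for e
    proof -
      have "cmod (ip e x) \<le> nrm e * nrm (X n - x)" for n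
        using cauchy_schwarz[of e "X n - x"] X[of n] EL[OF e] XL x e
        by (simp add: ip_diff_right L'_def)
      hence "cmod (ip e x) \<le> nrm e * 0"
        by (intro LIMSEQ_le_const[OF tendsto_mult_left[OF x(2)]]) auto
      thus ?thesis by simp
    qed
    thus "\<exists>x\<in>L'. (\<lambda>n. nrm (X n - x)) \<longlonglongrightarrow> 0" using x by (auto simp: L'_def)
  qed
  have L'L: "x \<in> L" if "x \<in> L'" for x using that by (simp add: L'_def)
  note zer = semi_inner.zero_mem[OF si] and ad = semi_inner.add_mem[OF si] and sc = semi_inner.scl_mem[OF si]
  show ?thesis
  proof (intro symmetric_relation.intro sh symmetric_relation_axioms.intro)
    show "(f, h) \<in> S \<inter> L' \<times> L'"
      if *: "\<And>n. (F n, G n) \<in> S \<inter> L' \<times> L'" "f \<in> L'" "h \<in> L'"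
        "(\<lambda>n::nat. nrm (F n - f)) \<longlonglongrightarrow> 0" "(\<lambda>n. nrm (G n - h)) \<longlonglongrightarrow> 0" for F G f h
      using graph_closed[of F G f h] * by (auto simp: L'_def)
    show "f \<in> L' \<and> h \<in> L'" if "(f, h) \<in> S \<inter> L' \<times> L'" for f h using that by blast
    show "(0, 0) \<in> S \<inter> L' \<times> L'" using graph_zero zer by blast
    show "(f + f', h + h') \<in> S \<inter> L' \<times> L'"
      if "(f, h) \<in> S \<inter> L' \<times> L'" "(f', h') \<in> S \<inter> L' \<times> L'" for f h f' h'
      using that graph_add ad by blast
    show "(a \<cdot> f, a \<cdot> h) \<in> S \<inter> L' \<times> L'" if "(f, h) \<in> S \<inter> L' \<times> L'" for f h a
      using that graph_scl sc by blast
    show "ip h f' = ip f h'"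
      if "(f, h) \<in> S \<inter> L' \<times> L'" "(f', h') \<in> S \<inter> L' \<times> L'" for f h f' h'
      by (rule graph_sym) (use that in simp_all)
  qed
qed

text \<open>Splitting off eigenvectors preserves the resolvent set: if \<open>(S - z) f = k\<close> and \<open>e\<close> is an eigenvector
for \<open>\<mu>\<close>, then \<open>(\<mu> - z) ip e f = ip e k\<close>, so \<open>f\<close> is orthogonal to \<open>e\<close> whenever \<open>k\<close> is.\<close>

lemma reduced_rho:
  assumes EV: "\<And>e. e \<in> E \<Longrightarrow> e \<in> eigvecs (\<mu> e) \<and> nrm e \<noteq> 0" and z: "z \<in> rho"
  defines "L' \<equiv> {x \<in> L. \<forall>e\<in>E. ip e x = 0}"
  shows "z \<in> symmetric_relation.rho scl L' ip (S \<inter> L' \<times> L')"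
proof -
  interpret R: symmetric_relation scl L' ip "S \<inter> L' \<times> L'"
    unfolding L'_def by (rule reduced_symmetric_relation) (use EV eigvecs_subspace(4) in blast)
  note [simp del] = R.graph_fst R.graph_snd
  obtain C where C: "below z C" using rho_below[OF z] by blast
  show ?thesis
  proof (rule R.rhoI)
    show "R.below z C" using C unfolding R.below_def below_def by auto
  next
    fix k assume k: "k \<in> L'"
    hence kL: "k \<in> L" by (simp add: L'_def)
    obtain f where f: "(f, k + z \<cdot> f) \<in> S" using rho_surj[OF z kL] by blast
    have fL: "f \<in> L" using f by auto
    have "ip e f = 0" if e: "e \<in> E" for e
    proof -
      have eL: "e \<in> L" using EV[OF e] eigvecs_subspace(4) by blast
      have "ip (\<mu> e \<cdot> e) f = ip e (k + z \<cdot> f)" using graph_sym[OF eigvecs_graph f] EV[OF e] by blast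
      hence "cnj (\<mu> e) * ip e f = z * ip e f"
        using eL fL kL k e by (simp add: ip_scl_left ip_add_right ip_scl_right L'_def)
      moreover have "cnj (\<mu> e) = \<mu> e" using eigenvalue_real[of e] EV[OF e] by (auto simp: complex_eq_iff)
      moreover have "\<mu> e \<noteq> z" using eigenvalue_not_rho EV[OF e] z by blast
      ultimately show ?thesis by simp
    qed
    hence "f \<in> L'" using fL by (simp add: L'_def)
    moreover have "k + z \<cdot> f \<in> L'" using k \<open>f \<in> L'\<close> by simp
    ultimately show "\<exists>f. (f, k + z \<cdot> f) \<in> S \<inter> L' \<times> L'" using f by blast
  qed
qed

text \<open>One half of Weyl's criterion. Assume that the spectrum in the disc of radius \<open>r\<close> is discrete. It is then
finite, and removing the finitely many eigenvectors leaves a symmetric relation for which all of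
\<open>(-r, r)\<close> is in the resolvent set, so that its elements satisfy \<open>r \<parallel>f\<parallel> \<le> \<parallel>h\<parallel>\<close> by the spectral gap.
A weakly null sequence hardly notices the removal. Writing the projection \<open>F' n\<close> as the image of some \<open>g\<close>,
one gets \<open>\<parallel>F' n\<parallel>\<^sup>2 \<le> K \<parallel>g\<parallel> \<le> K \<parallel>F' n\<parallel> / r\<close>, and \<open>1 \<le> K / r\<close> in the limit.
The hypothesis on \<open>K\<close> is the dual form of \<open>\<parallel>S (F n)\<parallel> \<le> K\<close>. This form suits vectors whose image under a
larger relation is known only up to its multi-valued part.\<close>

lemma no_weakly_null_test_sequence:
  assumes r: "r > 0" and disc: "\<And>z. cmod z \<le> r \<Longrightarrow> z \<notin> rho \<Longrightarrow> discrete_point z"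
    and F: "\<And>n. F n \<in> L" "\<And>n. nrm (F n) = 1" and weak: "\<And>e. e \<in> L \<Longrightarrow> (\<lambda>n. ip e (F n)) \<longlonglongrightarrow> 0"
    and K: "\<And>n g k. (g, k) \<in> S \<Longrightarrow> cmod (ip k (F n)) \<le> K * nrm g" and Kr: "K < r"
  shows False
proof -
  define \<Lambda> where "\<Lambda> = {z. cmod z \<le> r \<and> z \<notin> rho}"
  have \<Lambda>eq: "\<Lambda> = cball 0 r \<inter> - rho" by (auto simp: \<Lambda>_def)
  have fin\<Lambda>: "finite \<Lambda>"
  proof (rule ccontr)
    assume "infinite \<Lambda>"
    moreover have "compact \<Lambda>" unfolding \<Lambda>eq using open_rho by (intro compact_Int_closed) (auto simp: closed_def)
    ultimately obtain x where x: "x \<in> \<Lambda>" "x islimpt \<Lambda>"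
      unfolding compact_eq_Bolzano_Weierstrass by blast
    have "x islimpt - rho" using islimpt_subset[OF x(2)] by (auto simp: \<Lambda>_def)
    moreover have "x isolated_in - rho" using disc[of x] x(1) by (auto simp: \<Lambda>_def discrete_point_def)
    ultimately show False by (simp add: isolated_in_islimpt_iff)
  qed
  have "\<exists>E. finite E \<and> E \<subseteq> eigvecs z \<and> orthonormal E (\<lambda>e. e)
      \<and> (\<forall>f\<in>eigvecs z. (\<forall>e\<in>E. ip e f = 0) \<longrightarrow> nrm f = 0)" if z: "z \<in> \<Lambda>" for z
  proof -
    have "fin_dim (eigvecs z)" using disc[of z] z by (auto simp: \<Lambda>_def discrete_point_def)
    then obtain B where B: "finite B" "B \<subseteq> eigvecs z"
        "\<And>f. f \<in> eigvecs z \<Longrightarrow> \<exists>c. nrm (f - (\<Sum>b\<in>B. c b \<cdot> b)) = 0" unfolding fin_dim_def by blast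
    obtain E where E: "finite E" "E \<subseteq> eigvecs z" "orthonormal E (\<lambda>e. e)"
        "\<And>b. b \<in> B \<Longrightarrow> nrm (b - (\<Sum>e\<in>E. ip e b \<cdot> e)) = 0"
      using gram_schmidt[OF B(1,2) eigvecs_subspace(4,1,2,3)] by blast
    have "nrm f = 0" if f: "f \<in> eigvecs z" and o: "\<forall>e\<in>E. ip e f = 0" for f
    proof -
      have fL [simp]: "f \<in> L" using f eigvecs_subspace(4) by blast
      have EL [simp]: "e \<in> L" if "e \<in> E" for e using that E eigvecs_subspace(4) by blast
      have BL [simp]: "b \<in> L" if "b \<in> B" for b using that B eigvecs_subspace(4) by blast
      have fe: "ip f e = 0" if "e \<in> E" for e using o that ip_cnj[of e f] by simp
      have fb: "ip f b = 0" if b: "b \<in> B" for b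
      proof -
        have "ip f (b - (\<Sum>e\<in>E. ip e b \<cdot> e)) = 0" using E(4)[OF b] b by (intro ip_null_right) auto
        moreover have "ip f (\<Sum>e\<in>E. ip e b \<cdot> e) = 0"
          by (subst ip_sum_right) (auto simp: ip_scl_right fe)
        ultimately show ?thesis using b by (simp add: ip_diff_right)
      qed
      obtain c where c: "nrm (f - (\<Sum>b\<in>B. c b \<cdot> b)) = 0" using B(3)[OF f] by blast
      have "ip f (f - (\<Sum>b\<in>B. c b \<cdot> b)) = 0" using c by (intro ip_null_right) auto
      moreover have "ip f (\<Sum>b\<in>B. c b \<cdot> b) = 0"
        by (subst ip_sum_right) (auto simp: ip_scl_right fb)
      ultimately have "ip f f = 0" by (simp add: ip_diff_right)
      thus ?thesis by (simp add: ip_self)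
    qed
    thus ?thesis using E by blast
  qed
  then obtain EE where EE: "\<And>z. z \<in> \<Lambda> \<Longrightarrow> finite (EE z)" "\<And>z. z \<in> \<Lambda> \<Longrightarrow> EE z \<subseteq> eigvecs z"
      "\<And>z. z \<in> \<Lambda> \<Longrightarrow> orthonormal (EE z) (\<lambda>e. e)"
      "\<And>z f. z \<in> \<Lambda> \<Longrightarrow> f \<in> eigvecs z \<Longrightarrow> (\<forall>e\<in>EE z. ip e f = 0) \<Longrightarrow> nrm f = 0"
    by metis
  define E where "E = (\<Union>z\<in>\<Lambda>. EE z)"
  have finE: "finite E" using fin\<Lambda> EE(1) by (auto simp: E_def)
  have "\<exists>z. e \<in> eigvecs z" if "e \<in> E" for e using that EE(2) by (auto simp: E_def)
  then obtain \<mu> where \<mu>: "\<And>e. e \<in> E \<Longrightarrow> e \<in> eigvecs (\<mu> e)" by metis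
  have n1: "nrm e = 1" if "e \<in> E" for e using that EE(3) unfolding E_def orthonormal_def by blast
  have EL [simp]: "e \<in> L" if "e \<in> E" for e using \<mu>[OF that] eigvecs_subspace(4) by blast
  have on: "orthonormal E (\<lambda>e. e)"
    unfolding orthonormal_def
  proof (intro conjI ballI impI)
    fix e e' assume e: "e \<in> E" "e' \<in> E" "e \<noteq> e'"
    obtain z z' where z: "z \<in> \<Lambda>" "e \<in> EE z" "z' \<in> \<Lambda>" "e' \<in> EE z'" using e by (auto simp: E_def)
    show "ip e e' = 0"
    proof (cases "z = z'")
      case True thus ?thesis using EE(3)[OF z(1)] z e unfolding orthonormal_def by blast
    next
      case False thus ?thesis using eigvecs_orthogonal EE(2) z by blast
    qed
  qed (auto simp: n1)
  define L' where "L' = {x \<in> L. \<forall>e\<in>E. ip e x = 0}"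
  have EV: "e \<in> eigvecs (\<mu> e) \<and> nrm e \<noteq> 0" if "e \<in> E" for e using \<mu> n1 that by auto
  interpret R: symmetric_relation scl L' ip "S \<inter> L' \<times> L'"
    unfolding L'_def by (rule reduced_symmetric_relation) (use EV eigvecs_subspace(4) in blast)
  note [simp del] = R.graph_fst R.graph_snd
  have rr: "z \<in> R.rho" if "z \<in> rho" for z
    using reduced_rho[OF EV that] unfolding L'_def .
  have all: "complex_of_real t \<in> R.rho" if t: "\<bar>t\<bar> < r" for t
  proof (cases "complex_of_real t \<in> rho")
    case False
    have "finite (\<Lambda> - {complex_of_real t})" using fin\<Lambda> by simp
    then obtain d where d: "d > 0" "\<And>w. w \<in> \<Lambda> - {complex_of_real t} \<Longrightarrow> d \<le> dist (complex_of_real t) w"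
      using finite_set_avoid[of "\<Lambda> - {complex_of_real t}" "complex_of_real t"] by auto
    define \<eta> where "\<eta> = min d (r - \<bar>t\<bar>) / 4"
    show ?thesis
    proof (rule R.isolated_point_rho[of \<eta>])
      show "\<eta> > 0" using d t by (simp add: \<eta>_def)
      fix s assume s: "0 < \<bar>s - t\<bar>" "\<bar>s - t\<bar> < 4 * \<eta>"
      hence "\<bar>s - t\<bar> < d" "\<bar>s - t\<bar> < r - \<bar>t\<bar>" by (auto simp: \<eta>_def)
      hence "complex_of_real s \<notin> \<Lambda>" using d(2)[of "complex_of_real s"] s(1) by (auto simp: dist_real_def)
      moreover have "\<bar>s\<bar> \<le> r" using \<open>\<bar>s - t\<bar> < r - \<bar>t\<bar>\<close> by linarith
      ultimately have "complex_of_real s \<in> rho" by (auto simp: \<Lambda>_def)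
      thus "complex_of_real s \<in> R.rho" by (rule rr)
    next
      fix f assume "f \<in> R.eigvecs (complex_of_real t)"
      hence "(f, complex_of_real t \<cdot> f) \<in> S" "f \<in> L'" using R.eigvecs_graph by blast+
      hence "f \<in> eigvecs (complex_of_real t)" "\<forall>e\<in>E. ip e f = 0" by (auto intro: graph_eigvecs simp: L'_def)
      moreover have "complex_of_real t \<in> \<Lambda>" using False t by (simp add: \<Lambda>_def)
      ultimately have "nrm f = 0" using EE(4)[of "complex_of_real t" f] by (auto simp: E_def)
      thus "nrm f = 0" by simp
    qed
  qed (rule rr)
  have gap: "r * nrm f \<le> nrm h" if "(f, h) \<in> S \<inter> L' \<times> L'" for f h
    using R.spectral_gap[of r 0 f h] r all that by auto
  have zr: "0 \<in> R.rho" using all[of 0] r by simp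
  define F' where "F' n = F n - (\<Sum>e\<in>E. ip e (F n) \<cdot> e)" for n
  have F'L: "F' n \<in> L'" for n
    unfolding L'_def F'_def using gram_schmidt_step[OF on finE F(1)] F(1) by auto
  have F'L2 [simp]: "F' n \<in> L" for n using F'L by (simp add: L'_def)
  have ipF: "ip g (F' n) = ip g (F n)" if g: "g \<in> L'" for g n
  proof -
    have gL: "g \<in> L" using g by (simp add: L'_def)
    have "ip g e = 0" if "e \<in> E" for e using ip_cnj[of e g] g that by (simp add: L'_def)
    hence "ip g (\<Sum>e\<in>E. ip e (F n) \<cdot> e) = 0" using gL by (subst ip_sum_right) (auto simp: ip_scl_right)
    thus ?thesis using gL F(1) by (simp add: F'_def ip_diff_right)
  qed
  have le: "(nrm (F' n))\<^sup>2 \<le> K / r * nrm (F' n)" for n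
  proof -
    obtain g where g: "(g, F' n) \<in> S \<inter> L' \<times> L'" using R.rho_surj[OF zr F'L[of n]] by auto
    have "(nrm (F' n))\<^sup>2 = cmod (ip (F' n) (F n))"
      unfolding ipF[OF F'L, symmetric] by (simp only: ip_self[OF F'L2] norm_of_real abs_power2)
    also have "\<dots> \<le> K * nrm g" using K[of g "F' n" n] g by auto
    also have "\<dots> \<le> K * (nrm (F' n) / r)"
    proof (cases "K \<ge> 0")
      case True thus ?thesis using gap[OF g] r by (intro mult_left_mono) (auto simp: field_simps)
    next
      case False
      have "g \<in> L" using g by (simp add: L'_def)
      hence "K * nrm g \<le> 0" using False by (simp add: mult_nonpos_nonneg)
      moreover have "0 \<le> cmod (ip (F' n) (F n))" by simp
      ultimately have "nrm g = 0" using K[of g "F' n" n] g False \<open>g \<in> L\<close>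
        by (smt (verit) IntE mult_eq_0_iff)
      moreover have "nrm (F' n) = 0" using calculation \<open>(nrm (F' n))\<^sup>2 = _\<close> K[of g "F' n" n] g by auto
      ultimately show ?thesis by simp
    qed
    finally show ?thesis by simp
  qed
  have sq: "(nrm (F' n))\<^sup>2 = 1 - (\<Sum>e\<in>E. (cmod (ip e (F n)))\<^sup>2)" for n
  proof -
    have "ip (F n) (\<Sum>e\<in>E. ip e (F n) \<cdot> e) = of_real (\<Sum>e\<in>E. (cmod (ip e (F n)))\<^sup>2)"
      using F(1) ip_cnj[OF EL F(1), of _ n]
      by (subst ip_sum_right) (auto simp: ip_scl_right complex_norm_square simp del: of_real_power)
    thus ?thesis using orthonormal_nrm_sum[OF on finE, of "\<lambda>e. ip e (F n)"] F
      by (simp add: F'_def nrm_diff_sq)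
  qed
  have "(\<lambda>n. 1 - (\<Sum>e\<in>E. (cmod (ip e (F n)))\<^sup>2)) \<longlonglongrightarrow> 1 - (\<Sum>e\<in>E. (cmod 0)\<^sup>2)"
    by (intro tendsto_intros weak EL)
  hence lim2: "(\<lambda>n. (nrm (F' n))\<^sup>2) \<longlonglongrightarrow> 1" unfolding sq by simp
  hence "(\<lambda>n. sqrt ((nrm (F' n))\<^sup>2)) \<longlonglongrightarrow> sqrt 1" by (intro tendsto_intros)
  hence lim1: "(\<lambda>n. nrm (F' n)) \<longlonglongrightarrow> 1" by simp
  have "1 \<le> K / r * 1"
    by (rule LIMSEQ_le[OF lim2 tendsto_mult_left[OF lim1]]) (use le in blast)
  thus False using Kr r by simp
qed

end

section \<open>Lower bounds up to finitely many functionals\<close>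

lemma finite_family_convergent_subsequence:
  fixes a :: "'i \<Rightarrow> nat \<Rightarrow> complex"
  assumes "finite I" "\<And>i. i \<in> I \<Longrightarrow> bounded (range (a i))"
  shows "\<exists>\<phi>::nat \<Rightarrow> nat. strict_mono \<phi> \<and> (\<forall>i\<in>I. convergent (\<lambda>n. a i (\<phi> n)))"
  using assms
proof (induction I)
  case empty
  show ?case by (auto intro!: exI[of _ id] strict_mono_id)
next
  case (insert i I)
  then obtain \<phi> :: "nat \<Rightarrow> nat" where \<phi>: "strict_mono \<phi>" "\<And>j. j \<in> I \<Longrightarrow> convergent (\<lambda>n. a j (\<phi> n))" by auto
  have "bounded (range (\<lambda>n. a i (\<phi> n)))" using insert.prems[of i] by (auto intro: bounded_subset)
  from bounded_imp_convergent_subsequence[OF this] obtain l \<psi> where \<psi>: "strict_mono (\<psi>::nat\<Rightarrow>nat)" "((\<lambda>n. a i (\<phi> n)) \<circ> \<psi>) \<longlonglongrightarrow> l" by blast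
  have "convergent (\<lambda>n. a j ((\<phi> \<circ> \<psi>) n))" if "j \<in> insert i I" for j
  proof (cases "j = i")
    case True thus ?thesis using \<psi> by (auto simp: convergent_def o_def)
  next
    case False
    hence "convergent ((\<lambda>n. a j (\<phi> n)) \<circ> \<psi>)" using \<phi>(2)[of j] that \<psi>(1) by (intro convergent_subseq_convergent) auto
    thus ?thesis by (simp add: o_def)
  qed
  thus ?case using strict_mono_o[OF \<phi>(1) \<psi>(1)] by blast
qed

text \<open>The estimate \<open>r \<parallel>f\<parallel> \<le> \<parallel>h\<parallel>\<close> holds on the common kernel of finitely many functionals. Essential
spectrum in the open disc of radius \<open>r\<close> would produce infinitely many independent approximate eigenvectors,
and some combination of them would lie in this kernel and violate the estimate.\<close>

locale finitely_corrected_bound = symmetric_relation scl L ip S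
  for scl :: "complex \<Rightarrow> 'v::ab_group_add \<Rightarrow> 'v" (infixr "\<cdot>" 75) and L ip S +
  fixes I :: "'i set" and l :: "'i \<Rightarrow> 'v \<Rightarrow> complex" and D C r :: real
  assumes finI: "finite I" and C0: "C \<ge> 0" and r0: "r > 0"
    and l_add: "i \<in> I \<Longrightarrow> x \<in> L \<Longrightarrow> y \<in> L \<Longrightarrow> l i (x + y) = l i x + l i y"
    and l_scl: "i \<in> I \<Longrightarrow> x \<in> L \<Longrightarrow> l i (a \<cdot> x) = a * l i x"
    and l_bound: "i \<in> I \<Longrightarrow> x \<in> L \<Longrightarrow> cmod (l i x) \<le> D * nrm x"
    and bound: "(f, h) \<in> S \<Longrightarrow> nrm f \<le> nrm h / r + C * (\<Sum>i\<in>I. cmod (l i f))"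
begin

lemma l_diff: "i \<in> I \<Longrightarrow> x \<in> L \<Longrightarrow> y \<in> L \<Longrightarrow> l i (x - y) = l i x - l i y"
  using l_add[of i x "(-1) \<cdot> y"] l_scl[of i y "-1"] by simp

text \<open>At a normalised eigenvector with \<open>cmod z \<le> q * r\<close> the functionals have to supply at least \<open>1 - q\<close> in the
estimate, while Bessel's inequality bounds what they can supply to an orthonormal system.\<close>

lemma card_orthonormal_eigenvectors:
  assumes Q: "finite Q" "orthonormal Q e" and ev: "\<And>j. j \<in> Q \<Longrightarrow> e j \<in> eigvecs (z j)"
    and z: "\<And>j. j \<in> Q \<Longrightarrow> cmod (z j) \<le> q * r" and q: "q < 1"
  shows "real (card Q) * (1 - q)\<^sup>2 \<le> C\<^sup>2 * (card I * (card I * D\<^sup>2))"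
proof -
  have one: "(1 - q)\<^sup>2 \<le> C\<^sup>2 * (card I * (\<Sum>i\<in>I. (cmod (l i (e j)))\<^sup>2))" if j: "j \<in> Q" for j
  proof -
    have n1: "nrm (e j) = 1" "e j \<in> L" using Q(2) j by (auto simp: orthonormal_def)
    have "1 \<le> cmod (z j) / r + C * (\<Sum>i\<in>I. cmod (l i (e j)))"
      using bound[OF eigvecs_graph[OF ev[OF j]]] n1 by (simp add: nrm_scl)
    moreover have "cmod (z j) / r \<le> q" using z[OF j] r0 by (simp add: field_simps)
    ultimately have "1 - q \<le> C * (\<Sum>i\<in>I. cmod (l i (e j)))" by simp
    hence "(1 - q)\<^sup>2 \<le> (C * (\<Sum>i\<in>I. cmod (l i (e j))))\<^sup>2" using q by (intro power_mono) auto
    also have "\<dots> = C\<^sup>2 * (\<Sum>i\<in>I. cmod (l i (e j)))\<^sup>2" by (simp add: power_mult_distrib)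
    also have "\<dots> \<le> C\<^sup>2 * (card I * (\<Sum>i\<in>I. (cmod (l i (e j)))\<^sup>2))"
      using sum_squared_le_sum_of_squares[of "\<lambda>i. cmod (l i (e j))" I] finI
      by (intro mult_left_mono) (auto simp: mult.commute)
    finally show ?thesis .
  qed
  have "real (card Q) * (1 - q)\<^sup>2 = (\<Sum>j\<in>Q. (1 - q)\<^sup>2)" by simp
  also have "\<dots> \<le> (\<Sum>j\<in>Q. C\<^sup>2 * (card I * (\<Sum>i\<in>I. (cmod (l i (e j)))\<^sup>2)))"
    by (rule sum_mono) (rule one)
  also have "\<dots> = C\<^sup>2 * (card I * (\<Sum>i\<in>I. \<Sum>j\<in>Q. (cmod (l i (e j)))\<^sup>2))"
    by (subst sum.swap) (simp add: sum_distrib_left)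
  also have "\<dots> \<le> C\<^sup>2 * (card I * (\<Sum>i\<in>I. D\<^sup>2))"
    by (intro mult_left_mono sum_mono bessel_functional[OF Q(2,1)] l_add l_scl l_bound) auto
  finally show ?thesis by simp
qed

lemma finite_eigenvalues:
  assumes q: "0 \<le> q" "q < 1"
  shows "finite {z. cmod z \<le> q * r \<and> (\<exists>f\<in>eigvecs z. nrm f \<noteq> 0)}" (is "finite ?Z")
proof (rule ccontr)
  assume inf: "infinite ?Z"
  obtain N :: nat where N: "C\<^sup>2 * (card I * (card I * D\<^sup>2)) < real N * (1 - q)\<^sup>2"
    using ex_less_of_nat_mult[of "(1-q)\<^sup>2"] q by auto
  obtain Q where Q: "Q \<subseteq> ?Z" "finite Q" "card Q = N" using infinite_arbitrarily_large[OF inf] by blast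
  have "\<exists>e. e \<in> eigvecs z \<and> nrm e = 1" if zQ: "z \<in> Q" for z
  proof -
    obtain f where f: "f \<in> eigvecs z" "nrm f \<noteq> 0" using zQ Q by auto
    have fL: "f \<in> L" using f eigvecs_subspace(4) by blast
    have "nrm ((1 / complex_of_real (nrm f)) \<cdot> f) = 1" using f fL by (simp add: nrm_scl norm_divide)
    thus ?thesis using eigvecs_subspace(3)[OF f(1)] by blast
  qed
  then obtain e where e: "\<And>z. z \<in> Q \<Longrightarrow> e z \<in> eigvecs z" "\<And>z. z \<in> Q \<Longrightarrow> nrm (e z) = 1" by metis
  have "orthonormal Q e"
    unfolding orthonormal_def using e eigvecs_subspace(4) eigvecs_orthogonal by blast
  from card_orthonormal_eigenvectors[OF Q(2) this, of "\<lambda>z. z" q] e Q N q show False by auto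
qed

text \<open>Orthonormal systems of eigenvectors for \<open>z\<close> have bounded size, and one of maximal size spans.\<close>

lemma fin_dim_eigvecs:
  assumes z: "cmod z < r"
  shows "fin_dim (eigvecs z)"
proof -
  define P where "P n \<longleftrightarrow> (\<exists>E. finite E \<and> E \<subseteq> eigvecs z \<and> orthonormal E (\<lambda>e. e) \<and> card E = n)" for n
  define q where "q = cmod z / r"
  have q: "q < 1" "cmod z = q * r" using z r0 by (auto simp: q_def)
  obtain N :: nat where N: "C\<^sup>2 * (card I * (card I * D\<^sup>2)) < real N * (1 - q)\<^sup>2"
    using ex_less_of_nat_mult[of "(1-q)\<^sup>2"] q by auto
  have PN: "n \<le> N" if Pn: "P n" for n
  proof (rule ccontr)
    assume "\<not> n \<le> N"
    obtain E where E: "finite E" "E \<subseteq> eigvecs z" "orthonormal E (\<lambda>e. e)" "card E = n" using Pn by (auto simp: P_def)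
    have "real n * (1 - q)\<^sup>2 \<le> C\<^sup>2 * (card I * (card I * D\<^sup>2))"
      using card_orthonormal_eigenvectors[OF E(1,3), of "\<lambda>_. z" q] E q by auto
    moreover have "real N * (1 - q)\<^sup>2 \<le> real n * (1 - q)\<^sup>2" using \<open>\<not> n \<le> N\<close> by (intro mult_right_mono) auto
    ultimately show False using N by simp
  qed
  have "P 0" unfolding P_def by (rule exI[of _ "{}"]) (auto simp: orthonormal_def)
  then obtain n where n: "P n" "\<And>m. P m \<Longrightarrow> m \<le> n"
    using ex_has_greatest_nat[of P 0 id "Suc N"] PN by (auto simp: le_imp_less_Suc)
  obtain E where E: "finite E" "E \<subseteq> eigvecs z" "orthonormal E (\<lambda>e. e)" "card E = n" using n(1) by (auto simp: P_def)
  have EL: "e \<in> L" if "e \<in> E" for e using that E eigvecs_subspace(4) by blast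
  have sumV: "(\<Sum>e\<in>F. c e \<cdot> e) \<in> eigvecs z" if "F \<subseteq> eigvecs z" for F c
    using that by (induction F rule: infinite_finite_induct) (auto intro: eigvecs_subspace)
  have "nrm (f - (\<Sum>e\<in>E. ip e f \<cdot> e)) = 0" if f: "f \<in> eigvecs z" for f
  proof (rule ccontr)
    define d where "d = f - (\<Sum>e\<in>E. ip e f \<cdot> e)"
    assume "nrm (f - (\<Sum>e\<in>E. ip e f \<cdot> e)) \<noteq> 0"
    hence d0: "nrm d \<noteq> 0" by (simp add: d_def)
    have fL: "f \<in> L" using f eigvecs_subspace(4) by blast
    have "f + (-1) \<cdot> (\<Sum>e\<in>E. ip e f \<cdot> e) \<in> eigvecs z"
      by (intro eigvecs_subspace f sumV E)
    hence dV: "d \<in> eigvecs z" by (simp add: d_def)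
    have dL: "d \<in> L" using dV eigvecs_subspace(4) by blast
    define u where "u = (1 / complex_of_real (nrm d)) \<cdot> d"
    have uV: "u \<in> eigvecs z" unfolding u_def by (intro eigvecs_subspace dV)
    have uL: "u \<in> L" using dL by (simp add: u_def)
    have u1: "nrm u = 1" using d0 dL by (simp add: u_def nrm_scl norm_divide)
    have ou: "ip e u = 0" if "e \<in> E" for e
      using gram_schmidt_step[OF E(3,1) fL that] EL[OF that] dL by (simp add: u_def ip_scl_right d_def)
    have uo: "ip u e = 0" if "e \<in> E" for e using ou[OF that] ip_cnj[of e u] EL[OF that] uL by simp
    have uE: "u \<notin> E" using ou[of u] u1 uL by (auto simp: ip_self)
    have "orthonormal (insert u E) (\<lambda>e. e)"
      using E(3) ou uo u1 uL by (auto simp: orthonormal_def)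
    hence "P (Suc n)" unfolding P_def using E uV uE by (intro exI[of _ "insert u E"]) auto
    thus False using n(2) by fastforce
  qed
  hence "\<forall>f\<in>eigvecs z. \<exists>c. nrm (f - (\<Sum>b\<in>E. c b \<cdot> b)) = 0"
    by (intro ballI exI[of _ "\<lambda>e. ip e _"])
  thus ?thesis unfolding fin_dim_def using E(1,2) by (intro exI[of _ E] conjI)
qed

text \<open>A normalised sequence along which \<open>S - z\<close> tends to zero has a subsequence on which the finitely many
functionals converge. The corrected estimate makes this subsequence Cauchy, and its limit would be a
normalised eigenvector.\<close>

lemma below_if_no_eigenvector:
  assumes z: "cmod z < r" and noeig: "\<And>f. f \<in> eigvecs z \<Longrightarrow> nrm f = 0"
  shows "\<exists>C'. below z C'"
proof (rule ccontr)
  assume "\<not> ?thesis"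
  hence "\<not> below z C'" for C' by blast
  hence nb: "\<And>C'. \<exists>f h. (f, h) \<in> S \<and> nrm f > C' * nrm (h - z \<cdot> f)"
    unfolding below_def by (force simp: not_le)
  have "\<exists>f h. (f, h) \<in> S \<and> nrm f = 1 \<and> nrm (h - z \<cdot> f) \<le> 1 / real (Suc n)" for n
  proof -
    obtain f h where fh: "(f, h) \<in> S" "nrm f > real (Suc n) * nrm (h - z \<cdot> f)" using nb by blast
    have [simp]: "f \<in> L" "h \<in> L" using fh by auto
    have "0 \<le> real (Suc n) * nrm (h - z \<cdot> f)" by simp
    hence pos: "nrm f > 0" using fh(2) by linarith
    let ?a = "1 / complex_of_real (nrm f)"
    have "?a \<cdot> h - z \<cdot> (?a \<cdot> f) = ?a \<cdot> (h - z \<cdot> f)" by (simp add: algebra_simps)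
    hence "nrm (?a \<cdot> h - z \<cdot> (?a \<cdot> f)) = nrm (h - z \<cdot> f) / nrm f" using pos by (simp add: nrm_scl norm_divide)
    also have "\<dots> \<le> 1 / real (Suc n)" using fh(2) pos by (simp add: field_simps del: of_nat_Suc)
    finally show ?thesis using graph_scl[OF fh(1), of ?a] pos
      by (intro exI[of _ "?a \<cdot> f"] exI[of _ "?a \<cdot> h"]) (simp add: nrm_scl norm_divide)
  qed
  then obtain F G where FG: "\<And>n. (F n, G n) \<in> S" "\<And>n. nrm (F n) = 1"
      "\<And>n. nrm (G n - z \<cdot> F n) \<le> 1 / real (Suc n)" by metis
  have L1 [simp]: "F n \<in> L" "G n \<in> L" for n using FG(1)[of n] by auto
  have "bounded (range (\<lambda>n. l i (F n)))" if "i \<in> I" for i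
    using l_bound[OF that L1(1)] FG(2) unfolding bounded_iff by (intro exI[of _ D]) auto
  from finite_family_convergent_subsequence[where a = "\<lambda>i n. l i (F n)", OF finI this]
  obtain \<phi> :: "nat \<Rightarrow> nat" where \<phi>: "strict_mono \<phi>" "\<And>i. i \<in> I \<Longrightarrow> convergent (\<lambda>n. l i (F (\<phi> n)))" by auto
  define X Y where "X n = F (\<phi> n)" and "Y n = G (\<phi> n)" for n
  have XY: "(X n, Y n) \<in> S" "nrm (X n) = 1" for n using FG by (auto simp: X_def Y_def)
  have XL [simp]: "X n \<in> L" "Y n \<in> L" for n by (auto simp: X_def Y_def)
  have YX: "nrm (Y n - z \<cdot> X n) \<le> 1 / real (Suc n)" for n
  proof -
    have "nrm (Y n - z \<cdot> X n) \<le> 1 / real (Suc (\<phi> n))" using FG(3) by (simp add: X_def Y_def)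
    also have "\<dots> \<le> 1 / real (Suc n)" using seq_suble[OF \<phi>(1), of n] by (intro divide_left_mono) auto
    finally show ?thesis .
  qed
  have lX: "convergent (\<lambda>n. l i (X n))" if "i \<in> I" for i using \<phi>(2)[OF that] by (simp add: X_def)
  define p where "p = 1 - cmod z / r"
  have p: "p > 0" using z r0 by (simp add: p_def)
  have est: "p * nrm (X m - X n) \<le> (1 / real (Suc m) + 1 / real (Suc n)) / r + C * (\<Sum>i\<in>I. cmod (l i (X m) - l i (X n)))" for m n
  proof -
    have sum_eq: "(\<Sum>i\<in>I. cmod (l i (X m - X n))) = (\<Sum>i\<in>I. cmod (l i (X m) - l i (X n)))"
      by (intro sum.cong) (auto simp: l_diff)
    have "nrm (X m - X n) \<le> nrm (Y m - Y n) / r + C * (\<Sum>i\<in>I. cmod (l i (X m) - l i (X n)))"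
      using bound[OF graph_diff[OF XY(1) XY(1)], of m n] unfolding sum_eq .
    moreover have "Y m - Y n = z \<cdot> (X m - X n) + ((Y m - z \<cdot> X m) - (Y n - z \<cdot> X n))" by (simp add: algebra_simps)
    hence "nrm (Y m - Y n) \<le> nrm (z \<cdot> (X m - X n)) + nrm ((Y m - z \<cdot> X m) - (Y n - z \<cdot> X n))"
      by (metis nrm_triangle XL diff_mem scl_mem)
    hence "nrm (Y m - Y n) \<le> cmod z * nrm (X m - X n) + (1 / real (Suc m) + 1 / real (Suc n))"
      using nrm_triangle_diff[of "Y m - z \<cdot> X m" "Y n - z \<cdot> X n"] YX[of m] YX[of n] by (simp add: nrm_scl)
    hence "nrm (Y m - Y n) / r \<le> (cmod z * nrm (X m - X n) + (1 / real (Suc m) + 1 / real (Suc n))) / r"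
      using r0 by (intro divide_right_mono) auto
    ultimately have "nrm (X m - X n) \<le> (cmod z * nrm (X m - X n) + (1 / real (Suc m) + 1 / real (Suc n))) / r
        + C * (\<Sum>i\<in>I. cmod (l i (X m) - l i (X n)))" by linarith
    thus ?thesis by (simp add: p_def algebra_simps add_divide_distrib)
  qed
  have "\<exists>x\<in>L. (\<lambda>n. nrm (X n - x)) \<longlonglongrightarrow> 0"
  proof (rule complete)
    fix \<epsilon> :: real assume \<epsilon>: "\<epsilon> > 0"
    define c where "c = C * card I + 1"
    define \<delta> where "\<delta> = p * \<epsilon> / (2 * c)"
    have den: "c > 0" unfolding c_def using C0 by (intro add_nonneg_pos) auto
    have \<delta>: "\<delta> > 0" using p \<epsilon> den by (simp add: \<delta>_def)
    have "\<exists>N. \<forall>m\<ge>N. \<forall>n\<ge>N. cmod (l i (X m) - l i (X n)) < \<delta>" if "i \<in> I" for i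
      using lX[OF that] \<delta> by (simp add: Cauchy_convergent_iff[symmetric] Cauchy_def dist_norm)
    then obtain N where N: "\<And>i m n. i \<in> I \<Longrightarrow> m \<ge> N i \<Longrightarrow> n \<ge> N i \<Longrightarrow> cmod (l i (X m) - l i (X n)) < \<delta>" by metis
    obtain N0 :: nat where N0: "1 / real (Suc N0) < p * \<epsilon> * r / 4"
      using nat_approx_posE[of "p * \<epsilon> * r / 4"] p \<epsilon> r0 by auto
    define M where "M = Max (insert N0 (N ` I))"
    have M: "M \<ge> N0" "\<And>i. i \<in> I \<Longrightarrow> M \<ge> N i" using finI by (auto simp: M_def)
    show "\<exists>N. \<forall>m\<ge>N. \<forall>n\<ge>N. nrm (X m - X n) < \<epsilon>"
    proof (intro exI[of _ M] allI impI)
      fix m n assume mn: "m \<ge> M" "n \<ge> M"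
      have inv: "1 / real (Suc k) < p * \<epsilon> * r / 4" if "k \<ge> M" for k
      proof -
        have "1 / real (Suc k) \<le> 1 / real (Suc N0)" using that M(1) by (intro divide_left_mono) auto
        thus ?thesis using N0 by linarith
      qed
      have "(\<Sum>i\<in>I. cmod (l i (X m) - l i (X n))) \<le> (\<Sum>i\<in>I. \<delta>)"
        using N M(2) mn by (intro sum_mono less_imp_le) (meson order_trans)
      hence "C * (\<Sum>i\<in>I. cmod (l i (X m) - l i (X n))) \<le> C * (card I * \<delta>)" using C0 by (intro mult_left_mono) auto
      also have "\<dots> \<le> c * \<delta>" using \<delta> by (simp add: c_def algebra_simps)
      also have "\<dots> = p * \<epsilon> / 2" using den by (simp add: \<delta>_def)
      finally have "p * nrm (X m - X n) \<le> (1 / real (Suc m) + 1 / real (Suc n)) / r + p * \<epsilon> / 2"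
        using est[of m n] by linarith
      moreover have "(1 / real (Suc m) + 1 / real (Suc n)) / r < (p * \<epsilon> * r / 2) / r"
        using inv[OF mn(1)] inv[OF mn(2)] r0 by (intro divide_strict_right_mono) linarith+
      moreover have "(p * \<epsilon> * r / 2) / r = p * \<epsilon> / 2" using r0 by simp
      ultimately have "p * nrm (X m - X n) < p * \<epsilon>" by linarith
      thus "nrm (X m - X n) < \<epsilon>" using p by simp
    qed
  qed simp
  then obtain x where x [simp]: "x \<in> L" and lim: "(\<lambda>n. nrm (X n - x)) \<longlonglongrightarrow> 0" by blast
  have "(x, z \<cdot> x) \<in> S"
  proof (rule graph_closed[OF XY(1) _ _ lim])
    let ?u = "\<lambda>n. 1 / real (Suc n) + cmod z * nrm (X n - x)"
    show "(\<lambda>n. nrm (Y n - z \<cdot> x)) \<longlonglongrightarrow> 0"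
    proof (rule tendsto_sandwich[of "\<lambda>_. 0" _ _ ?u])
      show "\<forall>\<^sub>F n in sequentially. nrm (Y n - z \<cdot> x) \<le> ?u n"
      proof (rule always_eventually, rule allI)
        fix n
        have eq: "Y n - z \<cdot> x = (Y n - z \<cdot> X n) + z \<cdot> (X n - x)" by (simp add: algebra_simps)
        show "nrm (Y n - z \<cdot> x) \<le> ?u n"
          unfolding eq using nrm_triangle[of "Y n - z \<cdot> X n" "z \<cdot> (X n - x)"] YX[of n] by (simp add: nrm_scl)
      qed
      have "?u \<longlonglongrightarrow> 0 + cmod z * 0" by (intro tendsto_intros lim LIMSEQ_Suc[OF lim_1_over_n])
      thus "?u \<longlonglongrightarrow> 0" by simp
    qed auto
  qed auto
  hence "nrm x = 0" using noeig graph_eigvecs by blast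
  hence "nrm (X n) \<le> nrm (X n - x)" for n using nrm_le_add[of "X n" x] by simp
  hence "1 \<le> nrm (X n - x)" for n using XY(2) by simp
  hence "(1::real) \<le> 0" by (intro LIMSEQ_le_const[OF lim]) auto
  thus False by simp
qed

text \<open>Away from the finitely many eigenvalues in a slightly smaller disc, \<open>S - z\<close> is bounded below. The disc
remains connected when finitely many points are removed, so a single point \<open>z0\<close> of the resolvent set
suffices for the whole punctured disc.\<close>

theorem discrete_in_ball:
  assumes z0: "z0 \<in> rho" "cmod z0 < r" and z: "cmod z < r" "z \<notin> rho"
  shows "discrete_point z"
proof -
  obtain s where s: "cmod z < s" "cmod z0 < s" "s < r"
    using dense[of "max (cmod z) (cmod z0)" r] z0 z by auto
  define Z where "Z = {z. cmod z \<le> s \<and> (\<exists>f\<in>eigvecs z. nrm f \<noteq> 0)}"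
  have s0: "s > 0" using s(1) norm_ge_zero[of z] by linarith
  have finZ: "finite Z" using finite_eigenvalues[of "s / r"] s s0 r0 by (simp add: Z_def)
  define \<Omega> where "\<Omega> = ball (0::complex) s - Z"
  have "connected \<Omega>" unfolding \<Omega>_def by (rule connected_open_delete_finite) (use finZ in auto)
  moreover have "\<exists>C'. below w C'" if "w \<in> \<Omega>" for w
    by (rule below_if_no_eigenvector) (use that s in \<open>auto simp: \<Omega>_def Z_def\<close>)
  moreover have "z0 \<in> \<Omega>" using z0 s eigenvalue_not_rho by (auto simp: \<Omega>_def Z_def)
  ultimately have \<Omega>: "\<Omega> \<subseteq> rho" using rho_connected[of \<Omega> z0] z0 by blast
  have zZ: "z \<in> Z" using \<Omega> z s by (auto simp: \<Omega>_def)
  hence ev: "\<exists>f\<in>eigvecs z. nrm f \<noteq> 0" by (simp add: Z_def)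
  have "open (ball (0::complex) s - (Z - {z}))" using finZ by (intro open_Diff finite_imp_closed) auto
  moreover have "(ball (0::complex) s - (Z - {z})) \<inter> (- rho) = {z}"
    using \<Omega> z s by (auto simp: \<Omega>_def)
  ultimately have "z isolated_in (- rho)" using z unfolding isolated_in_def by blast
  thus ?thesis using ev fin_dim_eigvecs[OF z(1)] by (simp add: discrete_point_def)
qed

end

section \<open>Absolute continuity and the fundamental theorem of calculus\<close>

lemma division_interval:
  fixes d :: "real set set"
  assumes "d division_of t" "k \<in> d"
  obtains u v where "k = {u..v}" "u \<le> v" "Inf k = u" "Sup k = v"
proof -
  obtain u v where k: "k = cbox u v" using division_ofD(4)[OF assms] by blast
  moreover have "k \<noteq> {}" using division_ofD(3)[OF assms] .
  ultimately have "k = {u..v}" "u \<le> v" by (auto simp: box_real)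
  thus ?thesis using that by simp
qed

text \<open>Intervals of a division may share endpoints; half-open intervals of the same length do not overlap.\<close>

lemma division_half_open_disjoint:
  fixes d :: "real set set"
  assumes d: "d division_of t"
  shows "disjoint_family_on (\<lambda>k. {Inf k<..Sup k}) d"
  unfolding disjoint_family_on_def
proof (intro ballI impI)
  fix k k' assume k: "k \<in> d" "k' \<in> d" "k \<noteq> k'"
  obtain u v where uv: "k = {u..v}" "u \<le> v" "Inf k = u" "Sup k = v" by (rule division_interval[OF d k(1)])
  obtain u' v' where uv': "k' = {u'..v'}" "u' \<le> v'" "Inf k' = u'" "Sup k' = v'" by (rule division_interval[OF d k(2)])
  have int: "{u<..<v} \<inter> {u'<..<v'} = {}" using division_ofD(5)[OF d k] uv uv' by (simp add: interior_atLeastAtMost_real)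
  show "{Inf k<..Sup k} \<inter> {Inf k'<..Sup k'} = {}"
  proof (rule ccontr)
    assume "{Inf k<..Sup k} \<inter> {Inf k'<..Sup k'} \<noteq> {}"
    hence "max u u' < min v v'" using uv uv' by auto
    then obtain y where "max u u' < y" "y < min v v'" using dense by blast
    hence "y \<in> {u<..<v} \<inter> {u'<..<v'}" by auto
    thus False using int by blast
  qed
qed

text \<open>The derivative \<open>p\<close> is carried along as data, together with its integrability and its validity almost
everywhere: this is the form in which the canonical relation supplies it.\<close>

definition ac_deriv :: "real \<Rightarrow> real \<Rightarrow> (real \<Rightarrow> 'a::euclidean_space) \<Rightarrow> (real \<Rightarrow> 'a) \<Rightarrow> bool" where
  "ac_deriv a b F p \<longleftrightarrow> abs_continuous_on {a..b} F \<and> set_integrable lebesgue {a<..b} p \<and>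
     (AE x in lebesgue. a < x \<and> x < b \<longrightarrow> (F has_vector_derivative p x) (at x))"

lemma abs_continuous_on_subset: "abs_continuous_on S f \<Longrightarrow> T \<subseteq> S \<Longrightarrow> abs_continuous_on T f"
  unfolding abs_continuous_on_def by (meson order_trans)

lemma abs_continuous_onE:
  assumes "abs_continuous_on S f" "\<epsilon> > 0"
  obtains \<delta> where "\<delta> > 0"
    "\<And>d t. d division_of t \<Longrightarrow> t \<subseteq> S \<Longrightarrow> (\<Sum>k\<in>d. Sup k - Inf k) < \<delta>
      \<Longrightarrow> (\<Sum>k\<in>d. norm (f (Sup k) - f (Inf k))) < \<epsilon>"
proof -
  have "\<exists>\<delta>>0. \<forall>d t. d division_of t \<and> t \<subseteq> S \<and> (\<Sum>k\<in>d. Sup k - Inf k) < \<delta>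
      \<longrightarrow> (\<Sum>k\<in>d. norm (f (Sup k) - f (Inf k))) < \<epsilon>"
    using assms unfolding abs_continuous_on_def by simp
  then obtain \<delta> where 1: "\<delta> > 0" and 2: "\<forall>d t. d division_of t \<and> t \<subseteq> S \<and> (\<Sum>k\<in>d. Sup k - Inf k) < \<delta>
      \<longrightarrow> (\<Sum>k\<in>d. norm (f (Sup k) - f (Inf k))) < \<epsilon>" by (elim exE conjE)
  show thesis by (rule that[OF 1]) (use 2 in blast)
qed

lemma abs_continuous_on_cong:
  assumes f: "abs_continuous_on S f" and fg: "\<And>x. x \<in> S \<Longrightarrow> f x = g x"
  shows "abs_continuous_on S g"
  unfolding abs_continuous_on_def
proof (intro allI impI)
  fix \<epsilon> :: real assume \<epsilon>: "\<epsilon> > 0"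
  obtain \<delta> where \<delta>: "\<delta> > 0" "\<And>d t. d division_of t \<Longrightarrow> t \<subseteq> S \<Longrightarrow> (\<Sum>k\<in>d. Sup k - Inf k) < \<delta>
      \<Longrightarrow> (\<Sum>k\<in>d. norm (f (Sup k) - f (Inf k))) < \<epsilon>" using abs_continuous_onE[OF f \<epsilon>] by (metis (no_types, lifting))
  have eq: "(\<Sum>k\<in>d. norm (f (Sup k) - f (Inf k))) = (\<Sum>k\<in>d. norm (g (Sup k) - g (Inf k)))"
    if d: "d division_of t" "t \<subseteq> S" for d t
  proof (rule sum.cong[OF refl])
    fix k assume k: "k \<in> d"
    obtain u v where uv: "k = {u..v}" "u \<le> v" "Inf k = u" "Sup k = v" by (rule division_interval[OF d(1) k])
    have "k \<subseteq> S" using division_ofD(2)[OF d(1) k] d(2) by blast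
    hence "u \<in> S" "v \<in> S" using uv by auto
    thus "norm (f (Sup k) - f (Inf k)) = norm (g (Sup k) - g (Inf k))" using uv fg by simp
  qed
  show "\<exists>\<delta>>0. \<forall>d t. d division_of t \<and> t \<subseteq> S \<and> (\<Sum>k\<in>d. Sup k - Inf k) < \<delta>
      \<longrightarrow> (\<Sum>k\<in>d. norm (g (Sup k) - g (Inf k))) < \<epsilon>"
    by (intro exI[of _ \<delta>] conjI allI impI \<delta>(1)) (use \<delta>(2) eq in \<open>metis\<close>)
qed

text \<open>One criterion that covers differences, products on compact intervals, components and vectors.\<close>

lemma abs_continuous_on_dominated:
  assumes f: "abs_continuous_on S f" and g: "abs_continuous_on S g" and C: "C \<ge> 0"
    and le: "\<And>x y. x \<in> S \<Longrightarrow> y \<in> S \<Longrightarrow> norm (h y - h x) \<le> C * norm (f y - f x) + C * norm (g y - g x)"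
  shows "abs_continuous_on S h"
  unfolding abs_continuous_on_def
proof (intro allI impI)
  fix \<epsilon> :: real assume \<epsilon>: "\<epsilon> > 0"
  define e where "e = \<epsilon> / (2 * (C + 1))"
  have e: "e > 0" using \<epsilon> C by (simp add: e_def)
  obtain d1 where d1: "d1 > 0" "\<And>d t. d division_of t \<Longrightarrow> t \<subseteq> S \<Longrightarrow> (\<Sum>k\<in>d. Sup k - Inf k) < d1
      \<Longrightarrow> (\<Sum>k\<in>d. norm (f (Sup k) - f (Inf k))) < e" using abs_continuous_onE[OF f e] by (metis (no_types, lifting))
  obtain d2 where d2: "d2 > 0" "\<And>d t. d division_of t \<Longrightarrow> t \<subseteq> S \<Longrightarrow> (\<Sum>k\<in>d. Sup k - Inf k) < d2
      \<Longrightarrow> (\<Sum>k\<in>d. norm (g (Sup k) - g (Inf k))) < e" using abs_continuous_onE[OF g e] by (metis (no_types, lifting))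
  show "\<exists>\<delta>>0. \<forall>d t. d division_of t \<and> t \<subseteq> S \<and> (\<Sum>k\<in>d. Sup k - Inf k) < \<delta>
      \<longrightarrow> (\<Sum>k\<in>d. norm (h (Sup k) - h (Inf k))) < \<epsilon>"
  proof (intro exI[of _ "min d1 d2"] conjI allI impI)
    fix d t assume d: "d division_of t \<and> t \<subseteq> S \<and> (\<Sum>k\<in>d. Sup k - Inf k) < min d1 d2"
    have "(\<Sum>k\<in>d. norm (h (Sup k) - h (Inf k)))
       \<le> (\<Sum>k\<in>d. C * norm (f (Sup k) - f (Inf k)) + C * norm (g (Sup k) - g (Inf k)))"
    proof (rule sum_mono)
      fix k assume k: "k \<in> d"
      obtain u v where uv: "k = {u..v}" "u \<le> v" "Inf k = u" "Sup k = v" using division_interval[of d t k] d k by blast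
      have "k \<subseteq> S" using division_ofD(2)[of d t k] d k by blast
      hence "u \<in> S" "v \<in> S" using uv by auto
      thus "norm (h (Sup k) - h (Inf k)) \<le> C * norm (f (Sup k) - f (Inf k)) + C * norm (g (Sup k) - g (Inf k))"
        using uv le[of u v] by simp
    qed
    also have "\<dots> = C * (\<Sum>k\<in>d. norm (f (Sup k) - f (Inf k))) + C * (\<Sum>k\<in>d. norm (g (Sup k) - g (Inf k)))"
      by (simp add: sum.distrib sum_distrib_left)
    also have "\<dots> \<le> C * e + C * e"
      using less_imp_le[OF d1(2)[of d t]] less_imp_le[OF d2(2)[of d t]] d C
      by (intro add_mono mult_left_mono) simp_all
    also have "\<dots> < 2 * (C + 1) * e" using e by (simp add: algebra_simps)
    also have "\<dots> = \<epsilon>" using C by (simp add: e_def)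
    finally show "(\<Sum>k\<in>d. norm (h (Sup k) - h (Inf k))) < \<epsilon>" .
  qed (use d1 d2 in auto)
qed

lemma abs_continuous_on_imp_continuous:
  fixes f :: "real \<Rightarrow> 'a::real_normed_vector"
  assumes f: "abs_continuous_on {a..b} f"
  shows "continuous_on {a..b} f"
  unfolding continuous_on_iff
proof (intro ballI allI impI)
  fix x :: real and \<epsilon> :: real assume x: "x \<in> {a..b}" and \<epsilon>: "\<epsilon> > 0"
  obtain \<delta> where \<delta>: "\<delta> > 0" "\<And>d t. d division_of t \<Longrightarrow> t \<subseteq> {a..b} \<Longrightarrow> (\<Sum>k\<in>d. Sup k - Inf k) < \<delta>
      \<Longrightarrow> (\<Sum>k\<in>d. norm (f (Sup k) - f (Inf k))) < \<epsilon>" using abs_continuous_onE[OF f \<epsilon>] by (metis (no_types, lifting))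
  have *: "norm (f v - f u) < \<epsilon>" if "u \<in> {a..b}" "v \<in> {a..b}" "u \<le> v" "v - u < \<delta>" for u v
  proof -
    have "{{u..v}} division_of {u..v}" using division_of_self[of u v] that by (auto simp: box_real)
    from \<delta>(2)[OF this] that show ?thesis by auto
  qed
  show "\<exists>d>0. \<forall>x'\<in>{a..b}. dist x' x < d \<longrightarrow> dist (f x') (f x) < \<epsilon>"
  proof (intro exI[of _ \<delta>] conjI ballI impI)
    fix y assume "y \<in> {a..b}" "dist y x < \<delta>"
    thus "dist (f y) (f x) < \<epsilon>"
      using *[of x y] *[of y x] x by (cases "x \<le> y") (auto simp: dist_norm norm_minus_commute)
  qed (use \<delta> in auto)
qed

text \<open>Let \<open>K\<close> consist of the points where the derivative fails to vanish, and of the endpoints, and cover this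
null set by an open set \<open>T\<close> of measure less than \<open>\<delta>\<close>. In a division fine for a suitable gauge, an interval
tagged outside \<open>K\<close> has increment at most \<open>\<epsilon>\<close> times its length, while the intervals tagged in \<open>K\<close> lie in
\<open>T\<close>, so absolute continuity makes their increments add up to less than \<open>\<epsilon>\<close>.\<close>

lemma abs_continuous_zero_derivative:
  fixes D :: "real \<Rightarrow> 'a::real_normed_vector"
  assumes ab: "a \<le> b" and ac: "abs_continuous_on {a..b} D"
    and der: "AE x in lebesgue. a < x \<and> x < b \<longrightarrow> (D has_vector_derivative 0) (at x)"
  shows "D b = D a"
proof -
  have small: "norm (D b - D a) \<le> \<epsilon> * (b - a) + \<epsilon>" if \<epsilon>: "\<epsilon> > 0" for \<epsilon>
  proof -
    obtain \<delta> where \<delta>: "\<delta> > 0" "\<And>d t. d division_of t \<Longrightarrow> t \<subseteq> {a..b} \<Longrightarrow> (\<Sum>k\<in>d. Sup k - Inf k) < \<delta>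
      \<Longrightarrow> (\<Sum>k\<in>d. norm (D (Sup k) - D (Inf k))) < \<epsilon>" using abs_continuous_onE[OF ac \<epsilon>] by (metis (no_types, lifting))
    define K where "K = {x. a < x \<and> x < b \<and> \<not> (D has_vector_derivative 0) (at x)} \<union> {a, b}"
    have "{x. a < x \<and> x < b \<and> \<not> (D has_vector_derivative 0) (at x)} \<in> null_sets lebesgue"
      using AE_iff_null_sets[of "{x. a < x \<and> x < b \<and> \<not> (D has_vector_derivative 0) (at x)}" lebesgue] der
      by (auto simp: completion.complete_sets_sandwich eventually_ae_filter intro: null_sets_completion_subset elim!: AE_E)
    hence K0: "K \<in> null_sets lebesgue" unfolding K_def
      by (intro null_sets.Un) (auto simp flip: negligible_iff_null_sets)
    obtain T where T: "open T" "K \<subseteq> T" "T - K \<in> lmeasurable" "emeasure lebesgue (T - K) < ennreal \<delta>"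
      using sets_lebesgue_outer_open[of K \<delta>] K0 \<delta>(1) by (auto dest: null_setsD2)
    have eT: "emeasure lebesgue T < ennreal \<delta>"
      using emeasure_Un_null_set[of "T - K" lebesgue K] T K0 by (auto simp: Un_absorb2 fmeasurable_def)
    have "\<exists>r>0. \<forall>y. \<bar>y - x\<bar> < r \<longrightarrow> norm (D y - D x) \<le> \<epsilon> * \<bar>y - x\<bar>" if x: "x \<in> {a..b} - K" for x
    proof -
      have "(D has_vector_derivative 0) (at x)" using x by (auto simp: K_def less_le)
      hence "(D has_derivative (\<lambda>_. 0)) (at x)" by (simp add: has_vector_derivative_def)
      thus ?thesis using \<epsilon> unfolding has_derivative_at_alt by (auto simp: real_norm_def)
    qed
    then obtain r where r: "\<And>x. x \<in> {a..b} - K \<Longrightarrow> r x > 0"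
      "\<And>x y. x \<in> {a..b} - K \<Longrightarrow> \<bar>y - x\<bar> < r x \<Longrightarrow> norm (D y - D x) \<le> \<epsilon> * \<bar>y - x\<bar>" by metis
    define \<gamma> where "\<gamma> x = (if x \<in> K then T else if x \<in> {a..b} then ball x (r x) else ball x 1)" for x
    have "gauge \<gamma>" using T r by (auto simp: gauge_def \<gamma>_def)
    then obtain p where p: "p tagged_division_of {a..b}" "\<gamma> fine p" by (rule fine_division_exists_real)
    note pD = tagged_division_ofD[OF p(1)]
    have interval: "\<exists>u v. k = {u..v} \<and> u \<le> x \<and> x \<le> v \<and> Inf k = u \<and> Sup k = v \<and> a \<le> u \<and> v \<le> b \<and> k \<subseteq> \<gamma> x" if xkp: "(x, k) \<in> p" for x k
    proof -
      obtain u v where k: "k = cbox u v" using pD(4)[OF xkp] by blast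
      have "x \<in> k" "k \<subseteq> {a..b}" using pD(2,3)[OF xkp] by auto
      moreover have "k \<subseteq> \<gamma> x" using p(2) xkp by (auto simp: fine_def)
      ultimately show ?thesis using k by (intro exI[of _ u] exI[of _ v]) (auto simp: box_real)
    qed
    let ?g = "\<lambda>k. D (Sup k) - D (Inf k)"
    define p1 where "p1 = {(x, k) \<in> p. x \<in> K}"
    define p2 where "p2 = {(x, k) \<in> p. x \<notin> K}"
    have fin: "finite p" by (rule pD(1))
    have p12: "p = p1 \<union> p2" "p1 \<inter> p2 = {}" "finite p1" "finite p2"
      using fin by (auto simp: p1_def p2_def intro: finite_subset[OF _ fin])
    have "D b - D a = (\<Sum>(x, k)\<in>p. ?g k)" by (rule additive_tagged_division_1[OF ab p(1), symmetric])
    hence "norm (D b - D a) \<le> (\<Sum>(x, k)\<in>p. norm (?g k))"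
      by (metis (mono_tags, lifting) case_prod_beta norm_sum sum.cong)
    also have "\<dots> = (\<Sum>(x, k)\<in>p1. norm (?g k)) + (\<Sum>(x, k)\<in>p2. norm (?g k))"
      unfolding p12(1) by (rule sum.union_disjoint) (use p12 in auto)
    also have "(\<Sum>(x, k)\<in>p2. norm (?g k)) \<le> \<epsilon> * (b - a)"
    proof -
      have "(\<Sum>(x, k)\<in>p2. norm (?g k)) \<le> (\<Sum>(x, k)\<in>p2. \<epsilon> * (Sup k - Inf k))"
      proof (rule sum_mono, clarify)
        fix x k assume xk: "(x, k) \<in> p2"
        obtain u v where uv: "k = {u..v}" "u \<le> x" "x \<le> v" "Inf k = u" "Sup k = v" "a \<le> u" "v \<le> b" "k \<subseteq> \<gamma> x"
          using interval[of x k] xk by (auto simp: p2_def)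
        have xK: "x \<in> {a..b} - K" using xk uv by (auto simp: p2_def)
        have near: "\<bar>y - x\<bar> < r x" if "y \<in> k" for y
          using uv(8) that xK by (auto simp: \<gamma>_def dist_real_def abs_minus_commute)
        have "norm (D v - D x) \<le> \<epsilon> * \<bar>v - x\<bar>" "norm (D u - D x) \<le> \<epsilon> * \<bar>u - x\<bar>"
          by (intro r(2)[OF xK] near, use uv in simp)+
        hence "norm (D v - D u) \<le> \<epsilon> * (v - x) + \<epsilon> * (x - u)"
          using norm_triangle_ineq4[of "D v - D x" "D u - D x"] uv by simp
        thus "norm (?g k) \<le> \<epsilon> * (Sup k - Inf k)" using uv by (simp add: algebra_simps)
      qed
      also have "\<dots> \<le> (\<Sum>(x, k)\<in>p. \<epsilon> * (Sup k - Inf k))"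
      proof (rule sum_mono2[OF fin])
        show "p2 \<subseteq> p" by (auto simp: p2_def)
        fix y assume "y \<in> p - p2"
        then obtain x k where y: "y = (x, k)" "(x, k) \<in> p" by (cases y) auto
        obtain u v where "u \<le> x" "x \<le> v" "Inf k = u" "Sup k = v" using interval[OF y(2)] by blast
        thus "0 \<le> (case y of (x, k) \<Rightarrow> \<epsilon> * (Sup k - Inf k))" using y \<epsilon> by simp
      qed
      also have "\<dots> = \<epsilon> * (\<Sum>(x, k)\<in>p. Sup k - Inf k)" by (simp add: sum_distrib_left case_prod_beta)
      also have "(\<Sum>(x, k)\<in>p. Sup k - Inf k) = b - a"
        using additive_tagged_division_1[OF ab p(1), of "\<lambda>x. x"] by simp
      finally show ?thesis .
    qed
    also have "(\<Sum>(x, k)\<in>p1. norm (?g k)) \<le> \<epsilon>"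
    proof -
      have "p1 \<subseteq> p" by (auto simp: p1_def)
      hence "p1 tagged_partial_division_of {a..b}"
        using p(1) tagged_partial_division_subset unfolding tagged_division_of_def by blast
      hence tp: "p1 tagged_division_of (\<Union>(snd ` p1))" by (rule tagged_partial_division_of_Union_self)
      have dv: "(snd ` p1) division_of (\<Union>(snd ` p1))" by (rule division_of_tagged_division[OF tp])
      have "snd y \<subseteq> {a..b}" if "y \<in> p1" for y using pD(3)[of "fst y" "snd y"] that by (auto simp: p1_def)
      hence sub: "\<Union>(snd ` p1) \<subseteq> {a..b}" by blast
      have subT: "k \<subseteq> T" if "k \<in> snd ` p1" for k using interval that by (fastforce simp: p1_def \<gamma>_def)
      let ?h = "\<lambda>k. if k = {} then 0 else norm (?g k)"
      have "k \<noteq> {}" if "(x, k) \<in> p1" for x k using interval[of x k] that by (auto simp: p1_def)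
      hence "(\<Sum>(x, k)\<in>p1. norm (?g k)) = (\<Sum>(x, k)\<in>p1. ?h k)" by (intro sum.cong) auto
      also have "\<dots> = (\<Sum>k\<in>snd ` p1. ?h k)"
      proof (rule sum.over_tagged_division_lemma[OF tp])
        fix u v :: real assume "box u v = {}"
        hence "v \<le> u" by (auto simp: box_real)
        thus "?h (cbox u v) = 0" by (cases "u = v") (auto simp: box_real)
      qed
      also have "\<dots> = (\<Sum>k\<in>snd ` p1. norm (?g k))"
        using division_ofD(3)[OF dv] by (intro sum.cong) auto
      also have "\<dots> < \<epsilon>"
      proof (rule \<delta>(2)[OF dv sub])
        have le: "Inf k \<le> Sup k" if k: "k \<in> snd ` p1" for k
        proof -
          obtain u v where "u \<le> v" "Inf k = u" "Sup k = v" by (rule division_interval[OF dv k])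
          thus ?thesis by simp
        qed
        have "ennreal (\<Sum>k\<in>snd ` p1. Sup k - Inf k) = (\<Sum>k\<in>snd ` p1. ennreal (Sup k - Inf k))"
          by (rule sum_ennreal[symmetric]) (use le in simp)
        also have "\<dots> = (\<Sum>k\<in>snd ` p1. emeasure lebesgue {Inf k<..Sup k})"
          by (rule sum.cong) (use le in \<open>simp_all\<close>)
        also have "\<dots> = emeasure lebesgue (\<Union>k\<in>snd ` p1. {Inf k<..Sup k})"
          by (rule sum_emeasure) (use p12 division_half_open_disjoint[OF dv] in auto)
        also have "\<dots> \<le> emeasure lebesgue T"
        proof (rule emeasure_mono)
          show "(\<Union>k\<in>snd ` p1. {Inf k<..Sup k}) \<subseteq> T"
          proof safe
            fix x y k assume xk: "(y, k) \<in> p1" and x: "x \<in> {Inf (snd (y, k))<..Sup (snd (y, k))}"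
            then obtain u v where "k = {u..v}" "Inf k = u" "Sup k = v" using interval[of y k] by (auto simp: p1_def)
            hence "x \<in> k" using x by auto
            thus "x \<in> T" using subT[of k] xk by force
          qed
        qed (use T in auto)
        finally have "ennreal (\<Sum>k\<in>snd ` p1. Sup k - Inf k) < ennreal \<delta>" using eT by (rule le_less_trans)
        thus "(\<Sum>k\<in>snd ` p1. Sup k - Inf k) < \<delta>" by (meson ennreal_leI leD not_less)
      qed
      finally show ?thesis by simp
    qed
    finally show ?thesis by simp
  qed
  have "norm (D b - D a) \<le> 0"
  proof (rule field_le_epsilon)
    fix e :: real assume e: "e > 0"
    have "norm (D b - D a) \<le> e / (b - a + 1) * (b - a) + e / (b - a + 1)" by (rule small) (use e ab in auto)
    also have "\<dots> = e / (b - a + 1) * (b - a + 1)" by (simp only: distrib_left mult_1_right)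
    also have "\<dots> = e" using ab by simp
    finally show "norm (D b - D a) \<le> 0 + e" by simp
  qed
  thus ?thesis by simp
qed

lemma ac_deriv_subset:
  assumes "ac_deriv a b F p" "a \<le> a'" "b' \<le> b"
  shows "ac_deriv a' b' F p"
  unfolding ac_deriv_def
proof (intro conjI)
  show "abs_continuous_on {a'..b'} F"
    by (rule abs_continuous_on_subset[of "{a..b}"]) (use assms in \<open>auto simp: ac_deriv_def\<close>)
  show "set_integrable lebesgue {a'<..b'} p"
    by (rule set_integrable_subset[of _ "{a<..b}"]) (use assms in \<open>auto simp: ac_deriv_def\<close>)
  have "AE x in lebesgue. a < x \<and> x < b \<longrightarrow> (F has_vector_derivative p x) (at x)"
    using assms by (simp add: ac_deriv_def)
  thus "AE x in lebesgue. a' < x \<and> x < b' \<longrightarrow> (F has_vector_derivative p x) (at x)"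
    by eventually_elim (use assms in auto)
qed

lemma set_integral_Ioc_diff:
  fixes p :: "real \<Rightarrow> 'a::euclidean_space"
  assumes p: "set_integrable lebesgue {a<..b} p" and uv: "a \<le> u" "u \<le> v" "v \<le> b"
  shows "(LINT y:{a<..v}|lebesgue. p y) - (LINT y:{a<..u}|lebesgue. p y) = (LINT y:{u<..v}|lebesgue. p y)"
proof -
  have eq: "{a<..v} = {a<..u} \<union> {u<..v}" using uv by auto
  have "(LINT y:{a<..v}|lebesgue. p y) = (LINT y:{a<..u}|lebesgue. p y) + (LINT y:{u<..v}|lebesgue. p y)"
    unfolding eq by (rule set_integral_Un) (use uv in \<open>auto intro: set_integrable_subset[OF p]\<close>)
  thus ?thesis by simp
qed

lemma set_integral_Ioc_eq_integral:
  fixes p :: "real \<Rightarrow> 'a::euclidean_space"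
  assumes p: "set_integrable lebesgue {u<..v} p"
  shows "(LINT y:{u<..v}|lebesgue. p y) = integral {u..v} p"
proof -
  have "(LINT y:{u<..v}|lebesgue. p y) = integral {u<..v} p"
    by (rule set_lebesgue_integral_eq_integral(2)[OF p])
  also have "\<dots> = integral {u..v} p"
  proof (rule integral_spike_set)
    show "negligible {x \<in> {u<..v} - {u..v}. p x \<noteq> 0}" by (rule negligible_subset[of "{}"]) auto
    show "negligible {x \<in> {u..v} - {u<..v}. p x \<noteq> 0}" by (rule negligible_subset[of "{u}"]) auto
  qed
  finally show ?thesis .
qed

text \<open>For absolute continuity, split \<open>\<bar>p\<bar>\<close> at a height \<open>n\<close>: the part above has small integral, and the part
below contributes at most \<open>n\<close> times the length. For the derivative, the differentiation theorem for
Henstock-Kurzweil primitives yields right-hand derivatives almost everywhere; applied to the reflected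
function it yields the left-hand ones.\<close>

lemma ac_deriv_integral:
  fixes p :: "real \<Rightarrow> 'a::euclidean_space"
  assumes ab: "a \<le> b" and p: "set_integrable lebesgue {a<..b} p"
  shows "ac_deriv a b (\<lambda>x. F0 + (LINT y:{a<..x}|lebesgue. p y)) p"
proof -
  define P where "P x = F0 + (LINT y:{a<..x}|lebesgue. p y)" for x
  define q where "q x = indicat_real {a<..b} x *\<^sub>R p x" for x
  have q: "integrable lebesgue q" using p by (simp add: set_integrable_def q_def[abs_def])
  have P_diff: "P v - P u = (LINT y:{u<..v}|lebesgue. q y)" if "a \<le> u" "u \<le> v" "v \<le> b" for u v
  proof -
    have "P v - P u = (LINT y:{u<..v}|lebesgue. p y)"
      using set_integral_Ioc_diff[OF p that] by (simp add: P_def)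
    also have "\<dots> = (LINT y:{u<..v}|lebesgue. q y)"
      by (rule set_lebesgue_integral_cong) (use that in \<open>auto simp: q_def\<close>)
    finally show ?thesis .
  qed
  have "abs_continuous_on {a..b} P"
    unfolding abs_continuous_on_def
  proof (intro allI impI)
    fix \<epsilon> :: real assume \<epsilon>: "\<epsilon> > 0"
    define g where "g x = norm (q x)" for x
    have g: "integrable lebesgue g" using q by (simp add: g_def[abs_def])
    have gm [measurable]: "g \<in> borel_measurable lebesgue" using g by auto
    define f where "f n x = (if g x > real n then g x else 0)" for n :: nat and x
    have fm [measurable]: "f n \<in> borel_measurable lebesgue" for n unfolding f_def[abs_def] by measurable
    have fint: "integrable lebesgue (f n)" for n
      by (rule Bochner_Integration.integrable_bound[OF g]) (auto simp: f_def g_def)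
    have "(\<lambda>n. integral\<^sup>L lebesgue (f n)) \<longlonglongrightarrow> integral\<^sup>L lebesgue (\<lambda>_::real. 0::real)"
    proof (rule integral_dominated_convergence[where w = g])
      show "AE x in lebesgue. (\<lambda>n. f n x) \<longlonglongrightarrow> 0"
      proof (rule AE_I2)
        fix x
        obtain N :: nat where "g x \<le> real N" using real_arch_simple by blast
        hence "eventually (\<lambda>n. f n x = 0) sequentially"
          unfolding eventually_sequentially by (intro exI[of _ N]) (auto simp: f_def)
        thus "(\<lambda>n. f n x) \<longlonglongrightarrow> 0" by (rule tendsto_eventually)
      qed
      show "AE x in lebesgue. norm (f n x) \<le> g x" for n by (auto simp: f_def g_def)
    qed (use g in auto)
    hence "eventually (\<lambda>n. integral\<^sup>L lebesgue (f n) < \<epsilon> / 2) sequentially"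
      using \<epsilon> by (auto dest!: order_tendstoD(2)[of _ _ _ "\<epsilon> / 2"])
    then obtain n where n: "integral\<^sup>L lebesgue (f n) < \<epsilon> / 2" by (auto simp: eventually_sequentially)
    show "\<exists>\<delta>>0. \<forall>d t. d division_of t \<and> t \<subseteq> {a..b} \<and> (\<Sum>k\<in>d. Sup k - Inf k) < \<delta>
      \<longrightarrow> (\<Sum>k\<in>d. norm (P (Sup k) - P (Inf k))) < \<epsilon>"
    proof (intro exI[of _ "\<epsilon> / (2 * (real n + 1))"] conjI allI impI)
      show "\<epsilon> / (2 * (real n + 1)) > 0" using \<epsilon> by simp
      fix d t assume "d division_of t \<and> t \<subseteq> {a..b} \<and> (\<Sum>k\<in>d. Sup k - Inf k) < \<epsilon> / (2 * (real n + 1))"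
      hence d: "d division_of t" "t \<subseteq> {a..b}" and len: "(\<Sum>k\<in>d. Sup k - Inf k) < \<epsilon> / (2 * (real n + 1))" by auto
      define I where "I k = {Inf k<..Sup k}" for k :: "real set"
      have one: "norm (P (Sup k) - P (Inf k)) \<le> real n * (Sup k - Inf k) + (LINT x|lebesgue. indicat_real (I k) x * f n x)"
        if k: "k \<in> d" for k
      proof -
        obtain u v where uv: "k = {u..v}" "u \<le> v" "Inf k = u" "Sup k = v" by (rule division_interval[OF d(1) k])
        have "k \<subseteq> {a..b}" using division_ofD(2)[OF d(1) k] d(2) by blast
        hence le: "a \<le> u" "v \<le> b" using uv by auto
        have "norm (P v - P u) = norm (LINT y|lebesgue. indicat_real {u<..v} y *\<^sub>R q y)"
          using P_diff[OF le(1) uv(2) le(2)] by (simp add: set_lebesgue_integral_def)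
        also have "\<dots> \<le> (LINT y|lebesgue. norm (indicat_real {u<..v} y *\<^sub>R q y))"
          by (rule integral_norm_bound)
        also have "\<dots> \<le> (LINT y|lebesgue. real n * indicat_real {u<..v} y + indicat_real {u<..v} y * f n y)"
        proof (rule integral_mono)
          show "integrable lebesgue (\<lambda>y. norm (indicat_real {u<..v} y *\<^sub>R q y))"
            by (intro integrable_norm integrable_mult_indicator q) auto
          show "integrable lebesgue (\<lambda>y. real n * indicat_real {u<..v} y + indicat_real {u<..v} y * f n y)"
            using integrable_mult_indicator[of "{u<..v}" lebesgue "f n"] fint uv(2)
            by (intro Bochner_Integration.integrable_add integrable_mult_right integrable_real_indicator) auto
          show "norm (indicat_real {u<..v} y *\<^sub>R q y) \<le> real n * indicat_real {u<..v} y + indicat_real {u<..v} y * f n y" for y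
            by (auto simp: f_def g_def split: split_indicator)
        qed
        also have "\<dots> = real n * (v - u) + (LINT x|lebesgue. indicat_real {u<..v} x * f n x)"
          using integrable_mult_indicator[of "{u<..v}" lebesgue "f n"] fint uv(2)
          by (subst Bochner_Integration.integral_add)
             (auto intro!: integrable_real_indicator simp: integrable_mult_right measure_def)
        finally show ?thesis using uv by (simp add: I_def)
      qed
      have fin: "finite d" by (rule division_ofD(1)[OF d(1)])
      have "(\<Sum>k\<in>d. norm (P (Sup k) - P (Inf k)))
         \<le> (\<Sum>k\<in>d. real n * (Sup k - Inf k) + (LINT x|lebesgue. indicat_real (I k) x * f n x))"
        by (rule sum_mono) (rule one)
      also have "\<dots> = real n * (\<Sum>k\<in>d. Sup k - Inf k) + (\<Sum>k\<in>d. LINT x|lebesgue. indicat_real (I k) x * f n x)"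
        by (simp add: sum.distrib sum_distrib_left)
      also have "(\<Sum>k\<in>d. LINT x|lebesgue. indicat_real (I k) x * f n x) = (LINT x|lebesgue. (\<Sum>k\<in>d. indicat_real (I k) x * f n x))"
        using integrable_mult_indicator[OF _ fint] by (intro Bochner_Integration.integral_sum[symmetric]) (auto simp: I_def)
      also have "\<dots> \<le> integral\<^sup>L lebesgue (f n)"
      proof (rule integral_mono[OF _ fint])
        show "integrable lebesgue (\<lambda>x. \<Sum>k\<in>d. indicat_real (I k) x * f n x)"
          using integrable_mult_indicator[OF _ fint] by (intro Bochner_Integration.integrable_sum) (auto simp: I_def)
        show "(\<Sum>k\<in>d. indicat_real (I k) x * f n x) \<le> f n x" for x
        proof -
          have "(\<Sum>k\<in>d. indicat_real (I k) x) = indicat_real (\<Union>k\<in>d. I k) x"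
            by (rule indicator_UN_disjoint[symmetric]) (use fin division_half_open_disjoint[OF d(1)] in \<open>auto simp: I_def\<close>)
          hence "(\<Sum>k\<in>d. indicat_real (I k) x * f n x) = indicat_real (\<Union>k\<in>d. I k) x * f n x"
            by (simp add: sum_distrib_right[symmetric])
          also have "\<dots> \<le> f n x" by (auto simp: f_def g_def split: split_indicator)
          finally show ?thesis .
        qed
      qed
      also have "integral\<^sup>L lebesgue (f n) < \<epsilon> / 2" by (rule n)
      also have "real n * (\<Sum>k\<in>d. Sup k - Inf k) \<le> real n * (\<epsilon> / (2 * (real n + 1)))"
        using len by (intro mult_left_mono) auto
      also have "\<dots> \<le> \<epsilon> / 2" using \<epsilon> by (simp add: field_simps)
      finally show "(\<Sum>k\<in>d. norm (P (Sup k) - P (Inf k))) < \<epsilon>" by simp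
    qed
  qed
  moreover have "AE x in lebesgue. a < x \<and> x < b \<longrightarrow> (P has_vector_derivative p x) (at x)"
  proof -
    have qi: "q integrable_on cbox u v" for u v
    proof -
      have "set_integrable lebesgue (cbox u v) q" unfolding set_integrable_def
        by (rule integrable_mult_indicator[OF _ q]) auto
      thus ?thesis using set_lebesgue_integral_eq_integral(1) by blast
    qed
    have qi': "q integrable_on {u..v}" for u v using qi[of u v] by (simp add: box_real)
    obtain N1 where N1: "negligible N1" "\<And>x e. x \<notin> N1 \<Longrightarrow> 0 < e \<Longrightarrow> \<exists>d>0. \<forall>h. 0 < h \<and> h < d \<longrightarrow>
        norm (integral (cbox x (x + h *\<^sub>R One)) q /\<^sub>R h ^ DIM(real) - q x) < e"
      using integrable_ccontinuous_explicit[OF qi] by metis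
    have qr: "(\<lambda>x. q (- x)) integrable_on cbox u v" for u v :: real
      using qi[of "-v" "-u"] Henstock_Kurzweil_Integration.integrable_reflect[where f = q and a = "-v" and b = "-u"] by simp
    obtain N2 where N2: "negligible N2" "\<And>x e. x \<notin> N2 \<Longrightarrow> 0 < e \<Longrightarrow> \<exists>d>0. \<forall>h. 0 < h \<and> h < d \<longrightarrow>
        norm (integral (cbox x (x + h *\<^sub>R One)) (\<lambda>x. q (- x)) /\<^sub>R h ^ DIM(real) - q (- x)) < e"
      using integrable_ccontinuous_explicit[OF qr] by metis
    have N2': "negligible (uminus ` N2)" 
      by (rule negligible_differentiable_image_negligible[OF _ N2(1)])
         (auto intro!: differentiable_on_minus differentiable_on_ident)
    have der: "(P has_vector_derivative p x) (at x)" if x: "x \<notin> N1 \<union> uminus ` N2" "a < x" "x < b" for x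
    proof -
      have qx: "q x = p x" using x by (simp add: q_def)
      have "- x \<notin> N2" using x(1) by (metis UnI2 imageI minus_minus)
      have P_int: "P v - P u = integral {u..v} q" if "a \<le> u" "u \<le> v" "v \<le> b" for u v
      proof -
        have "set_integrable lebesgue {u<..v} q" unfolding set_integrable_def
          by (rule integrable_mult_indicator[OF _ q]) auto
        thus ?thesis using P_diff[OF that] set_integral_Ioc_eq_integral[of u v q] by simp
      qed
      have "(P has_derivative (\<lambda>h. h *\<^sub>R p x)) (at x)"
        unfolding has_derivative_at_alt
      proof (intro conjI allI impI)
        show "bounded_linear (\<lambda>h. h *\<^sub>R p x)" by (rule bounded_linear_scaleR_left)
        fix e :: real assume e: "e > 0"
        obtain d1 where d1: "d1 > 0" "\<And>h. 0 < h \<Longrightarrow> h < d1 \<Longrightarrow> norm (integral {x..x + h} q /\<^sub>R h - q x) < e"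
          using N1(2)[of x e] x e by (auto simp: box_real)
        obtain d2 where d2: "d2 > 0" "\<And>h. 0 < h \<Longrightarrow> h < d2 \<Longrightarrow> norm (integral {-x..-x + h} (\<lambda>x. q (- x)) /\<^sub>R h - q x) < e"
          using N2(2)[of "-x" e] \<open>- x \<notin> N2\<close> e by (auto simp: box_real)
        have scale: "norm (w - h *\<^sub>R q x) \<le> e * h" if "norm (w /\<^sub>R h - q x) < e" "h > 0" for w :: 'a and h
        proof -
          have "w - h *\<^sub>R q x = h *\<^sub>R (w /\<^sub>R h - q x)" using that(2) by (simp add: scaleR_diff_right)
          hence "norm (w - h *\<^sub>R q x) = h * norm (w /\<^sub>R h - q x)" using that(2) by simp
          thus ?thesis using that by (simp add: mult.commute)
        qed
        show "\<exists>d>0. \<forall>y. norm (y - x) < d \<longrightarrow> norm (P y - P x - (y - x) *\<^sub>R p x) \<le> e * norm (y - x)"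
        proof (intro exI[of _ "min (min d1 d2) (min (x - a) (b - x))"] conjI allI impI)
          fix y assume y: "norm (y - x) < min (min d1 d2) (min (x - a) (b - x))"
          consider "y = x" | "y > x" | "y < x" by linarith
          thus "norm (P y - P x - (y - x) *\<^sub>R p x) \<le> e * norm (y - x)"
          proof cases
            case 2
            have "norm (P y - P x - (y - x) *\<^sub>R q x) \<le> e * (y - x)"
            proof (rule scale)
              show "norm ((P y - P x) /\<^sub>R (y - x) - q x) < e"
                using d1(2)[of "y - x"] P_int[of x y] 2 x y by auto
            qed (use 2 in simp)
            thus ?thesis using 2 by (simp add: qx)
          next
            case 3
            have "norm (P x - P y - (x - y) *\<^sub>R q x) \<le> e * (x - y)"
            proof (rule scale)
              have "integral {- x..- x + (x - y)} (\<lambda>x. q (- x)) = integral {y..x} q"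
                using Henstock_Kurzweil_Integration.integral_reflect_real[where a = y and b = x and f = q] by simp
              thus "norm ((P x - P y) /\<^sub>R (x - y) - q x) < e"
                using d2(2)[of "x - y"] P_int[of y x] 3 x y by auto
            qed (use 3 in simp)
            moreover have eq: "P y - P x - (y - x) *\<^sub>R q x = - (P x - P y - (x - y) *\<^sub>R q x)"
              by (simp add: scaleR_diff_left)
            have "norm (P y - P x - (y - x) *\<^sub>R q x) = norm (P x - P y - (x - y) *\<^sub>R q x)"
              unfolding eq by (rule norm_minus_cancel)
            ultimately show ?thesis using 3 by (simp add: qx)
          qed simp
        qed (use d1 d2 x in auto)
      qed
      thus ?thesis by (simp add: has_vector_derivative_def)
    qed
    have "AE x in lebesgue. x \<notin> N1 \<union> uminus ` N2"
      using N1(1) N2' by (intro AE_not_in) (simp flip: negligible_iff_null_sets)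
    thus ?thesis by (rule eventually_mono) (use der in blast)
  qed
  ultimately show ?thesis unfolding ac_deriv_def P_def using p by simp
qed

lemma ac_deriv_diff:
  fixes F G :: "real \<Rightarrow> 'a::euclidean_space"
  assumes F: "ac_deriv a b F p" and G: "ac_deriv a b G q"
  shows "ac_deriv a b (\<lambda>x. F x - G x) (\<lambda>x. p x - q x)"
  unfolding ac_deriv_def
proof (intro conjI)
  show "abs_continuous_on {a..b} (\<lambda>x. F x - G x)"
  proof (rule abs_continuous_on_dominated[of _ F G 1])
    fix x y
    have "F y - G y - (F x - G x) = (F y - F x) - (G y - G x)" by simp
    thus "norm (F y - G y - (F x - G x)) \<le> 1 * norm (F y - F x) + 1 * norm (G y - G x)"
      using norm_triangle_ineq4[of "F y - F x" "G y - G x"] by (simp only: mult_1_left)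
  qed (use F G in \<open>auto simp: ac_deriv_def\<close>)
  show "set_integrable lebesgue {a<..b} (\<lambda>x. p x - q x)"
    using F G by (intro set_integral_diff) (auto simp: ac_deriv_def)
  have "AE x in lebesgue. a < x \<and> x < b \<longrightarrow> (F has_vector_derivative p x) (at x)"
    "AE x in lebesgue. a < x \<and> x < b \<longrightarrow> (G has_vector_derivative q x) (at x)"
    using F G by (simp_all add: ac_deriv_def)
  thus "AE x in lebesgue. a < x \<and> x < b \<longrightarrow> ((\<lambda>x. F x - G x) has_vector_derivative p x - q x) (at x)"
    by eventually_elim (auto intro: has_vector_derivative_diff)
qed

text \<open>The primitive of \<open>p\<close> differs from \<open>F\<close> by an absolutely continuous function whose derivative is zero.\<close>

lemma ac_deriv_FTC:
  fixes F :: "real \<Rightarrow> 'a::euclidean_space"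
  assumes F: "ac_deriv a b F p" and uv: "a \<le> u" "u \<le> v" "v \<le> b"
  shows "F v - F u = (LINT x:{u<..v}|lebesgue. p x)"
proof -
  have Fuv: "ac_deriv u v F p" by (rule ac_deriv_subset[OF F uv(1,3)])
  have p: "set_integrable lebesgue {u<..v} p" using Fuv by (simp add: ac_deriv_def)
  let ?P = "\<lambda>x. 0 + (LINT y:{u<..x}|lebesgue. p y)"
  have "ac_deriv u v (\<lambda>x. F x - ?P x) (\<lambda>x. p x - p x)"
    by (rule ac_deriv_diff[OF Fuv ac_deriv_integral[OF uv(2) p]])
  hence "F v - ?P v = F u - ?P u"
    by (intro abs_continuous_zero_derivative[OF uv(2)]) (auto simp: ac_deriv_def)
  thus ?thesis by (simp add: set_lebesgue_integral_def diff_eq_eq add.commute)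
qed

lemma ac_deriv_cong:
  fixes F :: "real \<Rightarrow> 'a::euclidean_space"
  assumes F: "ac_deriv a b F p" and eq: "\<And>x. a \<le> x \<Longrightarrow> x \<le> b \<Longrightarrow> F x = G x"
  shows "ac_deriv a b G p"
  unfolding ac_deriv_def
proof (intro conjI)
  show "abs_continuous_on {a..b} G"
    by (rule abs_continuous_on_cong[of _ F]) (use F eq in \<open>auto simp: ac_deriv_def\<close>)
  show "set_integrable lebesgue {a<..b} p" using F by (simp add: ac_deriv_def)
  have "AE x in lebesgue. a < x \<and> x < b \<longrightarrow> (F has_vector_derivative p x) (at x)"
    using F by (simp add: ac_deriv_def)
  thus "AE x in lebesgue. a < x \<and> x < b \<longrightarrow> (G has_vector_derivative p x) (at x)"
  proof eventually_elim
    case (elim x)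
    show ?case
    proof
      assume x: "a < x \<and> x < b"
      hence "(F has_vector_derivative p x) (at x)" using elim by blast
      thus "(G has_vector_derivative p x) (at x)"
        by (rule has_vector_derivative_transform_within_open[of _ _ _ "{a<..<b}"]) (use x eq in auto)
    qed
  qed
qed

lemma set_integrable_continuous_mult:
  fixes F :: "real \<Rightarrow> 'a::{euclidean_space, real_normed_algebra}"
  assumes F: "continuous_on {a..b} F" and q: "set_integrable lebesgue {a<..b} q"
  shows "set_integrable lebesgue {a<..b} (\<lambda>x. F x * q x)" "set_integrable lebesgue {a<..b} (\<lambda>x. q x * F x)"
proof -
  have "bounded (F ` {a..b})" by (intro compact_imp_bounded compact_continuous_image F) auto
  then obtain B where B: "\<And>x. x \<in> {a..b} \<Longrightarrow> norm (F x) \<le> B" unfolding bounded_iff by blast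
  have "set_borel_measurable lebesgue {a..b} F"
    unfolding set_borel_measurable_def
    using continuous_imp_measurable_on_sets_lebesgue[OF F] by (subst borel_measurable_restrict_space_iff[symmetric]) auto
  hence Fm: "(\<lambda>x. indicator {a..b} x *\<^sub>R F x) \<in> borel_measurable lebesgue" by (simp add: set_borel_measurable_def)
  have qi: "integrable lebesgue (\<lambda>x. indicator {a<..b} x *\<^sub>R q x)" using q by (simp add: set_integrable_def)
  have qm: "(\<lambda>x. indicator {a<..b} x *\<^sub>R q x) \<in> borel_measurable lebesgue" using qi by auto
  have qB: "integrable lebesgue (\<lambda>x. B * norm (indicator {a<..b} x *\<^sub>R q x))"
    by (intro integrable_mult_right integrable_norm qi)
  have eq1: "(\<lambda>x. indicator {a<..b} x *\<^sub>R (F x * q x)) = (\<lambda>x. (indicator {a..b} x *\<^sub>R F x) * (indicator {a<..b} x *\<^sub>R q x))"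
    and eq2: "(\<lambda>x. indicator {a<..b} x *\<^sub>R (q x * F x)) = (\<lambda>x. (indicator {a<..b} x *\<^sub>R q x) * (indicator {a..b} x *\<^sub>R F x))"
    by (auto split: split_indicator)
  show "set_integrable lebesgue {a<..b} (\<lambda>x. F x * q x)"
    unfolding set_integrable_def
  proof (rule Bochner_Integration.integrable_bound[OF qB])
    show "(\<lambda>x. indicator {a<..b} x *\<^sub>R (F x * q x)) \<in> borel_measurable lebesgue"
      unfolding eq1 by (intro borel_measurable_times Fm qm)
    show "AE x in lebesgue. norm (indicator {a<..b} x *\<^sub>R (F x * q x)) \<le> norm (B * norm (indicator {a<..b} x *\<^sub>R q x))"
    proof (rule AE_I2)
      fix x
      have "norm (F x * q x) \<le> B * norm (q x)" if "x \<in> {a<..b}"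
        using norm_mult_ineq[of "F x" "q x"] B[of x] that mult_right_mono[of "norm (F x)" B "norm (q x)"] by force
      thus "norm (indicator {a<..b} x *\<^sub>R (F x * q x)) \<le> norm (B * norm (indicator {a<..b} x *\<^sub>R q x))"
        by (auto split: split_indicator)
    qed
  qed
  show "set_integrable lebesgue {a<..b} (\<lambda>x. q x * F x)"
    unfolding set_integrable_def
  proof (rule Bochner_Integration.integrable_bound[OF qB])
    show "(\<lambda>x. indicator {a<..b} x *\<^sub>R (q x * F x)) \<in> borel_measurable lebesgue"
      unfolding eq2 by (intro borel_measurable_times Fm qm)
    show "AE x in lebesgue. norm (indicator {a<..b} x *\<^sub>R (q x * F x)) \<le> norm (B * norm (indicator {a<..b} x *\<^sub>R q x))"
    proof (rule AE_I2)
      fix x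
      have "norm (q x * F x) \<le> B * norm (q x)" if "x \<in> {a<..b}"
        using norm_mult_ineq[of "q x" "F x"] B[of x] that mult_left_mono[of "norm (F x)" B "norm (q x)"]
        by (force simp: mult.commute)
      thus "norm (indicator {a<..b} x *\<^sub>R (q x * F x)) \<le> norm (B * norm (indicator {a<..b} x *\<^sub>R q x))"
        by (auto split: split_indicator)
    qed
  qed
qed

lemma ac_deriv_mult:
  fixes F G :: "real \<Rightarrow> 'a::{euclidean_space, real_normed_algebra}"
  assumes F: "ac_deriv a b F p" and G: "ac_deriv a b G q"
  shows "ac_deriv a b (\<lambda>x. F x * G x) (\<lambda>x. F x * q x + p x * G x)"
proof -
  have cF: "continuous_on {a..b} F" and cG: "continuous_on {a..b} G"
    using F G by (auto simp: ac_deriv_def intro: abs_continuous_on_imp_continuous)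
  have "bounded (F ` {a..b})" "bounded (G ` {a..b})"
    by (intro compact_imp_bounded compact_continuous_image cF cG; auto)+
  then obtain B1 B2 where B: "\<And>x. x \<in> {a..b} \<Longrightarrow> norm (F x) \<le> B1" "\<And>x. x \<in> {a..b} \<Longrightarrow> norm (G x) \<le> B2"
    unfolding bounded_iff by blast
  define B where "B = max 0 (max B1 B2)"
  have BB: "norm (F x) \<le> B" "norm (G x) \<le> B" if "x \<in> {a..b}" for x
    using B(1)[OF that] B(2)[OF that] by (auto simp: B_def)
  show ?thesis
    unfolding ac_deriv_def
  proof (intro conjI)
    show "abs_continuous_on {a..b} (\<lambda>x. F x * G x)"
    proof (rule abs_continuous_on_dominated[of _ F G B])
      fix x y assume xy: "x \<in> {a..b}" "y \<in> {a..b}"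
      have "F y * G y - F x * G x = (F y - F x) * G y + F x * (G y - G x)" by (simp add: algebra_simps)
      hence "norm (F y * G y - F x * G x) \<le> norm ((F y - F x) * G y) + norm (F x * (G y - G x))"
        using norm_triangle_ineq by metis
      also have "\<dots> \<le> norm (F y - F x) * norm (G y) + norm (F x) * norm (G y - G x)"
        by (intro add_mono norm_mult_ineq)
      also have "\<dots> \<le> norm (F y - F x) * B + B * norm (G y - G x)"
        using BB xy by (intro add_mono mult_left_mono mult_right_mono) auto
      finally show "norm (F y * G y - F x * G x) \<le> B * norm (F y - F x) + B * norm (G y - G x)"
        by (simp add: mult.commute)
    qed (use F G in \<open>auto simp: ac_deriv_def B_def\<close>)
    show "set_integrable lebesgue {a<..b} (\<lambda>x. F x * q x + p x * G x)"
      using F G by (intro set_integral_add set_integrable_continuous_mult cF cG) (auto simp: ac_deriv_def)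
    have "AE x in lebesgue. a < x \<and> x < b \<longrightarrow> (F has_vector_derivative p x) (at x)"
      "AE x in lebesgue. a < x \<and> x < b \<longrightarrow> (G has_vector_derivative q x) (at x)"
      using F G by (simp_all add: ac_deriv_def)
    thus "AE x in lebesgue. a < x \<and> x < b \<longrightarrow>
        ((\<lambda>x. F x * G x) has_vector_derivative F x * q x + p x * G x) (at x)"
      by eventually_elim (auto intro: has_vector_derivative_mult)
  qed
qed

lemma ac_deriv_bounded_linear:
  fixes F :: "real \<Rightarrow> 'a::euclidean_space" and T :: "'a \<Rightarrow> 'b::euclidean_space"
  assumes F: "ac_deriv a b F p" and T: "bounded_linear T"
  shows "ac_deriv a b (\<lambda>x. T (F x)) (\<lambda>x. T (p x))"
proof -
  interpret bounded_linear T by (rule T)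
  obtain K where K: "K > 0" "\<And>x. norm (T x) \<le> norm x * K" using pos_bounded by blast
  show ?thesis
    unfolding ac_deriv_def
  proof (intro conjI)
    show "abs_continuous_on {a..b} (\<lambda>x. T (F x))"
    proof (rule abs_continuous_on_dominated[of _ F F K])
      fix x y
      have "norm (T (F y) - T (F x)) \<le> norm (F y - F x) * K" using K(2)[of "F y - F x"] by (simp add: diff)
      also have "\<dots> \<le> norm (F y - F x) * K + norm (F y - F x) * K" using K(1) by simp
      finally show "norm (T (F y) - T (F x)) \<le> K * norm (F y - F x) + K * norm (F y - F x)" by (simp add: mult.commute)
    qed (use F K in \<open>auto simp: ac_deriv_def\<close>)
    show "set_integrable lebesgue {a<..b} (\<lambda>x. T (p x))"
      using F integrable_bounded_linear[OF T, of lebesgue "\<lambda>x. indicator {a<..b} x *\<^sub>R p x"]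
      by (simp add: ac_deriv_def set_integrable_def scaleR)
    have "AE x in lebesgue. a < x \<and> x < b \<longrightarrow> (F has_vector_derivative p x) (at x)"
      using F by (simp add: ac_deriv_def)
    thus "AE x in lebesgue. a < x \<and> x < b \<longrightarrow> ((\<lambda>x. T (F x)) has_vector_derivative T (p x)) (at x)"
      by eventually_elim (auto intro: bounded_linear.has_vector_derivative[OF T])
  qed
qed

lemma ac_deriv_smooth:
  fixes v v' :: "real \<Rightarrow> real"
  assumes ab: "a \<le> b" and v: "\<And>x. a \<le> x \<Longrightarrow> x \<le> b \<Longrightarrow> (v has_real_derivative v' x) (at x)"
    and v': "continuous_on {a..b} v'"
  shows "ac_deriv a b v v'"
proof -
  have si: "set_integrable lebesgue {a<..b} v'"
    by (rule set_integrable_subset[OF absolutely_integrable_continuous_real[OF v']]) auto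
  have "v a + (LINT y:{a<..x}|lebesgue. v' y) = v x" if x: "a \<le> x" "x \<le> b" for x
  proof -
    have "set_integrable lebesgue {a<..x} v'" by (rule set_integrable_subset[OF si]) (use x in auto)
    hence "(LINT y:{a<..x}|lebesgue. v' y) = integral {a..x} v'" by (rule set_integral_Ioc_eq_integral)
    also have "(v' has_integral (v x - v a)) {a..x}"
    proof (rule fundamental_theorem_of_calculus[OF x(1)])
      fix y assume "y \<in> {a..x}"
      hence "(v has_real_derivative v' y) (at y)" using v x by auto
      thus "(v has_vector_derivative v' y) (at y within {a..x})"
        by (simp add: has_real_derivative_iff_has_vector_derivative has_vector_derivative_at_within)
    qed
    hence "integral {a..x} v' = v x - v a" by (rule integral_unique)
    finally show ?thesis by simp
  qed
  thus ?thesis by (intro ac_deriv_cong[OF ac_deriv_integral[OF ab si, of "v a"]]) auto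
qed

section \<open>The Hilbert space of a diagonal system\<close>

locale diagonal_system =
  fixes \<phi> :: "real \<Rightarrow> real"
  assumes phi_measurable: "\<phi> \<in> borel_measurable half_line"
    and sin_sq_integrable: "integrable half_line (\<lambda>x. (sin (\<phi> x))\<^sup>2)"
begin

abbreviation "H \<equiv> H_diag \<phi>"
definition ws :: "real \<Rightarrow> real" where "ws x = (sin (\<phi> x))\<^sup>2"
definition wc :: "real \<Rightarrow> real" where "wc x = (cos (\<phi> x))\<^sup>2"

lemma ws_nonneg [simp]: "0 \<le> ws x" and wc_nonneg [simp]: "0 \<le> wc x"
  and ws_wc: "ws x + wc x = 1"
  by (auto simp: ws_def wc_def)

lemma ws_le_1 [simp]: "ws x \<le> 1" and wc_le_1 [simp]: "wc x \<le> 1"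
  using ws_wc[of x] ws_nonneg[of x] wc_nonneg[of x] by linarith+

lemma ws_measurable [measurable]: "ws \<in> borel_measurable half_line"
  and wc_measurable [measurable]: "wc \<in> borel_measurable half_line"
  using phi_measurable unfolding ws_def[abs_def] wc_def[abs_def] by measurable

lemma ws_integrable: "integrable half_line ws"
  using sin_sq_integrable unfolding ws_def[abs_def] .

lemma pairing_diag: "pairing (H x) v w = ws x * (cnj (v $ 1) * w $ 1) + wc x * (cnj (v $ 2) * w $ 2)"
  by (simp add: pairing_def H_diag_def cmatrix_def map_matrix_def sum_2 matrix_vector_mult_def ws_def wc_def algebra_simps)

text \<open>The density of the squared norm of \<open>f\<close>.\<close>

definition dens :: "(real \<Rightarrow> complex^2) \<Rightarrow> real \<Rightarrow> real" where
  "dens f x = ws x * (cmod (f x $ 1))\<^sup>2 + wc x * (cmod (f x $ 2))\<^sup>2"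

lemma dens_nonneg [simp]: "0 \<le> dens f x"
  by (simp add: dens_def)

lemma pairing_self: "pairing (H x) (f x) (f x) = of_real (dens f x)"
proof -
  have "cnj z * z = of_real ((cmod z)\<^sup>2)" for z by (metis complex_norm_square mult.commute)
  thus ?thesis by (simp add: pairing_diag dens_def del: of_real_power)
qed

lemma vec_nth_measurable [measurable (raw)]:
  "f \<in> borel_measurable N \<Longrightarrow> (\<lambda>x. (f x :: complex^2) $ i) \<in> borel_measurable N"
  by (rule measurable_compose[of f N borel]) (auto intro!: borel_measurable_continuous_onI continuous_intros)

lemma cnj_measurable: "f \<in> borel_measurable N \<Longrightarrow> (\<lambda>x. cnj (f x)) \<in> borel_measurable N"
  by (rule measurable_compose[of f N borel]) (auto intro!: borel_measurable_continuous_onI continuous_intros)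

lemma vector_2_eq: "vector [a, b] = a *s axis 1 1 + b *s (axis 2 1 :: complex^2)"
  by (simp add: vec_eq_iff forall_2 axis_def)

lemma continuous_on_axis_scale: "continuous_on UNIV (\<lambda>a. a *s (axis i 1 :: complex^2))"
  unfolding vector_scalar_mult_def by (intro continuous_on_vec_lambda continuous_intros)

lemma vector_measurable [measurable (raw)]:
  assumes "u \<in> borel_measurable N" "v \<in> borel_measurable N"
  shows "(\<lambda>x. vector [u x, v x] :: complex^2) \<in> borel_measurable N"
  unfolding vector_2_eq
  by (intro borel_measurable_add measurable_compose[OF assms(1)] measurable_compose[OF assms(2)]
      borel_measurable_continuous_onI continuous_on_axis_scale)

lemma scale_measurable [measurable (raw)]:
  "f \<in> borel_measurable N \<Longrightarrow> (\<lambda>x. a *s (f x :: complex^2)) \<in> borel_measurable N"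
proof -
  assume [measurable]: "f \<in> borel_measurable N"
  have "(\<lambda>x. a *s f x) = (\<lambda>x. vector [a * f x $ 1, a * f x $ 2])"
    by (auto simp: vec_eq_iff forall_2)
  thus ?thesis by simp
qed

lemma dens_measurable [measurable (raw)]: "f \<in> borel_measurable half_line \<Longrightarrow> dens f \<in> borel_measurable half_line"
  unfolding dens_def[abs_def]
  by (intro borel_measurable_add borel_measurable_times borel_measurable_power
      measurable_compose[OF vec_nth_measurable borel_measurable_norm] ws_measurable wc_measurable)

lemma L2_iff: "f \<in> L2_space H \<longleftrightarrow> f \<in> borel_measurable half_line \<and> integrable half_line (dens f)"
  unfolding L2_space_def pairing_self by (auto simp: complex_of_real_integrable_eq)

lemma L2_measurable: "f \<in> L2_space H \<Longrightarrow> f \<in> borel_measurable half_line"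
  by (simp add: L2_iff)

lemma L2_dens: "f \<in> L2_space H \<Longrightarrow> integrable half_line (dens f)"
  by (simp add: L2_iff)

lemma L2_iff_nn: "f \<in> L2_space H \<longleftrightarrow> f \<in> borel_measurable half_line \<and> (\<integral>\<^sup>+x. ennreal (dens f x) \<partial>half_line) < \<infinity>"
  unfolding L2_iff integrable_iff_bounded by (auto intro: dens_measurable)

lemma dens_add_le: "dens (\<lambda>x. f x + g x) x \<le> 2 * dens f x + 2 * dens g x"
proof -
  have "(cmod (a + b))\<^sup>2 \<le> 2 * (cmod a)\<^sup>2 + 2 * (cmod b)\<^sup>2" for a b
  proof -
    have "(cmod (a + b))\<^sup>2 \<le> (cmod a + cmod b)\<^sup>2" by (intro power_mono norm_triangle_ineq) auto
    also have "\<dots> \<le> 2 * (cmod a)\<^sup>2 + 2 * (cmod b)\<^sup>2"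
      using sum_squares_bound[of "cmod a" "cmod b"] by (simp add: power2_sum)
    finally show ?thesis .
  qed
  hence "ws x * (cmod (f x $ 1 + g x $ 1))\<^sup>2 \<le> ws x * (2 * (cmod (f x $ 1))\<^sup>2 + 2 * (cmod (g x $ 1))\<^sup>2)"
    "wc x * (cmod (f x $ 2 + g x $ 2))\<^sup>2 \<le> wc x * (2 * (cmod (f x $ 2))\<^sup>2 + 2 * (cmod (g x $ 2))\<^sup>2)"
    by (intro mult_left_mono; simp)+
  thus ?thesis by (simp add: dens_def algebra_simps)
qed

lemma dens_scale: "dens (\<lambda>x. a *s f x) x = (cmod a)\<^sup>2 * dens f x"
  by (simp add: dens_def norm_mult power_mult_distrib algebra_simps)

lemma L2_zero: "(\<lambda>_. 0) \<in> L2_space H"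
  by (simp add: L2_iff dens_def[abs_def])

lemma L2_add: "f \<in> L2_space H \<Longrightarrow> g \<in> L2_space H \<Longrightarrow> (\<lambda>x. f x + g x) \<in> L2_space H"
proof -
  assume f: "f \<in> L2_space H" and g: "g \<in> L2_space H"
  have [measurable]: "f \<in> borel_measurable half_line" "g \<in> borel_measurable half_line"
    using f g by (auto simp: L2_iff)
  have i: "integrable half_line (\<lambda>x. 2 * dens f x + 2 * dens g x)" using f g by (auto simp: L2_iff)
  have "integrable half_line (dens (\<lambda>x. f x + g x))"
    by (rule Bochner_Integration.integrable_bound[OF i]) (auto intro: dens_add_le)
  thus ?thesis by (auto simp: L2_iff)
qed

lemma L2_scale: "f \<in> L2_space H \<Longrightarrow> (\<lambda>x. a *s f x) \<in> L2_space H"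
proof -
  have "dens (\<lambda>x. a *s f x) = (\<lambda>x. (cmod a)\<^sup>2 * dens f x)" by (rule ext) (rule dens_scale)
  thus "f \<in> L2_space H \<Longrightarrow> (\<lambda>x. a *s f x) \<in> L2_space H" by (auto simp: L2_iff)
qed

lemma pairing_integrable:
  assumes "f \<in> L2_space H" "g \<in> L2_space H"
  shows "integrable half_line (\<lambda>x. pairing (H x) (f x) (g x))"
proof -
  have [measurable]: "f \<in> borel_measurable half_line" "g \<in> borel_measurable half_line"
    using assms by (auto simp: L2_iff)
  have i: "integrable half_line (\<lambda>x. dens f x + dens g x)" using assms by (auto simp: L2_iff)
  have b: "cmod (cnj a * b) \<le> (cmod a)\<^sup>2 + (cmod b)\<^sup>2" for a b
  proof -
    have "2 * (cmod a * cmod b) \<le> (cmod a)\<^sup>2 + (cmod b)\<^sup>2"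
      using sum_squares_bound[of "cmod a" "cmod b"] by simp
    moreover have "0 \<le> cmod a * cmod b" by simp
    ultimately show ?thesis unfolding norm_mult complex_mod_cnj by linarith
  qed
  show ?thesis
  proof (rule Bochner_Integration.integrable_bound[OF i])
    show "(\<lambda>x. pairing (H x) (f x) (g x)) \<in> borel_measurable half_line"
      unfolding pairing_diag
      by (intro borel_measurable_add borel_measurable_times borel_measurable_of_real cnj_measurable
          vec_nth_measurable ws_measurable wc_measurable) measurable
    show "AE x in half_line. cmod (pairing (H x) (f x) (g x)) \<le> norm (dens f x + dens g x)"
    proof (rule AE_I2)
      fix x
      have "cmod (pairing (H x) (f x) (g x)) \<le> ws x * cmod (cnj (f x $ 1) * g x $ 1) + wc x * cmod (cnj (f x $ 2) * g x $ 2)"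
        unfolding pairing_diag by (rule norm_triangle_le) (simp add: norm_mult)
      also have "\<dots> \<le> ws x * ((cmod (f x $ 1))\<^sup>2 + (cmod (g x $ 1))\<^sup>2) + wc x * ((cmod (f x $ 2))\<^sup>2 + (cmod (g x $ 2))\<^sup>2)"
        by (intro add_mono mult_left_mono b) auto
      also have "\<dots> = dens f x + dens g x" by (simp add: dens_def algebra_simps)
      finally show "cmod (pairing (H x) (f x) (g x)) \<le> norm (dens f x + dens g x)" by simp
    qed
  qed
qed

abbreviation fscale :: "complex \<Rightarrow> (real \<Rightarrow> complex^2) \<Rightarrow> real \<Rightarrow> complex^2" where
  "fscale a f \<equiv> (\<lambda>x. a *s f x)"

lemma semi_inner_L2: "semi_inner fscale (L2_space H) (L2_inner H)"
proof
  show "fscale a (f + g) = fscale a f + fscale a g" for a f g by (auto simp: vector_add_ldistrib)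
  show "fscale (a + b) f = fscale a f + fscale b f" for a b f by (auto simp: vector_sadd_rdistrib)
  show "fscale a (fscale b f) = fscale (a * b) f" for a b f by (auto simp: vector_smult_assoc)
  show "fscale 1 f = f" for f by auto
  show "0 \<in> L2_space H" using L2_zero by (simp add: zero_fun_def)
  show "f + g \<in> L2_space H" if "f \<in> L2_space H" "g \<in> L2_space H" for f g
    using L2_add[OF that] by (simp add: plus_fun_def)
  show "fscale a f \<in> L2_space H" if "f \<in> L2_space H" for a f using L2_scale[OF that] .
  show "L2_inner H f (g + h) = L2_inner H f g + L2_inner H f h"
    if "f \<in> L2_space H" "g \<in> L2_space H" "h \<in> L2_space H" for f g h
    unfolding L2_inner_def
    by (subst Bochner_Integration.integral_add[OF pairing_integrable pairing_integrable, symmetric])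
       (use that in \<open>auto simp: pairing_diag algebra_simps\<close>)
  show "L2_inner H f (fscale a g) = a * L2_inner H f g" for f g a
    unfolding L2_inner_def
    by (subst integral_mult_right_zero[symmetric]) (simp add: pairing_diag algebra_simps)
  show "L2_inner H g f = cnj (L2_inner H f g)" for f g
  proof -
    have "(\<lambda>x. pairing (H x) (g x) (f x)) = (\<lambda>x. cnj (pairing (H x) (f x) (g x)))"
      by (simp add: pairing_diag algebra_simps)
    thus ?thesis unfolding L2_inner_def by simp
  qed
  show "0 \<le> Re (L2_inner H f f)" for f
    unfolding L2_inner_def pairing_self by simp
qed

sublocale L2: semi_inner fscale "L2_space H" "L2_inner H"
  by (rule semi_inner_L2)

lemma L2_nrm_eq: "L2_nrm H = L2.nrm"
  by (auto simp: L2_nrm_def L2.nrm_def)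

lemma L2_nrm_sq: "(L2.nrm f)\<^sup>2 = (LINT x|half_line. dens f x)"
proof -
  have "Re (L2_inner H f f) = (LINT x|half_line. dens f x)"
    unfolding L2_inner_def pairing_self by simp
  thus ?thesis by (simp add: L2.nrm_def)
qed

lemma L2_nn_nrm: "f \<in> L2_space H \<Longrightarrow> (\<integral>\<^sup>+x. ennreal (dens f x) \<partial>half_line) = ennreal ((L2.nrm f)\<^sup>2)"
  unfolding L2_nrm_sq by (rule nn_integral_eq_integral) (auto simp: L2_iff)

lemma L2_nrm_0_iff: "f \<in> L2_space H \<Longrightarrow> L2.nrm f = 0 \<longleftrightarrow> (AE x in half_line. dens f x = 0)"
  using integral_nonneg_eq_0_iff_AE[OF L2_dens[of f]] L2_nrm_sq[of f] by auto

lemma summable_of_weighted_squares: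
  fixes d :: "nat \<Rightarrow> complex"
  assumes "\<And>n. 2 ^ n * (cmod (d n))\<^sup>2 \<le> K"
  shows "summable d"
proof (rule summable_comparison_test[of d "\<lambda>n. sqrt K * (1 / sqrt 2) ^ n"])
  have "cmod (d n) \<le> sqrt K * (1 / sqrt 2) ^ n" for n
  proof -
    have "(cmod (d n))\<^sup>2 \<le> K * (1 / 2) ^ n" using assms[of n] by (simp add: field_simps)
    hence "cmod (d n) \<le> sqrt (K * (1 / 2) ^ n)" by (rule real_le_rsqrt)
    also have "\<dots> = sqrt K * (1 / sqrt 2) ^ n" by (simp add: real_sqrt_mult real_sqrt_power real_sqrt_divide)
    finally show ?thesis .
  qed
  thus "\<exists>N. \<forall>n\<ge>N. norm (d n) \<le> sqrt K * (1 / sqrt 2) ^ n" by simp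
  show "summable (\<lambda>n. sqrt K * (1 / sqrt 2) ^ n)" by (intro summable_mult summable_geometric) auto
qed

text \<open>The argument of Riesz and Fischer. The factors \<open>2 ^ n\<close> make a pointwise bound on the weighted squares of the increments
enough for the increments to be summable, so each component converges almost everywhere on the set where
its weight is positive. Elsewhere the component is invisible to the norm, and the limit is taken of the
zero sequence there. Fatou's lemma gives the estimates.\<close>

lemma L2_fast_cauchy_limit:
  assumes Y: "\<And>n::nat. Y n \<in> L2_space H" and fast: "\<And>n m. n \<le> m \<Longrightarrow> L2.nrm (Y m - Y n) \<le> (1 / 2) ^ n"
  shows "\<exists>f\<in>L2_space H. \<forall>n. L2.nrm (Y n - f) \<le> (1 / 2) ^ n"
proof -
  have Ym [measurable]: "Y n \<in> borel_measurable half_line" for n using Y by (simp add: L2_iff)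
  define d where "d n = Y (Suc n) - Y n" for n
  have dL: "d n \<in> L2_space H" for n unfolding d_def by (intro L2.diff_mem Y)
  have dm [measurable]: "d n \<in> borel_measurable half_line" for n using dL by (simp add: L2_iff)
  have "(\<integral>\<^sup>+x. (\<Sum>n. ennreal (2 ^ n * dens (d n) x)) \<partial>half_line) = (\<Sum>n. \<integral>\<^sup>+x. ennreal (2 ^ n * dens (d n) x) \<partial>half_line)"
    by (rule nn_integral_suminf) measurable
  also have "\<dots> \<le> (\<Sum>n. ennreal ((1 / 2) ^ n))"
  proof (rule suminf_le)
    fix n
    have "(\<integral>\<^sup>+x. ennreal (2 ^ n * dens (d n) x) \<partial>half_line) = ennreal (2 ^ n) * (\<integral>\<^sup>+x. ennreal (dens (d n) x) \<partial>half_line)"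
      by (subst nn_integral_cmult[symmetric]) (auto simp: ennreal_mult)
    also have "\<dots> = ennreal (2 ^ n * (L2.nrm (d n))\<^sup>2)"
      by (simp add: L2_nn_nrm[OF dL] ennreal_mult)
    also have "\<dots> \<le> ennreal ((1 / 2) ^ n)"
    proof (rule ennreal_leI)
      have "(L2.nrm (d n))\<^sup>2 \<le> ((1 / 2) ^ n)\<^sup>2"
        using fast[of n "Suc n"] L2.nrm_nonneg[OF dL[of n]] by (intro power_mono) (auto simp: d_def)
      hence "2 ^ n * (L2.nrm (d n))\<^sup>2 \<le> 2 ^ n * ((1 / 2) ^ n)\<^sup>2" by simp
      also have "\<dots> = (1 / 2) ^ n" by (simp add: power2_eq_square power_divide)
      finally show "2 ^ n * (L2.nrm (d n))\<^sup>2 \<le> (1 / 2) ^ n" .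
    qed
    finally show "(\<integral>\<^sup>+x. ennreal (2 ^ n * dens (d n) x) \<partial>half_line) \<le> ennreal ((1 / 2) ^ n)" .
  qed auto
  also have "\<dots> = ennreal (\<Sum>n. (1 / 2) ^ n)"
    by (rule suminf_ennreal2) (auto intro!: summable_geometric)
  also have "\<dots> < \<infinity>" by simp
  finally have "AE x in half_line. (\<Sum>n. ennreal (2 ^ n * dens (d n) x)) \<noteq> \<infinity>"
    by (intro nn_integral_noteq_infinite) (auto simp: less_top)
  hence conv: "AE x in half_line. (ws x \<noteq> 0 \<longrightarrow> convergent (\<lambda>n. Y n x $ 1)) \<and> (wc x \<noteq> 0 \<longrightarrow> convergent (\<lambda>n. Y n x $ 2))"
  proof eventually_elim
    case (elim x)
    hence "summable (\<lambda>n. 2 ^ n * dens (d n) x)" by (intro summable_suminf_not_top) (auto simp: top_ennreal_def)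
    hence "Bseq (\<lambda>n. 2 ^ n * dens (d n) x)" 
      by (rule convergent_imp_Bseq[OF convergentI[OF summable_LIMSEQ_zero]])
    then obtain K where K: "\<And>n. norm (2 ^ n * dens (d n) x) \<le> K" by (auto simp: Bseq_def)
    have main: "convergent (\<lambda>n. Y n x $ i)" if w: "w > 0" "\<And>n. w * (cmod (d n x $ i))\<^sup>2 \<le> dens (d n) x" for w i
    proof -
      have "2 ^ n * (cmod (d n x $ i))\<^sup>2 \<le> K / w" for n
      proof -
        have "2 ^ n * (w * (cmod (d n x $ i))\<^sup>2) \<le> 2 ^ n * dens (d n) x" by (intro mult_left_mono w) auto
        also have "\<dots> \<le> K" using K[of n] by simp
        finally show ?thesis using w by (simp add: field_simps)
      qed
      hence "summable (\<lambda>n. d n x $ i)" by (rule summable_of_weighted_squares)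
      hence "convergent (\<lambda>n. \<Sum>k<n. d k x $ i)" by (simp add: summable_iff_convergent)
      moreover have "(\<Sum>k<n. d k x $ i) = Y n x $ i - Y 0 x $ i" for n
        using sum_lessThan_telescope[of "\<lambda>k. Y k x $ i" n] by (simp add: d_def)
      ultimately have "convergent (\<lambda>n. Y n x $ i - Y 0 x $ i)" by simp
      hence "convergent (\<lambda>n. (Y n x $ i - Y 0 x $ i) + Y 0 x $ i)" by (intro convergent_add convergent_const)
      thus ?thesis by simp
    qed
    show ?case
    proof (intro conjI impI)
      assume "ws x \<noteq> 0"
      thus "convergent (\<lambda>n. Y n x $ 1)" by (intro main[of "ws x"]) (auto simp: less_le dens_def)
    next
      assume "wc x \<noteq> 0"
      thus "convergent (\<lambda>n. Y n x $ 2)" by (intro main[of "wc x"]) (auto simp: less_le dens_def)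
    qed
  qed
  define f where "f x = (vector [lim (\<lambda>n. if ws x = 0 then 0 else Y n x $ 1), lim (\<lambda>n. if wc x = 0 then 0 else Y n x $ 2)] :: complex^2)" for x
  have fm [measurable]: "f \<in> borel_measurable half_line" unfolding f_def[abs_def] by measurable
  have dl: "AE x in half_line. \<forall>n. (\<lambda>m. dens (Y n - Y m) x) \<longlonglongrightarrow> dens (Y n - f) x"
    using conv
  proof eventually_elim
    case (elim x)
    show ?case
    proof
      fix n
      have 1: "(\<lambda>m. ws x * (cmod (Y n x $ 1 - Y m x $ 1))\<^sup>2) \<longlonglongrightarrow> ws x * (cmod (Y n x $ 1 - f x $ 1))\<^sup>2"
      proof (cases "ws x = 0")
        case False
        hence "(\<lambda>m. Y m x $ 1) \<longlonglongrightarrow> f x $ 1" using elim by (simp add: f_def convergent_LIMSEQ_iff)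
        thus ?thesis by (intro tendsto_mult tendsto_power tendsto_norm tendsto_diff tendsto_const)
      qed simp
      have 2: "(\<lambda>m. wc x * (cmod (Y n x $ 2 - Y m x $ 2))\<^sup>2) \<longlonglongrightarrow> wc x * (cmod (Y n x $ 2 - f x $ 2))\<^sup>2"
      proof (cases "wc x = 0")
        case False
        hence "(\<lambda>m. Y m x $ 2) \<longlonglongrightarrow> f x $ 2" using elim by (simp add: f_def convergent_LIMSEQ_iff)
        thus ?thesis by (intro tendsto_mult tendsto_power tendsto_norm tendsto_diff tendsto_const)
      qed simp
      show "(\<lambda>m. dens (Y n - Y m) x) \<longlonglongrightarrow> dens (Y n - f) x"
        using tendsto_add[OF 1 2] by (simp add: dens_def)
    qed
  qed
  have bound: "(\<integral>\<^sup>+x. ennreal (dens (Y n - f) x) \<partial>half_line) \<le> ennreal (((1 / 2) ^ n)\<^sup>2)" for n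
  proof -
    have mm [measurable]: "Y n - Y m \<in> borel_measurable half_line" for m
      unfolding fun_diff_def by measurable
    have "(\<integral>\<^sup>+x. ennreal (dens (Y n - f) x) \<partial>half_line) = (\<integral>\<^sup>+x. liminf (\<lambda>m. ennreal (dens (Y n - Y m) x)) \<partial>half_line)"
    proof (rule nn_integral_cong_AE)
      show "AE x in half_line. ennreal (dens (Y n - f) x) = liminf (\<lambda>m. ennreal (dens (Y n - Y m) x))"
        using dl
      proof eventually_elim
        case (elim x)
        hence "(\<lambda>m. ennreal (dens (Y n - Y m) x)) \<longlonglongrightarrow> ennreal (dens (Y n - f) x)" by (intro tendsto_ennrealI) auto
        thus ?case by (metis lim_imp_Liminf trivial_limit_sequentially)
      qed
    qed
    also have "\<dots> \<le> liminf (\<lambda>m. \<integral>\<^sup>+x. ennreal (dens (Y n - Y m) x) \<partial>half_line)"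
      by (rule nn_integral_liminf) measurable
    also have "\<dots> \<le> liminf (\<lambda>m. ennreal (((1 / 2) ^ n)\<^sup>2))"
    proof (rule Liminf_mono)
      show "\<forall>\<^sub>F m in sequentially. (\<integral>\<^sup>+x. ennreal (dens (Y n - Y m) x) \<partial>half_line) \<le> ennreal (((1 / 2) ^ n)\<^sup>2)"
        unfolding eventually_sequentially
      proof (intro exI[of _ n] allI impI)
        fix m assume "n \<le> m"
        hence "L2.nrm (Y n - Y m) \<le> (1 / 2) ^ n" using fast[of n m] L2.nrm_minus_commute[OF Y Y] by metis
        hence "(L2.nrm (Y n - Y m))\<^sup>2 \<le> ((1 / 2) ^ n)\<^sup>2"
          using L2.nrm_nonneg[OF L2.diff_mem[OF Y Y]] by (intro power_mono) auto
        thus "(\<integral>\<^sup>+x. ennreal (dens (Y n - Y m) x) \<partial>half_line) \<le> ennreal (((1 / 2) ^ n)\<^sup>2)"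
          by (simp add: L2_nn_nrm[OF L2.diff_mem[OF Y Y]] ennreal_leI)
      qed
    qed
    also have "\<dots> = ennreal (((1 / 2) ^ n)\<^sup>2)" by (simp add: Liminf_const)
    finally show ?thesis .
  qed
  have YfL: "Y n - f \<in> L2_space H" for n
    unfolding L2_iff_nn
  proof
    show "Y n - f \<in> borel_measurable half_line" unfolding fun_diff_def by measurable
    show "(\<integral>\<^sup>+x. ennreal (dens (Y n - f) x) \<partial>half_line) < \<infinity>"
      using bound[of n] by (rule order.strict_trans1) simp
  qed
  have "Y 0 - (Y 0 - f) \<in> L2_space H" by (intro L2.diff_mem Y YfL)
  hence fL: "f \<in> L2_space H" by simp
  have "L2.nrm (Y n - f) \<le> (1 / 2) ^ n" for n
  proof -
    have "(L2.nrm (Y n - f))\<^sup>2 \<le> ((1 / 2) ^ n)\<^sup>2"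
      using bound[of n] unfolding L2_nn_nrm[OF YfL] by (subst (asm) ennreal_le_iff) auto
    thus ?thesis by (rule power2_le_imp_le) simp
  qed
  thus ?thesis using fL by blast
qed

lemma semi_hilbert_L2: "semi_hilbert fscale (L2_space H) (L2_inner H)"
proof
  fix X :: "nat \<Rightarrow> real \<Rightarrow> complex^2"
  assume X: "\<And>n. X n \<in> L2_space H" and cau: "\<And>\<epsilon>. \<epsilon> > 0 \<Longrightarrow> \<exists>N. \<forall>m\<ge>N. \<forall>n\<ge>N. L2.nrm (X m - X n) < \<epsilon>"
  have "\<exists>N. \<forall>m\<ge>N. \<forall>n\<ge>N. L2.nrm (X m - X n) < (1 / 2) ^ k" for k :: nat by (rule cau) simp
  then obtain N where N: "\<And>k m n. m \<ge> N k \<Longrightarrow> n \<ge> N k \<Longrightarrow> L2.nrm (X m - X n) < (1 / 2) ^ k" by metis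
  define k where "k n = (\<Sum>i\<le>n. N i)" for n :: nat
  have kN: "N n \<le> k m" if "n \<le> m" for n m
    unfolding k_def by (rule member_le_sum) (use that in auto)
  have "\<exists>f\<in>L2_space H. \<forall>n. L2.nrm (X (k n) - f) \<le> (1 / 2) ^ n"
    by (rule L2_fast_cauchy_limit) (auto intro!: X less_imp_le N kN)
  then obtain f where f: "f \<in> L2_space H" "\<And>n. L2.nrm (X (k n) - f) \<le> (1 / 2) ^ n" by blast
  have "(\<lambda>n. L2.nrm (X n - f)) \<longlonglongrightarrow> 0"
  proof (rule LIMSEQ_I)
    fix \<epsilon> :: real assume \<epsilon>: "\<epsilon> > 0"
    obtain j where j: "(1 / 2 :: real) ^ j < \<epsilon> / 2" using real_arch_pow_inv[of "\<epsilon> / 2" "1 / 2"] \<epsilon> by auto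
    show "\<exists>no. \<forall>n\<ge>no. norm (L2.nrm (X n - f) - 0) < \<epsilon>"
    proof (intro exI[of _ "N j"] allI impI)
      fix n assume n: "n \<ge> N j"
      have "L2.nrm (X n - f) \<le> L2.nrm (X n - X (k j)) + L2.nrm (X (k j) - f)"
        by (rule L2.nrm_triangle3) (use X f in auto)
      also have "\<dots> < \<epsilon>" using N[OF n kN[of j j]] f(2)[of j] j by simp
      finally show "norm (L2.nrm (X n - f) - 0) < \<epsilon>"
        using L2.nrm_nonneg[OF L2.diff_mem[OF X f(1)], of n] by simp
    qed
  qed
  thus "\<exists>x\<in>L2_space H. (\<lambda>n. L2.nrm (X n - x)) \<longlonglongrightarrow> 0" using f by blast
qed

end

section \<open>The canonical relation in integrated form\<close>

lemma set_integrable_half_line: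
  fixes f :: "real \<Rightarrow> 'a::{banach, second_countable_topology}"
  assumes S: "S \<in> sets lebesgue" "S \<subseteq> {0<..}"
  shows "set_integrable half_line S f \<longleftrightarrow> set_integrable lebesgue S f"
    and "(LINT x:S|half_line. f x) = (LINT x:S|lebesgue. f x)"
proof -
  have eq: "(\<lambda>x. indicator {0<..} x *\<^sub>R indicat_real S x *\<^sub>R f x) = (\<lambda>x. indicat_real S x *\<^sub>R f x)"
    by (rule ext) (use S(2) in \<open>auto simp: indicator_def\<close>)
  show "set_integrable half_line S f \<longleftrightarrow> set_integrable lebesgue S f"
    unfolding set_integrable_def half_line_def by (subst integrable_restrict_space, simp, simp only: eq)
  show "(LINT x:S|half_line. f x) = (LINT x:S|lebesgue. f x)"
    unfolding set_lebesgue_integral_def half_line_def by (subst integral_restrict_space, simp, simp only: eq)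
qed

lemma AE_half_line: "(AE x in half_line. P x) \<longleftrightarrow> (AE x in lebesgue. 0 < x \<longrightarrow> P x)"
  unfolding half_line_def by (subst AE_restrict_space_iff) auto

lemma space_half_line [simp]: "space half_line = {0<..}"
  by (simp add: half_line_def)

lemma sets_half_line: "S \<in> sets lebesgue \<Longrightarrow> S \<subseteq> {0<..} \<Longrightarrow> S \<in> sets half_line"
  unfolding half_line_def by (auto simp: sets_restrict_space)

lemma indicator_half_line_measurable [measurable]:
  "S \<in> sets lebesgue \<Longrightarrow> (indicator S :: real \<Rightarrow> 'a::{zero_neq_one, topological_space}) \<in> borel_measurable half_line"
  unfolding half_line_def by (rule measurable_restrict_space1) (rule borel_measurable_indicator)

lemma continuous_on_half_line_measurable:
  fixes f :: "real \<Rightarrow> 'a::euclidean_space"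
  assumes "continuous_on {0<..} f" shows "f \<in> borel_measurable half_line"
  unfolding half_line_def by (rule continuous_imp_measurable_on_sets_lebesgue[OF assms]) auto

context diagonal_system
begin

text \<open>The indicator functions times the two unit vectors: pairing with them integrates one component
against its weight.\<close>

definition e1 :: "real set \<Rightarrow> real \<Rightarrow> complex^2" where "e1 S x = vector [indicator S x, 0]"
definition e2 :: "real set \<Rightarrow> real \<Rightarrow> complex^2" where "e2 S x = vector [0, indicator S x]"

lemma L2I:
  assumes "f \<in> borel_measurable half_line" "integrable half_line g" "\<And>x. x > 0 \<Longrightarrow> dens f x \<le> g x"
  shows "f \<in> L2_space H"
proof -
  have "integrable half_line (dens f)"
    by (rule Bochner_Integration.integrable_bound[OF assms(2)]) (use assms in \<open>force intro!: AE_I2 dens_measurable\<close>)+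
  thus ?thesis using assms by (simp add: L2_iff)
qed

lemma e1_measurable: "S \<in> sets lebesgue \<Longrightarrow> e1 S \<in> borel_measurable half_line"
  and e2_measurable: "S \<in> sets lebesgue \<Longrightarrow> e2 S \<in> borel_measurable half_line"
  unfolding e1_def[abs_def] e2_def[abs_def] by (auto intro!: vector_measurable)

lemma e1_mem [simp]: "S \<in> sets lebesgue \<Longrightarrow> e1 S \<in> L2_space H"
  by (rule L2I[OF e1_measurable ws_integrable]) (auto simp: dens_def e1_def split: split_indicator)

lemma indicator_Ioc_integrable: "integrable half_line (indicat_real {0<..b})"
proof -
  have "emeasure half_line {0<..b} = emeasure lebesgue {0<..b}"
    unfolding half_line_def by (subst emeasure_restrict_space) auto
  also have "\<dots> < \<infinity>" by (cases "0 \<le> b") auto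
  finally show ?thesis by (intro integrable_real_indicator sets_half_line) auto
qed

lemma e2_mem [simp]:
  assumes "S \<in> sets lebesgue" "S \<inter> {0<..} \<subseteq> {0<..b}"
  shows "e2 S \<in> L2_space H"
proof (rule L2I[OF e2_measurable[OF assms(1)] indicator_Ioc_integrable])
  fix x :: real assume "x > 0"
  thus "dens (e2 S) x \<le> indicat_real {0<..b} x"
    using assms(2) by (auto simp: dens_def e2_def split: split_indicator)
qed

lemma pairing_e1: "pairing (H x) (e1 S x) (h x) = indicat_real S x *\<^sub>R (ws x * h x $ 1)"
  and pairing_e2: "pairing (H x) (e2 S x) (h x) = indicat_real S x *\<^sub>R (wc x * h x $ 2)"
  by (auto simp: pairing_diag e1_def e2_def split: split_indicator)

lemma ip_e1: "L2_inner H (e1 S) h = (LINT x:S|half_line. ws x * h x $ 1)"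
  and ip_e2: "L2_inner H (e2 S) h = (LINT x:S|half_line. wc x * h x $ 2)"
  by (simp_all add: L2_inner_def pairing_e1 pairing_e2 set_lebesgue_integral_def)

text \<open>The equation \<open>J f' = - H h\<close> decouples into \<open>f\<^sub>1' = - wc h\<^sub>2\<close> and \<open>f\<^sub>2' = ws h\<^sub>1\<close>. Here \<open>V1 h\<close> and \<open>V2 h\<close>
are the two primitives that vanish at \<open>0\<close>, written as inner products so that Cauchy-Schwarz bounds them
pointwise, and \<open>V a h\<close> is the solution with \<open>f 0 = (a, 0)\<close>.\<close>

definition V1 :: "(real \<Rightarrow> complex^2) \<Rightarrow> real \<Rightarrow> complex" where "V1 h x = L2_inner H (e2 {0<..x}) h"
definition V2 :: "(real \<Rightarrow> complex^2) \<Rightarrow> real \<Rightarrow> complex" where "V2 h x = L2_inner H (e1 {0<..x}) h"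
definition V :: "complex \<Rightarrow> (real \<Rightarrow> complex^2) \<Rightarrow> real \<Rightarrow> complex^2" where
  "V a h x = vector [a - V1 h x, V2 h x]"

lemma e2_Ioc_mem [simp]: "e2 {a<..b} \<in> L2_space H"
  by (rule e2_mem[of _ b]) auto

lemma V1_0 [simp]: "V1 h 0 = 0" and V2_0 [simp]: "V2 h 0 = 0"
  by (simp_all add: V1_def V2_def ip_e1 ip_e2 set_lebesgue_integral_def)

lemma V1_lin: "h \<in> L2_space H \<Longrightarrow> k \<in> L2_space H \<Longrightarrow> V1 (h + k) x = V1 h x + V1 k x"
  "h \<in> L2_space H \<Longrightarrow> k \<in> L2_space H \<Longrightarrow> V1 (h - k) x = V1 h x - V1 k x"
  "h \<in> L2_space H \<Longrightarrow> V1 (fscale a h) x = a * V1 h x"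
  by (simp_all add: V1_def L2.ip_add_right L2.ip_diff_right L2.ip_scl_right)

lemma V2_lin: "h \<in> L2_space H \<Longrightarrow> k \<in> L2_space H \<Longrightarrow> V2 (h + k) x = V2 h x + V2 k x"
  "h \<in> L2_space H \<Longrightarrow> k \<in> L2_space H \<Longrightarrow> V2 (h - k) x = V2 h x - V2 k x"
  "h \<in> L2_space H \<Longrightarrow> V2 (fscale a h) x = a * V2 h x"
  by (simp_all add: V2_def L2.ip_add_right L2.ip_diff_right L2.ip_scl_right)

lemma V1_eq: "V1 h x = (LINT y:{0<..x}|lebesgue. wc y * h y $ 2)"
  and V2_eq: "V2 h x = (LINT y:{0<..x}|lebesgue. ws y * h y $ 1)"
  unfolding V1_def V2_def ip_e1 ip_e2 by (subst set_integrable_half_line; auto)+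

lemma weighted_set_integrable:
  assumes h: "h \<in> L2_space H"
  shows "set_integrable lebesgue {0<..b} (\<lambda>x. ws x * h x $ 1)"
    and "set_integrable lebesgue {0<..b} (\<lambda>x. wc x * h x $ 2)"
proof -
  have "set_integrable half_line {0<..b} (\<lambda>x. ws x * h x $ 1)"
    using pairing_integrable[OF e1_mem h, of "{0<..b}"] by (simp add: pairing_e1 set_integrable_def)
  thus "set_integrable lebesgue {0<..b} (\<lambda>x. ws x * h x $ 1)" by (subst (asm) set_integrable_half_line) auto
  have "set_integrable half_line {0<..b} (\<lambda>x. wc x * h x $ 2)"
    using pairing_integrable[OF e2_Ioc_mem h, of 0 b] by (simp add: pairing_e2 set_integrable_def)
  thus "set_integrable lebesgue {0<..b} (\<lambda>x. wc x * h x $ 2)" by (subst (asm) set_integrable_half_line) auto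
qed

lemma V1_ac_deriv:
  assumes h: "h \<in> L2_space H" and b: "0 \<le> b"
  shows "ac_deriv 0 b (V1 h) (\<lambda>x. wc x * h x $ 2)"
  using ac_deriv_integral[OF b weighted_set_integrable(2)[OF h], of 0] by (simp add: V1_eq[abs_def])

lemma V2_ac_deriv:
  assumes h: "h \<in> L2_space H" and b: "0 \<le> b"
  shows "ac_deriv 0 b (V2 h) (\<lambda>x. ws x * h x $ 1)"
  using ac_deriv_integral[OF b weighted_set_integrable(1)[OF h], of 0] by (simp add: V2_eq[abs_def])

lemma ac_deriv_const_minus:
  fixes F :: "real \<Rightarrow> 'a::euclidean_space"
  assumes "ac_deriv a b F p" shows "ac_deriv a b (\<lambda>x. k - F x) (\<lambda>x. - p x)"
proof -
  have "ac_deriv a b (\<lambda>_. k) (\<lambda>_. 0)"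
    unfolding ac_deriv_def by (auto simp: abs_continuous_on_def set_integrable_def)
  from ac_deriv_diff[OF this assms] show ?thesis by simp
qed

lemma V_nth_ac_deriv:
  assumes h: "h \<in> L2_space H" and b: "0 \<le> b"
  shows "ac_deriv 0 b (\<lambda>x. V a h x $ 1) (\<lambda>x. - (wc x * h x $ 2))"
    and "ac_deriv 0 b (\<lambda>x. V a h x $ 2) (\<lambda>x. ws x * h x $ 1)"
  using ac_deriv_const_minus[OF V1_ac_deriv[OF h b], of a] V2_ac_deriv[OF h b]
  by (simp_all add: V_def)

lemma continuous_on_from_compact:
  fixes F :: "real \<Rightarrow> 'a::euclidean_space"
  assumes "\<And>b. b > 0 \<Longrightarrow> continuous_on {0..b} F" shows "continuous_on {0<..} F"
proof (rule continuous_at_imp_continuous_on, rule ballI)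
  fix x :: real assume "x \<in> {0<..}"
  hence x: "x > 0" by simp
  have "continuous_on {0..x + 1} F" using x by (intro assms) auto
  hence "continuous_on {0<..<x + 1} F" by (rule continuous_on_subset) auto
  thus "isCont F x" using x by (simp add: continuous_on_eq_continuous_at)
qed

lemma V_nth_continuous:
  assumes h: "h \<in> L2_space H"
  shows "continuous_on {0<..} (\<lambda>x. V a h x $ 1)" "continuous_on {0<..} (\<lambda>x. V a h x $ 2)"
  using V_nth_ac_deriv[OF h, of _ a] unfolding ac_deriv_def
  by (auto intro!: continuous_on_from_compact abs_continuous_on_imp_continuous)

lemma V_measurable:
  assumes h: "h \<in> L2_space H" shows "V a h \<in> borel_measurable half_line"
proof -
  have "(\<lambda>x. vector [V a h x $ 1, V a h x $ 2] :: complex^2) \<in> borel_measurable half_line"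
    by (rule vector_measurable[OF continuous_on_half_line_measurable[OF V_nth_continuous(1)[OF h, of a]]
          continuous_on_half_line_measurable[OF V_nth_continuous(2)[OF h, of a]]])
  moreover have "(\<lambda>x. vector [V a h x $ 1, V a h x $ 2]) = V a h" by (auto simp: V_def)
  ultimately show ?thesis by (simp only:)
qed

lemma operator_equation_iff:
  "J *v g' = - (cmatrix (H x) *v h x) \<longleftrightarrow> g' = vector [- (wc x * h x $ 2), ws x * h x $ 1]"
  by (auto simp: vec_eq_iff forall_2 J_def H_diag_def cmatrix_def map_matrix_def matrix_vector_mult_def
      sum_2 ws_def wc_def)

lemma L2_cong:
  assumes "f \<in> L2_space H" "\<And>x. x > 0 \<Longrightarrow> f x = g x"
  shows "g \<in> L2_space H"
proof (rule L2I[OF _ L2_dens[OF assms(1)]])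
  show "g \<in> borel_measurable half_line"
    using L2_measurable[OF assms(1)] by (subst measurable_cong[of _ _ f]) (use assms(2) in auto)
qed (use assms in \<open>auto simp: dens_def\<close>)

lemma L2_nrm_cong: "(\<And>x. x > 0 \<Longrightarrow> f x = g x) \<Longrightarrow> L2.nrm f = L2.nrm g"
proof -
  assume "\<And>x. x > 0 \<Longrightarrow> f x = g x"
  hence "(L2.nrm f)\<^sup>2 = (L2.nrm g)\<^sup>2"
    unfolding L2_nrm_sq by (intro Bochner_Integration.integral_cong) (auto simp: dens_def)
  moreover have "0 \<le> L2.nrm f" "0 \<le> L2.nrm g" by (auto simp: L2.nrm_def L2_inner_def pairing_self)
  ultimately show ?thesis by simp
qed

lemma L2_eq_iff: "L2_eq H f g \<longleftrightarrow> L2.nrm (f - g) = 0"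
  by (simp add: L2_eq_def L2_nrm_eq fun_diff_def)

lemma bounded_linear_axis: "bounded_linear (\<lambda>a. a *s (axis i 1 :: complex^2))"
proof (rule bounded_linear_intro[where K = 1])
  show "norm (a *s (axis i 1 :: complex^2)) \<le> norm a * 1" for a :: complex
    using exhaust_2[of i] by (auto simp: norm_vec_def L2_set_def sum_2 axis_def)
qed (auto simp: vec_eq_iff axis_def)

lemma vector_has_vector_derivative:
  assumes "(u has_vector_derivative u') (at x)" "(v has_vector_derivative v') (at x)"
  shows "((\<lambda>x. vector [u x, v x] :: complex^2) has_vector_derivative vector [u', v']) (at x)"
  unfolding vector_2_eq
  by (intro has_vector_derivative_add bounded_linear.has_vector_derivative[OF bounded_linear_axis] assms)

lemma norm_vector_2_le: "norm (vector [a, b] :: complex^2) \<le> cmod a + cmod b"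
  unfolding norm_vec_def L2_set_def sum_2
  by (simp add: sqrt_sum_squares_le_sum)

text \<open>The inverse of the canonical relation is explicit: two weighted Hardy operators and one free constant.
From here on no differential equation occurs any more.\<close>

lemma canonical_relation_iff:
  "(f, h) \<in> canonical_relation H \<longleftrightarrow>
     f \<in> L2_space H \<and> h \<in> L2_space H \<and> (\<exists>a. V a h \<in> L2_space H \<and> L2.nrm (f - V a h) = 0)"
proof
  assume "(f, h) \<in> canonical_relation H"
  then obtain g where f: "f \<in> L2_space H" and h: "h \<in> L2_space H" and g: "g \<in> L2_space H"
    and fg: "L2_eq H f g" and ac: "locally_abs_continuous g"
    and der: "AE x in half_line. \<exists>g'. (g has_vector_derivative g') (at x) \<and> J *v g' = - (cmatrix (H x) *v h x)"
    and g0: "g 0 $ 2 = 0"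
    unfolding canonical_relation_def by blast
  have der': "AE x in lebesgue. 0 < x \<longrightarrow> (g has_vector_derivative vector [- (wc x * h x $ 2), ws x * h x $ 1]) (at x)"
    using der unfolding AE_half_line operator_equation_iff by eventually_elim auto
  have nth: "((\<lambda>x. g x $ i) has_vector_derivative g' $ i) (at x)" if "(g has_vector_derivative g') (at x)" for g' x i
    using bounded_linear.has_vector_derivative[OF bounded_linear_vec_nth that] .
  have acn: "abs_continuous_on {0..b} (\<lambda>x. g x $ i)" if "b > 0" for b i
  proof (rule abs_continuous_on_dominated[of _ g g 1])
    show "norm (g y $ i - g x $ i) \<le> 1 * norm (g y - g x) + 1 * norm (g y - g x)" for x y
      using Finite_Cartesian_Product.norm_nth_le[where x = "g y - g x" and i = i] norm_ge_zero[of "g y - g x"] by (simp only: vector_minus_component)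
  qed (use ac that in \<open>auto simp: locally_abs_continuous_def\<close>)
  have si: "set_integrable lebesgue {0<..b} (\<lambda>x. - (wc x * h x $ 2))" for b
    using weighted_set_integrable(2)[OF h, of b] by (simp add: set_integrable_def)
  have g1: "ac_deriv 0 b (\<lambda>x. g x $ 1) (\<lambda>x. - (wc x * h x $ 2))" if "b > 0" for b
    unfolding ac_deriv_def
  proof (intro conjI acn that si)
    show "AE x in lebesgue. 0 < x \<and> x < b \<longrightarrow> ((\<lambda>x. g x $ 1) has_vector_derivative - (wc x * h x $ 2)) (at x)"
      using der' by eventually_elim (use nth[of "vector [- (wc _ * h _ $ 2), ws _ * h _ $ 1]" _ 1] in auto)
  qed
  have g2: "ac_deriv 0 b (\<lambda>x. g x $ 2) (\<lambda>x. ws x * h x $ 1)" if "b > 0" for b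
    unfolding ac_deriv_def
  proof (intro conjI acn that weighted_set_integrable h)
    show "AE x in lebesgue. 0 < x \<and> x < b \<longrightarrow> ((\<lambda>x. g x $ 2) has_vector_derivative (ws x * h x $ 1)) (at x)"
      using der' by eventually_elim (use nth[of "vector [- (wc _ * h _ $ 2), ws _ * h _ $ 1]" _ 2] in auto)
  qed
  have eq: "g x = V (g 0 $ 1) h x" if x: "x > 0" for x
  proof -
    have "g x $ 1 - g 0 $ 1 = (LINT y:{0<..x}|lebesgue. - (wc y * h y $ 2))"
      by (rule ac_deriv_FTC[OF g1[OF x]]) (use x in auto)
    also have "\<dots> = - V1 h x" unfolding V1_eq by (simp add: set_lebesgue_integral_def)
    finally have "g x $ 1 - g 0 $ 1 = - V1 h x" .
    moreover have "g x $ 2 - g 0 $ 2 = V2 h x"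
      unfolding V2_eq by (rule ac_deriv_FTC[OF g2[OF x]]) (use x in auto)
    ultimately show ?thesis using g0 by (simp add: V_def vec_eq_iff forall_2 algebra_simps)
  qed
  have "V (g 0 $ 1) h \<in> L2_space H" by (rule L2_cong[OF g eq])
  moreover have "L2.nrm (f - V (g 0 $ 1) h) = L2.nrm (f - g)" by (rule L2_nrm_cong) (simp add: eq)
  ultimately show "f \<in> L2_space H \<and> h \<in> L2_space H \<and> (\<exists>a. V a h \<in> L2_space H \<and> L2.nrm (f - V a h) = 0)"
    using f h fg by (auto simp: L2_eq_iff)
next
  assume "f \<in> L2_space H \<and> h \<in> L2_space H \<and> (\<exists>a. V a h \<in> L2_space H \<and> L2.nrm (f - V a h) = 0)"
  then obtain a where f: "f \<in> L2_space H" and h: "h \<in> L2_space H" and g: "V a h \<in> L2_space H"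
    and fg: "L2.nrm (f - V a h) = 0" by blast
  note ac1 = V_nth_ac_deriv(1)[OF h, of _ a] and ac2 = V_nth_ac_deriv(2)[OF h, of _ a]
  have "locally_abs_continuous (V a h)"
    unfolding locally_abs_continuous_def
  proof (intro allI impI)
    fix b :: real assume b: "b > 0"
    show "abs_continuous_on {0..b} (V a h)"
    proof (rule abs_continuous_on_dominated[of _ "\<lambda>x. V a h x $ 1" "\<lambda>x. V a h x $ 2" 1])
      fix x y
      have "V a h y - V a h x = vector [V a h y $ 1 - V a h x $ 1, V a h y $ 2 - V a h x $ 2]"
        by (simp add: vec_eq_iff forall_2)
      thus "norm (V a h y - V a h x) \<le> 1 * norm (V a h y $ 1 - V a h x $ 1) + 1 * norm (V a h y $ 2 - V a h x $ 2)"
        using norm_vector_2_le[of "V a h y $ 1 - V a h x $ 1" "V a h y $ 2 - V a h x $ 2"] by (simp only: mult_1_left)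
    qed (use ac1[of b] ac2[of b] b in \<open>auto simp: ac_deriv_def\<close>)
  qed
  moreover have "AE x in half_line. \<exists>g'. (V a h has_vector_derivative g') (at x) \<and> J *v g' = - (cmatrix (H x) *v h x)"
  proof -
    have "AE x in lebesgue. 0 < x \<and> x < real n \<longrightarrow> ((\<lambda>x. V a h x $ 1) has_vector_derivative - (wc x * h x $ 2)) (at x)
       \<and> ((\<lambda>x. V a h x $ 2) has_vector_derivative ws x * h x $ 1) (at x)" for n
      using ac1[of "real n"] ac2[of "real n"] unfolding ac_deriv_def by (auto elim!: eventually_elim2)
    hence "AE x in lebesgue. \<forall>n. 0 < x \<and> x < real n \<longrightarrow> ((\<lambda>x. V a h x $ 1) has_vector_derivative - (wc x * h x $ 2)) (at x)
       \<and> ((\<lambda>x. V a h x $ 2) has_vector_derivative ws x * h x $ 1) (at x)"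
      by (subst AE_all_countable) blast
    thus ?thesis unfolding AE_half_line
    proof eventually_elim
      case (elim x)
      show ?case
      proof
        assume x: "0 < x"
        obtain n :: nat where "x < real n" using reals_Archimedean2 by blast
        hence d: "((\<lambda>x. V a h x $ 1) has_vector_derivative - (wc x * h x $ 2)) (at x)"
          "((\<lambda>x. V a h x $ 2) has_vector_derivative ws x * h x $ 1) (at x)" using elim x by auto
        have "V a h = (\<lambda>x. vector [V a h x $ 1, V a h x $ 2])" by (auto simp: V_def)
        hence "(V a h has_vector_derivative vector [- (wc x * h x $ 2), ws x * h x $ 1]) (at x)"
          using vector_has_vector_derivative[OF d] by simp
        thus "\<exists>g'. (V a h has_vector_derivative g') (at x) \<and> J *v g' = - (cmatrix (H x) *v h x)"
          using operator_equation_iff by blast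
      qed
    qed
  qed
  moreover have "V a h 0 $ 2 = 0" by (simp add: V_def)
  ultimately show "(f, h) \<in> canonical_relation H"
    unfolding canonical_relation_def using f h g fg by (auto simp: L2_eq_iff)
qed

end

section \<open>Closedness and symmetry of the canonical relation\<close>

lemma tendsto_by_bound:
  fixes z :: "nat \<Rightarrow> 'a::real_normed_vector"
  assumes "\<And>n. norm (z n - w) \<le> K * b n" "b \<longlonglongrightarrow> 0"
  shows "z \<longlonglongrightarrow> w"
proof (rule LIM_zero_cancel, rule Lim_null_comparison)
  show "(\<lambda>n. K * b n) \<longlonglongrightarrow> 0" by (rule tendsto_mult_right_zero[OF assms(2)])
qed (use assms(1) in simp)

context diagonal_system
begin

lemma e1_nrm_le: "S \<in> sets lebesgue \<Longrightarrow> (L2.nrm (e1 S))\<^sup>2 \<le> (LINT x|half_line. ws x)"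
  unfolding L2_nrm_sq
  by (rule integral_mono[OF L2_dens ws_integrable]) (auto simp: dens_def e1_def split: split_indicator)

lemma e2_nrm_le: "0 \<le> a \<Longrightarrow> a \<le> b \<Longrightarrow> (L2.nrm (e2 {a<..b}))\<^sup>2 \<le> b - a"
proof -
  assume ab: "0 \<le> a" "a \<le> b"
  have eq: "(LINT x|half_line. indicat_real {a<..b} x) = b - a"
  proof -
    have "(LINT x|half_line. indicat_real {a<..b} x) = measure half_line {a<..b}" 
    proof -
      have "{a<..b} \<inter> {0<..} = {a<..b}" using ab by auto
      thus ?thesis by simp
    qed
    also have "\<dots> = b - a" unfolding half_line_def
      by (subst measure_restrict_space) (use ab in \<open>auto\<close>)
    finally show ?thesis .
  qed
  have "integrable half_line (indicat_real {a<..b})"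
    by (rule Bochner_Integration.integrable_bound[OF indicator_Ioc_integrable[of b]])
       (use ab in \<open>auto intro!: AE_I2 indicator_half_line_measurable split: split_indicator\<close>)
  hence "(L2.nrm (e2 {a<..b}))\<^sup>2 \<le> (LINT x|half_line. indicat_real {a<..b} x)"
    unfolding L2_nrm_sq
    by (intro integral_mono L2_dens) (auto simp: dens_def e2_def split: split_indicator)
  thus ?thesis using eq by simp
qed

lemma V1_bound: "h \<in> L2_space H \<Longrightarrow> 0 \<le> x \<Longrightarrow> cmod (V1 h x) \<le> sqrt x * L2.nrm h"
proof -
  assume h: "h \<in> L2_space H" and x: "0 \<le> x"
  have "L2.nrm (e2 {0<..x}) \<le> sqrt x"
    using e2_nrm_le[of 0 x] x by (intro real_le_rsqrt) auto
  hence "L2.nrm (e2 {0<..x}) * L2.nrm h \<le> sqrt x * L2.nrm h" using h by (intro mult_right_mono) auto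
  thus ?thesis using L2.cauchy_schwarz[of "e2 {0<..x}" h] h by (simp add: V1_def)
qed

lemma V2_bound: "h \<in> L2_space H \<Longrightarrow> cmod (V2 h x) \<le> sqrt (LINT x|half_line. ws x) * L2.nrm h"
proof -
  assume h: "h \<in> L2_space H"
  have "L2.nrm (e1 {0<..x}) \<le> sqrt (LINT x|half_line. ws x)"
    using e1_nrm_le[of "{0<..x}"] by (intro real_le_rsqrt) auto
  hence "L2.nrm (e1 {0<..x}) * L2.nrm h \<le> sqrt (LINT x|half_line. ws x) * L2.nrm h" using h by (intro mult_right_mono) auto
  thus ?thesis using L2.cauchy_schwarz[of "e1 {0<..x}" h] h by (simp add: V2_def)
qed

lemma V_add: "h \<in> L2_space H \<Longrightarrow> k \<in> L2_space H \<Longrightarrow> V (a + b) (h + k) = V a h + V b k"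
  by (rule ext) (simp add: V_def V1_lin V2_lin vec_eq_iff forall_2)

lemma V_scale: "h \<in> L2_space H \<Longrightarrow> V (b * a) (fscale b h) = fscale b (V a h)"
  by (rule ext) (simp add: V_def V1_lin V2_lin vec_eq_iff forall_2 algebra_simps)

lemma canonical_relation_zero: "(0, 0) \<in> canonical_relation H"
proof -
  have "V 0 0 = (0 :: real \<Rightarrow> complex^2)"
    by (rule ext) (simp add: V_def V1_def V2_def vec_eq_iff forall_2)
  thus ?thesis unfolding canonical_relation_iff by (intro conjI exI[of _ 0]) auto
qed

lemma canonical_relation_add:
  assumes "(f, h) \<in> canonical_relation H" "(f', h') \<in> canonical_relation H"
  shows "(f + f', h + h') \<in> canonical_relation H"
proof -
  obtain a where a: "f \<in> L2_space H" "h \<in> L2_space H" "V a h \<in> L2_space H" "L2.nrm (f - V a h) = 0"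
    using assms(1) unfolding canonical_relation_iff by blast
  obtain b where b: "f' \<in> L2_space H" "h' \<in> L2_space H" "V b h' \<in> L2_space H" "L2.nrm (f' - V b h') = 0"
    using assms(2) unfolding canonical_relation_iff by blast
  have eq: "f + f' - V (a + b) (h + h') = (f - V a h) + (f' - V b h')"
    using a b by (simp add: V_add)
  have "L2.nrm (f + f' - V (a + b) (h + h')) \<le> 0"
    unfolding eq using L2.nrm_triangle[of "f - V a h" "f' - V b h'"] a b by simp
  moreover have "V (a + b) (h + h') \<in> L2_space H" using a b by (simp add: V_add)
  ultimately show ?thesis using a b L2.nrm_nonneg[of "f + f' - V (a + b) (h + h')"]
    unfolding canonical_relation_iff by (intro conjI exI[of _ "a + b"]) (auto intro: antisym)
qed

lemma canonical_relation_scale: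
  assumes "(f, h) \<in> canonical_relation H"
  shows "(fscale b f, fscale b h) \<in> canonical_relation H"
proof -
  obtain a where a: "f \<in> L2_space H" "h \<in> L2_space H" "V a h \<in> L2_space H" "L2.nrm (f - V a h) = 0"
    using assms(1) unfolding canonical_relation_iff by blast
  have eq: "fscale b f - V (b * a) (fscale b h) = fscale b (f - V a h)"
    using a by (auto simp: V_scale fun_diff_def vector_ssub_ldistrib)
  have "L2.nrm (fscale b f - V (b * a) (fscale b h)) = cmod b * L2.nrm (f - V a h)"
    unfolding eq by (rule L2.nrm_scl[OF L2.diff_mem]) (use a in auto)
  hence "L2.nrm (fscale b f - V (b * a) (fscale b h)) = 0" using a by simp
  moreover have "V (b * a) (fscale b h) \<in> L2_space H" using a by (simp add: V_scale)
  ultimately show ?thesis using a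
    unfolding canonical_relation_iff by (intro conjI exI[of _ "b * a"]) auto
qed

lemma dens_diff_zero_iff: "dens (f - g) x = 0 \<longleftrightarrow> (ws x = 0 \<or> f x $ 1 = g x $ 1) \<and> (wc x = 0 \<or> f x $ 2 = g x $ 2)"
proof -
  have "dens (f - g) x = 0 \<longleftrightarrow> ws x * (cmod (f x $ 1 - g x $ 1))\<^sup>2 = 0 \<and> wc x * (cmod (f x $ 2 - g x $ 2))\<^sup>2 = 0"
    unfolding dens_def by (subst add_nonneg_eq_0_iff) auto
  thus ?thesis by auto
qed

text \<open>Norm convergence gives convergence almost everywhere of a subsequence of the representatives
\<open>V (a n) (G n)\<close>, and Cauchy-Schwarz gives pointwise convergence of the primitives. Evaluation at one good
point with nonzero weight \<open>ws\<close> shows that the constants \<open>a n\<close> converge.\<close>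

lemma canonical_relation_closed:
  assumes FG: "\<And>n::nat. (F n, G n) \<in> canonical_relation H" and f: "f \<in> L2_space H" and h: "h \<in> L2_space H"
    and limF: "(\<lambda>n. L2.nrm (F n - f)) \<longlonglongrightarrow> 0" and limG: "(\<lambda>n. L2.nrm (G n - h)) \<longlonglongrightarrow> 0"
  shows "(f, h) \<in> canonical_relation H"
proof -
  have "\<exists>a. V a (G n) \<in> L2_space H \<and> L2.nrm (F n - V a (G n)) = 0" for n
    using FG[of n] unfolding canonical_relation_iff by blast
  then obtain a where a: "\<And>n. V (a n) (G n) \<in> L2_space H" "\<And>n. L2.nrm (F n - V (a n) (G n)) = 0" by metis
  have FL: "F n \<in> L2_space H" and GL: "G n \<in> L2_space H" for n
    using FG[of n] unfolding canonical_relation_iff by auto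
  define Y where "Y n = V (a n) (G n)" for n
  have YL: "Y n \<in> L2_space H" for n using a by (simp add: Y_def)
  have Yf: "L2.nrm (Y n - f) = L2.nrm (F n - f)" for n
  proof (rule L2.nrm_eq_if_null)
    have "Y n - f - (F n - f) = - (F n - Y n)" by simp
    thus "L2.nrm (Y n - f - (F n - f)) = 0" using a(2)[of n] FL YL by (simp only: L2.nrm_uminus L2.diff_mem Y_def)
  qed (use FL YL f in auto)
  have "(\<lambda>n. LINT x|half_line. norm (dens (Y n - f) x)) \<longlonglongrightarrow> 0"
  proof -
    have "(\<lambda>n. (L2.nrm (Y n - f))\<^sup>2) \<longlonglongrightarrow> 0\<^sup>2" unfolding Yf by (intro tendsto_power limF)
    thus ?thesis by (simp add: L2_nrm_sq)
  qed
  from tendsto_L1_AE_subseq[OF _ this] obtain r :: "nat \<Rightarrow> nat" where r: "strict_mono r"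
    and ae: "AE x in half_line. (\<lambda>n. dens (Y (r n) - f) x) \<longlonglongrightarrow> 0"
    using L2_dens[OF L2.diff_mem[OF YL f]] by blast
  have limG': "(\<lambda>n. L2.nrm (G (r n) - h)) \<longlonglongrightarrow> 0"
    using LIMSEQ_subseq_LIMSEQ[OF limG r] by (simp add: o_def)
  have V1lim: "(\<lambda>n. V1 (G (r n)) x) \<longlonglongrightarrow> V1 h x" if "x > 0" for x
    by (rule tendsto_by_bound[OF _ limG', of _ _ "sqrt x"])
       (use V1_bound[OF L2.diff_mem[OF GL h], of x] that in \<open>simp add: V1_lin GL h\<close>)
  have V2lim: "(\<lambda>n. V2 (G (r n)) x) \<longlonglongrightarrow> V2 h x" for x
    by (rule tendsto_by_bound[OF _ limG', of _ _ "sqrt (LINT x|half_line. ws x)"])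
       (use V2_bound[OF L2.diff_mem[OF GL h], of _ x] in \<open>simp add: V2_lin GL h\<close>)
  have ptw: "((ws x \<noteq> 0 \<longrightarrow> (\<lambda>n. Y (r n) x $ 1) \<longlonglongrightarrow> f x $ 1) \<and> (wc x \<noteq> 0 \<longrightarrow> (\<lambda>n. Y (r n) x $ 2) \<longlonglongrightarrow> f x $ 2))"
    if lim: "(\<lambda>n. dens (Y (r n) - f) x) \<longlonglongrightarrow> 0" for x
  proof -
    have *: "(\<lambda>n. z n) \<longlonglongrightarrow> w" if w0: "u > 0" and le: "\<And>n. u * (cmod (z n - w))\<^sup>2 \<le> dens (Y (r n) - f) x" for u :: real and z :: "nat \<Rightarrow> complex" and w
    proof -
      have "(\<lambda>n. dens (Y (r n) - f) x / u) \<longlonglongrightarrow> 0 / u" by (intro tendsto_intros lim) (use w0 in simp)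
      hence l1: "(\<lambda>n. dens (Y (r n) - f) x / u) \<longlonglongrightarrow> 0" by simp
      have "(\<lambda>n. (cmod (z n - w))\<^sup>2) \<longlonglongrightarrow> 0"
        by (rule tendsto_sandwich[OF _ _ tendsto_const l1]) (use le w0 in \<open>auto simp: field_simps\<close>)
      hence "(\<lambda>n. sqrt ((cmod (z n - w))\<^sup>2)) \<longlonglongrightarrow> sqrt 0" by (rule tendsto_real_sqrt)
      hence "(\<lambda>n. cmod (z n - w)) \<longlonglongrightarrow> 0" by simp
      thus ?thesis by (simp add: tendsto_norm_zero_iff LIM_zero_iff)
    qed
    show ?thesis
      by (intro conjI impI *[of "ws x"] *[of "wc x"]) (auto simp: dens_def less_le)
  qed
  obtain b where b: "AE x in half_line. dens (f - V b h) x = 0"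
  \<comment> \<open>If \<open>ws\<close> vanishes almost everywhere, the first component carries no weight, and any constant will do.\<close>
  proof (cases "AE x in half_line. ws x = 0")
    case True
    have "AE x in half_line. dens (f - V 0 h) x = 0"
      using ae True
    proof eventually_elim
      case (elim x)
      have "f x $ 2 = V2 h x" if "wc x \<noteq> 0"
        using LIMSEQ_unique[OF _ V2lim[of x]] ptw[OF elim(1)] that by (auto simp: Y_def V_def)
      thus ?case using elim(2) by (simp add: dens_diff_zero_iff V_def) blast
    qed
    thus ?thesis by (rule that)
  next
    case False
    have "\<not> (AE x in half_line. \<not> (ws x \<noteq> 0 \<and> (\<lambda>n. dens (Y (r n) - f) x) \<longlonglongrightarrow> 0))"
    proof
      assume "AE x in half_line. \<not> (ws x \<noteq> 0 \<and> (\<lambda>n. dens (Y (r n) - f) x) \<longlonglongrightarrow> 0)"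
      hence "AE x in half_line. ws x = 0" using ae by eventually_elim auto
      thus False using False by simp
    qed
    then obtain x0 where x0: "x0 > 0" "ws x0 \<noteq> 0" "(\<lambda>n. dens (Y (r n) - f) x0) \<longlonglongrightarrow> 0"
      using AE_I2[of half_line "\<lambda>x. \<not> (ws x \<noteq> 0 \<and> (\<lambda>n. dens (Y (r n) - f) x) \<longlonglongrightarrow> 0)"] by auto
    have "(\<lambda>n. Y (r n) x0 $ 1 + V1 (G (r n)) x0) \<longlonglongrightarrow> f x0 $ 1 + V1 h x0"
      using ptw[OF x0(3)] x0(2) by (intro tendsto_add V1lim x0(1)) auto
    hence alim: "(\<lambda>n. a (r n)) \<longlonglongrightarrow> f x0 $ 1 + V1 h x0" by (simp add: Y_def V_def)
    have "AE x in half_line. x > 0" by (rule AE_I2) simp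
    hence "AE x in half_line. dens (f - V (f x0 $ 1 + V1 h x0) h) x = 0"
      using ae
    proof eventually_elim
      case (elim x)
      have "f x $ 2 = V2 h x" if "wc x \<noteq> 0"
        using LIMSEQ_unique[OF _ V2lim[of x]] ptw[OF elim(2)] that by (auto simp: Y_def V_def)
      moreover have "f x $ 1 = f x0 $ 1 + V1 h x0 - V1 h x" if "ws x \<noteq> 0"
        using LIMSEQ_unique[OF _ tendsto_diff[OF alim V1lim[OF elim(1)]]] ptw[OF elim(2)] that by (auto simp: Y_def V_def)
      ultimately show ?case by (simp add: dens_diff_zero_iff V_def) blast
    qed
    thus ?thesis by (rule that)
  qed
  have Vm: "V b h \<in> borel_measurable half_line" by (rule V_measurable[OF h])
  have "integrable half_line (dens (V b h))"
  proof (rule Bochner_Integration.integrable_cong_AE_imp[OF L2_dens[OF f]])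
    show "AE x in half_line. dens f x = dens (V b h) x"
      using b
    proof eventually_elim
      case (elim x)
      thus ?case unfolding dens_diff_zero_iff by (auto simp: dens_def)
    qed
  qed (use Vm in \<open>auto intro: dens_measurable\<close>)
  hence VL: "V b h \<in> L2_space H" using Vm by (simp add: L2_iff)
  hence "L2.nrm (f - V b h) = 0" using b f by (subst L2_nrm_0_iff) auto
  thus ?thesis unfolding canonical_relation_iff using f h VL by blast
qed

lemma ac_deriv_cnj: "ac_deriv a b F p \<Longrightarrow> ac_deriv a b (\<lambda>x. cnj (F x)) (\<lambda>x. cnj (p x))"
  by (rule ac_deriv_bounded_linear[OF _ bounded_linear_cnj])

text \<open>Lagrange's identity; the boundary term at \<open>0\<close> vanishes since both second components do.\<close>

lemma wronskian_identity:
  assumes h: "h \<in> L2_space H" and l: "l \<in> L2_space H" and x: "0 \<le> x"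
  shows "(LINT y:{0<..x}|lebesgue. pairing (H y) (h y) (V b l y) - pairing (H y) (V a h y) (l y))
       = cnj (V a h x $ 2) * V b l x $ 1 - cnj (V a h x $ 1) * V b l x $ 2"
proof -
  let ?g = "V a h" and ?k = "V b l"
  have "ac_deriv 0 x (\<lambda>y. cnj (?g y $ 2) * ?k y $ 1 - cnj (?g y $ 1) * ?k y $ 2)
     (\<lambda>y. (cnj (?g y $ 2) * - (wc y * l y $ 2) + cnj (ws y * h y $ 1) * ?k y $ 1)
        - (cnj (?g y $ 1) * (ws y * l y $ 1) + cnj (- (wc y * h y $ 2)) * ?k y $ 2))"
    by (intro ac_deriv_diff ac_deriv_mult ac_deriv_cnj V_nth_ac_deriv h l x)
  from ac_deriv_FTC[OF this order_refl x order_refl]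
  have "(LINT y:{0<..x}|lebesgue. (cnj (?g y $ 2) * - (wc y * l y $ 2) + cnj (ws y * h y $ 1) * ?k y $ 1)
        - (cnj (?g y $ 1) * (ws y * l y $ 1) + cnj (- (wc y * h y $ 2)) * ?k y $ 2))
     = cnj (?g x $ 2) * ?k x $ 1 - cnj (?g x $ 1) * ?k x $ 2"
    by (simp add: V_def)
  moreover have "(cnj (?g y $ 2) * - (wc y * l y $ 2) + cnj (ws y * h y $ 1) * ?k y $ 1)
        - (cnj (?g y $ 1) * (ws y * l y $ 1) + cnj (- (wc y * h y $ 2)) * ?k y $ 2)
     = pairing (H y) (h y) (?k y) - pairing (H y) (?g y) (l y)" for y
    by (simp add: pairing_diag algebra_simps)
  ultimately show ?thesis by simp
qed

text \<open>Since \<open>wc = 1 - ws\<close> and \<open>ws\<close> is integrable, bounded second components that are square integrable with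
respect to \<open>wc\<close> are square integrable outright, whereas \<open>1 / (1 + x)\<close> is not integrable.\<close>

lemma slow_decay_not_square_integrable:
  assumes f: "f \<in> L2_space H" and k: "k \<in> L2_space H"
    and bnd: "\<And>x. x > 0 \<Longrightarrow> (cmod (f x $ 2))\<^sup>2 + (cmod (k x $ 2))\<^sup>2 \<le> B"
    and low: "\<And>x. x \<ge> X0 \<Longrightarrow> \<delta> / (1 + x) \<le> (cmod (f x $ 2))\<^sup>2 + (cmod (k x $ 2))\<^sup>2"
    and X0: "X0 > 0" and \<delta>: "\<delta> > 0"
  shows False
proof -
  let ?u = "\<lambda>x. (cmod (f x $ 2))\<^sup>2 + (cmod (k x $ 2))\<^sup>2"
  let ?w = "\<lambda>x. B * ws x + dens f x + dens k x"
  have wint: "integrable half_line ?w" using L2_dens[OF f] L2_dens[OF k] ws_integrable by auto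
  have uw: "?u x \<le> ?w x" if "x > 0" for x
  proof -
    have "?u x = (ws x + wc x) * ?u x" by (simp add: ws_wc)
    also have "\<dots> = ws x * ?u x + wc x * ?u x" by (rule distrib_right)
    also have "ws x * ?u x \<le> ws x * B" using bnd[OF that] by (intro mult_left_mono) auto
    also have "wc x * ?u x \<le> dens f x + dens k x" by (simp add: dens_def algebra_simps)
    finally show ?thesis by (simp add: algebra_simps)
  qed
  have w0: "0 \<le> ?w x" if "x > 0" for x using uw[OF that] by (rule order_trans[rotated]) simp
  define C where "C = (LINT x|half_line. ?w x)"
  have le: "\<delta> * (ln (1 + Y) - ln (1 + X0)) \<le> C" if Y: "Y \<ge> X0" for Y
  proof -
    have ac: "ac_deriv X0 Y (\<lambda>x. \<delta> * ln (1 + x)) (\<lambda>x. \<delta> / (1 + x))"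
      by (rule ac_deriv_smooth[OF Y]) (use X0 in \<open>auto intro!: derivative_eq_intros continuous_intros\<close>)
    hence si: "set_integrable lebesgue {X0<..Y} (\<lambda>x. \<delta> / (1 + x))" by (simp add: ac_deriv_def)
    have "\<delta> * ln (1 + Y) - \<delta> * ln (1 + X0) = (LINT x:{X0<..Y}|lebesgue. \<delta> / (1 + x))"
      by (rule ac_deriv_FTC[OF ac]) (use Y in auto)
    also have "\<dots> = (LINT x:{X0<..Y}|half_line. \<delta> / (1 + x))"
      using X0 by (subst set_integrable_half_line) auto
    also have "\<dots> \<le> C"
      unfolding C_def set_lebesgue_integral_def
    proof (rule integral_mono[OF _ wint])
      show "integrable half_line (\<lambda>x. indicat_real {X0<..Y} x *\<^sub>R (\<delta> / (1 + x)))"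
        using si X0 unfolding set_integrable_def[symmetric] by (subst set_integrable_half_line) auto
      fix x assume "x \<in> space half_line"
      hence x: "x > 0" by simp
      show "indicat_real {X0<..Y} x *\<^sub>R (\<delta> / (1 + x)) \<le> ?w x"
        using low[of x] uw[OF x] w0[OF x] by (auto split: split_indicator)
    qed
    finally show ?thesis by (simp add: algebra_simps)
  qed
  have "filterlim (\<lambda>Y. \<delta> * (ln (1 + Y) - ln (1 + X0))) at_top at_top"
    using \<delta> by real_asymp
  hence "eventually (\<lambda>Y. \<delta> * (ln (1 + Y) - ln (1 + X0)) > C) at_top" by (auto simp: filterlim_at_top_dense)
  then obtain N where "\<And>Y. Y \<ge> N \<Longrightarrow> \<delta> * (ln (1 + Y) - ln (1 + X0)) > C"
    unfolding eventually_at_top_linorder by blast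
  from this[of "max N X0"] le[of "max N X0"] show False by simp
qed

text \<open>The half-line is in the limit point case, so no boundary condition at infinity arises. By Lagrange's identity
the Wronskian \<open>W x\<close> tends to the difference \<open>\<Lambda>\<close> of both sides. The first components are
\<open>O(sqrt (1 + x))\<close> by Cauchy-Schwarz. Were \<open>\<Lambda>\<close> nonzero, the second components could not both decay faster
than \<open>1 / sqrt (1 + x)\<close>, which square integrability forbids.\<close>

lemma V_symmetric:
  assumes h: "h \<in> L2_space H" and l: "l \<in> L2_space H"
    and g: "V a h \<in> L2_space H" and k: "V b l \<in> L2_space H"
  shows "L2_inner H h (V b l) = L2_inner H (V a h) l"
proof (rule ccontr)
  assume neq: "L2_inner H h (V b l) \<noteq> L2_inner H (V a h) l"
  define p where "p y = pairing (H y) (h y) (V b l y) - pairing (H y) (V a h y) (l y)" for y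
  define W where "W x = cnj (V a h x $ 2) * V b l x $ 1 - cnj (V a h x $ 1) * V b l x $ 2" for x
  define \<Lambda> where "\<Lambda> = L2_inner H h (V b l) - L2_inner H (V a h) l"
  have \<Lambda>0: "\<Lambda> \<noteq> 0" using neq by (simp add: \<Lambda>_def)
  have pint: "integrable half_line p" unfolding p_def[abs_def]
    by (intro Bochner_Integration.integrable_diff pairing_integrable h l g k)
  have \<Lambda>int: "(LINT y|half_line. p y) = \<Lambda>"
    unfolding p_def[abs_def] \<Lambda>_def L2_inner_def
    by (intro Bochner_Integration.integral_diff pairing_integrable h l g k)
  have Wlim: "(W \<longlongrightarrow> \<Lambda>) at_top"
  proof -
    have si: "set_integrable lebesgue {0..} (\<lambda>y. indicator {0<..} y *\<^sub>R p y)"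
      and eq: "(LINT y:{0..}|lebesgue. indicator {0<..} y *\<^sub>R p y) = \<Lambda>"
    proof -
      have e: "(\<lambda>y. indicat_real {0..} y *\<^sub>R indicat_real {0<..} y *\<^sub>R p y) = (\<lambda>y. indicat_real {0<..} y *\<^sub>R p y)"
        by (rule ext) (auto simp: indicator_def)
      show "set_integrable lebesgue {0..} (\<lambda>y. indicator {0<..} y *\<^sub>R p y)"
        using pint unfolding set_integrable_def half_line_def e by (subst (asm) integrable_restrict_space) auto
      show "(LINT y:{0..}|lebesgue. indicator {0<..} y *\<^sub>R p y) = \<Lambda>"
        using \<Lambda>int unfolding set_lebesgue_integral_def half_line_def e by (subst (asm) integral_restrict_space) auto
    qed
    have "((\<lambda>x. LINT y:{0..x}|lebesgue. indicator {0<..} y *\<^sub>R p y) \<longlongrightarrow> \<Lambda>) at_top"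
      unfolding eq[symmetric] by (rule tendsto_set_lebesgue_integral_at_top[OF _ si]) auto
    moreover have "\<forall>\<^sub>F x in at_top. (LINT y:{0..x}|lebesgue. indicator {0<..} y *\<^sub>R p y) = W x"
    proof (rule eventually_at_top_linorderI[of 0])
      fix x :: real assume x: "0 \<le> x"
      have e: "(\<lambda>y. indicat_real {0..x} y *\<^sub>R indicat_real {0<..} y *\<^sub>R p y) = (\<lambda>y. indicat_real {0<..x} y *\<^sub>R p y)"
        by (rule ext) (auto simp: indicator_def)
      have "(LINT y:{0..x}|lebesgue. indicator {0<..} y *\<^sub>R p y) = (LINT y:{0<..x}|lebesgue. p y)"
        unfolding set_lebesgue_integral_def e ..
      also have "\<dots> = W x" unfolding p_def W_def by (rule wronskian_identity[OF h l x])
      finally show "(LINT y:{0..x}|lebesgue. indicator {0<..} y *\<^sub>R p y) = W x" .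
    qed
    ultimately show ?thesis by (rule Lim_transform_eventually)
  qed
  define m where "m = cmod \<Lambda> / 2"
  have m: "m > 0" using \<Lambda>0 by (simp add: m_def)
  have "((\<lambda>x. cmod (W x)) \<longlongrightarrow> cmod \<Lambda>) at_top" by (intro tendsto_norm Wlim)
  hence "eventually (\<lambda>x. cmod (W x) > m) at_top" using m by (intro order_tendstoD(1)) (auto simp: m_def)
  then obtain X where X: "\<And>x. x \<ge> X \<Longrightarrow> cmod (W x) > m" by (auto simp: eventually_at_top_linorder)
  define X0 where "X0 = max X 1"
  define K where "K = max 1 (max (cmod a + L2.nrm h) (cmod b + L2.nrm l))"
  have K1: "K \<ge> 1" by (simp add: K_def)
  define K2 where "K2 = sqrt (LINT x|half_line. ws x)"
  have growth: "cmod (V a h x $ 1) \<le> K * sqrt (1 + x)" "cmod (V b l x $ 1) \<le> K * sqrt (1 + x)" if x: "x > 0" for x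
  proof -
    have *: "cmod (c - V1 j x) \<le> (cmod c + L2.nrm j) * sqrt (1 + x)" if j: "j \<in> L2_space H" for c j
    proof -
      have "cmod (c - V1 j x) \<le> cmod c + sqrt x * L2.nrm j"
        using norm_triangle_ineq4[of c "V1 j x"] V1_bound[OF j, of x] x by simp
      also have "\<dots> \<le> cmod c * sqrt (1 + x) + sqrt (1 + x) * L2.nrm j"
        using x j mult_left_mono[of 1 "sqrt (1 + x)" "cmod c"] by (intro add_mono mult_right_mono) auto
      finally show ?thesis by (simp add: algebra_simps)
    qed
    have "(cmod a + L2.nrm h) * sqrt (1 + x) \<le> K * sqrt (1 + x)" "(cmod b + L2.nrm l) * sqrt (1 + x) \<le> K * sqrt (1 + x)"
      by (intro mult_right_mono; use x in \<open>simp add: K_def\<close>)+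
    thus "cmod (V a h x $ 1) \<le> K * sqrt (1 + x)" "cmod (V b l x $ 1) \<le> K * sqrt (1 + x)"
      using *[OF h, of a] *[OF l, of b] by (auto simp: V_def)
  qed
  let ?u = "\<lambda>x. cmod (V a h x $ 2)" and ?v = "\<lambda>x. cmod (V b l x $ 2)"
  show False
  proof (rule slow_decay_not_square_integrable[OF g k])
    show "(?u x)\<^sup>2 + (?v x)\<^sup>2 \<le> (K2 * L2.nrm h)\<^sup>2 + (K2 * L2.nrm l)\<^sup>2" for x
      unfolding K2_def V_def using V2_bound[OF h, of x] V2_bound[OF l, of x] by (intro add_mono power_mono) auto
    show "X0 > 0" by (simp add: X0_def)
    show "m\<^sup>2 / (2 * K\<^sup>2) > 0" using m K1 by simp
    show "m\<^sup>2 / (2 * K\<^sup>2) / (1 + x) \<le> (?u x)\<^sup>2 + (?v x)\<^sup>2" if x: "x \<ge> X0" for x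
    proof -
      have x0: "x > 0" "x \<ge> X" using x by (auto simp: X0_def)
      have "m \<le> cmod (W x)" using X[OF x0(2)] by simp
      also have "\<dots> \<le> ?u x * cmod (V b l x $ 1) + cmod (V a h x $ 1) * ?v x"
        unfolding W_def using norm_triangle_ineq4 by (metis complex_mod_cnj norm_mult)
      also have "\<dots> \<le> ?u x * (K * sqrt (1 + x)) + (K * sqrt (1 + x)) * ?v x"
        by (intro add_mono mult_left_mono mult_right_mono growth x0) auto
      also have "\<dots> = K * sqrt (1 + x) * (?u x + ?v x)" by (simp add: algebra_simps)
      finally have "m\<^sup>2 \<le> (K * sqrt (1 + x) * (?u x + ?v x))\<^sup>2" using m by (intro power_mono) auto
      also have "\<dots> = K\<^sup>2 * (1 + x) * (?u x + ?v x)\<^sup>2" using x0 by (simp add: power_mult_distrib)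
      also have "\<dots> \<le> K\<^sup>2 * (1 + x) * (2 * ((?u x)\<^sup>2 + (?v x)\<^sup>2))"
        using sum_squares_bound[of "?u x" "?v x"] x0 by (intro mult_left_mono) (auto simp: power2_sum)
      finally have "m\<^sup>2 / (K\<^sup>2 * (1 + x)) \<le> 2 * ((?u x)\<^sup>2 + (?v x)\<^sup>2)"
        using K1 x0 by (subst pos_divide_le_eq) (auto simp: mult.commute intro: mult_pos_pos)
      hence "m\<^sup>2 / (K\<^sup>2 * (1 + x)) / 2 \<le> 2 * ((?u x)\<^sup>2 + (?v x)\<^sup>2) / 2"
        by (rule divide_right_mono) simp
      moreover have "m\<^sup>2 / (2 * K\<^sup>2) / (1 + x) = m\<^sup>2 / (K\<^sup>2 * (1 + x)) / 2" by simp
      moreover have "2 * ((?u x)\<^sup>2 + (?v x)\<^sup>2) / 2 = (?u x)\<^sup>2 + (?v x)\<^sup>2" by simp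
      ultimately show ?thesis by (simp only:)
    qed
  qed
qed

lemma canonical_relation_symmetric:
  assumes "(f, h) \<in> canonical_relation H" "(f', h') \<in> canonical_relation H"
  shows "L2_inner H h f' = L2_inner H f h'"
proof -
  obtain a where a: "f \<in> L2_space H" "h \<in> L2_space H" "V a h \<in> L2_space H" "L2.nrm (f - V a h) = 0"
    using assms(1) unfolding canonical_relation_iff by blast
  obtain b where b: "f' \<in> L2_space H" "h' \<in> L2_space H" "V b h' \<in> L2_space H" "L2.nrm (f' - V b h') = 0"
    using assms(2) unfolding canonical_relation_iff by blast
  have "L2_inner H h (f' - V b h') = 0" using a b by (intro L2.ip_null_right) auto
  hence 1: "L2_inner H h f' = L2_inner H h (V b h')" using a b by (simp add: L2.ip_diff_right)
  have "L2_inner H h' (f - V a h) = 0" using a b by (intro L2.ip_null_right) auto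
  hence "L2_inner H h' f = L2_inner H h' (V a h)" using a b by (simp add: L2.ip_diff_right)
  hence 2: "L2_inner H f h' = L2_inner H (V a h) h'"
    using L2.ip_cnj[of f h'] L2.ip_cnj[of "V a h" h'] a b by simp
  show ?thesis using V_symmetric[OF a(2) b(2) a(3) b(3)] 1 2 by simp
qed

sublocale CR: symmetric_relation fscale "L2_space H" "L2_inner H" "canonical_relation H"
proof (intro symmetric_relation.intro semi_hilbert_L2 symmetric_relation_axioms.intro)
  show "f \<in> L2_space H \<and> h \<in> L2_space H" if "(f, h) \<in> canonical_relation H" for f h
    using that unfolding canonical_relation_iff by blast
qed (rule canonical_relation_zero canonical_relation_add canonical_relation_scale
    canonical_relation_symmetric canonical_relation_closed; assumption)+

end

section \<open>Weighted Hardy inequalities\<close>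

lemma Ioc_half_line:
  fixes f :: "real \<Rightarrow> 'a::{banach, second_countable_topology}"
  assumes "0 \<le> a"
  shows "set_integrable half_line {a<..b} f \<longleftrightarrow> set_integrable lebesgue {a<..b} f"
    and "(LINT x:{a<..b}|half_line. f x) = (LINT x:{a<..b}|lebesgue. f x)"
  by (rule set_integrable_half_line; use assms in auto)+

lemma set_integral_Ioi_le:
  fixes f :: "real \<Rightarrow> real"
  assumes a: "0 \<le> a" and fm: "f \<in> borel_measurable half_line" and f0: "\<And>x. 0 \<le> f x"
    and le: "\<And>X. X \<ge> a \<Longrightarrow> set_integrable half_line {a<..X} f \<and> (LINT x:{a<..X}|half_line. f x) \<le> C"
  shows "set_integrable half_line {a<..} f" "(LINT x:{a<..}|half_line. f x) \<le> C"
proof -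
  have C0: "C \<ge> 0" using le[of a] by (simp add: set_lebesgue_integral_def)
  define F where "F n x = ennreal (indicat_real {a<..a + real n} x * f x)" for n x
  have nn: "(\<integral>\<^sup>+x. ennreal (indicat_real {a<..} x * f x) \<partial>half_line) \<le> ennreal C"
  proof -
    have "ennreal (indicat_real {a<..} x * f x) = (SUP n. F n x)" for x
    proof (cases "x > a")
      case True
      obtain n :: nat where "x - a \<le> real n" using real_arch_simple by blast
      hence "F n x = ennreal (f x)" using True by (auto simp: F_def indicator_def)
      moreover have "F m x \<le> ennreal (f x)" for m using f0[of x] by (auto simp: F_def indicator_def)
      ultimately have "(SUP n. F n x) = ennreal (f x)" by (intro antisym SUP_least SUP_upper2[of n]) auto
      thus ?thesis using True by simp
    qed (auto simp: F_def indicator_def)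
    hence "(\<integral>\<^sup>+x. ennreal (indicat_real {a<..} x * f x) \<partial>half_line) = (\<integral>\<^sup>+x. (SUP n. F n x) \<partial>half_line)" by simp
    also have "\<dots> = (SUP n. \<integral>\<^sup>+x. F n x \<partial>half_line)"
    proof (rule nn_integral_monotone_convergence_SUP)
      show "incseq F" unfolding F_def incseq_def le_fun_def
        by (auto intro!: ennreal_leI mult_right_mono f0 simp: indicator_def)
      show "F n \<in> borel_measurable half_line" for n unfolding F_def
        by (intro measurable_compose[OF _ measurable_ennreal] borel_measurable_times
            indicator_half_line_measurable fm) auto
    qed
    also have "\<dots> \<le> ennreal C"
    proof (rule SUP_least)
      fix n :: nat
      have l: "set_integrable half_line {a<..a + real n} f" "(LINT x:{a<..a + real n}|half_line. f x) \<le> C"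
        using le[of "a + real n"] by auto
      have "(\<integral>\<^sup>+x. F n x \<partial>half_line) = ennreal (LINT x:{a<..a + real n}|half_line. f x)"
        unfolding F_def set_lebesgue_integral_def real_scaleR_def
        by (rule nn_integral_eq_integral) (use l f0 in \<open>auto simp: set_integrable_def\<close>)
      thus "(\<integral>\<^sup>+x. F n x \<partial>half_line) \<le> ennreal C" using l by (simp add: ennreal_leI)
    qed
    finally show ?thesis .
  qed
  have mm: "(\<lambda>x. indicat_real {a<..} x * f x) \<in> borel_measurable half_line"
    by (intro borel_measurable_times indicator_half_line_measurable fm) auto
  have nn': "(\<integral>\<^sup>+x. ennreal (norm (indicat_real {a<..} x * f x)) \<partial>half_line) < \<infinity>"
    using nn f0 by (simp add: order.strict_trans1)
  show si: "set_integrable half_line {a<..} f"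
    unfolding set_integrable_def real_scaleR_def by (rule integrableI_bounded[OF mm nn'])
  have "ennreal (LINT x:{a<..}|half_line. f x) = (\<integral>\<^sup>+x. ennreal (indicat_real {a<..} x * f x) \<partial>half_line)"
    unfolding set_lebesgue_integral_def real_scaleR_def
    by (rule nn_integral_eq_integral[symmetric]) (use si f0 in \<open>auto simp: set_integrable_def\<close>)
  hence "ennreal (LINT x:{a<..}|half_line. f x) \<le> ennreal C" using nn by simp
  thus "(LINT x:{a<..}|half_line. f x) \<le> C" using C0 by (simp add: ennreal_le_iff)
qed

context diagonal_system
begin

text \<open>The tail of the weight; \<open>x * Sig x\<close> is the quantity that governs the Hardy inequality with weights
\<open>ws\<close> and \<open>wc\<close>, as \<open>wc\<close> is close to \<open>1\<close>.\<close>

definition Sig :: "real \<Rightarrow> real" where "Sig x = (LINT t:{x<..}|half_line. ws t)"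

lemma ws_set_integrable: "S \<in> sets lebesgue \<Longrightarrow> set_integrable half_line S ws"
proof -
  assume S: "S \<in> sets lebesgue"
  have "integrable half_line (\<lambda>x. indicat_real S x *\<^sub>R ws x)"
    by (rule Bochner_Integration.integrable_bound[OF ws_integrable])
       (use S in \<open>auto split: split_indicator intro!: borel_measurable_times indicator_half_line_measurable ws_measurable\<close>)
  thus ?thesis by (simp add: set_integrable_def)
qed

lemma Sig_nonneg: "0 \<le> Sig x"
  unfolding Sig_def set_lebesgue_integral_def by (intro Bochner_Integration.integral_nonneg) auto

lemma Sig_diff:
  assumes "0 \<le> x" "x \<le> y"
  shows "Sig x - Sig y = (LINT t:{x<..y}|half_line. ws t)"
proof -
  have eq: "{x<..} = {x<..y} \<union> {y<..}" using assms by auto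
  have "(LINT t:{x<..y} \<union> {y<..}|half_line. ws t) = (LINT t:{x<..y}|half_line. ws t) + (LINT t:{y<..}|half_line. ws t)"
    by (rule set_integral_Un[OF _ ws_set_integrable ws_set_integrable]) auto
  hence "Sig x = (LINT t:{x<..y}|half_line. ws t) + Sig y"
    unfolding Sig_def eq .
  thus ?thesis by simp
qed

lemma Sig_mono: "0 \<le> x \<Longrightarrow> x \<le> y \<Longrightarrow> Sig y \<le> Sig x"
proof -
  assume *: "0 \<le> x" "x \<le> y"
  have "0 \<le> (LINT t:{x<..y}|half_line. ws t)" unfolding set_lebesgue_integral_def
    by (intro Bochner_Integration.integral_nonneg) auto
  thus ?thesis using Sig_diff[OF *] by simp
qed

lemma Sig_ac_deriv: "0 \<le> a \<Longrightarrow> a \<le> b \<Longrightarrow> ac_deriv a b Sig (\<lambda>x. - ws x)"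
proof -
  assume ab: "0 \<le> a" "a \<le> b"
  have si: "set_integrable lebesgue {0<..b} ws"
    using ws_set_integrable[of "{0<..b}"] Ioc_half_line(1)[where a = 0 and b = b and f = ws] by simp
  have "ac_deriv 0 b (\<lambda>x. Sig 0 - (0 + (LINT y:{0<..x}|lebesgue. ws y))) (\<lambda>x. - ws x)"
    by (intro ac_deriv_const_minus ac_deriv_integral si) (use ab in auto)
  moreover have "Sig 0 - (0 + (LINT y:{0<..x}|lebesgue. ws y)) = Sig x" if "0 \<le> x" for x
    using Sig_diff[of 0 x] Ioc_half_line(2)[where a = 0 and b = x and f = ws] that by simp
  ultimately have "ac_deriv 0 b Sig (\<lambda>x. - ws x)" by (rule ac_deriv_cong)
  thus ?thesis by (rule ac_deriv_subset) (use ab in auto)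
qed

text \<open>With \<open>S' = - s\<close>, \<open>b = B / x\<close> (so that \<open>b' = - b\<^sup>2 / B\<close>) and \<open>u' = c g\<close>, the left-hand side is the derivative
of \<open>(S + b) u\<^sup>2\<close>. Completing the square, \<open>2 (S + b) u c g \<le> 4 B c g\<^sup>2 + c (S + b)\<^sup>2 u\<^sup>2 / (4 B)\<close>, and
\<open>S + b \<le> 2 b\<close> makes the last term at most \<open>b\<^sup>2 u\<^sup>2 / B\<close>. So \<open>S + b\<close> is a supersolution of the Riccati
equation attached to the Hardy inequality with constant \<open>4 B\<close>.\<close>

lemma hardy_pointwise:
  fixes s c S b B u g :: real
  assumes "0 \<le> c" "c \<le> 1" "0 \<le> S" "S \<le> b" "B > 0"
  shows "(S + b) * (u * (c * g) + (c * g) * u) + (- s - b\<^sup>2 / B) * (u * u) \<le> 4 * B * (c * g\<^sup>2) - s * u\<^sup>2"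
proof -
  have "0 \<le> (4 * B * g - (S + b) * u)\<^sup>2" by simp
  hence "8 * B * ((S + b) * u * g) \<le> 16 * B\<^sup>2 * g\<^sup>2 + (S + b)\<^sup>2 * u\<^sup>2"
    by (simp add: power2_eq_square algebra_simps)
  hence "c * (8 * B * ((S + b) * u * g)) \<le> c * (16 * B\<^sup>2 * g\<^sup>2 + (S + b)\<^sup>2 * u\<^sup>2)"
    using assms by (intro mult_left_mono) auto
  also have "\<dots> = 16 * B\<^sup>2 * (c * g\<^sup>2) + c * ((S + b)\<^sup>2 * u\<^sup>2)" by (simp add: algebra_simps)
  also have "c * ((S + b)\<^sup>2 * u\<^sup>2) \<le> 1 * ((2 * b)\<^sup>2 * u\<^sup>2)"
    using assms by (intro mult_mono mult_right_mono power_mono) auto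
  finally have "4 * B * (2 * ((S + b) * u * (c * g))) \<le> 4 * B * (4 * B * (c * g\<^sup>2) + b\<^sup>2 / B * u\<^sup>2)"
    using assms(5) by (simp add: power2_eq_square algebra_simps)
  hence "2 * ((S + b) * u * (c * g)) \<le> 4 * B * (c * g\<^sup>2) + b\<^sup>2 / B * u\<^sup>2" using assms(5) by simp
  thus ?thesis by (simp add: power2_eq_square algebra_simps)
qed

text \<open>Integrate \<open>hardy_pointwise\<close>: the function \<open>(Sig x + B / x) (u x)\<^sup>2\<close> starts at zero and ends nonnegative.\<close>

lemma hardy_real:
  fixes u g :: "real \<Rightarrow> real"
  assumes N: "0 < N" "N \<le> X" and B: "B > 0" and Sb: "\<And>x. N \<le> x \<Longrightarrow> x \<le> X \<Longrightarrow> x * Sig x \<le> B"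
    and u: "ac_deriv N X u (\<lambda>x. wc x * g x)" "u N = 0"
    and gi: "set_integrable lebesgue {N<..X} (\<lambda>x. wc x * (g x)\<^sup>2)"
  shows "set_integrable lebesgue {N<..X} (\<lambda>x. ws x * (u x)\<^sup>2)"
    and "(LINT x:{N<..X}|lebesgue. ws x * (u x)\<^sup>2) \<le> 4 * B * (LINT x:{N<..X}|lebesgue. wc x * (g x)\<^sup>2)"
proof -
  have v: "ac_deriv N X (\<lambda>x. - (B / x)) (\<lambda>x. B / x\<^sup>2)"
    by (rule ac_deriv_smooth[OF N(2)])
       (use N in \<open>auto intro!: derivative_eq_intros continuous_intros simp: power2_eq_square\<close>)
  have Sg: "ac_deriv N X Sig (\<lambda>x. - ws x)" by (rule Sig_ac_deriv) (use N in auto)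
  have "continuous_on {N..X} u" using u(1) by (simp add: ac_deriv_def abs_continuous_on_imp_continuous)
  hence cu: "continuous_on {N..X} (\<lambda>x. (u x)\<^sup>2)" by (rule continuous_on_power)
  have wsi: "set_integrable lebesgue {N<..X} ws"
    using ws_set_integrable[of "{N<..X}"] N Ioc_half_line(1)[where a = N and b = X and f = ws] by simp
  show si: "set_integrable lebesgue {N<..X} (\<lambda>x. ws x * (u x)\<^sup>2)"
    by (rule set_integrable_continuous_mult(2)[OF cu wsi])
  define w where "w x = Sig x - (- (B / x))" for x
  define d where "d x = w x * (u x * (wc x * g x) + (wc x * g x) * u x) + (- ws x - B / x\<^sup>2) * (u x * u x)" for x
  have ac: "ac_deriv N X (\<lambda>x. w x * (u x * u x)) d"
    unfolding w_def d_def by (intro ac_deriv_mult ac_deriv_diff v Sg u)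
  have "w X * (u X * u X) - w N * (u N * u N) = (LINT x:{N<..X}|lebesgue. d x)"
    by (rule ac_deriv_FTC[OF ac]) (use N in auto)
  moreover have "w X \<ge> 0" using Sig_nonneg[of X] B N by (simp add: w_def)
  ultimately have "0 \<le> (LINT x:{N<..X}|lebesgue. d x)" using u(2) by (metis diff_zero mult_nonneg_nonneg mult_zero_right zero_le_square)
  also have "\<dots> \<le> (LINT x:{N<..X}|lebesgue. 4 * B * (wc x * (g x)\<^sup>2) - ws x * (u x)\<^sup>2)"
  proof (rule set_integral_mono)
    show "set_integrable lebesgue {N<..X} d" using ac by (simp add: ac_deriv_def)
    show "set_integrable lebesgue {N<..X} (\<lambda>x. 4 * B * (wc x * (g x)\<^sup>2) - ws x * (u x)\<^sup>2)"
      by (intro set_integral_diff set_integrable_mult_right gi si)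
    fix x assume x: "x \<in> {N<..X}"
    have "Sig x \<le> B / x" using Sb[of x] x N by (simp add: field_simps)
    from hardy_pointwise[where s = "ws x" and c = "wc x" and S = "Sig x" and b = "B / x" and u = "u x" and g = "g x",
        OF wc_nonneg wc_le_1 Sig_nonneg this B]
    show "d x \<le> 4 * B * (wc x * (g x)\<^sup>2) - ws x * (u x)\<^sup>2"
      using B x N by (simp add: d_def w_def power_divide power2_eq_square)
  qed
  also have "\<dots> = 4 * B * (LINT x:{N<..X}|lebesgue. wc x * (g x)\<^sup>2) - (LINT x:{N<..X}|lebesgue. ws x * (u x)\<^sup>2)"
    by (subst set_integral_diff(2)) (auto intro: gi si set_integrable_mult_right)
  finally show "(LINT x:{N<..X}|lebesgue. ws x * (u x)\<^sup>2) \<le> 4 * B * (LINT x:{N<..X}|lebesgue. wc x * (g x)\<^sup>2)" by simp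
qed

lemma hardy_complex:
  fixes U g :: "real \<Rightarrow> complex"
  assumes N: "0 < N" "N \<le> X" and B: "B > 0" and Sb: "\<And>x. N \<le> x \<Longrightarrow> x \<le> X \<Longrightarrow> x * Sig x \<le> B"
    and U: "ac_deriv N X U (\<lambda>x. wc x * g x)" "U N = 0"
    and gm: "g \<in> borel_measurable half_line" and gi: "set_integrable half_line {N<..X} (\<lambda>x. wc x * (cmod (g x))\<^sup>2)"
  shows "set_integrable half_line {N<..X} (\<lambda>x. ws x * (cmod (U x))\<^sup>2)"
    and "(LINT x:{N<..X}|half_line. ws x * (cmod (U x))\<^sup>2) \<le> 4 * B * (LINT x:{N<..X}|half_line. wc x * (cmod (g x))\<^sup>2)"
proof -
  have part: "set_integrable lebesgue {N<..X} (\<lambda>x. wc x * (T (g x))\<^sup>2)"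
    if T: "bounded_linear T" "\<And>z. \<bar>T z\<bar> \<le> cmod z" for T :: "complex \<Rightarrow> real"
  proof -
    have Tm: "(\<lambda>x. T (g x)) \<in> borel_measurable half_line"
      by (rule measurable_compose[OF gm]) (auto intro!: borel_measurable_continuous_onI linear_continuous_on T)
    have im: "indicat_real {N<..X} \<in> borel_measurable half_line" by (rule indicator_half_line_measurable) auto
    have "set_integrable half_line {N<..X} (\<lambda>x. wc x * (T (g x))\<^sup>2)"
      unfolding set_integrable_def
    proof (rule Bochner_Integration.integrable_bound[OF gi[unfolded set_integrable_def]])
      show "(\<lambda>x. indicat_real {N<..X} x *\<^sub>R (wc x * (T (g x))\<^sup>2)) \<in> borel_measurable half_line"
        unfolding real_scaleR_def
        by (intro borel_measurable_times borel_measurable_power im Tm wc_measurable)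
      show "AE x in half_line. norm (indicat_real {N<..X} x *\<^sub>R (wc x * (T (g x))\<^sup>2))
          \<le> norm (indicat_real {N<..X} x *\<^sub>R (wc x * (cmod (g x))\<^sup>2))"
        using power_mono[OF T(2) abs_ge_zero, of _ 2] by (auto intro!: AE_I2 mult_left_mono split: split_indicator)
    qed
    thus ?thesis using N by (subst (asm) Ioc_half_line) auto
  qed
  have Re: "ac_deriv N X (\<lambda>x. Re (U x)) (\<lambda>x. wc x * Re (g x))" and Im: "ac_deriv N X (\<lambda>x. Im (U x)) (\<lambda>x. wc x * Im (g x))"
    using ac_deriv_bounded_linear[OF U(1) bounded_linear_Re] ac_deriv_bounded_linear[OF U(1) bounded_linear_Im] by simp_all
  note pRe = part[OF bounded_linear_Re abs_Re_le_cmod] and pIm = part[OF bounded_linear_Im abs_Im_le_cmod]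
  note hRe = hardy_real[OF N B Sb Re _ pRe] and hIm = hardy_real[OF N B Sb Im _ pIm]
  have U0: "Re (U N) = 0" "Im (U N) = 0" using U(2) by auto
  have sq: "w * (cmod z)\<^sup>2 = w * (Re z)\<^sup>2 + w * (Im z)\<^sup>2" for w z by (simp add: cmod_power2 distrib_left)
  have "set_integrable lebesgue {N<..X} (\<lambda>x. ws x * (cmod (U x))\<^sup>2)"
    unfolding sq using hRe(1) hIm(1) U0 by (intro set_integral_add) auto
  thus "set_integrable half_line {N<..X} (\<lambda>x. ws x * (cmod (U x))\<^sup>2)"
    using N by (subst Ioc_half_line) auto
  have "(LINT x:{N<..X}|lebesgue. ws x * (cmod (U x))\<^sup>2)
      = (LINT x:{N<..X}|lebesgue. ws x * (Re (U x))\<^sup>2) + (LINT x:{N<..X}|lebesgue. ws x * (Im (U x))\<^sup>2)"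
    unfolding sq using hRe(1) hIm(1) U0 by (intro set_integral_add) auto
  also have "\<dots> \<le> 4 * B * (LINT x:{N<..X}|lebesgue. wc x * (Re (g x))\<^sup>2) + 4 * B * (LINT x:{N<..X}|lebesgue. wc x * (Im (g x))\<^sup>2)"
    using hRe(2) hIm(2) U0 by (intro add_mono) auto
  also have "\<dots> = 4 * B * (LINT x:{N<..X}|lebesgue. wc x * (cmod (g x))\<^sup>2)"
    unfolding sq by (subst set_integral_add(2)[OF pRe pIm]) (simp add: distrib_left)
  finally show "(LINT x:{N<..X}|half_line. ws x * (cmod (U x))\<^sup>2) \<le> 4 * B * (LINT x:{N<..X}|half_line. wc x * (cmod (g x))\<^sup>2)"
    using N by (subst (1 2) Ioc_half_line(2)) auto
qed

text \<open>Cut-offs of one component to a set.\<close>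

definition c1 :: "real set \<Rightarrow> (real \<Rightarrow> complex^2) \<Rightarrow> real \<Rightarrow> complex^2" where
  "c1 I f x = vector [indicator I x * f x $ 1, 0]"
definition c2 :: "real set \<Rightarrow> (real \<Rightarrow> complex^2) \<Rightarrow> real \<Rightarrow> complex^2" where
  "c2 I f x = vector [0, indicator I x * f x $ 2]"

lemma c_measurable:
  "I \<in> sets lebesgue \<Longrightarrow> f \<in> borel_measurable half_line \<Longrightarrow> c1 I f \<in> borel_measurable half_line"
  "I \<in> sets lebesgue \<Longrightarrow> f \<in> borel_measurable half_line \<Longrightarrow> c2 I f \<in> borel_measurable half_line"
  unfolding c1_def[abs_def] c2_def[abs_def]
  by (intro vector_measurable borel_measurable_times indicator_half_line_measurable vec_nth_measurable; simp)+

lemma dens_c: "dens (c1 I f) x = indicat_real I x * (ws x * (cmod (f x $ 1))\<^sup>2)"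
  "dens (c2 I f) x = indicat_real I x * (wc x * (cmod (f x $ 2))\<^sup>2)"
  by (auto simp: dens_def c1_def c2_def split: split_indicator)

lemma dens_c_le: "dens (c1 I f) x \<le> dens f x" "dens (c2 I f) x \<le> dens f x"
  unfolding dens_c by (auto simp: dens_def split: split_indicator)

lemma c_mem [simp]:
  assumes "I \<in> sets lebesgue" "f \<in> L2_space H"
  shows "c1 I f \<in> L2_space H" "c2 I f \<in> L2_space H"
  by (rule L2I[OF c_measurable(1)[OF assms(1) L2_measurable[OF assms(2)]] L2_dens[OF assms(2)] dens_c_le(1)],
      rule L2I[OF c_measurable(2)[OF assms(1) L2_measurable[OF assms(2)]] L2_dens[OF assms(2)] dens_c_le(2)])

lemma c_nrm_sq: "(L2.nrm (c1 I f))\<^sup>2 = (LINT x:I|half_line. ws x * (cmod (f x $ 1))\<^sup>2)"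
  "(L2.nrm (c2 I f))\<^sup>2 = (LINT x:I|half_line. wc x * (cmod (f x $ 2))\<^sup>2)"
  unfolding L2_nrm_sq dens_c set_lebesgue_integral_def by simp_all

lemma c_mem_iff:
  "I \<in> sets lebesgue \<Longrightarrow> f \<in> borel_measurable half_line \<Longrightarrow> set_integrable half_line I (\<lambda>x. ws x * (cmod (f x $ 1))\<^sup>2) \<Longrightarrow> c1 I f \<in> L2_space H"
  "I \<in> sets lebesgue \<Longrightarrow> f \<in> borel_measurable half_line \<Longrightarrow> set_integrable half_line I (\<lambda>x. wc x * (cmod (f x $ 2))\<^sup>2) \<Longrightarrow> c2 I f \<in> L2_space H"
  unfolding L2_iff by (simp_all add: c_measurable dens_c[abs_def] set_integrable_def)

lemma ip_e_c:
  assumes "S \<subseteq> I"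
  shows "L2_inner H (e1 S) (c1 I f) = L2_inner H (e1 S) f" "L2_inner H (e2 S) (c2 I f) = L2_inner H (e2 S) f"
  unfolding ip_e1 ip_e2 c1_def c2_def set_lebesgue_integral_def
  by (rule Bochner_Integration.integral_cong; use assms in \<open>auto split: split_indicator\<close>)+

lemma nrm_c_mono:
  assumes I: "I \<in> sets lebesgue" "I' \<in> sets lebesgue" "I \<subseteq> I'" and f: "f \<in> L2_space H"
  shows "L2.nrm (c1 I f) \<le> L2.nrm (c1 I' f)" "L2.nrm (c2 I f) \<le> L2.nrm (c2 I' f)"
proof -
  have "(L2.nrm (c1 I f))\<^sup>2 \<le> (L2.nrm (c1 I' f))\<^sup>2" unfolding L2_nrm_sq
    by (rule integral_mono[OF L2_dens L2_dens]) (use I f in \<open>auto simp: dens_c split: split_indicator\<close>)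
  thus "L2.nrm (c1 I f) \<le> L2.nrm (c1 I' f)" using I f by (simp add: power2_le_iff_abs_le)
  have "(L2.nrm (c2 I f))\<^sup>2 \<le> (L2.nrm (c2 I' f))\<^sup>2" unfolding L2_nrm_sq
    by (rule integral_mono[OF L2_dens L2_dens]) (use I f in \<open>auto simp: dens_c split: split_indicator\<close>)
  thus "L2.nrm (c2 I f) \<le> L2.nrm (c2 I' f)" using I f by (simp add: power2_le_iff_abs_le)
qed

lemma nrm_c_Un:
  assumes I: "I \<in> sets lebesgue" "I' \<in> sets lebesgue" "I \<inter> I' = {}" and f: "f \<in> L2_space H"
  shows "(L2.nrm (c1 (I \<union> I') f))\<^sup>2 = (L2.nrm (c1 I f))\<^sup>2 + (L2.nrm (c1 I' f))\<^sup>2"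
    and "(L2.nrm (c2 (I \<union> I') f))\<^sup>2 = (L2.nrm (c2 I f))\<^sup>2 + (L2.nrm (c2 I' f))\<^sup>2"
proof -
  have 1: "dens (c1 (I \<union> I') f) x = dens (c1 I f) x + dens (c1 I' f) x"
    and 2: "dens (c2 (I \<union> I') f) x = dens (c2 I f) x + dens (c2 I' f) x" for x
    unfolding dens_c using I(3) by (auto split: split_indicator)
  show "(L2.nrm (c1 (I \<union> I') f))\<^sup>2 = (L2.nrm (c1 I f))\<^sup>2 + (L2.nrm (c1 I' f))\<^sup>2"
    unfolding L2_nrm_sq 1 by (rule Bochner_Integration.integral_add) (use I f in \<open>auto intro!: L2_dens\<close>)
  show "(L2.nrm (c2 (I \<union> I') f))\<^sup>2 = (L2.nrm (c2 I f))\<^sup>2 + (L2.nrm (c2 I' f))\<^sup>2"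
    unfolding L2_nrm_sq 2 by (rule Bochner_Integration.integral_add) (use I f in \<open>auto intro!: L2_dens\<close>)
qed

lemma nrm_c_total:
  assumes f: "f \<in> L2_space H"
  shows "(L2.nrm f)\<^sup>2 = (L2.nrm (c1 {0<..} f))\<^sup>2 + (L2.nrm (c2 {0<..} f))\<^sup>2"
proof -
  have "(L2.nrm f)\<^sup>2 = (LINT x|half_line. dens (c1 {0<..} f) x + dens (c2 {0<..} f) x)"
    unfolding L2_nrm_sq by (rule Bochner_Integration.integral_cong) (auto simp: dens_c, auto simp: dens_def)
  also have "\<dots> = (L2.nrm (c1 {0<..} f))\<^sup>2 + (L2.nrm (c2 {0<..} f))\<^sup>2"
    unfolding L2_nrm_sq by (rule Bochner_Integration.integral_add) (use f in \<open>auto intro!: L2_dens\<close>)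
  finally show ?thesis .
qed

lemma e1_Ioi_nrm: "(L2.nrm (e1 {X<..}))\<^sup>2 = Sig X"
  unfolding L2_nrm_sq Sig_def set_lebesgue_integral_def
  by (rule Bochner_Integration.integral_cong) (auto simp: dens_def e1_def indicator_def)

lemma tail_bound_1:
  assumes N: "0 < N" and B: "B > 0" and Sb: "\<And>x. N \<le> x \<Longrightarrow> x * Sig x \<le> B" and h: "h \<in> L2_space H"
  shows "set_integrable half_line {N<..} (\<lambda>x. ws x * (cmod (V1 h x - V1 h N))\<^sup>2)"
    and "(LINT x:{N<..}|half_line. ws x * (cmod (V1 h x - V1 h N))\<^sup>2) \<le> 4 * B * (L2.nrm (c2 {N<..} h))\<^sup>2"
proof -
  have cont: "continuous_on {0<..} (V1 h)"
    using V1_ac_deriv[OF h] unfolding ac_deriv_def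
    by (auto intro!: continuous_on_from_compact abs_continuous_on_imp_continuous)
  have m: "(\<lambda>x. ws x * (cmod (V1 h x - V1 h N))\<^sup>2) \<in> borel_measurable half_line"
    by (intro borel_measurable_times borel_measurable_power borel_measurable_diff borel_measurable_const
        measurable_compose[OF _ borel_measurable_norm] continuous_on_half_line_measurable[OF cont] ws_measurable)
  have "set_integrable half_line {N<..X} (\<lambda>x. ws x * (cmod (V1 h x - V1 h N))\<^sup>2) \<and>
     (LINT x:{N<..X}|half_line. ws x * (cmod (V1 h x - V1 h N))\<^sup>2) \<le> 4 * B * (L2.nrm (c2 {N<..} h))\<^sup>2" if X: "X \<ge> N" for X
  proof -
    have "ac_deriv N X (V1 h) (\<lambda>x. wc x * h x $ 2)"
      by (rule ac_deriv_subset[OF V1_ac_deriv[OF h, of X]]) (use X N in auto)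
    moreover have "ac_deriv N X (\<lambda>_. V1 h N) (\<lambda>_. 0)"
      unfolding ac_deriv_def by (auto simp: abs_continuous_on_def set_integrable_def)
    ultimately have ac: "ac_deriv N X (\<lambda>x. V1 h x - V1 h N) (\<lambda>x. wc x * h x $ 2)"
      using ac_deriv_diff by fastforce
    have gi: "set_integrable half_line {N<..X} (\<lambda>x. wc x * (cmod (h x $ 2))\<^sup>2)"
      using L2_dens[OF c_mem(2)[of "{N<..X}" h]] h by (simp add: dens_c[abs_def] set_integrable_def)
    note hc = hardy_complex[OF N X B Sb ac _ vec_nth_measurable[OF L2_measurable[OF h]] gi]
    have "(LINT x:{N<..X}|half_line. wc x * (cmod (h x $ 2))\<^sup>2) \<le> (L2.nrm (c2 {N<..} h))\<^sup>2"
      unfolding c_nrm_sq(2)[symmetric] using h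
      by (intro power_mono nrm_c_mono L2.nrm_nonneg c_mem) auto
    hence "4 * B * (LINT x:{N<..X}|half_line. wc x * (cmod (h x $ 2))\<^sup>2) \<le> 4 * B * (L2.nrm (c2 {N<..} h))\<^sup>2"
      using B by (intro mult_left_mono) auto
    thus ?thesis using hc by force
  qed
  note * = set_integral_Ioi_le[OF _ m _ this]
  show "set_integrable half_line {N<..} (\<lambda>x. ws x * (cmod (V1 h x - V1 h N))\<^sup>2)"
    and "(LINT x:{N<..}|half_line. ws x * (cmod (V1 h x - V1 h N))\<^sup>2) \<le> 4 * B * (L2.nrm (c2 {N<..} h))\<^sup>2"
    using * N by auto
qed

text \<open>If the total integral vanishes, the primitive from \<open>0\<close> to \<open>X\<close> is minus the integral over the tail.\<close>

lemma V2_vanishing_total: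
  assumes h: "h \<in> L2_space H" and tot: "L2_inner H (e1 {0<..}) h = 0" and X: "0 \<le> X"
  shows "cmod (V2 h X) \<le> sqrt (Sig X) * L2.nrm (c1 {X<..} h)"
proof -
  have "e1 {0<..} = e1 {0<..X} + e1 {X<..}"
    by (rule ext) (use X in \<open>auto simp: e1_def vec_eq_iff forall_2 indicator_def\<close>)
  hence "0 = V2 h X + L2_inner H (e1 {X<..}) h"
    using tot h by (simp add: L2.ip_add_left V2_def)
  hence "V2 h X = - L2_inner H (e1 {X<..}) (c1 {X<..} h)"
    by (simp add: ip_e_c eq_neg_iff_add_eq_0)
  moreover have "L2.nrm (e1 {X<..}) = sqrt (Sig X)"
    using e1_Ioi_nrm[of X] L2.nrm_nonneg[OF e1_mem, of "{X<..}"] by (simp add: real_sqrt_unique)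
  ultimately show ?thesis
    using L2.cauchy_schwarz[of "e1 {X<..}" "c1 {X<..} h"] h by simp
qed

text \<open>The adjoint of the Hardy inequality, by duality. Let \<open>g\<close> be the second component of \<open>V 0 h\<close>, cut off to
\<open>(N, X]\<close>. Lagrange's identity rewrites the squared norm of \<open>g\<close> as a pairing of \<open>h\<^sub>1\<close> with \<open>V1 g\<close>,
to which the Hardy inequality applies with the factor \<open>2 sqrt B\<close>, plus a boundary term at \<open>X\<close>. There
\<open>V2 h X\<close> is at most \<open>sqrt (Sig X)\<close> times a tail norm of \<open>h\<close>, and \<open>V1 g X\<close> is at most \<open>sqrt X\<close> times the norm
of \<open>g\<close>, so \<open>X * Sig X \<le> B\<close> controls the product.\<close>

lemma dual_hardy_truncated:
  assumes N: "0 < N" "N \<le> X" and B: "B > 0" and Sb: "\<And>x. N \<le> x \<Longrightarrow> x * Sig x \<le> B"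
    and h: "h \<in> L2_space H" and tot: "L2_inner H (e1 {0<..}) h = 0"
  shows "set_integrable half_line {N<..X} (\<lambda>x. wc x * (cmod (V2 h x))\<^sup>2)"
    and "(LINT x:{N<..X}|half_line. wc x * (cmod (V2 h x))\<^sup>2)
       \<le> (sqrt B * L2.nrm (c1 {X<..} h) + 2 * sqrt B * L2.nrm (c1 {N<..} h))\<^sup>2"
proof -
  have V2n: "V 0 h x $ 2 = V2 h x" for x by (simp add: V_def)
  have V2m: "(\<lambda>x. V2 h x) \<in> borel_measurable half_line"
    using vec_nth_measurable[OF V_measurable[OF h, of 0], of 2] by (simp add: V2n)
  define K where "K = sqrt (LINT x|half_line. ws x) * L2.nrm h"
  show si: "set_integrable half_line {N<..X} (\<lambda>x. wc x * (cmod (V2 h x))\<^sup>2)"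
    unfolding set_integrable_def
  proof (rule Bochner_Integration.integrable_bound)
    show "integrable half_line (\<lambda>x. indicat_real {0<..X} x * K\<^sup>2)"
      by (intro integrable_mult_left indicator_Ioc_integrable)
    show "(\<lambda>x. indicat_real {N<..X} x *\<^sub>R (wc x * (cmod (V2 h x))\<^sup>2)) \<in> borel_measurable half_line"
      unfolding real_scaleR_def
      by (intro borel_measurable_times borel_measurable_power measurable_compose[OF V2m borel_measurable_norm]
          indicator_half_line_measurable wc_measurable) auto
    show "AE x in half_line. norm (indicat_real {N<..X} x *\<^sub>R (wc x * (cmod (V2 h x))\<^sup>2)) \<le> norm (indicat_real {0<..X} x * K\<^sup>2)"
    proof (rule AE_I2)
      fix x
      have "wc x * (cmod (V2 h x))\<^sup>2 \<le> 1 * K\<^sup>2"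
        unfolding K_def using V2_bound[OF h, of x] by (intro mult_mono power_mono) auto
      thus "norm (indicat_real {N<..X} x *\<^sub>R (wc x * (cmod (V2 h x))\<^sup>2)) \<le> norm (indicat_real {0<..X} x * K\<^sup>2)"
        using N by (auto split: split_indicator)
    qed
  qed
  define g where "g = c2 {N<..X} (V 0 h)"
  have gL [simp]: "g \<in> L2_space H"
    unfolding g_def by (rule c_mem_iff(2)) (use si V_measurable[OF h] in \<open>auto simp: V2n\<close>)
  have g1: "g x $ 1 = 0" and g2: "g x $ 2 = indicator {N<..X} x * V2 h x" for x
    by (auto simp: g_def c2_def V2n)
  define Q where "Q = (L2.nrm g)\<^sup>2"
  have Q: "Q = (LINT x:{N<..X}|half_line. wc x * (cmod (V2 h x))\<^sup>2)"
    unfolding Q_def g_def c_nrm_sq V2n ..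
  have V2g: "V2 g x = 0" for x unfolding V2_eq g1 by (simp add: set_lebesgue_integral_def)
  have V1g0: "V1 g x = 0" if "x \<le> N" for x
  proof -
    have "V1 g x = (LINT y:{0<..x}|lebesgue. 0)"
      unfolding V1_eq by (rule set_lebesgue_integral_cong) (use that in \<open>auto simp: g2\<close>)
    thus ?thesis by (simp add: set_lebesgue_integral_def)
  qed
  have ac: "ac_deriv N X (V1 g) (\<lambda>x. wc x * g x $ 2)"
    by (rule ac_deriv_subset[OF V1_ac_deriv[OF gL, of X]]) (use N in auto)
  have eqg: "indicat_real {N<..X} x *\<^sub>R (wc x * (cmod (g x $ 2))\<^sup>2) = indicat_real {N<..X} x *\<^sub>R (wc x * (cmod (V2 h x))\<^sup>2)" for x
    by (auto simp: g2 split: split_indicator)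
  have gi: "set_integrable half_line {N<..X} (\<lambda>x. wc x * (cmod (g x $ 2))\<^sup>2)"
    using si unfolding set_integrable_def eqg .
  note hc = hardy_complex[OF N B Sb ac V1g0[OF order_refl] vec_nth_measurable[OF L2_measurable[OF gL]] gi]
  define k where "k = c1 {N<..X} (V 0 g)"
  have V1n: "V 0 g x $ 1 = - V1 g x" for x by (simp add: V_def)
  have kL [simp]: "k \<in> L2_space H"
    unfolding k_def by (rule c_mem_iff(1)) (use hc(1) V_measurable[OF gL] in \<open>auto simp: V1n\<close>)
  have "(L2.nrm k)\<^sup>2 = (LINT x:{N<..X}|half_line. ws x * (cmod (V1 g x))\<^sup>2)"
    unfolding k_def c_nrm_sq V1n by simp
  also have "\<dots> \<le> 4 * B * (LINT x:{N<..X}|half_line. wc x * (cmod (g x $ 2))\<^sup>2)" by (rule hc(2))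
  also have "(LINT x:{N<..X}|half_line. wc x * (cmod (g x $ 2))\<^sup>2) = Q"
    unfolding Q set_lebesgue_integral_def eqg ..
  also have "4 * B * Q = (2 * sqrt B * L2.nrm g)\<^sup>2" using B by (simp add: Q_def power_mult_distrib)
  finally have nk: "L2.nrm k \<le> 2 * sqrt B * L2.nrm g" by (rule power2_le_imp_le) (use B in auto)
  have wr: "(LINT y:{0<..X}|lebesgue. pairing (H y) (h y) (V 0 g y) - pairing (H y) (V 0 h y) (g y))
       = - cnj (V2 h X) * V1 g X"
    using wronskian_identity[OF h gL, of X 0 0] N by (simp add: V_def V2g)
  have "(LINT y:{0<..X}|lebesgue. pairing (H y) (h y) (V 0 g y) - pairing (H y) (V 0 h y) (g y))
      = (LINT y:{0<..X}|half_line. pairing (H y) (h y) (V 0 g y) - pairing (H y) (V 0 h y) (g y))"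
    by (subst Ioc_half_line(2)) auto
  also have "\<dots> = (LINT y|half_line. pairing (H y) (c1 {N<..} h y) (k y) - of_real (dens g y))"
    unfolding set_lebesgue_integral_def
  proof (rule Bochner_Integration.integral_cong[OF refl])
    fix y assume "y \<in> space half_line"
    hence y: "y > 0" by simp
    have sq: "complex_of_real ((cmod (V2 h y))\<^sup>2) = cnj (V2 h y) * V2 h y"
      unfolding complex_norm_square by (rule mult.commute)
    let ?i = "indicator {N<..X} y :: complex"
    have p1: "pairing (H y) (h y) (V 0 g y) = ws y * (cnj (h y $ 1) * - V1 g y)"
      by (simp add: pairing_diag V_def V2g)
    have p2: "pairing (H y) (V 0 h y) (g y) = ?i * (wc y * (cnj (V2 h y) * V2 h y))"
      by (simp add: pairing_diag V2n g1 g2)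
    have p3: "pairing (H y) (c1 {N<..} h y) (k y) = ?i * (ws y * (cnj (h y $ 1) * - V1 g y))"
      by (auto simp: pairing_diag c1_def k_def V_def split: split_indicator)
    have "dens g y = indicat_real {N<..X} y * (wc y * (cmod (V2 h y))\<^sup>2)"
      by (auto simp: dens_def g1 g2 split: split_indicator)
    hence p4: "complex_of_real (dens g y) = ?i * (wc y * (cnj (V2 h y) * V2 h y))"
      by (simp only: sq[symmetric]) (simp split: split_indicator)
    show "indicat_real {0<..X} y *\<^sub>R (pairing (H y) (h y) (V 0 g y) - pairing (H y) (V 0 h y) (g y))
       = pairing (H y) (c1 {N<..} h y) (k y) - of_real (dens g y)"
      unfolding p1 p2 p3 p4
      using y N V1g0[of y] by (cases "y \<le> N"; cases "y \<le> X") simp_all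
  qed
  also have "\<dots> = L2_inner H (c1 {N<..} h) k - (LINT y|half_line. complex_of_real (dens g y))"
    unfolding L2_inner_def
    by (rule Bochner_Integration.integral_diff[OF pairing_integrable]) (use h L2_dens[OF gL] in auto)
  also have "(LINT y|half_line. complex_of_real (dens g y)) = of_real Q" by (simp add: Q_def L2_nrm_sq)
  finally have "of_real Q = cnj (V2 h X) * V1 g X + L2_inner H (c1 {N<..} h) k" using wr by (simp add: algebra_simps)
  hence "cmod (of_real Q) \<le> cmod (V2 h X) * cmod (V1 g X) + cmod (L2_inner H (c1 {N<..} h) k)"
    by (metis complex_mod_cnj norm_mult norm_triangle_ineq)
  hence "Q \<le> cmod (V2 h X) * cmod (V1 g X) + cmod (L2_inner H (c1 {N<..} h) k)"
    by (simp add: Q_def norm_power)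
  also have "cmod (V2 h X) * cmod (V1 g X) \<le> (sqrt (Sig X) * L2.nrm (c1 {X<..} h)) * (sqrt X * L2.nrm g)"
    using V2_vanishing_total[OF h tot, of X] V1_bound[OF gL, of X] N h Sig_nonneg[of X] by (intro mult_mono) auto
  also have "\<dots> = sqrt (X * Sig X) * (L2.nrm (c1 {X<..} h) * L2.nrm g)" by (simp add: real_sqrt_mult)
  also have "\<dots> \<le> sqrt B * (L2.nrm (c1 {X<..} h) * L2.nrm g)"
    using Sb[OF N(2)] h by (intro mult_right_mono) auto
  also have "cmod (L2_inner H (c1 {N<..} h) k) \<le> L2.nrm (c1 {N<..} h) * (2 * sqrt B * L2.nrm g)"
    using L2.cauchy_schwarz[of "c1 {N<..} h" k] h nk mult_left_mono[OF nk L2.nrm_nonneg, of "c1 {N<..} h"] by fastforce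
  finally have le: "L2.nrm g * L2.nrm g \<le> (sqrt B * L2.nrm (c1 {X<..} h) + 2 * sqrt B * L2.nrm (c1 {N<..} h)) * L2.nrm g"
    by (simp add: Q_def power2_eq_square algebra_simps)
  have "L2.nrm g \<le> sqrt B * L2.nrm (c1 {X<..} h) + 2 * sqrt B * L2.nrm (c1 {N<..} h)"
  proof (cases "L2.nrm g = 0")
    case True
    thus ?thesis using B h by simp
  next
    case False
    hence "L2.nrm g > 0" using L2.nrm_nonneg[OF gL] by linarith
    thus ?thesis using le by simp
  qed
  hence "(L2.nrm g)\<^sup>2 \<le> (sqrt B * L2.nrm (c1 {X<..} h) + 2 * sqrt B * L2.nrm (c1 {N<..} h))\<^sup>2"
    by (intro power_mono) auto
  thus "(LINT x:{N<..X}|half_line. wc x * (cmod (V2 h x))\<^sup>2)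
       \<le> (sqrt B * L2.nrm (c1 {X<..} h) + 2 * sqrt B * L2.nrm (c1 {N<..} h))\<^sup>2"
    using Q by (simp add: Q_def)
qed

lemma nrm_c1_tail_tendsto:
  assumes h: "h \<in> L2_space H"
  shows "((\<lambda>n. L2.nrm (c1 {real n<..} h)) \<longlongrightarrow> 0) sequentially"
proof -
  have "(\<lambda>n. LINT x|half_line. dens (c1 {real n<..} h) x) \<longlonglongrightarrow> (LINT x|half_line. 0)"
  proof (rule integral_dominated_convergence[where w = "dens h"])
    show "AE x in half_line. (\<lambda>n. dens (c1 {real n<..} h) x) \<longlonglongrightarrow> 0"
    proof (rule AE_I2)
      fix x
      obtain m :: nat where "x \<le> real m" using real_arch_simple by blast
      hence "\<forall>n\<ge>m. dens (c1 {real n<..} h) x = 0" by (auto simp: dens_c indicator_def)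
      thus "(\<lambda>n. dens (c1 {real n<..} h) x) \<longlonglongrightarrow> 0"
        by (intro tendsto_eventually) (auto simp: eventually_sequentially)
    qed
    show "AE x in half_line. norm (dens (c1 {real n<..} h) x) \<le> dens h x" for n
      using dens_c_le(1) by auto
    show "dens (c1 {real n<..} h) \<in> borel_measurable half_line" for n
      by (intro dens_measurable L2_measurable c_mem h) auto
  qed (use h in \<open>auto simp: L2_dens\<close>)
  hence "(\<lambda>n. (L2.nrm (c1 {real n<..} h))\<^sup>2) \<longlonglongrightarrow> 0" unfolding L2_nrm_sq by simp
  hence "(\<lambda>n. sqrt ((L2.nrm (c1 {real n<..} h))\<^sup>2)) \<longlonglongrightarrow> sqrt 0" by (rule tendsto_real_sqrt)
  thus ?thesis using h by simp
qed

text \<open>As the point of truncation tends to infinity, the boundary contribution disappears and only the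
constant \<open>4 * B\<close> of the Hardy inequality remains.\<close>

lemma tail_bound_2:
  assumes N: "0 < N" and B: "B > 0" and Sb: "\<And>x. N \<le> x \<Longrightarrow> x * Sig x \<le> B"
    and h: "h \<in> L2_space H" and tot: "L2_inner H (e1 {0<..}) h = 0"
  shows "set_integrable half_line {N<..} (\<lambda>x. wc x * (cmod (V2 h x))\<^sup>2)"
    and "(LINT x:{N<..}|half_line. wc x * (cmod (V2 h x))\<^sup>2) \<le> 4 * B * (L2.nrm (c1 {N<..} h))\<^sup>2"
proof -
  let ?T = "L2.nrm (c1 {N<..} h)"
  have "V 0 h x $ 2 = V2 h x" for x by (simp add: V_def)
  hence V2m: "(\<lambda>x. V2 h x) \<in> borel_measurable half_line"
    using vec_nth_measurable[OF V_measurable[OF h, of 0], of 2] by simp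
  have m: "(\<lambda>x. wc x * (cmod (V2 h x))\<^sup>2) \<in> borel_measurable half_line"
    by (intro borel_measurable_times borel_measurable_power measurable_compose[OF V2m borel_measurable_norm] wc_measurable)
  have "set_integrable half_line {N<..X} (\<lambda>x. wc x * (cmod (V2 h x))\<^sup>2) \<and>
      (LINT x:{N<..X}|half_line. wc x * (cmod (V2 h x))\<^sup>2) \<le> 4 * B * ?T\<^sup>2" if X: "X \<ge> N" for X
  proof
    show "set_integrable half_line {N<..X} (\<lambda>x. wc x * (cmod (V2 h x))\<^sup>2)"
      by (rule dual_hardy_truncated[OF N X B Sb h tot])
    have lim: "(\<lambda>n. (sqrt B * L2.nrm (c1 {real n<..} h) + 2 * sqrt B * ?T)\<^sup>2) \<longlonglongrightarrow> (sqrt B * 0 + 2 * sqrt B * ?T)\<^sup>2"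
      by (intro tendsto_intros nrm_c1_tail_tendsto h)
    obtain n0 :: nat where n0: "X \<le> real n0" using real_arch_simple by blast
    have "(LINT x:{N<..X}|half_line. wc x * (cmod (V2 h x))\<^sup>2) \<le> (sqrt B * 0 + 2 * sqrt B * ?T)\<^sup>2"
    proof (rule LIMSEQ_le_const[OF lim], intro exI[of _ n0] allI impI)
      fix n assume "n \<ge> n0"
      hence Xn: "X \<le> real n" "N \<le> real n" using n0 X by auto
      note dh = dual_hardy_truncated[OF N Xn(2) B Sb h tot]
      have "(LINT x:{N<..X}|half_line. wc x * (cmod (V2 h x))\<^sup>2) \<le> (LINT x:{N<..real n}|half_line. wc x * (cmod (V2 h x))\<^sup>2)"
        unfolding set_lebesgue_integral_def
      proof (rule integral_mono)
        show "integrable half_line (\<lambda>x. indicat_real {N<..X} x *\<^sub>R (wc x * (cmod (V2 h x))\<^sup>2))"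
          using dual_hardy_truncated(1)[OF N X B Sb h tot] by (simp add: set_integrable_def)
        show "integrable half_line (\<lambda>x. indicat_real {N<..real n} x *\<^sub>R (wc x * (cmod (V2 h x))\<^sup>2))"
          using dh(1) by (simp add: set_integrable_def)
      qed (use Xn in \<open>auto split: split_indicator\<close>)
      also have "\<dots> \<le> (sqrt B * L2.nrm (c1 {real n<..} h) + 2 * sqrt B * ?T)\<^sup>2" by (rule dh(2))
      finally show "(LINT x:{N<..X}|half_line. wc x * (cmod (V2 h x))\<^sup>2) \<le> (sqrt B * L2.nrm (c1 {real n<..} h) + 2 * sqrt B * ?T)\<^sup>2" .
    qed
    thus "(LINT x:{N<..X}|half_line. wc x * (cmod (V2 h x))\<^sup>2) \<le> 4 * B * ?T\<^sup>2"
      using B by (simp add: power_mult_distrib)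
  qed
  note * = set_integral_Ioi_le[OF _ m _ this]
  show "set_integrable half_line {N<..} (\<lambda>x. wc x * (cmod (V2 h x))\<^sup>2)"
    and "(LINT x:{N<..}|half_line. wc x * (cmod (V2 h x))\<^sup>2) \<le> 4 * B * ?T\<^sup>2"
    using * N by auto
qed

section \<open>Solutions controlled up to finitely many functionals\<close>

lemma nrm_sq_le_on_Ioc:
  assumes k: "k \<in> L2_space H" and C: "C \<ge> 0" and pq: "0 \<le> p" "p \<le> q"
    and le: "\<And>x. x > 0 \<Longrightarrow> dens k x \<le> indicat_real {p<..q} x * C"
  shows "(L2.nrm k)\<^sup>2 \<le> (q - p) * C"
proof -
  have i: "integrable half_line (indicat_real {p<..q})"
    using Ioc_half_line(1)[where a = p and b = q and f = "\<lambda>_. 1::real"] pq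
    by (simp add: set_integrable_def)
  have "(L2.nrm k)\<^sup>2 \<le> (LINT x|half_line. indicat_real {p<..q} x * C)"
    unfolding L2_nrm_sq by (rule integral_mono[OF L2_dens[OF k]]) (use i le in auto)
  also have "\<dots> = (LINT x:{p<..q}|half_line. 1) * C" by (simp add: set_lebesgue_integral_def)
  also have "(LINT x:{p<..q}|half_line. (1::real)) = q - p"
    using pq by (subst Ioc_half_line(2)) (auto simp: set_lebesgue_integral_def)
  finally show ?thesis .
qed

lemma V1_diff: "h \<in> L2_space H \<Longrightarrow> 0 \<le> p \<Longrightarrow> p \<le> x \<Longrightarrow> V1 h x - V1 h p = L2_inner H (e2 {p<..x}) h"
  and V2_diff: "h \<in> L2_space H \<Longrightarrow> 0 \<le> p \<Longrightarrow> p \<le> x \<Longrightarrow> V2 h x - V2 h p = L2_inner H (e1 {p<..x}) h"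
proof -
  assume h: "h \<in> L2_space H" and p: "0 \<le> p" "p \<le> x"
  have "e2 {0<..x} = e2 {0<..p} + e2 {p<..x}" "e1 {0<..x} = e1 {0<..p} + e1 {p<..x}"
    by (rule ext, use p in \<open>auto simp: e1_def e2_def vec_eq_iff forall_2 indicator_def\<close>)+
  thus "V1 h x - V1 h p = L2_inner H (e2 {p<..x}) h" "V2 h x - V2 h p = L2_inner H (e1 {p<..x}) h"
    using h by (simp_all add: V1_def V2_def L2.ip_add_left)
qed

text \<open>On \<open>I\<close> the solution operator has squared norm at most \<open>\<kappa>\<close> up to finitely many functionals of the solution.
Input and output are both restricted to \<open>I\<close>; this is what makes the property additive over disjoint
sets without loss in \<open>\<kappa>\<close>. The condition on the integral of \<open>h\<close> holds throughout the range of the relation.\<close>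

definition controlled :: "real set \<Rightarrow> real \<Rightarrow> bool" where
  "controlled I \<kappa> \<longleftrightarrow> (\<exists>E C. finite E \<and> E \<subseteq> L2_space H \<and> C \<ge> 0 \<and>
     (\<forall>a h. h \<in> L2_space H \<longrightarrow> V a h \<in> L2_space H \<longrightarrow> L2_inner H (e1 {0<..}) h = 0 \<longrightarrow>
       (L2.nrm (c1 I (V a h)))\<^sup>2 + (L2.nrm (c2 I (V a h)))\<^sup>2
         \<le> \<kappa> * ((L2.nrm (c1 I h))\<^sup>2 + (L2.nrm (c2 I h))\<^sup>2) + C * (\<Sum>e\<in>E. (cmod (L2_inner H e (V a h)))\<^sup>2)))"

lemma controlledI:
  assumes E: "E1 \<in> L2_space H" "E2 \<in> L2_space H" and C: "C1 \<ge> 0" "C2 \<ge> 0"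
    and le: "\<And>a h. h \<in> L2_space H \<Longrightarrow> V a h \<in> L2_space H \<Longrightarrow> L2_inner H (e1 {0<..}) h = 0 \<Longrightarrow>
      (L2.nrm (c1 I (V a h)))\<^sup>2 \<le> \<kappa> * (L2.nrm (c2 I h))\<^sup>2 + C1 * (cmod (L2_inner H E1 (V a h)))\<^sup>2 \<and>
      (L2.nrm (c2 I (V a h)))\<^sup>2 \<le> \<kappa> * (L2.nrm (c1 I h))\<^sup>2 + C2 * (cmod (L2_inner H E2 (V a h)))\<^sup>2"
  shows "controlled I \<kappa>"
  unfolding controlled_def
proof (intro exI[of _ "{E1, E2}"] exI[of _ "C1 + C2"] conjI allI impI)
  fix a h assume h: "h \<in> L2_space H" "V a h \<in> L2_space H" "L2_inner H (e1 {0<..}) h = 0"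
  let ?q = "\<lambda>e. (cmod (L2_inner H e (V a h)))\<^sup>2"
  have "?q E1 \<le> (\<Sum>e\<in>{E1, E2}. ?q e)" "?q E2 \<le> (\<Sum>e\<in>{E1, E2}. ?q e)"
    by (rule member_le_sum; simp)+
  hence "C1 * ?q E1 \<le> C1 * (\<Sum>e\<in>{E1, E2}. ?q e)" "C2 * ?q E2 \<le> C2 * (\<Sum>e\<in>{E1, E2}. ?q e)"
    using C by (intro mult_left_mono; simp)+
  thus "(L2.nrm (c1 I (V a h)))\<^sup>2 + (L2.nrm (c2 I (V a h)))\<^sup>2
         \<le> \<kappa> * ((L2.nrm (c1 I h))\<^sup>2 + (L2.nrm (c2 I h))\<^sup>2) + (C1 + C2) * (\<Sum>e\<in>{E1, E2}. ?q e)"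
    using le[OF h] by (simp only: distrib_left distrib_right) linarith
qed (use E C in auto)

lemma controlled_mono:
  assumes "controlled I \<kappa>" "\<kappa> \<le> \<kappa>'" shows "controlled I \<kappa>'"
proof -
  obtain E C where EC: "finite E" "E \<subseteq> L2_space H" "C \<ge> 0"
    "\<And>a h. h \<in> L2_space H \<Longrightarrow> V a h \<in> L2_space H \<Longrightarrow> L2_inner H (e1 {0<..}) h = 0 \<Longrightarrow>
       (L2.nrm (c1 I (V a h)))\<^sup>2 + (L2.nrm (c2 I (V a h)))\<^sup>2
         \<le> \<kappa> * ((L2.nrm (c1 I h))\<^sup>2 + (L2.nrm (c2 I h))\<^sup>2) + C * (\<Sum>e\<in>E. (cmod (L2_inner H e (V a h)))\<^sup>2)"
    using assms(1) unfolding controlled_def by blast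
  have "\<kappa> * ((L2.nrm (c1 I h))\<^sup>2 + (L2.nrm (c2 I h))\<^sup>2) \<le> \<kappa>' * ((L2.nrm (c1 I h))\<^sup>2 + (L2.nrm (c2 I h))\<^sup>2)" for h
    using assms(2) by (intro mult_right_mono) auto
  thus ?thesis unfolding controlled_def using EC
    by (intro exI[of _ E] exI[of _ C] conjI allI impI) (auto intro: order_trans[OF EC(4) add_right_mono])
qed

lemma controlled_Un:
  assumes I: "controlled I \<kappa>" "controlled I' \<kappa>" and m: "I \<in> sets lebesgue" "I' \<in> sets lebesgue" "I \<inter> I' = {}"
  shows "controlled (I \<union> I') \<kappa>"
proof -
  obtain E C where EC: "finite E" "E \<subseteq> L2_space H" "C \<ge> 0"
    "\<And>a h. h \<in> L2_space H \<Longrightarrow> V a h \<in> L2_space H \<Longrightarrow> L2_inner H (e1 {0<..}) h = 0 \<Longrightarrow>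
       (L2.nrm (c1 I (V a h)))\<^sup>2 + (L2.nrm (c2 I (V a h)))\<^sup>2
         \<le> \<kappa> * ((L2.nrm (c1 I h))\<^sup>2 + (L2.nrm (c2 I h))\<^sup>2) + C * (\<Sum>e\<in>E. (cmod (L2_inner H e (V a h)))\<^sup>2)"
    using I(1) unfolding controlled_def by blast
  obtain E' C' where EC': "finite E'" "E' \<subseteq> L2_space H" "C' \<ge> 0"
    "\<And>a h. h \<in> L2_space H \<Longrightarrow> V a h \<in> L2_space H \<Longrightarrow> L2_inner H (e1 {0<..}) h = 0 \<Longrightarrow>
       (L2.nrm (c1 I' (V a h)))\<^sup>2 + (L2.nrm (c2 I' (V a h)))\<^sup>2
         \<le> \<kappa> * ((L2.nrm (c1 I' h))\<^sup>2 + (L2.nrm (c2 I' h))\<^sup>2) + C' * (\<Sum>e\<in>E'. (cmod (L2_inner H e (V a h)))\<^sup>2)"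
    using I(2) unfolding controlled_def by blast
  show ?thesis
    unfolding controlled_def
  proof (intro exI[of _ "E \<union> E'"] exI[of _ "C + C'"] conjI allI impI)
    fix a h assume h: "h \<in> L2_space H" "V a h \<in> L2_space H" "L2_inner H (e1 {0<..}) h = 0"
    let ?q = "\<lambda>E. \<Sum>e\<in>E. (cmod (L2_inner H e (V a h)))\<^sup>2"
    have "C * ?q E \<le> C * ?q (E \<union> E')" "C' * ?q E' \<le> C' * ?q (E \<union> E')"
      using EC EC' by (intro mult_left_mono sum_mono2; auto)+
    thus "(L2.nrm (c1 (I \<union> I') (V a h)))\<^sup>2 + (L2.nrm (c2 (I \<union> I') (V a h)))\<^sup>2
         \<le> \<kappa> * ((L2.nrm (c1 (I \<union> I') h))\<^sup>2 + (L2.nrm (c2 (I \<union> I') h))\<^sup>2) + (C + C') * ?q (E \<union> E')"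
      using EC(4)[OF h] EC'(4)[OF h] unfolding nrm_c_Un[OF m h(1)] nrm_c_Un[OF m h(2)]
      by (simp only: distrib_left distrib_right)
  qed (use EC EC' in auto)
qed

text \<open>After subtraction of the values at the left endpoint, each component is a primitive over an interval of
length at most \<open>q - p\<close>, and Cauchy-Schwarz yields one factor \<open>q - p\<close> pointwise and another one from
integration. The two subtracted constants cost one functional each.\<close>

lemma controlled_Ioc:
  assumes pq: "0 \<le> p" "p \<le> q"
  shows "controlled {p<..q} ((q - p)\<^sup>2)"
proof (rule controlledI[of "e1 {p<..q}" "e2 {p<..q}" "1 / (L2.nrm (e1 {p<..q}))\<^sup>2" "1 / (L2.nrm (e2 {p<..q}))\<^sup>2"])
  fix a h assume h: "h \<in> L2_space H" "V a h \<in> L2_space H"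
  let ?I = "{p<..q}" and ?f = "V a h"
  have st: "(L2.nrm (c1 ?I ?f))\<^sup>2 \<le> (q - p)\<^sup>2 * (L2.nrm (c2 ?I h))\<^sup>2 + 1 / (L2.nrm (e1 ?I))\<^sup>2 * (cmod (L2_inner H (e1 ?I) ?f))\<^sup>2"
  proof -
    let ?k = "c1 ?I ?f - fscale (?f p $ 1) (e1 ?I)"
    have kL: "?k \<in> L2_space H" using h by (intro L2.diff_mem L2.scl_mem) auto
    have "(L2.nrm ?k)\<^sup>2 \<le> (q - p) * ((q - p) * (L2.nrm (c2 ?I h))\<^sup>2)"
    proof (rule nrm_sq_le_on_Ioc[OF kL _ pq])
      fix x :: real assume "x > 0"
      show "dens ?k x \<le> indicat_real ?I x * ((q - p) * (L2.nrm (c2 ?I h))\<^sup>2)"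
      proof (cases "x \<in> ?I")
        case True
        have "cmod (V1 h x - V1 h p) = cmod (L2_inner H (e2 {p<..x}) (c2 ?I h))"
          using V1_diff[OF h(1) pq(1), of x] True by (subst ip_e_c) auto
        also have "\<dots> \<le> L2.nrm (e2 {p<..x}) * L2.nrm (c2 ?I h)" using h by (intro L2.cauchy_schwarz) auto
        finally have "(cmod (V1 h x - V1 h p))\<^sup>2 \<le> (L2.nrm (e2 {p<..x}) * L2.nrm (c2 ?I h))\<^sup>2" by (rule power_mono) simp
        also have "\<dots> \<le> (q - p) * (L2.nrm (c2 ?I h))\<^sup>2"
          using e2_nrm_le[of p x] pq True unfolding power_mult_distrib by (intro mult_right_mono) auto
        finally have b: "(cmod (V1 h x - V1 h p))\<^sup>2 \<le> (q - p) * (L2.nrm (c2 ?I h))\<^sup>2" .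
        have "dens ?k x = ws x * (cmod (V1 h x - V1 h p))\<^sup>2"
          using True by (simp add: dens_def c1_def e1_def V_def norm_minus_commute)
        also have "\<dots> \<le> 1 * ((q - p) * (L2.nrm (c2 ?I h))\<^sup>2)" using b by (intro mult_mono) auto
        finally show ?thesis using True by simp
      qed (simp add: dens_def c1_def e1_def)
    qed (use pq in auto)
    moreover have "L2_inner H (e1 ?I) (c1 ?I ?f) = L2_inner H (e1 ?I) ?f" by (rule ip_e_c) simp
    ultimately show ?thesis
      using L2.nrm_sq_le_diff_scl[of "c1 ?I ?f" "e1 ?I" "?f p $ 1"] h by (simp add: power2_eq_square mult.assoc)
  qed
  moreover have "(L2.nrm (c2 ?I ?f))\<^sup>2 \<le> (q - p)\<^sup>2 * (L2.nrm (c1 ?I h))\<^sup>2 + 1 / (L2.nrm (e2 ?I))\<^sup>2 * (cmod (L2_inner H (e2 ?I) ?f))\<^sup>2"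
  proof -
    let ?k = "c2 ?I ?f - fscale (?f p $ 2) (e2 ?I)"
    have kL: "?k \<in> L2_space H" using h by (intro L2.diff_mem L2.scl_mem) auto
    have e1le: "(L2.nrm (e1 {p<..x}))\<^sup>2 \<le> (x - p) * 1" if "p \<le> x" for x
      by (rule nrm_sq_le_on_Ioc) (use pq that in \<open>auto simp: dens_def e1_def split: split_indicator\<close>)
    have "(L2.nrm ?k)\<^sup>2 \<le> (q - p) * ((q - p) * (L2.nrm (c1 ?I h))\<^sup>2)"
    proof (rule nrm_sq_le_on_Ioc[OF kL _ pq])
      fix x :: real assume "x > 0"
      show "dens ?k x \<le> indicat_real ?I x * ((q - p) * (L2.nrm (c1 ?I h))\<^sup>2)"
      proof (cases "x \<in> ?I")
        case True
        have "cmod (V2 h x - V2 h p) = cmod (L2_inner H (e1 {p<..x}) (c1 ?I h))"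
          using V2_diff[OF h(1) pq(1), of x] True by (subst ip_e_c) auto
        also have "\<dots> \<le> L2.nrm (e1 {p<..x}) * L2.nrm (c1 ?I h)" using h by (intro L2.cauchy_schwarz) auto
        finally have "(cmod (V2 h x - V2 h p))\<^sup>2 \<le> (L2.nrm (e1 {p<..x}) * L2.nrm (c1 ?I h))\<^sup>2" by (rule power_mono) simp
        also have "\<dots> \<le> (q - p) * (L2.nrm (c1 ?I h))\<^sup>2"
          using e1le[of x] pq True unfolding power_mult_distrib by (intro mult_right_mono) auto
        finally have b: "(cmod (V2 h x - V2 h p))\<^sup>2 \<le> (q - p) * (L2.nrm (c1 ?I h))\<^sup>2" .
        have "dens ?k x = wc x * (cmod (V2 h x - V2 h p))\<^sup>2"
          using True by (simp add: dens_def c2_def e2_def V_def)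
        also have "\<dots> \<le> 1 * ((q - p) * (L2.nrm (c1 ?I h))\<^sup>2)" using b by (intro mult_mono) auto
        finally show ?thesis using True by simp
      qed (simp add: dens_def c2_def e2_def)
    qed (use pq in auto)
    moreover have "L2_inner H (e2 ?I) (c2 ?I ?f) = L2_inner H (e2 ?I) ?f" by (rule ip_e_c) simp
    ultimately show ?thesis
      using L2.nrm_sq_le_diff_scl[of "c2 ?I ?f" "e2 ?I" "?f p $ 2"] h by (simp add: power2_eq_square mult.assoc)
  qed
  ultimately show "(L2.nrm (c1 ?I ?f))\<^sup>2 \<le> (q - p)\<^sup>2 * (L2.nrm (c2 ?I h))\<^sup>2 + 1 / (L2.nrm (e1 ?I))\<^sup>2 * (cmod (L2_inner H (e1 ?I) ?f))\<^sup>2 \<and>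
    (L2.nrm (c2 ?I ?f))\<^sup>2 \<le> (q - p)\<^sup>2 * (L2.nrm (c1 ?I h))\<^sup>2 + 1 / (L2.nrm (e2 ?I))\<^sup>2 * (cmod (L2_inner H (e2 ?I) ?f))\<^sup>2" ..
qed auto

text \<open>Cutting into short pieces multiplies the number of functionals and leaves the constant alone.\<close>

lemma controlled_initial:
  assumes "\<delta> \<ge> 0" shows "controlled {0<..real n * \<delta>} (\<delta>\<^sup>2)"
proof (induction n)
  case 0
  have "controlled {0<..0} ((0 - 0)\<^sup>2)" by (rule controlled_Ioc) auto
  from controlled_mono[OF this, of "\<delta>\<^sup>2"] show ?case by simp
next
  case (Suc n)
  have "controlled {real n * \<delta><..real n * \<delta> + \<delta>} ((real n * \<delta> + \<delta> - real n * \<delta>)\<^sup>2)"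
    by (rule controlled_Ioc) (use assms in auto)
  hence "controlled ({0<..real n * \<delta>} \<union> {real n * \<delta><..real n * \<delta> + \<delta>}) (\<delta>\<^sup>2)"
    by (intro controlled_Un Suc.IH) auto
  moreover have "{0<..y} \<union> {y<..y + \<delta>} = {0<..y + \<delta>}" if "0 \<le> y" for y :: real
    using assms that by auto
  from this[of "real n * \<delta>"]
  have "{0<..real n * \<delta>} \<union> {real n * \<delta><..real n * \<delta> + \<delta>} = {0<..real (Suc n) * \<delta>}"
    using assms by (simp add: algebra_simps)
  ultimately show ?case by simp
qed

lemma V_tail_nrm_1:
  "(L2.nrm (c1 {N<..} (V (V1 h N) h)))\<^sup>2 = (LINT x:{N<..}|half_line. ws x * (cmod (V1 h x - V1 h N))\<^sup>2)"
  unfolding c_nrm_sq by (simp add: V_def norm_minus_commute)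

lemma V_tail_mem_1:
  assumes "0 < N" "B > 0" "\<And>x. N \<le> x \<Longrightarrow> x * Sig x \<le> B" "h \<in> L2_space H"
  shows "c1 {N<..} (V (V1 h N) h) \<in> L2_space H"
  by (rule c_mem_iff(1)) (use tail_bound_1(1)[OF assms] V_measurable[OF assms(4)] in \<open>auto simp: V_def norm_minus_commute\<close>)

lemma V_tail_split_1: "c1 {N<..} (V a h) = c1 {N<..} (V (V1 h N) h) + fscale (a - V1 h N) (e1 {N<..})"
  by (rule ext) (auto simp: c1_def e1_def V_def vec_eq_iff forall_2 indicator_def)

text \<open>The first component involves the unknown constant \<open>a\<close>, which costs one functional; the second component
obeys the dual Hardy inequality without correction.\<close>

lemma controlled_tail:
  assumes N: "0 < N" and B: "B > 0" and Sb: "\<And>x. N \<le> x \<Longrightarrow> x * Sig x \<le> B"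
  shows "controlled {N<..} (4 * B)"
proof (rule controlledI[of "e1 {N<..}" 0 "1 / (L2.nrm (e1 {N<..}))\<^sup>2" 0])
  fix a h assume h: "h \<in> L2_space H" "V a h \<in> L2_space H" "L2_inner H (e1 {0<..}) h = 0"
  let ?I = "{N<..}"
  have "c1 ?I (V a h) - fscale (a - V1 h N) (e1 ?I) = c1 ?I (V (V1 h N) h)" unfolding V_tail_split_1[of N a] by simp
  hence "(L2.nrm (c1 ?I (V a h) - fscale (a - V1 h N) (e1 ?I)))\<^sup>2 \<le> 4 * B * (L2.nrm (c2 ?I h))\<^sup>2"
    using tail_bound_1(2)[OF N B Sb h(1)] by (simp only: V_tail_nrm_1)
  moreover have "L2_inner H (e1 ?I) (c1 ?I (V a h)) = L2_inner H (e1 ?I) (V a h)" by (rule ip_e_c) simp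
  ultimately have "(L2.nrm (c1 ?I (V a h)))\<^sup>2 \<le> 4 * B * (L2.nrm (c2 ?I h))\<^sup>2 + 1 / (L2.nrm (e1 ?I))\<^sup>2 * (cmod (L2_inner H (e1 ?I) (V a h)))\<^sup>2"
    using L2.nrm_sq_le_diff_scl[of "c1 ?I (V a h)" "e1 ?I" "a - V1 h N"] h by simp
  moreover have "(L2.nrm (c2 ?I (V a h)))\<^sup>2 \<le> 4 * B * (L2.nrm (c1 ?I h))\<^sup>2"
    using tail_bound_2(2)[OF N B Sb h(1,3)] by (simp add: c_nrm_sq V_def)
  ultimately show "(L2.nrm (c1 ?I (V a h)))\<^sup>2 \<le> 4 * B * (L2.nrm (c2 ?I h))\<^sup>2 + 1 / (L2.nrm (e1 ?I))\<^sup>2 * (cmod (L2_inner H (e1 ?I) (V a h)))\<^sup>2 \<and>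
    (L2.nrm (c2 ?I (V a h)))\<^sup>2 \<le> 4 * B * (L2.nrm (c1 ?I h))\<^sup>2 + 0 * (cmod (L2_inner H 0 (V a h)))\<^sup>2" by simp
qed auto

lemma controlled_all:
  assumes N: "0 < N" and B: "B > 0" and Sb: "\<And>x. N \<le> x \<Longrightarrow> x * Sig x \<le> B"
  shows "controlled {0<..} (4 * B)"
proof -
  \<comment> \<open>The pieces of length \<open>N / n\<close> are so short that their constant does not exceed \<open>4 * B\<close>.\<close>
  obtain n :: nat where n: "n > 0" "N / (2 * sqrt B) \<le> real n"
    using real_arch_simple[of "max 1 (N / (2 * sqrt B))"] by (metis max.bounded_iff of_nat_0_less_iff zero_less_one order_less_le_trans)
  define \<delta> where "\<delta> = N / real n"
  have \<delta>: "\<delta> \<ge> 0" "real n * \<delta> = N" using n N by (auto simp: \<delta>_def)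
  have "\<delta> \<le> 2 * sqrt B" using n N B by (simp add: \<delta>_def field_simps)
  hence "\<delta>\<^sup>2 \<le> (2 * sqrt B)\<^sup>2" using \<delta> by (intro power_mono)
  hence "\<delta>\<^sup>2 \<le> 4 * B" using B by (simp add: power_mult_distrib)
  hence "controlled {0<..N} (4 * B)" using controlled_mono[OF controlled_initial[OF \<delta>(1), of n]] \<delta>(2) by simp
  hence "controlled ({0<..N} \<union> {N<..}) (4 * B)" by (intro controlled_Un controlled_tail[OF N B Sb]) auto
  moreover have "{0<..N} \<union> {N<..} = {0<..}" using N by auto
  ultimately show ?thesis by simp
qed

text \<open>The bounds on the tail also settle solvability: together with \<open>range_total\<close>, the range of the relation
consists exactly of the \<open>h\<close> with vanishing total integral.\<close>

lemma V_mem: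
  assumes N: "0 < N" and B: "B > 0" and Sb: "\<And>x. N \<le> x \<Longrightarrow> x * Sig x \<le> B"
    and h: "h \<in> L2_space H" and tot: "L2_inner H (e1 {0<..}) h = 0"
  shows "V a h \<in> L2_space H"
proof -
  note Vm = V_measurable[OF h, of a]
  define K where "K = (cmod a + sqrt N * L2.nrm h)\<^sup>2 + (sqrt (LINT x|half_line. ws x) * L2.nrm h)\<^sup>2"
  have K0: "K \<ge> 0" by (simp add: K_def)
  have le: "dens (V a h) x \<le> K" if x: "0 < x" "x \<le> N" for x
  proof -
    have "sqrt x * L2.nrm h \<le> sqrt N * L2.nrm h" using x h by (intro mult_right_mono) auto
    hence "cmod (a - V1 h x) \<le> cmod a + sqrt N * L2.nrm h"
      using norm_triangle_ineq4[of a "V1 h x"] V1_bound[OF h, of x] x by simp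
    hence "ws x * (cmod (a - V1 h x))\<^sup>2 \<le> 1 * (cmod a + sqrt N * L2.nrm h)\<^sup>2" by (intro mult_mono power_mono) auto
    moreover have "wc x * (cmod (V2 h x))\<^sup>2 \<le> 1 * (sqrt (LINT x|half_line. ws x) * L2.nrm h)\<^sup>2"
      using V2_bound[OF h, of x] by (intro mult_mono power_mono) auto
    ultimately show ?thesis by (simp add: dens_def V_def K_def)
  qed
  have small: "c1 {0<..N} (V a h) \<in> L2_space H" "c2 {0<..N} (V a h) \<in> L2_space H"
  proof -
    have i: "integrable half_line (\<lambda>x. indicat_real {0<..N} x * K)" by (intro integrable_mult_left indicator_Ioc_integrable)
    have d1: "dens (c1 {0<..N} (V a h)) x \<le> indicat_real {0<..N} x * K" if x: "x > 0" for x
    proof (cases "x \<le> N")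
      case True
      have "dens (c1 {0<..N} (V a h)) x \<le> K" by (rule order_trans[OF dens_c_le(1) le[OF x True]])
      thus ?thesis using x True by simp
    qed (simp add: dens_c)
    have d2: "dens (c2 {0<..N} (V a h)) x \<le> indicat_real {0<..N} x * K" if x: "x > 0" for x
    proof (cases "x \<le> N")
      case True
      have "dens (c2 {0<..N} (V a h)) x \<le> K" by (rule order_trans[OF dens_c_le(2) le[OF x True]])
      thus ?thesis using x True by simp
    qed (simp add: dens_c)
    show "c1 {0<..N} (V a h) \<in> L2_space H"
      by (rule L2I[OF c_measurable(1)[OF _ Vm] i d1]) auto
    show "c2 {0<..N} (V a h) \<in> L2_space H"
      by (rule L2I[OF c_measurable(2)[OF _ Vm] i d2]) auto
  qed
  have t1: "c1 {N<..} (V a h) \<in> L2_space H"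
    unfolding V_tail_split_1[of N a] by (intro L2.add_mem L2.scl_mem V_tail_mem_1[OF N B Sb h]) auto
  have t2: "c2 {N<..} (V a h) \<in> L2_space H"
    by (rule c_mem_iff(2)) (use tail_bound_2(1)[OF N B Sb h tot] Vm in \<open>auto simp: V_def\<close>)
  have "(c1 {0<..N} (V a h) + c2 {0<..N} (V a h)) + (c1 {N<..} (V a h) + c2 {N<..} (V a h)) \<in> L2_space H"
    by (intro L2.add_mem small t1 t2)
  thus ?thesis
    by (rule L2_cong) (auto simp: c1_def c2_def vec_eq_iff forall_2 indicator_def)
qed

end

section \<open>Discrete spectrum near zero\<close>

lemma sum_fun_apply: "(\<Sum>i\<in>I. f i) x = (\<Sum>i\<in>I. f i x)"
  for f :: "'i \<Rightarrow> 'a \<Rightarrow> 'b::comm_monoid_add"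
  by (induction I rule: infinite_finite_induct) auto

lemma sum_squares_le_square_sum:
  fixes a :: "'i \<Rightarrow> real"
  assumes "\<And>i. i \<in> I \<Longrightarrow> 0 \<le> a i"
  shows "(\<Sum>i\<in>I. (a i)\<^sup>2) \<le> (\<Sum>i\<in>I. a i)\<^sup>2"
  using assms
proof (induction I rule: infinite_finite_induct)
  case (insert i I)
  have "0 \<le> a i * (\<Sum>i\<in>I. a i)" using insert by (intro mult_nonneg_nonneg sum_nonneg) auto
  thus ?case using insert by (simp add: power2_sum)
qed auto

context diagonal_system
begin

lemma multivalued_part_iff: "h \<in> multivalued_part H \<longleftrightarrow> (0, h) \<in> canonical_relation H"
  by (simp add: multivalued_part_def zero_fun_def)

sublocale OP: symmetric_relation fscale "operator_space H" "L2_inner H" "canonical_operator H"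
  unfolding canonical_operator_def operator_space_def
  by (rule CR.reduced_symmetric_relation) (use multivalued_part_iff CR.graph_snd in blast)

lemma operator_space_L2: "f \<in> operator_space H \<Longrightarrow> f \<in> L2_space H"
  by (simp add: operator_space_def)

text \<open>By symmetry the domain of the relation is orthogonal to its multi-valued part, so reducing to the
operator part restricts only the second entries.\<close>

lemma domain_operator_space: "(f, h) \<in> canonical_relation H \<Longrightarrow> f \<in> operator_space H"
proof -
  assume fh: "(f, h) \<in> canonical_relation H"
  have fL: "f \<in> L2_space H" "h \<in> L2_space H" using CR.graph_mem[OF fh] by auto
  have "L2_inner H e f = 0" if "e \<in> multivalued_part H" for e
    using CR.graph_sym[OF that[unfolded multivalued_part_iff] fh] fL by simp
  thus ?thesis using fL by (simp add: operator_space_def)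
qed

lemma canonical_operator_iff:
  "(f, h) \<in> canonical_operator H \<longleftrightarrow> (f, h) \<in> canonical_relation H \<and> h \<in> operator_space H"
  unfolding canonical_operator_def using domain_operator_space by auto

lemma resolvent_set_eq: "resolvent_set H = OP.rho"
  unfolding resolvent_set_def OP.rho_def OP.below_def L2_nrm_eq L2_eq_def fun_diff_def ..

lemma eigenspace_eq: "eigenspace H z = OP.eigvecs z"
  unfolding eigenspace_def OP.eigvecs_def L2_nrm_eq L2_eq_def fun_diff_def ..

lemma finite_dimensional_eq: "finite_dimensional H W \<longleftrightarrow> OP.fin_dim W"
  unfolding finite_dimensional_def OP.fin_dim_def L2_nrm_eq L2_eq_def
  by (simp add: fun_diff_def sum_fun_apply)

lemma essential_spectrum_eq: "essential_spectrum H = {z. z \<notin> OP.rho \<and> \<not> OP.discrete_point z}"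
  unfolding essential_spectrum_def discrete_spectrum_def spectrum_def OP.discrete_point_def
    resolvent_set_eq eigenspace_eq finite_dimensional_eq L2_nrm_eq by auto

lemma essential_spectrum_closed: "closed (essential_spectrum H)"
proof -
  have "open (- essential_spectrum H)"
  proof (subst open_subopen, rule ballI)
    fix z assume z: "z \<in> - essential_spectrum H"
    show "\<exists>T. open T \<and> z \<in> T \<and> T \<subseteq> - essential_spectrum H"
    proof (cases "z \<in> OP.rho")
      case True
      thus ?thesis using OP.open_rho by (intro exI[of _ OP.rho]) (auto simp: essential_spectrum_eq)
    next
      case False
      hence d: "OP.discrete_point z" using z by (auto simp: essential_spectrum_eq)
      then obtain T where T: "open T" "T \<inter> - OP.rho = {z}"
        unfolding OP.discrete_point_def isolated_in_def by blast
      hence "T \<subseteq> - essential_spectrum H" using d by (auto simp: essential_spectrum_eq)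
      thus ?thesis using T by blast
    qed
  qed
  thus ?thesis by (simp add: closed_def)
qed

text \<open>The essential spectrum is closed, so the least modulus is attained.\<close>

lemma M_attained:
  assumes "essential_spectrum H \<noteq> {}"
  obtains t where "t \<in> essential_spectrum H" "M H = ereal (cmod t)"
    "\<And>u. u \<in> essential_spectrum H \<Longrightarrow> cmod t \<le> cmod u"
proof -
  obtain t where t: "t \<in> essential_spectrum H" "\<And>u. u \<in> essential_spectrum H \<Longrightarrow> dist 0 t \<le> dist 0 u"
    using distance_attains_inf[OF essential_spectrum_closed assms, of 0] by blast
  have "(LEAST r. \<exists>t\<in>essential_spectrum H. r = cmod t) = cmod t"
    by (rule Least_equality) (use t in auto)
  thus ?thesis using that[of t] t assms by (simp add: M_def)
qed

text \<open>The constant \<open>(1, 0)\<close>, which spans the kernel of the relation.\<close>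

definition e0 :: "real \<Rightarrow> complex^2" where "e0 = V 1 0"

lemma e0_apply: "e0 x = vector [1, 0]"
  by (simp add: e0_def V_def V1_def V2_def L2.ip_zero_right)

lemma V_zero: "V a 0 = fscale a e0"
  using V_scale[OF L2.zero_mem, of a 1] by (simp add: e0_def zero_fun_def)

lemma e0_mem [simp]: "e0 \<in> L2_space H"
  by (rule L2_cong[OF e1_mem[of UNIV]]) (auto simp: e1_def e0_apply)

lemma ip_e0: "L2_inner H e0 h = L2_inner H (e1 {0<..}) h"
  unfolding L2_inner_def by (rule Bochner_Integration.integral_cong) (auto simp: pairing_diag e0_apply e1_def)

lemma e0_kernel: "(e0, 0) \<in> canonical_relation H"
  unfolding canonical_relation_iff using L2.zero_mem by (auto simp: V_zero intro!: exI[of _ 1])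

lemma range_total: "(f, h) \<in> canonical_relation H \<Longrightarrow> L2_inner H (e1 {0<..}) h = 0"
  using CR.graph_sym[OF e0_kernel, of f h] CR.graph_mem[of f h] by (simp add: ip_e0)

text \<open>If \<open>sin \<phi>\<close> vanishes almost everywhere, every \<open>h\<close> belongs to the multi-valued part; the operator acts in a
trivial space and has empty spectrum.\<close>

lemma rho_UNIV_if_null:
  assumes null: "L2.nrm e0 = 0"
  shows "OP.rho = UNIV"
proof -
  have "AE x in half_line. dens e0 x = 0" using null by (subst (asm) L2_nrm_0_iff) auto
  hence ws0: "AE x in half_line. ws x = 0" by eventually_elim (auto simp: dens_def e0_apply)
  have zero: "L2.nrm f = 0" if f: "f \<in> operator_space H" for f
  proof -
    have fL: "f \<in> L2_space H" by (rule operator_space_L2[OF f])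
    have V20: "V2 f x = 0" for x
    proof -
      have "(LINT y:{0<..x}|half_line. ws y * f y $ 1) = (LINT y|half_line. 0)"
        unfolding set_lebesgue_integral_def
      proof (rule integral_cong_AE)
        show "(\<lambda>y. indicat_real {0<..x} y *\<^sub>R (ws y * f y $ 1)) \<in> borel_measurable half_line"
          using pairing_integrable[OF e1_mem fL, of "{0<..x}"] by (auto simp: pairing_e1)
        show "AE y in half_line. indicat_real {0<..x} y *\<^sub>R (ws y * f y $ 1) = 0"
          using ws0 by eventually_elim simp
      qed simp
      thus ?thesis by (simp add: V2_def ip_e1)
    qed
    have d0: "AE x in half_line. dens (V 0 f) x = 0"
      using ws0 by eventually_elim (simp add: dens_def V_def V20)
    have Vm: "V 0 f \<in> borel_measurable half_line" by (rule V_measurable[OF fL])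
    have "integrable half_line (dens (V 0 f))"
      by (rule Bochner_Integration.integrable_cong_AE_imp[of _ "\<lambda>_. 0"])
         (use d0 Vm in \<open>auto intro: dens_measurable elim!: eventually_mono\<close>)
    hence VL: "V 0 f \<in> L2_space H" using Vm by (simp add: L2_iff)
    hence "L2.nrm (V 0 f) = 0" using d0 by (subst L2_nrm_0_iff) auto
    hence "L2.nrm (0 - V 0 f) = 0" using L2.nrm_uminus[OF VL] by simp
    hence "(0, f) \<in> canonical_relation H" unfolding canonical_relation_iff using fL VL L2.zero_mem by blast
    hence "L2_inner H f f = 0" using f by (simp add: operator_space_def multivalued_part_iff)
    thus ?thesis using fL by (simp add: L2.ip_self)
  qed
  have "z \<in> OP.rho" for z
    unfolding OP.rho_def
  proof (intro CollectI conjI exI[of _ 0] ballI)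
    show "OP.below z 0" unfolding OP.below_def using zero OP.graph_mem by fastforce
    fix k assume k: "k \<in> operator_space H"
    have "(0, 0) \<in> canonical_operator H" by (rule OP.graph_zero)
    moreover have "0 - fscale z 0 - k = - k" by (rule ext) simp
    hence "L2.nrm (0 - fscale z 0 - k) = 0"
      using zero[OF k] L2.nrm_uminus[OF operator_space_L2[OF k]] by simp
    ultimately show "\<exists>(f, h)\<in>canonical_operator H. L2.nrm (h - fscale z f - k) = 0" by blast
  qed
  thus ?thesis by blast
qed

text \<open>Stated for restrictions of the relation because it serves twice: for the operator itself, and for its
part orthogonal to the kernel.\<close>

lemma finitely_corrected_bound_exists:
  assumes SR: "symmetric_relation fscale X (L2_inner H) S" and X: "X \<subseteq> L2_space H" and S: "S \<subseteq> canonical_relation H"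
    and N: "0 < N" and B: "B > 0" and Sb: "\<And>x. N \<le> x \<Longrightarrow> x * Sig x \<le> B"
  shows "\<exists>E D C. finitely_corrected_bound fscale X (L2_inner H) S E (L2_inner H) D C (1 / (2 * sqrt B))"
proof -
  obtain E C where EC: "finite E" "E \<subseteq> L2_space H" "C \<ge> 0"
    "\<And>a h. h \<in> L2_space H \<Longrightarrow> V a h \<in> L2_space H \<Longrightarrow> L2_inner H (e1 {0<..}) h = 0 \<Longrightarrow>
       (L2.nrm (c1 {0<..} (V a h)))\<^sup>2 + (L2.nrm (c2 {0<..} (V a h)))\<^sup>2
         \<le> 4 * B * ((L2.nrm (c1 {0<..} h))\<^sup>2 + (L2.nrm (c2 {0<..} h))\<^sup>2) + C * (\<Sum>e\<in>E. (cmod (L2_inner H e (V a h)))\<^sup>2)"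
    using controlled_all[OF N B Sb] unfolding controlled_def by blast
  define D where "D = (\<Sum>e\<in>E. L2.nrm e)"
  have D: "L2.nrm e \<le> D" if "e \<in> E" for e
    unfolding D_def by (rule member_le_sum) (use that EC in auto)
  have "finitely_corrected_bound fscale X (L2_inner H) S E (L2_inner H) D (sqrt C) (1 / (2 * sqrt B))"
  proof (intro finitely_corrected_bound.intro SR finitely_corrected_bound_axioms.intro)
    show "finite E" "sqrt C \<ge> 0" "1 / (2 * sqrt B) > 0" using EC B by auto
    show "L2_inner H e (x + y) = L2_inner H e x + L2_inner H e y" if "e \<in> E" "x \<in> X" "y \<in> X" for e x y
      using that EC X by (intro L2.ip_add_right) auto
    show "L2_inner H e (fscale a x) = a * L2_inner H e x" if "e \<in> E" "x \<in> X" for e x a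
      using that EC X by (intro L2.ip_scl_right) auto
    show "cmod (L2_inner H e x) \<le> D * L2.nrm x" if "e \<in> E" "x \<in> X" for e x
    proof -
      have xL: "e \<in> L2_space H" "x \<in> L2_space H" using that EC X by auto
      have "cmod (L2_inner H e x) \<le> L2.nrm e * L2.nrm x" by (rule L2.cauchy_schwarz[OF xL])
      also have "\<dots> \<le> D * L2.nrm x" using D[OF that(1)] xL by (intro mult_right_mono) auto
      finally show ?thesis .
    qed
    show "L2.nrm f \<le> L2.nrm h / (1 / (2 * sqrt B)) + sqrt C * (\<Sum>e\<in>E. cmod (L2_inner H e f))" if "(f, h) \<in> S" for f h
    proof -
      have fh: "(f, h) \<in> canonical_relation H" using that S by blast
      then obtain a where a: "f \<in> L2_space H" "h \<in> L2_space H" "V a h \<in> L2_space H" "L2.nrm (f - V a h) = 0"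
        unfolding canonical_relation_iff by blast
      have nf: "L2.nrm f = L2.nrm (V a h)" using a by (intro L2.nrm_eq_if_null) auto
      have ipf: "L2_inner H e f = L2_inner H e (V a h)" if "e \<in> E" for e
      proof -
        have "L2_inner H e (f - V a h) = 0" using a EC that by (intro L2.ip_null_right) auto
        thus ?thesis using a EC that by (subst (asm) L2.ip_diff_right) auto
      qed
      let ?q = "\<Sum>e\<in>E. (cmod (L2_inner H e f))\<^sup>2" and ?s = "\<Sum>e\<in>E. cmod (L2_inner H e f)"
      have "(L2.nrm f)\<^sup>2 \<le> 4 * B * (L2.nrm h)\<^sup>2 + C * ?q"
        using EC(4)[OF a(2,3) range_total[OF fh]] ipf unfolding nf nrm_c_total[OF a(3)] nrm_c_total[OF a(2)] by simp
      also have "?q \<le> ?s\<^sup>2" by (rule sum_squares_le_square_sum) auto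
      hence "4 * B * (L2.nrm h)\<^sup>2 + C * ?q \<le> 4 * B * (L2.nrm h)\<^sup>2 + C * ?s\<^sup>2"
        using EC(3) by (intro add_left_mono mult_left_mono)
      also have "\<dots> = (2 * sqrt B * L2.nrm h)\<^sup>2 + (sqrt C * ?s)\<^sup>2" using B EC(3) by (simp add: power_mult_distrib)
      also have "\<dots> \<le> (2 * sqrt B * L2.nrm h + sqrt C * ?s)\<^sup>2"
        using B EC(3) a by (simp add: power2_sum sum_nonneg)
      finally have "L2.nrm f \<le> 2 * sqrt B * L2.nrm h + sqrt C * ?s"
        by (rule power2_le_imp_le) (use B EC(3) a in \<open>auto intro!: add_nonneg_nonneg mult_nonneg_nonneg sum_nonneg\<close>)
      thus ?thesis by (simp add: mult.commute)
    qed
  qed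
  thus ?thesis by blast
qed

text \<open>One point of the resolvent set near zero has to be found by hand. In the orthogonal complement of the
kernel, \<open>0\<close> is in the resolvent set: the corrected estimate together with injectivity bounds the operator
below, and \<open>V_mem\<close> solves the equation. Hence small imaginary numbers are resolvent points there, and on
the kernel the operator minus \<open>\<i> \<epsilon>\<close> is multiplication by \<open>- \<i> \<epsilon>\<close>.\<close>

lemma small_imaginary_resolvent:
  assumes nz: "L2.nrm e0 \<noteq> 0"
    and N: "0 < N" and B: "B > 0" and Sb: "\<And>x. N \<le> x \<Longrightarrow> x * Sig x \<le> B"
  shows "\<exists>\<epsilon>0>0. \<forall>\<epsilon>. 0 < \<epsilon> \<longrightarrow> \<epsilon> < \<epsilon>0 \<longrightarrow> \<i> * complex_of_real \<epsilon> \<in> OP.rho"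
proof -
  have e0X: "e0 \<in> operator_space H" by (rule domain_operator_space[OF e0_kernel])
  have e0S: "(e0, 0) \<in> canonical_operator H" using e0_kernel OP.zero_mem by (simp add: canonical_operator_iff)
  have ee: "L2_inner H e0 e0 \<noteq> 0" using nz by (simp add: L2.ip_self)
  define X where "X = {x \<in> operator_space H. \<forall>e\<in>{e0}. L2_inner H e x = 0}"
  have SR: "symmetric_relation fscale X (L2_inner H) (canonical_operator H \<inter> X \<times> X)"
    unfolding X_def by (rule OP.reduced_symmetric_relation) (use e0X in simp)
  interpret R: symmetric_relation fscale X "L2_inner H" "canonical_operator H \<inter> X \<times> X" by (rule SR)
  note [simp del] = R.graph_fst R.graph_snd
  have XL: "X \<subseteq> L2_space H" unfolding X_def using operator_space_L2 by blast
  have SS: "canonical_operator H \<inter> X \<times> X \<subseteq> canonical_relation H" unfolding canonical_operator_def by blast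
  obtain E D C where "finitely_corrected_bound fscale X (L2_inner H) (canonical_operator H \<inter> X \<times> X) E (L2_inner H) D C (1 / (2 * sqrt B))"
    using finitely_corrected_bound_exists[OF SR XL SS N B Sb] by blast
  then interpret F: finitely_corrected_bound fscale X "L2_inner H" "canonical_operator H \<inter> X \<times> X" E "L2_inner H" D C "1 / (2 * sqrt B)" .
  have "\<exists>C'. R.below 0 C'"
  proof (rule F.below_if_no_eigenvector)
    show "cmod 0 < 1 / (2 * sqrt B)" using B by simp
    fix f assume "f \<in> R.eigvecs 0"
    hence f0: "(f, fscale 0 f) \<in> canonical_operator H \<inter> X \<times> X" by (rule R.eigvecs_graph)
    have "fscale 0 f = 0" by (simp add: zero_fun_def)
    hence f: "(f, 0) \<in> canonical_relation H" "f \<in> X" using f0 SS by auto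
    then obtain a where a: "f \<in> L2_space H" "L2.nrm (f - fscale a e0) = 0"
      unfolding canonical_relation_iff V_zero by blast
    have "L2_inner H e0 (f - fscale a e0) = 0" using a by (intro L2.ip_null_right L2.diff_mem L2.scl_mem) auto
    hence "a * L2_inner H e0 e0 = 0" using f(2) a by (simp add: L2.ip_diff_right L2.ip_scl_right X_def)
    hence "a = 0" using ee by simp
    thus "L2.nrm f = 0" using a(2) by (simp add: fun_diff_def)
  qed
  then obtain C' where C': "R.below 0 C'" by blast
  have "0 \<in> R.rho"
  proof (rule R.rhoI[OF C'])
    fix k assume k: "k \<in> X"
    hence kL: "k \<in> L2_space H" and kX: "k \<in> operator_space H" and tot: "L2_inner H (e1 {0<..}) k = 0"
      using XL by (auto simp: X_def ip_e0)
    define \<beta> where "\<beta> = L2_inner H e0 (V 0 k) / L2_inner H e0 e0"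
    have VL: "V a k \<in> L2_space H" for a by (rule V_mem[OF N B Sb kL tot])
    have "V (0 + (- \<beta>)) (k + 0) = V 0 k + V (- \<beta>) 0" by (rule V_add[OF kL L2.zero_mem])
    hence "L2_inner H e0 (V (- \<beta>) k) = L2_inner H e0 (V 0 k) + L2_inner H e0 (fscale (- \<beta>) e0)"
      using VL[of 0] L2.ip_add_right[OF e0_mem VL[of 0] L2.scl_mem[OF e0_mem, of "- \<beta>"]] by (simp add: V_zero)
    also have "L2_inner H e0 (fscale (- \<beta>) e0) = - \<beta> * L2_inner H e0 e0"
      by (rule L2.ip_scl_right) auto
    also have "L2_inner H e0 (V 0 k) + - \<beta> * L2_inner H e0 e0 = 0" using ee by (simp add: \<beta>_def)
    finally have ip0: "L2_inner H e0 (V (- \<beta>) k) = 0" .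
    have "(V (- \<beta>) k, k) \<in> canonical_relation H"
      unfolding canonical_relation_iff using VL kL by (intro conjI exI[of _ "- \<beta>"]) auto
    hence "(V (- \<beta>) k, k) \<in> canonical_operator H" "V (- \<beta>) k \<in> X"
      unfolding canonical_operator_iff X_def using kX ip0 domain_operator_space by blast+
    moreover have "k + fscale 0 (V (- \<beta>) k) = k" by (rule ext) simp
    ultimately show "\<exists>f. (f, k + fscale 0 f) \<in> canonical_operator H \<inter> X \<times> X"
      using k by (intro exI[of _ "V (- \<beta>) k"]) (simp only: Int_iff mem_Sigma_iff)
  qed
  then obtain \<epsilon>0 where \<epsilon>0: "\<epsilon>0 > 0" "ball 0 \<epsilon>0 \<subseteq> R.rho"
    using R.open_rho by (auto simp: open_contains_ball)
  have "\<i> * complex_of_real \<epsilon> \<in> OP.rho" if \<epsilon>: "0 < \<epsilon>" "\<epsilon> < \<epsilon>0" for \<epsilon>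
  proof (rule OP.rhoI)
    let ?z = "\<i> * complex_of_real \<epsilon>"
    show "OP.below ?z (1 / \<bar>Im ?z\<bar>)" by (rule OP.below_nonreal) (use \<epsilon> in simp)
    have zR: "?z \<in> R.rho" using \<epsilon> \<epsilon>0 by (auto simp: norm_mult)
    fix k assume k: "k \<in> operator_space H"
    have kL: "k \<in> L2_space H" by (rule operator_space_L2[OF k])
    define \<beta> where "\<beta> = L2_inner H e0 k / L2_inner H e0 e0"
    define k' where "k' = k - fscale \<beta> e0"
    have "L2_inner H e0 k' = 0"
      using kL ee by (simp add: k'_def L2.ip_diff_right L2.ip_scl_right[OF e0_mem e0_mem] \<beta>_def)
    hence k'X: "k' \<in> X" using OP.diff_mem[OF k OP.scl_mem[OF e0X]] by (simp add: X_def k'_def)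
    obtain f where f: "(f, k' + fscale ?z f) \<in> canonical_operator H \<inter> X \<times> X"
      using R.rho_surj[OF zR k'X] by blast
    let ?c = "- \<beta> / ?z"
    have "(f + fscale ?c e0, (k' + fscale ?z f) + fscale ?c 0) \<in> canonical_operator H"
      using OP.graph_add[OF _ OP.graph_scl[OF e0S, of ?c]] f by blast
    moreover have "(k' + fscale ?z f) + fscale ?c 0 = k + fscale ?z (f + fscale ?c e0)"
      using \<epsilon> by (auto simp: k'_def vec_eq_iff field_simps)
    ultimately show "\<exists>f. (f, k + fscale ?z f) \<in> canonical_operator H" by metis
  qed
  thus ?thesis using \<epsilon>0(1) by blast
qed

text \<open>If \<open>x * Sig x \<le> B\<close> eventually, the Hardy constant \<open>2 sqrt B\<close> bounds the inverse up to finitely many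
functionals, so the spectrum inside the circle of radius \<open>1 / (2 * sqrt B)\<close> is discrete.\<close>

theorem discrete_below_hardy_bound:
  assumes N: "0 < N" and B: "B > 0" and Sb: "\<And>x. N \<le> x \<Longrightarrow> x * Sig x \<le> B"
    and z: "cmod z < 1 / (2 * sqrt B)"
  shows "z \<notin> essential_spectrum H"
proof (cases "L2.nrm e0 = 0")
  case True
  thus ?thesis using rho_UNIV_if_null by (simp add: essential_spectrum_eq)
next
  case False
  obtain \<epsilon>0 where \<epsilon>0: "\<epsilon>0 > 0" "\<And>\<epsilon>. 0 < \<epsilon> \<Longrightarrow> \<epsilon> < \<epsilon>0 \<Longrightarrow> \<i> * complex_of_real \<epsilon> \<in> OP.rho"
    using small_imaginary_resolvent[OF False N B Sb] by blast
  have "min \<epsilon>0 (1 / (2 * sqrt B)) > 0" using \<epsilon>0 B by simp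
  then obtain \<epsilon> where \<epsilon>: "0 < \<epsilon>" "\<epsilon> < \<epsilon>0" "\<epsilon> < 1 / (2 * sqrt B)" using dense by (metis min_less_iff_conj)
  have SS: "canonical_operator H \<subseteq> canonical_relation H" unfolding canonical_operator_def by blast
  have XL: "operator_space H \<subseteq> L2_space H" using operator_space_L2 by blast
  obtain E D C where "finitely_corrected_bound fscale (operator_space H) (L2_inner H) (canonical_operator H) E (L2_inner H) D C (1 / (2 * sqrt B))"
    using finitely_corrected_bound_exists[OF OP.symmetric_relation_axioms XL SS N B Sb] by blast
  then interpret F: finitely_corrected_bound fscale "operator_space H" "L2_inner H" "canonical_operator H" E "L2_inner H" D C "1 / (2 * sqrt B)" .
  have "z \<notin> OP.rho \<Longrightarrow> OP.discrete_point z"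
    by (rule F.discrete_in_ball[OF \<epsilon>0(2)[OF \<epsilon>(1,2)]]) (use \<epsilon> z in \<open>auto simp: norm_mult\<close>)
  thus ?thesis by (auto simp: essential_spectrum_eq)
qed

section \<open>Test functions and essential spectrum near zero\<close>

lemma nrm_c2_tail_tendsto:
  assumes h: "h \<in> L2_space H"
  shows "((\<lambda>n. L2.nrm (c2 {real n<..} h)) \<longlongrightarrow> 0) sequentially"
proof -
  have "(\<lambda>n. LINT x|half_line. dens (c2 {real n<..} h) x) \<longlonglongrightarrow> (LINT x|half_line. 0)"
  proof (rule integral_dominated_convergence[where w = "dens h"])
    show "AE x in half_line. (\<lambda>n. dens (c2 {real n<..} h) x) \<longlonglongrightarrow> 0"
    proof (rule AE_I2)
      fix x
      obtain m :: nat where "x \<le> real m" using real_arch_simple by blast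
      hence "\<forall>n\<ge>m. dens (c2 {real n<..} h) x = 0" by (auto simp: dens_c indicator_def)
      thus "(\<lambda>n. dens (c2 {real n<..} h) x) \<longlonglongrightarrow> 0"
        by (intro tendsto_eventually) (auto simp: eventually_sequentially)
    qed
    show "AE x in half_line. norm (dens (c2 {real n<..} h) x) \<le> dens h x" for n
      using dens_c_le(2) by auto
    show "dens (c2 {real n<..} h) \<in> borel_measurable half_line" for n
      by (intro dens_measurable L2_measurable c_mem h) auto
  qed (use h in \<open>auto simp: L2_dens\<close>)
  hence "(\<lambda>n. (L2.nrm (c2 {real n<..} h))\<^sup>2) \<longlonglongrightarrow> 0" unfolding L2_nrm_sq by simp
  hence "(\<lambda>n. sqrt ((L2.nrm (c2 {real n<..} h))\<^sup>2)) \<longlonglongrightarrow> sqrt 0" by (rule tendsto_real_sqrt)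
  thus ?thesis using h by simp
qed

lemma Sig_tendsto: "(\<lambda>n. Sig (real n)) \<longlonglongrightarrow> 0"
proof -
  have "c1 {real n<..} e0 = e1 {real n<..}" for n
    by (rule ext) (simp add: c1_def e1_def e0_apply)
  hence "(\<lambda>n. L2.nrm (e1 {real n<..})) \<longlonglongrightarrow> 0" using nrm_c1_tail_tendsto[OF e0_mem] by simp
  hence "(\<lambda>n. (L2.nrm (e1 {real n<..}))\<^sup>2) \<longlonglongrightarrow> 0\<^sup>2" by (rule tendsto_power)
  thus ?thesis by (simp add: e1_Ioi_nrm)
qed

lemma Sig_small: assumes "\<epsilon> > 0" shows "\<exists>y>X. Sig y < \<epsilon>"
proof -
  have "eventually (\<lambda>n. Sig (real n) < \<epsilon>) sequentially" using Sig_tendsto assms by (rule order_tendstoD)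
  then obtain n where n: "\<And>m. m \<ge> n \<Longrightarrow> Sig (real m) < \<epsilon>" by (auto simp: eventually_sequentially)
  obtain m :: nat where "X < real m" using reals_Archimedean2 by blast
  hence "X < real (max m n)" by simp
  thus ?thesis using n[of "max m n"] by auto
qed

definition mass :: "real set \<Rightarrow> real" where "mass S = (LINT t:S|half_line. ws t)"

lemma mass_Ioc: "0 \<le> a \<Longrightarrow> a \<le> b \<Longrightarrow> mass {a<..b} = Sig a - Sig b"
  using Sig_diff by (simp add: mass_def)

lemma mass_nonneg: "0 \<le> mass S"
  unfolding mass_def set_lebesgue_integral_def by (intro Bochner_Integration.integral_nonneg) auto

lemma ip_e1_e1: "L2_inner H (e1 S) (e1 T) = of_real (mass (S \<inter> T))"
proof -
  have "L2_inner H (e1 S) (e1 T) = (LINT x|half_line. complex_of_real (indicat_real (S \<inter> T) x *\<^sub>R ws x))"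
    unfolding L2_inner_def by (rule Bochner_Integration.integral_cong) (auto simp: pairing_diag e1_def split: split_indicator)
  thus ?thesis by (simp only: integral_complex_of_real mass_def set_lebesgue_integral_def)
qed

lemma mass_mono: "S \<in> sets lebesgue \<Longrightarrow> T \<in> sets lebesgue \<Longrightarrow> S \<subseteq> T \<Longrightarrow> mass S \<le> mass T"
  unfolding mass_def set_lebesgue_integral_def
  by (rule integral_mono) (use ws_set_integrable in \<open>auto simp: set_integrable_def split: split_indicator\<close>)

text \<open>The second component of \<open>V 0 (trapezoid N x y)\<close> rises from \<open>0\<close> to \<open>1\<close> on \<open>(0, N]\<close>, equals \<open>1\<close> up to \<open>x\<close>,
and returns to \<open>0\<close> on \<open>(x, y]\<close>, the slopes being proportional to \<open>ws\<close>.\<close>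

definition trapezoid :: "real \<Rightarrow> real \<Rightarrow> real \<Rightarrow> real \<Rightarrow> complex^2" where
  "trapezoid N x y = fscale (1 / mass {0<..N}) (e1 {0<..N}) - fscale (1 / mass {x<..y}) (e1 {x<..y})"

lemma trapezoid_mem [simp]: "trapezoid N x y \<in> L2_space H"
  unfolding trapezoid_def by (intro L2.diff_mem L2.scl_mem) auto

lemma trapezoid_nth: "trapezoid N x y t $ 2 = 0"
  by (simp add: trapezoid_def e1_def)

lemma V1_trapezoid: "V1 (trapezoid N x y) t = 0"
  unfolding V1_eq by (simp add: trapezoid_nth set_lebesgue_integral_def)

lemma V2_trapezoid:
  "V2 (trapezoid N x y) t = of_real (mass ({0<..t} \<inter> {0<..N}) / mass {0<..N} - mass ({0<..t} \<inter> {x<..y}) / mass {x<..y})"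
proof -
  have "V2 (trapezoid N x y) t = L2_inner H (e1 {0<..t}) (fscale (1 / mass {0<..N}) (e1 {0<..N}))
      - L2_inner H (e1 {0<..t}) (fscale (1 / mass {x<..y}) (e1 {x<..y}))"
    unfolding V2_def trapezoid_def by (rule L2.ip_diff_right) (auto intro: L2.scl_mem)
  also have "L2_inner H (e1 {0<..t}) (fscale (1 / mass {0<..N}) (e1 {0<..N})) = (1 / mass {0<..N}) * L2_inner H (e1 {0<..t}) (e1 {0<..N})"
    by (rule L2.ip_scl_right) auto
  also have "L2_inner H (e1 {0<..t}) (fscale (1 / mass {x<..y}) (e1 {x<..y})) = (1 / mass {x<..y}) * L2_inner H (e1 {0<..t}) (e1 {x<..y})"
    by (rule L2.ip_scl_right) auto
  finally show ?thesis by (simp add: ip_e1_e1)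
qed

lemma trapezoid_profile:
  assumes N: "0 < N" "N < x" "x < y" and m: "mass {0<..N} > 0" "mass {x<..y} > 0" and t: "0 < t"
  shows "cmod (V2 (trapezoid N x y) t) \<le> 1" "N \<le> t \<Longrightarrow> t \<le> x \<Longrightarrow> V2 (trapezoid N x y) t = 1"
    "y \<le> t \<Longrightarrow> V2 (trapezoid N x y) t = 0"
proof -
  let ?a = "mass ({0<..t} \<inter> {0<..N}) / mass {0<..N}" and ?b = "mass ({0<..t} \<inter> {x<..y}) / mass {x<..y}"
  have a: "0 \<le> ?a" "?a \<le> 1" and b: "0 \<le> ?b" "?b \<le> 1"
  proof -
    have "mass ({0<..t} \<inter> {0<..N}) \<le> mass {0<..N}" by (rule mass_mono) auto
    thus "?a \<le> 1" using m(1) by (simp only: pos_divide_le_eq mult_1)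
    have "mass ({0<..t} \<inter> {x<..y}) \<le> mass {x<..y}" by (rule mass_mono) auto
    thus "?b \<le> 1" using m(2) by (simp only: pos_divide_le_eq mult_1)
  qed (intro divide_nonneg_nonneg mass_nonneg)+
  show "cmod (V2 (trapezoid N x y) t) \<le> 1" unfolding V2_trapezoid norm_of_real using a b by (simp add: abs_le_iff)
  have full: "?a = 1" if "N \<le> t"
  proof -
    have "{0<..t} \<inter> {0<..N} = {0<..N}" using that by auto
    thus ?thesis using m by simp
  qed
  show "V2 (trapezoid N x y) t = 1" if "N \<le> t" "t \<le> x"
  proof -
    have "{0<..t} \<inter> {x<..y} = {}" using that by auto
    hence "?b = 0" by (simp only:) (simp add: mass_def set_lebesgue_integral_def)
    thus ?thesis unfolding V2_trapezoid full[OF that(1)] by simp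
  qed
  show "V2 (trapezoid N x y) t = 0" if "y \<le> t"
  proof -
    have "{0<..t} \<inter> {x<..y} = {x<..y}" using that N by auto
    hence "?b = 1" using m by simp
    moreover have "N \<le> t" using that N by simp
    ultimately show ?thesis unfolding V2_trapezoid full[OF \<open>N \<le> t\<close>] by simp
  qed
qed

text \<open>The plateau gives \<open>f\<close> a squared norm of about \<open>x\<close>, since \<open>wc\<close> differs from \<open>1\<close> by the integrable function
\<open>ws\<close>. The squared norm of \<open>h\<close> is dominated by the descent, which costs \<open>1 / mass {x<..y}\<close>. With the mass
close to \<open>Sig x\<close>, the quotient is about \<open>1 / (x * Sig x)\<close>.\<close>

lemma trapezoid_test_function:
  assumes N: "0 < N" "N < x" "x < y" and m: "mass {0<..N} > 0" "mass {x<..y} > 0"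
  defines "h \<equiv> trapezoid N x y"
  defines "f \<equiv> V 0 h"
  shows "(f, h) \<in> canonical_relation H"
    and "(L2.nrm h)\<^sup>2 = 1 / mass {0<..N} + 1 / mass {x<..y}"
    and "x - N - Sig 0 \<le> (L2.nrm f)\<^sup>2"
    and "\<And>Y. 0 \<le> Y \<Longrightarrow> L2.nrm (c2 {0<..Y} f) \<le> sqrt Y"
    and "\<And>t. f t $ 1 = 0"
proof -
  note prof = trapezoid_profile[OF N m]
  have hL: "h \<in> L2_space H" by (simp add: h_def)
  show f1: "f t $ 1 = 0" for t by (simp add: f_def V_def h_def V1_trapezoid)
  have f2: "f t $ 2 = V2 h t" for t by (simp add: f_def V_def)
  have df: "dens f t = wc t * (cmod (V2 h t))\<^sup>2" for t by (simp add: dens_def f1 f2)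
  have df1: "dens f t \<le> 1" if "t > 0" for t
    using prof(1)[OF that] unfolding df h_def by (intro mult_le_one power_le_one) auto
  have fL: "f \<in> L2_space H"
  proof (rule L2I[OF _ indicator_Ioc_integrable])
    show "f \<in> borel_measurable half_line" unfolding f_def by (rule V_measurable[OF hL])
    show "dens f t \<le> indicat_real {0<..y} t" if "t > 0" for t
    proof (cases "t \<le> y")
      case True thus ?thesis using df1[OF that] that by simp
    next
      case False thus ?thesis using prof(3)[OF that] unfolding df h_def by simp
    qed
  qed
  show "(f, h) \<in> canonical_relation H"
    unfolding canonical_relation_iff using fL hL by (auto simp: f_def intro!: exI[of _ 0])
  show "(L2.nrm h)\<^sup>2 = 1 / mass {0<..N} + 1 / mass {x<..y}"
  proof -
    let ?u = "fscale (1 / mass {0<..N}) (e1 {0<..N})" and ?v = "fscale (1 / mass {x<..y}) (e1 {x<..y})"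
    have uv: "?u \<in> L2_space H" "?v \<in> L2_space H" by (auto intro: L2.scl_mem)
    have e1n: "(L2.nrm (e1 S))\<^sup>2 = mass S" if "S \<in> sets lebesgue" for S
      using L2.nrm_sq[OF e1_mem[OF that]] by (simp add: ip_e1_e1)
    have dis: "{0<..N} \<inter> {x<..y} = {}" using N by auto
    have "L2_inner H ?u ?v = (1 / mass {x<..y}) * L2_inner H ?u (e1 {x<..y})" by (rule L2.ip_scl_right) (use uv in auto)
    also have "L2_inner H ?u (e1 {x<..y}) = cnj (1 / mass {0<..N}) * L2_inner H (e1 {0<..N}) (e1 {x<..y})"
      by (rule L2.ip_scl_left) auto
    also have "L2_inner H (e1 {0<..N}) (e1 {x<..y}) = 0" unfolding ip_e1_e1 dis by (simp add: mass_def set_lebesgue_integral_def)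
    finally have "L2_inner H ?u ?v = 0" by simp
    hence "(L2.nrm h)\<^sup>2 = (L2.nrm ?u)\<^sup>2 + (L2.nrm ?v)\<^sup>2"
      unfolding h_def trapezoid_def using L2.nrm_diff_sq[OF uv] by simp
    moreover have "(L2.nrm ?u)\<^sup>2 = (1 / mass {0<..N})\<^sup>2 * mass {0<..N}"
      using m L2.nrm_scl[OF e1_mem, of "{0<..N}" "1 / mass {0<..N}"] by (simp add: e1n power_mult_distrib norm_divide power_divide)
    moreover have "(L2.nrm ?v)\<^sup>2 = (1 / mass {x<..y})\<^sup>2 * mass {x<..y}"
      using m L2.nrm_scl[OF e1_mem, of "{x<..y}" "1 / mass {x<..y}"] by (simp add: e1n power_mult_distrib norm_divide power_divide)
    ultimately show ?thesis using m by (simp add: power2_eq_square)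
  qed
  show "x - N - Sig 0 \<le> (L2.nrm f)\<^sup>2"
  proof -
    have i: "integrable half_line (indicat_real {N<..x})"
      using Ioc_half_line(1)[where a = N and b = x and f = "\<lambda>_. 1::real"] N by (simp add: set_integrable_def)
    have "x - N = (LINT t:{N<..x}|half_line. (1::real))"
      using N by (subst Ioc_half_line(2)) (auto simp: set_lebesgue_integral_def)
    also have "\<dots> \<le> (LINT t|half_line. ws t + dens f t)"
      unfolding set_lebesgue_integral_def
    proof (rule integral_mono)
      show "integrable half_line (\<lambda>t. indicat_real {N<..x} t *\<^sub>R (1::real))" using i by simp
      show "integrable half_line (\<lambda>t. ws t + dens f t)" using ws_integrable L2_dens[OF fL] by simp
      fix t assume "t \<in> space half_line"
      hence t: "t > 0" by simp
      show "indicat_real {N<..x} t *\<^sub>R 1 \<le> ws t + dens f t"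
      proof (cases "t \<in> {N<..x}")
        case True
        hence "V2 h t = 1" using prof(2)[OF t] by (simp add: h_def)
        thus ?thesis using True ws_wc[of t] by (simp add: df)
      qed simp
    qed
    also have "\<dots> = (LINT t|half_line. ws t) + (L2.nrm f)\<^sup>2"
      unfolding L2_nrm_sq by (rule Bochner_Integration.integral_add[OF ws_integrable L2_dens[OF fL]])
    also have "(LINT t|half_line. ws t) = Sig 0"
      unfolding Sig_def set_lebesgue_integral_def by (rule Bochner_Integration.integral_cong) auto
    finally show ?thesis by simp
  qed
  show "L2.nrm (c2 {0<..Y} f) \<le> sqrt Y" if Y: "0 \<le> Y" for Y
  proof (rule real_le_rsqrt)
    have "(L2.nrm (c2 {0<..Y} f))\<^sup>2 \<le> (Y - 0) * 1"
    proof (rule nrm_sq_le_on_Ioc)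
      fix t :: real assume t: "t > 0"
      show "dens (c2 {0<..Y} f) t \<le> indicat_real {0<..Y} t * 1"
      proof (cases "t \<in> {0<..Y}")
        case True
        have "dens (c2 {0<..Y} f) t \<le> 1" by (rule order_trans[OF dens_c_le(2) df1[OF t]])
        thus ?thesis using True by simp
      qed (simp add: dens_c)
    qed (use fL Y in auto)
    thus "(L2.nrm (c2 {0<..Y} f))\<^sup>2 \<le> Y" by simp
  qed
qed

text \<open>The tool for weak convergence: a function whose second component is bounded has little mass
near zero compared with its growing norm, while a fixed \<open>e\<close> has little mass far out.\<close>

lemma ip_split_second:
  assumes e: "e \<in> L2_space H" and f: "f \<in> L2_space H" and f1: "\<And>t. f t $ 1 = 0" and Y: "0 \<le> Y"
  shows "cmod (L2_inner H e f) \<le> L2.nrm e * L2.nrm (c2 {0<..Y} f) + L2.nrm (c2 {Y<..} e) * L2.nrm f"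
proof -
  have "L2_inner H e f = L2_inner H (c2 {0<..Y} e) (c2 {0<..Y} f) + L2_inner H (c2 {Y<..} e) f"
  proof -
    have "L2_inner H e f = (LINT t|half_line. pairing (H t) (c2 {0<..Y} e t) (c2 {0<..Y} f t) + pairing (H t) (c2 {Y<..} e t) (f t))"
      unfolding L2_inner_def
    proof (rule Bochner_Integration.integral_cong[OF refl])
      fix t :: real assume "t \<in> space half_line"
      hence t: "t > 0" by simp
      show "pairing (H t) (e t) (f t) = pairing (H t) (c2 {0<..Y} e t) (c2 {0<..Y} f t) + pairing (H t) (c2 {Y<..} e t) (f t)"
        by (cases "t \<le> Y") (use t f1[of t] in \<open>auto simp: pairing_diag c2_def\<close>)
    qed
    also have "\<dots> = (LINT t|half_line. pairing (H t) (c2 {0<..Y} e t) (c2 {0<..Y} f t))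
        + (LINT t|half_line. pairing (H t) (c2 {Y<..} e t) (f t))"
      by (rule Bochner_Integration.integral_add) (use e f in \<open>auto intro!: pairing_integrable\<close>)
    finally show ?thesis by (simp only: L2_inner_def)
  qed
  hence "cmod (L2_inner H e f) \<le> cmod (L2_inner H (c2 {0<..Y} e) (c2 {0<..Y} f)) + cmod (L2_inner H (c2 {Y<..} e) f)"
    using norm_triangle_ineq by simp
  also have "\<dots> \<le> L2.nrm (c2 {0<..Y} e) * L2.nrm (c2 {0<..Y} f) + L2.nrm (c2 {Y<..} e) * L2.nrm f"
    using e f by (intro add_mono L2.cauchy_schwarz) auto
  also have "L2.nrm (c2 {0<..Y} e) \<le> L2.nrm e"
  proof (rule power2_le_imp_le)
    show "(L2.nrm (c2 {0<..Y} e))\<^sup>2 \<le> (L2.nrm e)\<^sup>2"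
      unfolding L2_nrm_sq by (rule integral_mono[OF L2_dens L2_dens]) (use e dens_c_le in auto)
  qed (use e in simp)
  hence "L2.nrm (c2 {0<..Y} e) * L2.nrm (c2 {0<..Y} f) + L2.nrm (c2 {Y<..} e) * L2.nrm f
     \<le> L2.nrm e * L2.nrm (c2 {0<..Y} f) + L2.nrm (c2 {Y<..} e) * L2.nrm f"
    using f by (intro add_right_mono mult_right_mono) auto
  finally show ?thesis .
qed

text \<open>The trapezoids are inserted at points \<open>x n\<close> tending to infinity at which \<open>x * Sig x\<close> exceeds \<open>b\<close>. Normalised,
they tend to zero weakly because their plateaus grow, and the quotients of the norms are eventually below
any \<open>sqrt q\<close> with \<open>q > 1 / b\<close>. With \<open>q < r\<^sup>2\<close> this excludes purely discrete spectrum in the disc of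
radius \<open>r\<close>.\<close>

theorem essential_spectrum_in_ball:
  assumes r: "r > 0" and b: "b > 0" "1 / b < r\<^sup>2" and often: "\<And>X. \<exists>x\<ge>X. x * Sig x > b"
  shows "\<exists>z\<in>essential_spectrum H. cmod z \<le> r"
proof (rule ccontr)
  assume "\<not> ?thesis"
  hence disc: "\<And>z. cmod z \<le> r \<Longrightarrow> z \<notin> OP.rho \<Longrightarrow> OP.discrete_point z"
    by (auto simp: essential_spectrum_eq)
  have Sig0: "Sig 0 > 0"
  proof -
    obtain x where x: "x \<ge> 1" "x * Sig x > b" using often by blast
    hence "Sig x > 0" using b by (metis Sig_nonneg less_eq_real_def mult_zero_right not_less order_less_trans)
    thus ?thesis using Sig_mono[of 0 x] x by simp
  qed
  obtain N where N: "N > 0" "Sig N < Sig 0" using Sig_small[OF Sig0, of 0] by blast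
  define m where "m = mass {0<..N}"
  have m: "m > 0" using N by (simp add: m_def mass_Ioc)
  \<comment> \<open>The squared norm of the trapezoid with corner \<open>x\<close> is at least \<open>x - c\<close>.\<close>
  define c where "c = N + Sig 0"
  obtain q where q: "1 / b < q" "q < r\<^sup>2" using dense[OF b(2)] by blast
  have q0: "q > 0" using q(1) b(1) by (meson divide_pos_pos less_trans zero_less_one)
  have "((\<lambda>x. (1 / m + x / b) / (x - c)) \<longlongrightarrow> inverse b) at_top" using b(1) m by real_asymp
  hence "((\<lambda>x. (1 / m + x / b) / (x - c)) \<longlongrightarrow> 1 / b) at_top" by (simp only: inverse_eq_divide)
  hence "eventually (\<lambda>x. (1 / m + x / b) / (x - c) < q) at_top" using q(1) by (rule order_tendstoD)
  then obtain X1 where X1: "\<And>x. x \<ge> X1 \<Longrightarrow> (1 / m + x / b) / (x - c) < q" by (auto simp: eventually_at_top_linorder)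
  have "\<exists>x y. x \<ge> real n + c + 1 \<and> x \<ge> X1 \<and> x < y \<and> x * (Sig x - Sig y) > b" for n
  proof -
    obtain x where x: "x \<ge> max (real n + c + 1) X1" "x * Sig x > b" using often by blast
    have x0: "x > 0" using x(1) N Sig0 by (simp add: c_def)
    have "(x * Sig x - b) / x > 0" using x(2) x0 by simp
    then obtain y where y: "y > x" "Sig y < (x * Sig x - b) / x" using Sig_small by blast
    hence "x * (Sig x - Sig y) > b" using x0 by (simp add: field_simps)
    thus ?thesis using x y by auto
  qed
  then obtain x y where xy: "\<And>n. x n \<ge> real n + c + 1" "\<And>n. x n \<ge> X1" "\<And>n. x n < y n" "\<And>n. x n * (Sig (x n) - Sig (y n)) > b"
    by metis
  define h where "h n = trapezoid N (x n) (y n)" for n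
  define f where "f n = V 0 (h n)" for n
  have c0: "c > N" using Sig0 by (simp add: c_def)
  have Nx: "N < x n" and x0: "x n > 0" for n using xy(1)[of n] c0 N by auto
  have mass_pos: "mass {x n<..y n} > 0" and mass_inv: "1 / mass {x n<..y n} \<le> x n / b" for n
  proof -
    have eq: "mass {x n<..y n} = Sig (x n) - Sig (y n)" using x0[of n] xy(3)[of n] by (simp add: mass_Ioc)
    have "x n * mass {x n<..y n} > b" using xy(4)[of n] by (simp add: eq)
    moreover from this show "mass {x n<..y n} > 0" using b(1) x0[of n] by (meson less_trans zero_less_mult_pos)
    ultimately show "1 / mass {x n<..y n} \<le> x n / b" using b(1) by (simp add: field_simps)
  qed
  note tf = trapezoid_test_function[OF N(1) Nx xy(3) m[unfolded m_def] mass_pos]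
  have fh: "(f n, h n) \<in> canonical_relation H" for n unfolding f_def h_def by (rule tf(1))
  have fL: "f n \<in> L2_space H" and hL: "h n \<in> L2_space H" for n using CR.graph_mem[OF fh] by auto
  have fX: "f n \<in> operator_space H" for n by (rule domain_operator_space[OF fh])
  have low: "x n - c \<le> (L2.nrm (f n))\<^sup>2" for n
    using tf(3)[of n] by (simp add: f_def h_def c_def)
  have low': "real n + 1 \<le> (L2.nrm (f n))\<^sup>2" for n using low[of n] xy(1)[of n] by simp
  have fpos: "L2.nrm (f n) > 0" for n
  proof -
    have "L2.nrm (f n) \<noteq> 0" using low'[of n] by auto
    thus ?thesis using L2.nrm_nonneg[OF fL, of n] by linarith
  qed
  have ratio: "(L2.nrm (h n))\<^sup>2 \<le> q * (L2.nrm (f n))\<^sup>2" for n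
  proof -
    have xc: "x n - c > 0" using xy(1)[of n] by simp
    have "(L2.nrm (h n))\<^sup>2 \<le> 1 / m + x n / b"
      using tf(2)[of n] mass_inv[of n] by (simp add: h_def m_def)
    also have "\<dots> \<le> q * (x n - c)" using X1[OF xy(2)[of n]] xc by (simp add: pos_divide_less_eq)
    also have "\<dots> \<le> q * (L2.nrm (f n))\<^sup>2" using low[of n] q0 by (intro mult_left_mono) auto
    finally show ?thesis .
  qed
  have hf: "L2.nrm (h n) \<le> sqrt q * L2.nrm (f n)" for n
  proof (rule power2_le_imp_le)
    show "(L2.nrm (h n))\<^sup>2 \<le> (sqrt q * L2.nrm (f n))\<^sup>2" using ratio[of n] q0 by (simp add: power_mult_distrib)
  qed (use q0 fpos[of n] in simp)
  define F where "F n = fscale (1 / complex_of_real (L2.nrm (f n))) (f n)" for n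
  have FX: "F n \<in> operator_space H" for n unfolding F_def by (rule OP.scl_mem[OF fX])
  have Fn: "L2.nrm (F n) = 1" for n
    unfolding F_def using L2.nrm_scl[OF fL[of n], of "1 / complex_of_real (L2.nrm (f n))"] fpos[of n] by (simp add: norm_divide)
  have ipF: "L2_inner H e (F n) = L2_inner H e (f n) / L2.nrm (f n)" if "e \<in> L2_space H" for e n
    unfolding F_def using L2.ip_scl_right[OF that fL[of n], of "1 / complex_of_real (L2.nrm (f n))"] by simp
  show False
  \<comment> \<open>The second entries \<open>h n\<close> need not be orthogonal to the multi-valued part, so they enter only through the
symmetry of the full relation.\<close>
  proof (rule OP.no_weakly_null_test_sequence[OF r disc FX Fn])
    show "sqrt q < r" using real_sqrt_less_mono[OF q(2)] r by simp
    show "cmod (L2_inner H k (F n)) \<le> sqrt q * L2.nrm g" if gk: "(g, k) \<in> canonical_operator H" for n g k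
    proof -
      have gk': "(g, k) \<in> canonical_relation H" by (rule conjunct1[OF gk[unfolded canonical_operator_iff]])
      have gL: "g \<in> L2_space H" "k \<in> L2_space H" using CR.graph_mem[OF gk'] by auto
      have "L2_inner H k (f n) = L2_inner H g (h n)" by (rule CR.graph_sym[OF gk' fh])
      hence "cmod (L2_inner H k (f n)) \<le> L2.nrm g * L2.nrm (h n)" using L2.cauchy_schwarz[OF gL(1) hL] by simp
      also have "\<dots> \<le> L2.nrm g * (sqrt q * L2.nrm (f n))" using hf[of n] gL by (intro mult_left_mono) auto
      finally show ?thesis using fpos[of n] by (simp add: ipF[OF gL(2)] norm_divide field_simps)
    qed
    show "(\<lambda>n. L2_inner H e (F n)) \<longlonglongrightarrow> 0" if "e \<in> operator_space H" for e
    proof -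
      have e: "e \<in> L2_space H" by (rule operator_space_L2[OF that])
      have bnd: "cmod (L2_inner H e (F n)) \<le> L2.nrm e * sqrt Y / sqrt (real n + 1) + L2.nrm (c2 {Y<..} e)" if Y: "0 \<le> Y" for n Y
      proof -
        have "cmod (L2_inner H e (f n)) \<le> L2.nrm e * L2.nrm (c2 {0<..Y} (f n)) + L2.nrm (c2 {Y<..} e) * L2.nrm (f n)"
          by (rule ip_split_second[OF e fL _ Y]) (use tf(5) in \<open>simp add: f_def h_def\<close>)
        also have "\<dots> \<le> L2.nrm e * sqrt Y + L2.nrm (c2 {Y<..} e) * L2.nrm (f n)"
          using tf(4)[OF Y, of n] e by (intro add_right_mono mult_left_mono) (auto simp: f_def h_def)
        finally have "cmod (L2_inner H e (F n)) \<le> L2.nrm e * sqrt Y / L2.nrm (f n) + L2.nrm (c2 {Y<..} e)"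
          using fpos[of n] by (simp add: ipF[OF e] norm_divide field_simps)
        moreover have "sqrt (real n + 1) \<le> L2.nrm (f n)" using low'[of n] fpos[of n] by (intro real_le_lsqrt) auto
        hence "L2.nrm e * sqrt Y / L2.nrm (f n) \<le> L2.nrm e * sqrt Y / sqrt (real n + 1)"
          using e Y fpos[of n] by (intro divide_left_mono mult_nonneg_nonneg mult_pos_pos) auto
        ultimately show ?thesis by linarith
      qed
      show ?thesis
      proof (rule LIMSEQ_I)
        fix \<epsilon> :: real assume \<epsilon>: "\<epsilon> > 0"
        have "eventually (\<lambda>k. L2.nrm (c2 {real k<..} e) < \<epsilon> / 2) sequentially"
          using nrm_c2_tail_tendsto[OF e] \<epsilon> by (intro order_tendstoD(2)) auto
        then obtain k where k: "L2.nrm (c2 {real k<..} e) < \<epsilon> / 2" by (auto simp: eventually_sequentially)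
        have "(\<lambda>n. L2.nrm e * sqrt (real k) / sqrt (real n + 1)) \<longlonglongrightarrow> 0"
    proof (rule tendsto_divide_0[OF tendsto_const])
      show "filterlim (\<lambda>n. sqrt (real n + 1)) at_infinity sequentially"
        by (rule filterlim_at_top_imp_at_infinity) real_asymp
    qed
        hence "eventually (\<lambda>n. L2.nrm e * sqrt (real k) / sqrt (real n + 1) < \<epsilon> / 2) sequentially"
          using \<epsilon> by (intro order_tendstoD(2)) auto
        then obtain n0 where n0: "\<And>n. n \<ge> n0 \<Longrightarrow> L2.nrm e * sqrt (real k) / sqrt (real n + 1) < \<epsilon> / 2"
          by (auto simp: eventually_sequentially)
        show "\<exists>no. \<forall>n\<ge>no. norm (L2_inner H e (F n) - 0) < \<epsilon>"
        proof (intro exI[of _ n0] allI impI)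
          fix n assume "n \<ge> n0"
          have "cmod (L2_inner H e (F n)) < \<epsilon> / 2 + \<epsilon> / 2"
            by (rule le_less_trans[OF bnd[of "real k" n] add_strict_mono[OF n0[OF \<open>n \<ge> n0\<close>] k]]) simp
          thus "norm (L2_inner H e (F n) - 0) < \<epsilon>" by simp
        qed
      qed
    qed
  qed
qed

end

section \<open>The bottom of the essential spectrum\<close>

theorem theorem1p3:
  fixes \<phi> :: "real \<Rightarrow> real" and A :: ereal
  assumes "\<phi> \<in> borel_measurable half_line"
    and "\<And>x. x > 0 \<Longrightarrow> \<phi> x \<in> {- pi / 2..<pi / 2}"
    and "integrable half_line (\<lambda>x. (sin (\<phi> x))\<^sup>2)"
    and "A = Limsup at_top (\<lambda>x::real. ereal (x * (LINT t:{x<..}|lebesgue. (sin (\<phi> t))\<^sup>2)))"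
  shows "1 / (2 * ereal_sqrt A) \<le> M (H_diag \<phi>) \<and> M (H_diag \<phi>) \<le> 1 / ereal_sqrt A"
proof -
  interpret diagonal_system \<phi> by unfold_locales (rule assms)+
  have "\<forall>\<^sub>F x in at_top. ereal (x * (LINT t:{x<..}|lebesgue. (sin (\<phi> t))\<^sup>2)) = ereal (x * Sig x)"
  proof (rule eventually_at_top_linorderI[of 0])
    fix x :: real assume x: "0 \<le> x"
    have "(LINT t:{x<..}|half_line. (sin (\<phi> t))\<^sup>2) = (LINT t:{x<..}|lebesgue. (sin (\<phi> t))\<^sup>2)"
      by (rule set_integrable_half_line(2)) (use x in auto)
    thus "ereal (x * (LINT t:{x<..}|lebesgue. (sin (\<phi> t))\<^sup>2)) = ereal (x * Sig x)"
      by (simp add: Sig_def ws_def)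
  qed
  hence A: "A = Limsup at_top (\<lambda>x. ereal (x * Sig x))" unfolding assms(4) by (rule Limsup_eq)
  have A0: "0 \<le> A" unfolding A
  proof (rule le_Limsup)
    show "\<forall>\<^sub>F x in at_top. (0::ereal) \<le> ereal (x * Sig x)"
      by (rule eventually_at_top_linorderI[of 0]) (simp add: Sig_nonneg)
  qed simp
  have lower: "cmod t \<ge> 1 / (2 * sqrt B)" if t: "t \<in> essential_spectrum H" and B: "A < ereal B" "B > 0" for t B
  proof (rule ccontr)
    assume "\<not> ?thesis"
    hence small: "cmod t < 1 / (2 * sqrt B)" by simp
    have "\<forall>\<^sub>F x in at_top. ereal (x * Sig x) < ereal B" using B(1) unfolding A by (rule Limsup_lessD)
    then obtain N where N: "\<And>x. x \<ge> N \<Longrightarrow> x * Sig x < B" by (auto simp: eventually_at_top_linorder)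
    have "t \<notin> essential_spectrum H"
      by (rule discrete_below_hardy_bound[of "max N 1" B]) (use N B small in \<open>auto intro: less_imp_le\<close>)
    thus False using t by simp
  qed
  have upper: "\<exists>z\<in>essential_spectrum H. cmod z \<le> r" if b: "ereal b < A" "b > 0" and r: "r > 0" "1 / b < r\<^sup>2" for b r
  proof (rule essential_spectrum_in_ball[OF r(1) b(2) r(2)])
    fix X :: real
    show "\<exists>x\<ge>X. x * Sig x > b"
    proof (rule ccontr)
      assume "\<not> ?thesis"
      hence "\<forall>\<^sub>F x in at_top. ereal (x * Sig x) \<le> ereal b"
        by (intro eventually_at_top_linorderI[of X]) (auto simp: not_less)
      hence "A \<le> ereal b" unfolding A by (rule Limsup_bounded)
      thus False using b(1) by simp
    qed
  qed
  show ?thesis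
  proof (cases A)
    case (real \<alpha>)
    have \<alpha>0: "\<alpha> \<ge> 0" using A0 real by simp
    have sq: "ereal_sqrt A = ereal (sqrt \<alpha>)" by (simp add: ereal_sqrt_def real)
    show ?thesis
    proof (cases "\<alpha> = 0")
      case True
      have "essential_spectrum H = {}"
      proof (rule ccontr)
        assume "essential_spectrum H \<noteq> {}"
        then obtain t where t: "t \<in> essential_spectrum H" by blast
        \<comment> \<open>This choice makes \<open>1 / (2 * sqrt B)\<close> equal to \<open>cmod t + 1\<close>.\<close>
        define B where "B = 1 / (4 * (cmod t + 1)\<^sup>2)"
        have pos: "cmod t + 1 > 0" by (simp add: add_nonneg_pos)
        hence "sqrt B = 1 / (2 * (cmod t + 1))" by (simp add: B_def real_sqrt_divide real_sqrt_mult)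
        hence "1 / (2 * sqrt B) = cmod t + 1" using pos by simp
        moreover have "B > 0" using pos by (simp add: B_def)
        ultimately show False using lower[OF t, of B] True real by (simp add: zero_ereal_def[symmetric])
      qed
      hence "M H = \<infinity>" by (simp add: M_def)
      thus ?thesis using sq True by (simp add: zero_ereal_def[symmetric] divide_ereal_def)
    next
      case False
      hence \<alpha>: "\<alpha> > 0" using \<alpha>0 by simp
      have e1: "1 / (2 * ereal_sqrt A) = ereal (1 / (2 * sqrt \<alpha>))" and e2: "1 / ereal_sqrt A = ereal (1 / sqrt \<alpha>)"
        using \<alpha> unfolding sq by (simp_all add: one_ereal_def)
      have in_ball: "\<exists>z\<in>essential_spectrum H. cmod z \<le> r" if r: "r > 1 / sqrt \<alpha>" for r
      proof -
        have r0: "r > 0" using r \<alpha> by (meson divide_pos_pos less_trans real_sqrt_gt_zero zero_less_one)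
        have "(1 / sqrt \<alpha>)\<^sup>2 < r\<^sup>2" using r \<alpha> by (intro power_strict_mono) auto
        hence "1 / \<alpha> < r\<^sup>2" using \<alpha> by (simp add: power_divide)
        hence "1 / r\<^sup>2 < \<alpha>" using \<alpha> r0 by (simp add: field_simps)
        then obtain b where b: "1 / r\<^sup>2 < b" "b < \<alpha>" using dense by blast
        have b0: "b > 0" using b(1) r0 by (meson divide_pos_pos less_trans zero_less_one zero_less_power)
        have "1 / b < r\<^sup>2" using b(1) b0 r0 by (simp add: field_simps)
        thus ?thesis using upper[of b r] b b0 r0 real by simp
      qed
      have "essential_spectrum H \<noteq> {}" using in_ball[of "1 / sqrt \<alpha> + 1"] by auto
      then obtain t where t: "t \<in> essential_spectrum H" "M H = ereal (cmod t)"
        "\<And>u. u \<in> essential_spectrum H \<Longrightarrow> cmod t \<le> cmod u" using M_attained by blast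
      have "cmod t \<le> 1 / sqrt \<alpha>"
      proof (rule dense_ge)
        fix r assume "1 / sqrt \<alpha> < r"
        then obtain z where "z \<in> essential_spectrum H" "cmod z \<le> r" using in_ball by blast
        thus "cmod t \<le> r" using t(3)[of z] by simp
      qed
      moreover have "1 / (2 * sqrt \<alpha>) \<le> cmod t"
      proof (rule ccontr)
        assume "\<not> ?thesis"
        hence "2 * sqrt \<alpha> * cmod t < 1" using \<alpha> by (simp add: field_simps)
        \<comment> \<open>The bound is available for every \<open>B > \<alpha>\<close>, and it is continuous in \<open>B\<close>.\<close>
        moreover have "((\<lambda>B. 2 * sqrt B * cmod t) \<longlongrightarrow> 2 * sqrt \<alpha> * cmod t) (at_right \<alpha>)"
          by (intro tendsto_intros)
        ultimately have "\<forall>\<^sub>F B in at_right \<alpha>. 2 * sqrt B * cmod t < 1" by (intro order_tendstoD(2))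
        moreover have "\<forall>\<^sub>F B in at_right \<alpha>. B > \<alpha>" by (simp add: eventually_at_right_less)
        ultimately have "\<forall>\<^sub>F B in at_right \<alpha>. 2 * sqrt B * cmod t < 1 \<and> B > \<alpha>" by eventually_elim auto
        then obtain B where B: "2 * sqrt B * cmod t < 1" "B > \<alpha>"
          using eventually_happens'[OF trivial_limit_at_right_real] by blast
        have "1 / (2 * sqrt B) \<le> cmod t" using lower[OF t(1), of B] B \<alpha> real by simp
        thus False using B \<alpha> by (simp add: field_simps)
      qed
      ultimately show ?thesis unfolding e1 e2 t(2) by simp
    qed
  next
    case PInf
    have sq: "ereal_sqrt A = \<infinity>" by (simp add: ereal_sqrt_def PInf)
    have in_ball: "\<exists>z\<in>essential_spectrum H. cmod z \<le> r" if r: "r > 0" for r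
    proof -
      have "1 / (2 / r\<^sup>2) < r\<^sup>2" "2 / r\<^sup>2 > 0" using r by auto
      thus ?thesis using upper[of "2 / r\<^sup>2" r] r PInf by simp
    qed
    have "essential_spectrum H \<noteq> {}" using in_ball[of 1] by auto
    then obtain t where t: "t \<in> essential_spectrum H" "M H = ereal (cmod t)"
      "\<And>u. u \<in> essential_spectrum H \<Longrightarrow> cmod t \<le> cmod u" using M_attained by blast
    have "cmod t \<le> 0"
    proof (rule dense_ge)
      fix r :: real assume "0 < r"
      then obtain z where "z \<in> essential_spectrum H" "cmod z \<le> r" using in_ball by blast
      thus "cmod t \<le> r" using t(3)[of z] by simp
    qed
    thus ?thesis unfolding sq t(2) by (simp add: zero_ereal_def)
  qed (use A0 in auto)
qed

end
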